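(* Let $n_1,n_2,n_3\geq 1$ and $\sigma\in\Sigma_3$ be orbit data whose characteristic polynomial has a root outside the unit circle. If the orbit data is realized by some quadratic transformation $f$ that properly fixes $C=\{xyz=0\}\subset\mathbf{P}^2$, then $\sigma=\mathrm{id}$, and $f$ maps each component of $C_{reg}$ to itself with multiplier $1$. Conversely, when $\sigma=\mathrm{id}$ and $n_1,n_2,n_3\geq 6$, there exists at least one such realization.
   Context: $\mathbf{P}^2$ is the complex projective plane with homogeneous coordinates $[x:y:z]$. $C_{reg}$ is the set of smooth points of $C$; its three components are each isomorphic to $\mathbf{C}^*\cong\mathbf{C}/\mathbf{Z}$. If $\tau$ is an automorphism of $C$, its multiplier is the number $a=\pm1$ such that $[D]\mapsto[\tau(D)]$ acts on $\mathrm{Pic}^0(C)\cong\mathbf{C}/\mathbf{Z}$ as $t\mapsto at$; if $\tau$ maps a component of $C_{reg}$ (with coordinate $t\in\mathbf{C}/\mathbf{Z}$) to itself, it acts there by $t\mapsto at+b$ for some $b$. Quadratic transformations. A quadratic transformation is a birational map $f:\mathbf{P}^2\dashrightarrow\mathbf{P}^2$ of polynomial degree two. It acts by blowing up three points $p_1^+,p_2^+,p_3^+$ (some possibly infinitely near to others), forming $I(f)$, and contracting three rational curves. $f^{-1}$ is also quadratic, with $I(f^{-1})=\{p_1^-,p_2^-,p_3^-\}$. When the $p_j^+$ are distinct points of $\mathbf{P}^2$, $p_j^-$ is the image of the line through the points $p_i^+$, $i\neq j$. In general, on the surface obtained by blowing up the three points of $I(f)$ (equivalently, via $f$, those of $I(f^{-1})$),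 with $h$ the class of the pullback of a line from the source and $e_j^\pm$ the classes of the total transforms of the exceptional curves over $p_j^\pm$, the indexing is such that $e_j^-=h-\sum_{i\ne j}e_i^+$. $f$ properly fixes $C$ if $\overline{f(C\setminus I(f))}=C$ and all points of $I(f)\cap C$ and $I(f^{-1})\cap C$ are smooth points of $C$; then $f$ restricts to an automorphism of $C$. Orbit data consist of integers $n_1,n_2,n_3\ge1$ and a permutation $\sigma$ of $\{1,2,3\}$, $\sigma_j=\sigma(j)$. Its characteristic polynomial is $P(\lambda)=\det(\lambda\,\mathrm{id}-T)$, where $T$ acts on the real vector space with basis $H$, $E_{i,n}$ ($1\le i\le3$, $0\le n\le n_i-1$) by $T(H)=2H-\sum_{j}E_{j,n_j-1}$, $T(E_{i,n})=E_{i,n-1}$ for $1\le n\le n_i-1$, and $T(E_{\sigma_i,0})=H-\sum_{j\ne i}E_{j,n_j-1}$. Realization. $f$ realizes the orbit data if the following three-step process can be carried out, for some order of treating the indices $1,2,3$. Start with $f_0=f$ on $X_0=\mathbf{P}^2$. At step $k=0,1,2$ pick an index $i$ not yet used such that $p_i^-$ and $p_{\sigma_i}^+$ are actual points of $X_k$ (not infinitely near to a remaining point of $I(f_k^{-1})$, resp. $I(f_k)$), such that $f_k^{n_i-1}(p_i^-)=p_{\sigma_i}^+$, and such that $n_i$ is minimal: $f_k^m(p_i^-)\notin I(f_k)$ for $0\le m<n_i-1$ and $f_k^m(p_i^-)\notin I(f_k^{-1})$ for $0<m\le n_i-1$. Blow up $p_i^-,f_k(p_i^-),\dots,f_k^{n_i-1}(p_i^-)$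 to obtain $X_{k+1}$ and the lift $f_{k+1}$ of $f_k$, whose indeterminacy points (and those of its inverse) are the remaining $p_j^+$ (resp. $p_j^-$). After three steps one has an automorphism $\hat f=f_3$ of $X=X_3$. *)

theory Defs
  imports
    "HOL-Analysis.Analysis"
    "HOL-Computational_Algebra.Computational_Algebra"
    "Jordan_Normal_Form.Char_Poly"
begin

no_notation Matrix.vec_index (infixl "$" 100)

text \<open>
  Conventions. Rational surfaces are treated in the style of Zariski: a smooth projective surface
  birational to the plane is given by the set of the local rings of its (closed) points, all of
  them viewed as subrings of the function field \<open>K = \<complex>(x,y)\<close> of the plane, where \<open>x = X/Z\<close> and
  \<open>y = Y/Z\<close>. A point of a surface \<^emph>\<open>is\<close> its local ring. In this way a
  point that is infinitely near to the plane and the corresponding actual point on a blown-up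
  surface are literally the same object, and all lifts of a birational map \<open>f\<close> to blown-up
  surfaces are given by one and the same automorphism \<open>g \<mapsto> g \<circ> f\<close> of \<open>K\<close>.

  Indices in \<open>{1,2,3}\<close> are elements of the type \<open>3\<close>, whose arithmetic is modulo 3 (so \<open>3 = 0\<close>).
\<close>

text \<open>The inner polynomial variable is \<open>x\<close>, the outer one is \<open>y\<close>.\<close>

type_synonym ratfun = "complex poly poly fract"
type_synonym point = "ratfun set"

definition const_fun :: "complex \<Rightarrow> ratfun" where
  "const_fun c = Fract [:[:c:]:] 1"

definition x_fun :: ratfun where
  "x_fun = Fract [:[:0, 1:]:] 1"

definition y_fun :: ratfun where
  "y_fun = Fract [:0, 1:] 1"

definition total_degree_le :: "complex poly poly \<Rightarrow> nat \<Rightarrow> bool" where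
  "total_degree_le a d \<longleftrightarrow> (\<forall>i j. coeff (coeff a j) i \<noteq> 0 \<longrightarrow> i + j \<le> d)"

text \<open>Value at \<open>v\<close> of the form \<open>Z\<^sup>d a(X/Z, Y/Z)\<close> of degree \<open>d\<close>, for \<open>a\<close> of total degree at most \<open>d\<close>.\<close>

definition form_value :: "nat \<Rightarrow> complex poly poly \<Rightarrow> complex^3 \<Rightarrow> complex" where
  "form_value d a v =
     (\<Sum>j\<le>d. \<Sum>i\<le>d - j. coeff (coeff a j) i * (v$1)^i * (v$2)^j * (v$3)^(d - i - j))"

text \<open>The local ring of the plane at the point with homogeneous coordinates \<open>v \<noteq> 0\<close>: quotients of
  forms of equal degree whose denominator does not vanish at \<open>v\<close>.\<close>

definition pt :: "complex^3 \<Rightarrow> point" where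
  "pt v = {Fract a b | a b. \<exists>d. total_degree_le a d \<and> total_degree_le b d \<and> form_value d b v \<noteq> 0}"

definition P2 :: "point set" where
  "P2 = pt ` {v. v \<noteq> 0}"

text \<open>Closure in the plane, computed on cones in \<open>\<complex>\<^sup>3 - {0}\<close>. (For the constructible sets to which
  this is applied, the classical and the Zariski closure agree.)\<close>

definition P2_closure :: "point set \<Rightarrow> point set" where
  "P2_closure A = pt ` (closure {v. v \<noteq> 0 \<and> pt v \<in> A} - {0})"

definition units_of_ring :: "point \<Rightarrow> ratfun set" where
  "units_of_ring R = {a \<in> R. a \<noteq> 0 \<and> inverse a \<in> R}"

definition max_ideal :: "point \<Rightarrow> ratfun set" where
  "max_ideal R = R - units_of_ring R"

definition dominates :: "point \<Rightarrow> point \<Rightarrow> bool" where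
  "dominates S R \<longleftrightarrow> R \<subseteq> S \<and> max_ideal R \<subseteq> max_ideal S"

text \<open>The points of the exceptional curve of the blowup of the point \<open>R\<close>. If \<open>u, v\<close> generate the
  maximal ideal of \<open>R\<close>, one chart of the blowup is \<open>Spec R[v/u]\<close>, and the set below is
  the local ring of its point \<open>u = v/u = 0\<close>. Every point of the exceptional curve has this form for
  a suitable choice of the generators, as the residue field of \<open>R\<close> is \<open>\<complex>\<close>.\<close>

definition local_ring_over :: "point \<Rightarrow> ratfun \<Rightarrow> point" where
  "local_ring_over R w =
     {poly p w / poly q w | p q. (\<forall>i. coeff p i \<in> R) \<and> (\<forall>i. coeff q i \<in> R)
        \<and> coeff q 0 \<in> units_of_ring R}"

definition exceptional_points :: "point \<Rightarrow> point set" where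
  "exceptional_points R =
     {local_ring_over R (v / u) | u v. max_ideal R = {a * u + b * v | a b. a \<in> R \<and> b \<in> R}}"

definition blowup :: "point set \<Rightarrow> point set \<Rightarrow> point set" where
  "blowup B X = (X - B) \<union> (\<Union>R\<in>B. exceptional_points R)"

text \<open>Successive blowups of single points, each of which has to lie on the surface obtained so far
  (in particular it may be infinitely near to the earlier ones).\<close>

fun successive_centers :: "point list \<Rightarrow> point set \<Rightarrow> bool" where
  "successive_centers [] X = True"
| "successive_centers (R # Rs) X = (R \<in> X \<and> successive_centers Rs (blowup {R} X))"

fun successive_blowup :: "point list \<Rightarrow> point set \<Rightarrow> point set" where
  "successive_blowup [] X = X"
| "successive_blowup (R # Rs) X = successive_blowup Rs (blowup {R} X)"

text \<open>A birational self-map \<open>f\<close> of the plane is represented by its pullback \<open>g \<mapsto> g \<circ> f\<close>, an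
  automorphism of \<open>K\<close> over \<open>\<complex>\<close>; the inverse map is represented by the inverse automorphism.\<close>

type_synonym ratmap = "ratfun \<Rightarrow> ratfun"

definition birational_map :: "ratmap \<Rightarrow> bool" where
  "birational_map f \<longleftrightarrow> bij f \<and> (\<forall>a b. f (a + b) = f a + f b) \<and> (\<forall>a b. f (a * b) = f a * f b)
     \<and> (\<forall>c. f (const_fun c) = const_fun c)"

text \<open>The least degree of forms \<open>A, B, C\<close> such that \<open>f = [A:B:C]\<close>, i.e. their degree once common
  factors are cancelled.\<close>

definition map_degree :: "ratmap \<Rightarrow> nat" where
  "map_degree f = (LEAST d. \<exists>a b c. c \<noteq> 0 \<and> total_degree_le a d \<and> total_degree_le b d
     \<and> total_degree_le c d \<and> f x_fun = Fract a c \<and> f y_fun = Fract b c)"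

definition quadratic_map :: "ratmap \<Rightarrow> bool" where
  "quadratic_map f \<longleftrightarrow> birational_map f \<and> map_degree f = 2"

text \<open>As a rational self-map of the surface \<open>X\<close>, \<open>f\<close> is regular at \<open>R\<close> with value \<open>S\<close> iff pulling
  back by \<open>f\<close> embeds the local ring \<open>S\<close> into \<open>R\<close> as a local homomorphism.\<close>

definition indeterminacy :: "ratmap \<Rightarrow> point set \<Rightarrow> point set" where
  "indeterminacy f X = {R \<in> X. \<not> (\<exists>S\<in>X. dominates R (f ` S))}"

definition map_pt :: "ratmap \<Rightarrow> point set \<Rightarrow> point \<Rightarrow> point" where
  "map_pt f X R = (THE S. S \<in> X \<and> dominates R (f ` S))"

text \<open>A prime divisor is given by the local ring of its generic point, a discrete valuation ring:
  the localization of the local ring \<open>R\<close> of a point at a prime element \<open>q\<close> (a local equation).\<close>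

definition prime_in :: "point \<Rightarrow> ratfun \<Rightarrow> bool" where
  "prime_in R q \<longleftrightarrow> q \<in> max_ideal R \<and> q \<noteq> 0
     \<and> (\<forall>a\<in>R. \<forall>b\<in>R. a * b / q \<in> R \<longrightarrow> a / q \<in> R \<or> b / q \<in> R)"

definition prime_divisors :: "point set \<Rightarrow> ratfun set set" where
  "prime_divisors X =
     {{a / b | a b. a \<in> R \<and> b \<in> R \<and> b / q \<notin> R} | R q. R \<in> X \<and> prime_in R q}"

definition val :: "ratfun set \<Rightarrow> ratfun \<Rightarrow> int" where
  "val V g = (THE k. \<exists>t. \<exists>u\<in>units_of_ring V. max_ideal V = {t * a | a. a \<in> V} \<and> g = t powi k * u)"

text \<open>Divisors on a surface \<open>X\<close> are given by their multiplicities along the prime divisors of \<open>X\<close>.\<close>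

definition lin_equiv :: "point set \<Rightarrow> (ratfun set \<Rightarrow> int) \<Rightarrow> (ratfun set \<Rightarrow> int) \<Rightarrow> bool" where
  "lin_equiv X D D' \<longleftrightarrow> (\<exists>g. g \<noteq> 0 \<and> (\<forall>V\<in>prime_divisors X. D V - D' V = val V g))"

text \<open>The pullback of the line \<open>Z = 0\<close>: its local equation at \<open>V\<close> is \<open>Z\<close> divided by that one of
  \<open>X, Y, Z\<close> which has the least valuation.\<close>

definition line_pullback :: "ratfun set \<Rightarrow> int" where
  "line_pullback V = - min 0 (min (val V x_fun) (val V y_fun))"

text \<open>The total transform of the exceptional curve over the point \<open>R\<close>, i.e. the divisor of the
  inverse image of the ideal of \<open>R\<close>.\<close>

definition total_exceptional :: "point \<Rightarrow> ratfun set \<Rightarrow> int" where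
  "total_exceptional R V =
     (if dominates V R then (INF a\<in>max_ideal R - {0}. val V a) else 0)"

text \<open>\<open>p\<^sub>1, p\<^sub>2, p\<^sub>3\<close> are the points of \<open>I(f)\<close> and \<open>q\<^sub>1, q\<^sub>2, q\<^sub>3\<close> those of \<open>I(f\<^sup>-\<^sup>1)\<close>, infinitely near ones
  included: \<open>f\<close> lifts to an isomorphism between the surface \<open>Y\<close> obtained by blowing up the former
  and the one obtained by blowing up the latter, and in the divisor class group of \<open>Y\<close>
  one has \<open>e\<^sub>j\<^sup>- = h - \<Sum>\<^bsub>i\<noteq>j\<^esub> e\<^sub>i\<^sup>+\<close>. The blowups may have to be performed in an order
  different from that of the labels.\<close>

definition base_points :: "ratmap \<Rightarrow> (3 \<Rightarrow> point) \<Rightarrow> (3 \<Rightarrow> point) \<Rightarrow> bool" where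
  "base_points f p q \<longleftrightarrow>
     (\<exists>is js Y. distinct is \<and> set is = UNIV \<and> distinct js \<and> set js = UNIV
        \<and> successive_centers (map p is) P2 \<and> successive_centers (map q js) P2
        \<and> Y = successive_blowup (map p is) P2
        \<and> (\<lambda>S. f ` S) ` successive_blowup (map q js) P2 = Y
        \<and> (\<forall>j. lin_equiv Y (total_exceptional (f ` q j))
                 (\<lambda>V. line_pullback V - (\<Sum>i\<in>UNIV - {j}. total_exceptional (p i) V))))"

definition realization_step ::
  "ratmap \<Rightarrow> (3 \<Rightarrow> point) \<Rightarrow> (3 \<Rightarrow> point) \<Rightarrow> (3 \<Rightarrow> nat) \<Rightarrow> (3 \<Rightarrow> 3) \<Rightarrow> 3 \<Rightarrow> point set \<Rightarrow> point set \<Rightarrow> bool"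
where
  "realization_step f p q n \<sigma> i X X' \<longleftrightarrow>
     q i \<in> X \<and> p (\<sigma> i) \<in> X
     \<and> (map_pt f X ^^ (n i - 1)) (q i) = p (\<sigma> i)
     \<and> (\<forall>m. m < n i - 1 \<longrightarrow> (map_pt f X ^^ m) (q i) \<notin> indeterminacy f X)
     \<and> (\<forall>m. 0 < m \<and> m \<le> n i - 1 \<longrightarrow> (map_pt f X ^^ m) (q i) \<notin> indeterminacy (inv_into UNIV f) X)
     \<and> X' = blowup ((\<lambda>m. (map_pt f X ^^ m) (q i)) ` {..n i - 1}) X"

definition realizes :: "ratmap \<Rightarrow> (3 \<Rightarrow> nat) \<Rightarrow> (3 \<Rightarrow> 3) \<Rightarrow> bool" where
  "realizes f n \<sigma> \<longleftrightarrow>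
     (\<exists>p q i j k X1 X2 X3. base_points f p q \<and> distinct [i, j, k]
        \<and> realization_step f p q n \<sigma> i P2 X1
        \<and> realization_step f p q n \<sigma> j X1 X2
        \<and> realization_step f p q n \<sigma> k X2 X3)"

datatype basis_elt = H | E 3 nat

definition orbit_basis :: "(3 \<Rightarrow> nat) \<Rightarrow> basis_elt list" where
  "orbit_basis n = H # map (E 1) [0..<n 1] @ map (E 2) [0..<n 2] @ map (E 3) [0..<n 3]"

definition unit_coord :: "basis_elt \<Rightarrow> basis_elt \<Rightarrow> real" where
  "unit_coord b c = (if c = b then 1 else 0)"

text \<open>\<open>orbit_map n \<sigma> b c\<close> is the coefficient of \<open>c\<close> in \<open>T(b)\<close>.\<close>

fun orbit_map :: "(3 \<Rightarrow> nat) \<Rightarrow> (3 \<Rightarrow> 3) \<Rightarrow> basis_elt \<Rightarrow> basis_elt \<Rightarrow> real" where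
  "orbit_map n \<sigma> H c = 2 * unit_coord H c - (\<Sum>j\<in>UNIV. unit_coord (E j (n j - 1)) c)"
| "orbit_map n \<sigma> (E i (Suc m)) c = unit_coord (E i m) c"
| "orbit_map n \<sigma> (E k 0) c =
     unit_coord H c - (\<Sum>j\<in>UNIV - {inv_into UNIV \<sigma> k}. unit_coord (E j (n j - 1)) c)"

definition orbit_char_poly :: "(3 \<Rightarrow> nat) \<Rightarrow> (3 \<Rightarrow> 3) \<Rightarrow> real poly" where
  "orbit_char_poly n \<sigma> =
     (let B = orbit_basis n; N = length B
      in char_poly (Matrix.mat N N (\<lambda>(r, c). orbit_map n \<sigma> (B ! c) (B ! r))))"

definition triangle :: "point set" where
  "triangle = {pt v | v. v \<noteq> 0 \<and> v$1 * v$2 * v$3 = 0}"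

text \<open>Smooth points: the gradient of \<open>XYZ\<close> does not vanish.\<close>

definition triangle_reg :: "point set" where
  "triangle_reg = {pt v | v. v \<noteq> 0 \<and> v$1 * v$2 * v$3 = 0
     \<and> (v$2 * v$3, v$1 * v$3, v$1 * v$2) \<noteq> (0, 0, 0)}"

definition reg_component :: "3 \<Rightarrow> point set" where
  "reg_component j = triangle_reg \<inter> {pt v | v. v \<noteq> 0 \<and> v$j = 0}"

definition properly_fixes_triangle :: "ratmap \<Rightarrow> bool" where
  "properly_fixes_triangle f \<longleftrightarrow>
     P2_closure (map_pt f P2 ` (triangle - indeterminacy f P2)) = triangle
     \<and> indeterminacy f P2 \<inter> triangle \<subseteq> triangle_reg
     \<and> indeterminacy (inv_into UNIV f) P2 \<inter> triangle \<subseteq> triangle_reg"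

text \<open>Isomorphisms between lines of the plane are the restrictions of linear maps, and a morphism on
  a nodal curve with smooth components is the same as a family of morphisms on the components that
  agree at the nodes.\<close>

definition triangle_automorphism :: "(point \<Rightarrow> point) \<Rightarrow> bool" where
  "triangle_automorphism \<tau> \<longleftrightarrow> bij_betw \<tau> triangle triangle
     \<and> (\<forall>j. \<exists>A :: complex^3^3. \<forall>v. v \<noteq> 0 \<and> v$j = 0 \<longrightarrow> A *v v \<noteq> 0 \<and> \<tau> (pt v) = pt (A *v v))"

definition restricts_to :: "ratmap \<Rightarrow> (point \<Rightarrow> point) \<Rightarrow> bool" where
  "restricts_to f \<tau> \<longleftrightarrow> triangle_automorphism \<tau>
     \<and> (\<forall>R \<in> triangle - indeterminacy f P2. \<tau> R = map_pt f P2 R)"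

text \<open>Coordinate on the \<open>j\<close>-th line. The value \<open>s = \<infinity>\<close> on the \<open>j\<close>-th line and the value \<open>s = 0\<close> on
  the \<open>(j+1)\<close>-st line give the same node.\<close>

definition edge_pt :: "3 \<Rightarrow> complex \<Rightarrow> point" where
  "edge_pt j s = pt (\<chi> i. if i = j then 0 else if i = j + 1 then 1 else s)"

text \<open>Every class in \<open>Pic\<^sup>0\<close> of the triangle is represented by a divisor supported at
  smooth points and having degree zero on each component.\<close>

definition div0_triangle :: "(point \<Rightarrow> int) set" where
  "div0_triangle = {D. finite {R. D R \<noteq> 0} \<and> {R. D R \<noteq> 0} \<subseteq> triangle_reg
     \<and> (\<forall>j. (\<Sum>R | R \<in> reg_component j \<and> D R \<noteq> 0. D R) = 0)}"

text \<open>\<open>D\<close> is the divisor of a rational function on the triangle that is regular and non-zero at the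
  nodes. On the \<open>j\<close>-th line the function is \<open>P\<^sub>j(s)/Q\<^sub>j(s)\<close>; its value at \<open>s = \<infinity>\<close> is the quotient of
  the leading coefficients, and the values on adjacent lines have to agree at the common node.\<close>

definition principal_triangle :: "(point \<Rightarrow> int) \<Rightarrow> bool" where
  "principal_triangle D \<longleftrightarrow> (\<exists>P Q :: 3 \<Rightarrow> complex poly. \<forall>j.
     poly (P j) 0 \<noteq> 0 \<and> poly (Q j) 0 \<noteq> 0 \<and> degree (P j) = degree (Q j)
     \<and> lead_coeff (P j) / lead_coeff (Q j) = poly (P (j + 1)) 0 / poly (Q (j + 1)) 0
     \<and> (\<forall>s. s \<noteq> 0 \<longrightarrow> D (edge_pt j s) = int (Polynomial.order s (P j)) - int (Polynomial.order s (Q j))))"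

definition push_divisor :: "(point \<Rightarrow> point) \<Rightarrow> (point \<Rightarrow> int) \<Rightarrow> point \<Rightarrow> int" where
  "push_divisor \<tau> D R = (\<Sum>S | D S \<noteq> 0 \<and> \<tau> S = R. D S)"

text \<open>\<open>[D] \<mapsto> [\<tau>(D)]\<close> is multiplication by \<open>a\<close> on \<open>Pic\<^sup>0 \<cong> \<complex>/\<int>\<close>.\<close>

definition has_multiplier :: "(point \<Rightarrow> point) \<Rightarrow> int \<Rightarrow> bool" where
  "has_multiplier \<tau> a \<longleftrightarrow> a \<in> {1, -1}
     \<and> (\<forall>D \<in> div0_triangle. principal_triangle (\<lambda>R. push_divisor \<tau> D R - a * D R))"

end

theory Submission
  imports Defs "HOL-Computational_Algebra.Field_as_Ring"
begin

text \<open>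
  A quadratic map \<open>f\<close> that properly fixes the triangle maps every line of it onto a line. As \<open>f\<close> is regular at
  the nodes and injective on each line, its components are \<open>f\<^bsub>\<pi>(j)\<^esub> = v\<^sub>j (N v)\<^sub>j\<close>, where \<open>\<pi>\<close> permutes
  the lines and \<open>N\<^sup>-\<^sup>1\<close> is a matrix with zero diagonal. Each line contains exactly one \<open>p\<^sub>j\<^sup>+\<close> and one
  \<open>p\<^sub>j\<^sup>-\<close>, and the regular part of the triangle is mapped by \<open>\<Phi>(j, s) = (\<pi>(j), (d\<^sub>j s)^(\<plusminus>1))\<close>. Valuation rings
  centred at points of the lines are permuted in the same way, so that they follow orbits on all
  the blown-up surfaces, and a realization of orbit data becomes a statement about \<open>\<Phi>\<close>.

  The operator \<open>T\<close> preserves a Lorentz form. It has no eigenvalue off the unit circle if it fixes a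
  non-zero class of non-negative square. If \<open>\<pi>\<close> is a three-cycle, then \<open>\<Phi>\<^sup>2\<close> maps \<open>p\<^sub>j\<^sup>-\<close> to \<open>p\<^sub>j\<^sup>+\<close>,
  whence \<open>n\<^sub>1 + n\<^sub>2 + n\<^sub>3 \<le> 9\<close>, and the canonical class is such a class; if \<open>\<pi>\<close> is a transposition, then
  \<open>n\<^sub>l = 1\<close> and \<open>\<sigma>(l) = l\<close> for some \<open>l\<close>, and \<open>H - E\<^sub>l\<close> is one. So \<open>\<pi> = id\<close>, which forces \<open>\<sigma> = id\<close>.
  Conversely, for \<open>\<pi> = \<sigma> = id\<close> it suffices that \<open>d\<^sub>j^n\<^sub>j = d\<^sub>1 d\<^sub>2 d\<^sub>3 \<noteq> 1\<close> and \<open>d\<^sub>j\<^sup>m \<noteq> 1\<close> for \<open>1 \<le> m \<le> n\<^sub>j\<close>,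
  and there are such \<open>d\<^sub>j\<close> on the unit circle.
\<close>

text \<open>The zero diagonal of the inverse of N arises as follows. Along the j-th line, each of
  the two components that do not vanish there is a coordinate times a linear form, and injectivity
  makes these two forms proportional on the line. So a principal 2x2 minor of N vanishes, and these
  minors are the diagonal of the adjugate. The obstacle to following orbits is that f is not regular
  where they end, while its lifts live on surfaces that change with every stage. A valuation ring
  has one centre on each of them, and f acts on such rings without exception. The points in
  \<open>realizes\<close> are constrained only by divisor classes. They are unique up to one common
  relabelling, as exceptional curves over different base points are not linearly equivalent. If c_j
  and e_j (up to inversion) are the coordinates of p_j^+ and p_j^-, the identity d_{j+1} d_{j+2} e_j
  = c_j gives both the two-step return for a three-cycle and the condition on d_j for the converse;
  d_1 d_2 d_3 \<noteq> 1 means that N is invertible. H - E_l is the class of the lines through the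
  base point p_l^+ = p_l^-, a pencil that f preserves.\<close>

no_notation fps_nth (infixl "$" 75)

section \<open>Polynomials in two variables and the values of the corresponding forms\<close>

lemma vec3_eq_iff: "(v::complex^3) = w \<longleftrightarrow> v$1 = w$1 \<and> v$2 = w$2 \<and> v$3 = w$3"
  by (simp add: Finite_Cartesian_Product.vec_eq_iff forall_3)

definition peval :: "complex poly poly \<Rightarrow> complex \<Rightarrow> complex \<Rightarrow> complex" where
  "peval a x y = poly (poly a [:y:]) x"

lemma peval_simps [simp]:
  "peval 0 x y = 0" "peval 1 x y = 1" "peval (a + b) x y = peval a x y + peval b x y"
  "peval (a - b) x y = peval a x y - peval b x y" "peval (- a) x y = - peval a x y"
  "peval (a * b) x y = peval a x y * peval b x y" "peval (a ^ k) x y = peval a x y ^ k"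
  "peval [:p:] x y = poly p x" "peval [:0, 1:] x y = y"
  by (simp_all add: peval_def poly_power)

text \<open>Over the domain \<complex>[x], the constants \<open>[:y:]\<close> would be infinitely
  many roots of a non-zero polynomial in the outer variable.\<close>

lemma peval_eq_0D:
  assumes "\<And>x y. peval a x y = 0"
  shows "a = 0"
proof (rule ccontr)
  assume "a \<noteq> 0"
  have "poly a [:y:] = 0" for y
    using assms unfolding peval_def by (intro iffD1[OF poly_all_0_iff_0]) blast
  hence "range (\<lambda>y. [:y:]) \<subseteq> {c. poly a c = 0}" by auto
  moreover have "infinite (range (\<lambda>y::complex. [:y:]))"
    by (simp add: finite_image_iff inj_def infinite_UNIV_char_0)
  ultimately show False using poly_roots_finite[OF \<open>a \<noteq> 0\<close>] finite_subset by blast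
qed

lemma peval_eqD: "(\<And>x y. peval a x y = peval b x y) \<Longrightarrow> a = b"
  using peval_eq_0D[of "a - b"] by simp

lemma poly_eq_sum_le:
  fixes p :: "'a::comm_semiring_1 poly"
  assumes "degree p \<le> n"
  shows "poly p x = (\<Sum>i\<le>n. coeff p i * x ^ i)"
  unfolding poly_altdef
  by (rule sum.mono_neutral_left) (use assms in \<open>auto simp: coeff_eq_0\<close>)

lemma total_degree_le_degree:
  assumes "total_degree_le a d"
  shows "degree a \<le> d" "degree (coeff a j) \<le> d - j"
proof -
  show "degree (coeff a j) \<le> d - j"
  proof (rule degree_le, intro allI impI)
    fix i assume "d - j < i"
    thus "coeff (coeff a j) i = 0" using assms unfolding total_degree_le_def by force
  qed
  show "degree a \<le> d"
  proof (rule degree_le, intro allI impI)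
    fix i assume "d < i"
    thus "coeff a i = 0" using assms unfolding total_degree_le_def
      by (intro poly_eqI) force
  qed
qed

lemma form_value_affine:
  assumes "total_degree_le a d"
  shows "form_value d a (vector [x, y, 1]) = peval a x y"
proof -
  have "peval a x y = (\<Sum>j\<le>d. poly (coeff a j) x * y ^ j)"
    unfolding peval_def
    by (subst poly_eq_sum_le[OF total_degree_le_degree(1)[OF assms]])
       (simp add: poly_sum poly_power)
  also have "\<dots> = (\<Sum>j\<le>d. (\<Sum>i\<le>d - j. coeff (coeff a j) i * x ^ i) * y ^ j)"
    by (subst poly_eq_sum_le[OF total_degree_le_degree(2)[OF assms]]) simp
  finally show ?thesis unfolding form_value_def
    by (simp add: sum_distrib_right)
qed

lemma form_value_scale: "form_value d a (c *s v) = c ^ d * form_value d a v"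
proof -
  have *: "coeff (coeff a j) i * (c * v$1) ^ i * (c * v$2) ^ j * (c * v$3) ^ (d - i - j)
     = c ^ d * (coeff (coeff a j) i * v$1 ^ i * v$2 ^ j * v$3 ^ (d - i - j))"
    if "j \<in> {..d}" "i \<in> {..d - j}" for i j
  proof -
    have "c ^ d = c ^ i * c ^ j * c ^ (d - i - j)"
      using that by (simp flip: power_add)
    thus ?thesis by (simp add: power_mult_distrib mult_ac)
  qed
  show ?thesis unfolding form_value_def sum_distrib_left vector_smult_component
    by (intro sum.cong refl *)
qed

lemma form_value_chart:
  assumes "total_degree_le a d" "v$3 \<noteq> 0"
  shows "form_value d a v = v$3 ^ d * peval a (v$1 / v$3) (v$2 / v$3)"
proof -
  have "v = v$3 *s vector [v$1 / v$3, v$2 / v$3, 1]"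
    using assms(2) by (simp add: vec3_eq_iff)
  thus ?thesis using form_value_scale[of d a "v$3"] form_value_affine[OF assms(1)] by metis
qed

lemma total_degree_le_mult:
  assumes "total_degree_le a d" "total_degree_le b e"
  shows "total_degree_le (a * b) (d + e)"
  unfolding total_degree_le_def
proof (intro allI impI)
  fix i j assume "coeff (coeff (a * b) j) i \<noteq> 0"
  hence "(\<Sum>k\<le>j. \<Sum>l\<le>i. coeff (coeff a k) l * coeff (coeff b (j - k)) (i - l)) \<noteq> 0"
    by (simp add: coeff_mult coeff_sum)
  then obtain k where k: "k \<le> j" "(\<Sum>l\<le>i. coeff (coeff a k) l * coeff (coeff b (j - k)) (i - l)) \<noteq> 0"
    by (meson atMost_iff sum.neutral)
  then obtain l where "l \<le> i" "coeff (coeff a k) l * coeff (coeff b (j - k)) (i - l) \<noteq> 0"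
    by (meson atMost_iff sum.neutral)
  hence "l + k \<le> d" "i - l + (j - k) \<le> e"
    using assms unfolding total_degree_le_def by (metis mult_eq_0_iff)+
  thus "i + j \<le> d + e" using \<open>l \<le> i\<close> \<open>k \<le> j\<close> by linarith
qed

text \<open>Off the line at infinity, a form value is the value of the dehomogenization times a
  power of \<open>v$3\<close>, and the identity is immediate. The case \<open>v$3 = 0\<close>
  follows by continuity along \<open>u t\<close>, without any reindexing of coefficient
  sums.\<close>

lemma form_value_mult:
  assumes "total_degree_le a d" "total_degree_le b e"
  shows "form_value (d + e) (a * b) v = form_value d a v * form_value e b v"
proof -
  note ab = total_degree_le_mult[OF assms]
  have *: "form_value (d + e) (a * b) v = form_value d a v * form_value e b v" if "v$3 \<noteq> 0" for v
    unfolding form_value_chart[OF assms(1) that] form_value_chart[OF assms(2) that]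
      form_value_chart[OF ab that]
    by (simp add: power_add)
  define u where "u t = (vector [v$1, v$2, t] :: complex^3)" for t
  define g where "g t = form_value (d + e) (a * b) (u t) - form_value d a (u t) * form_value e b (u t)" for t
  have "isCont (\<lambda>t. form_value k c (u t)) 0" for k c
    unfolding form_value_def u_def vector_3 by (intro continuous_intros)
  hence "isCont g 0" unfolding g_def by (intro continuous_intros)
  hence "g \<midarrow>0\<rightarrow> g 0" by (simp add: isCont_def)
  moreover have "g \<midarrow>0\<rightarrow> 0"
    by (rule tendsto_eventually) (auto simp: eventually_at_filter g_def u_def intro!: * always_eventually)
  ultimately have "g 0 = 0" by (rule LIM_unique)
  moreover have "u 0 = v" if "v$3 = 0" using that by (simp add: u_def vec3_eq_iff)
  ultimately show ?thesis using *[of v] unfolding g_def by (cases "v$3 = 0") auto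
qed

lemma form_value_add: "form_value d (a + b) v = form_value d a v + form_value d b v"
  by (simp add: form_value_def sum.distrib distrib_right)

lemma form_value_minus: "form_value d (- a) v = - form_value d a v"
  by (simp add: form_value_def sum_negf)

section \<open>Forms as functions, and fractions of forms\<close>

definition form :: "nat \<Rightarrow> (complex^3 \<Rightarrow> complex) \<Rightarrow> bool" where
  "form d A \<longleftrightarrow> (\<exists>a. total_degree_le a d \<and> A = form_value d a)"

lemma form_0: "form d (\<lambda>v. 0)"
  unfolding form_def by (intro exI[of _ 0]) (auto simp: total_degree_le_def form_value_def fun_eq_iff)

lemma form_add: "form d A \<Longrightarrow> form d B \<Longrightarrow> form d (\<lambda>v. A v + B v)"
  unfolding form_def
proof safe
  fix a b assume "total_degree_le a d" "total_degree_le b d"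
  moreover have "total_degree_le (a + b) d"
    using calculation unfolding total_degree_le_def by (metis add.left_neutral add.right_neutral coeff_add)
  ultimately show "\<exists>c. total_degree_le c d \<and> (\<lambda>v. form_value d a v + form_value d b v) = form_value d c"
    by (intro exI[of _ "a + b"]) (auto simp: form_value_add fun_eq_iff)
qed

lemma form_minus: "form d A \<Longrightarrow> form d (\<lambda>v. - A v)"
  unfolding form_def
proof safe
  fix a assume "total_degree_le a d"
  thus "\<exists>c. total_degree_le c d \<and> (\<lambda>v. - form_value d a v) = form_value d c"
    by (intro exI[of _ "- a"]) (auto simp: form_value_minus total_degree_le_def)
qed

lemma form_diff: "form d A \<Longrightarrow> form d B \<Longrightarrow> form d (\<lambda>v. A v - B v)"
  using form_add[OF _ form_minus, of d A B] by simp

lemma form_mult: "form d A \<Longrightarrow> form e B \<Longrightarrow> form (d + e) (\<lambda>v. A v * B v)"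
  unfolding form_def
proof safe
  fix a b assume "total_degree_le a d" "total_degree_le b e"
  thus "\<exists>c. total_degree_le c (d + e) \<and> (\<lambda>v. form_value d a v * form_value e b v) = form_value (d + e) c"
    by (intro exI[of _ "a * b"]) (auto simp: form_value_mult total_degree_le_mult)
qed

lemma form_const: "form 0 (\<lambda>v. c)"
  unfolding form_def
  by (intro exI[of _ "[:[:c:]:]"]) (auto simp: total_degree_le_def form_value_def fun_eq_iff coeff_pCons split: nat.splits)

lemma form_power: "form d A \<Longrightarrow> form (d * k) (\<lambda>v. A v ^ k)"
  by (induction k) (auto simp: form_const intro: form_mult)

lemma form_sum: "(\<And>i. i \<in> S \<Longrightarrow> form d (A i)) \<Longrightarrow> form d (\<lambda>v. \<Sum>i\<in>S. A i v)"
  by (induction S rule: infinite_finite_induct) (auto intro: form_0 form_add)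

lemma form_coord: "form 1 (\<lambda>v. v $ i)"
proof -
  have le1: "{..Suc 0} = {0, 1::nat}" by auto
  have "form 1 (\<lambda>v. v $ 1)" unfolding form_def
    by (intro exI[of _ "[:[:0,1:]:]"])
       (auto simp: total_degree_le_def form_value_def fun_eq_iff coeff_pCons le1 split: nat.splits)
  moreover have "form 1 (\<lambda>v. v $ 2)" unfolding form_def
    by (intro exI[of _ "[:0,1:]"])
       (auto simp: total_degree_le_def form_value_def fun_eq_iff coeff_pCons le1 split: nat.splits)
  moreover have "form 1 (\<lambda>v. v $ 3)" unfolding form_def
    by (intro exI[of _ "1"])
       (auto simp: total_degree_le_def form_value_def fun_eq_iff coeff_pCons one_pCons le1 split: nat.splits)
  ultimately show ?thesis using exhaust_3[of i] by auto
qed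

lemma form_const_mult: "form d A \<Longrightarrow> form d (\<lambda>v. c * A v)"
  using form_mult[OF form_const] by fastforce

lemma form_comp:
  assumes "form d A" "\<And>i. form e (\<lambda>v. F v $ i)"
  shows "form (d * e) (\<lambda>v. A (F v))"
proof -
  from assms(1) obtain a where A: "A = form_value d a" unfolding form_def by auto
  have "form (d * e) (\<lambda>v. coeff (coeff a j) i * F v $ 1 ^ i * F v $ 2 ^ j * F v $ 3 ^ (d - i - j))"
    if "j \<in> {..d}" "i \<in> {..d - j}" for i j
  proof -
    have "form (0 + e * i + e * j + e * (d - i - j)) (\<lambda>v. coeff (coeff a j) i * F v $ 1 ^ i * F v $ 2 ^ j * F v $ 3 ^ (d - i - j))"
      by (intro form_mult form_const form_power assms)
    moreover have "0 + e * i + e * j + e * (d - i - j) = e * (i + j + (d - i - j))"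
      by (simp add: algebra_simps)
    moreover have "i + j + (d - i - j) = d" using that by auto
    ultimately show ?thesis by (simp add: mult.commute)
  qed
  thus ?thesis unfolding A form_value_def by (intro form_sum)
qed

text \<open>Recovers the polynomial from a form that is given as a function; it is unique by
  \<open>peval_eqD\<close>. Products and substitutions of forms can thus be written as operations on
  functions, without carrying polynomials along.\<close>

definition dehom :: "(complex^3 \<Rightarrow> complex) \<Rightarrow> complex poly poly" where
  "dehom A = (THE a. \<forall>x y. peval a x y = A (vector [x, y, 1]))"

lemma dehomI: "(\<And>x y. peval a x y = A (vector [x, y, 1])) \<Longrightarrow> dehom A = a"
  unfolding dehom_def by (rule the_equality) (auto intro: peval_eqD)

lemma dehom_form:
  assumes "form d A"
  shows "total_degree_le (dehom A) d" "form_value d (dehom A) = A"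
    "peval (dehom A) x y = A (vector [x, y, 1])"
proof -
  obtain a where a: "total_degree_le a d" "A = form_value d a" using assms unfolding form_def by auto
  hence "dehom A = a" by (intro dehomI) (simp add: form_value_affine)
  thus "total_degree_le (dehom A) d" "form_value d (dehom A) = A" "peval (dehom A) x y = A (vector [x, y, 1])"
    using a by (auto simp: form_value_affine)
qed

lemma dehom_form_value: "total_degree_le a d \<Longrightarrow> dehom (form_value d a) = a"
  by (intro dehomI) (simp add: form_value_affine)

lemma dehom_mult: "form d A \<Longrightarrow> form e B \<Longrightarrow> dehom (\<lambda>v. A v * B v) = dehom A * dehom B"
  by (intro dehomI) (auto simp: dehom_form)

lemma dehom_add: "form d A \<Longrightarrow> form e B \<Longrightarrow> dehom (\<lambda>v. A v + B v) = dehom A + dehom B"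
  by (intro dehomI) (auto simp: dehom_form)

lemma dehom_const: "dehom (\<lambda>v. c) = [:[:c:]:]" by (intro dehomI) simp

lemma dehom_eq_0_iff: "form d A \<Longrightarrow> dehom A = 0 \<longleftrightarrow> (\<forall>v. A v = 0)"
  using dehom_form(2)[of d A] dehomI[of 0 A] by (auto simp: form_value_def fun_eq_iff)

lemma form_mult_nonzero:
  assumes "form d A" "form e B" "\<exists>v. A v \<noteq> 0" "\<exists>v. B v \<noteq> 0"
  shows "\<exists>v. A v * B v \<noteq> 0"
proof -
  have "dehom (\<lambda>v. A v * B v) \<noteq> 0"
    using assms by (simp add: dehom_mult[OF assms(1,2)] dehom_eq_0_iff[of d] dehom_eq_0_iff[of e])
  thus ?thesis using dehom_eq_0_iff[OF form_mult[OF assms(1,2)]] by simp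
qed

lemma form_cancel:
  assumes "form d A" "form e B" "form e C" "\<exists>v. A v \<noteq> 0" "\<And>v. A v * B v = A v * C v"
  shows "B v = C v"
  using form_mult_nonzero[OF assms(1) form_diff[OF assms(2,3)] assms(4)] assms(5)
  by (auto simp: algebra_simps)

text \<open>The rational function A/B on the plane, intended for forms A, B of the same
  degree.\<close>

definition fr :: "(complex^3 \<Rightarrow> complex) \<Rightarrow> (complex^3 \<Rightarrow> complex) \<Rightarrow> ratfun" where
  "fr A B = Fract (dehom A) (dehom B)"

lemma fr_eq_iff:
  assumes "form d A" "form d B" "form e A'" "form e B'" "\<exists>v. B v \<noteq> 0" "\<exists>v. B' v \<noteq> 0"
  shows "fr A B = fr A' B' \<longleftrightarrow> (\<forall>v. A v * B' v = A' v * B v)"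
proof -
  have "fr A B = fr A' B' \<longleftrightarrow> dehom A * dehom B' = dehom A' * dehom B"
    unfolding fr_def using assms by (intro eq_fract) (auto simp: dehom_eq_0_iff)
  also have "\<dots> \<longleftrightarrow> dehom (\<lambda>v. A v * B' v) = dehom (\<lambda>v. A' v * B v)"
    using assms by (simp add: dehom_mult)
  also have "\<dots> \<longleftrightarrow> (\<forall>v. A v * B' v = A' v * B v)"
  proof
    assume eq: "dehom (\<lambda>v. A v * B' v) = dehom (\<lambda>v. A' v * B v)"
    have "form (d + e) (\<lambda>v. A v * B' v)" "form (d + e) (\<lambda>v. A' v * B v)"
      using form_mult[OF assms(1,4)] form_mult[OF assms(3,2)] by (simp_all add: add.commute)
    from this[THEN dehom_form(2)] eq show "\<forall>v. A v * B' v = A' v * B v" by metis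
  qed simp
  finally show ?thesis .
qed

lemma total_degree_le_exists: "\<exists>d. \<forall>e\<ge>d. total_degree_le a e"
proof -
  define m where "m = Max ((\<lambda>j. degree (coeff a j)) ` {..degree a})"
  have "i + j \<le> degree a + m" if "coeff (coeff a j) i \<noteq> 0" for i j
  proof -
    have "j \<le> degree a" using that by (metis coeff_0 coeff_eq_0 not_le)
    moreover have "i \<le> degree (coeff a j)" using that by (rule le_degree)
    moreover have "degree (coeff a j) \<le> m" unfolding m_def using \<open>j \<le> degree a\<close> by (intro Max_ge) auto
    ultimately show ?thesis by linarith
  qed
  thus ?thesis unfolding total_degree_le_def by (metis le_trans)
qed

lemma ex_fr:
  obtains d A B where "form d A" "form d B" "\<exists>v. B v \<noteq> 0" "g = fr A B"
proof -
  obtain a b where g: "g = Fract a b" "b \<noteq> 0" by (cases g) auto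
  obtain d1 d2 where "\<forall>e\<ge>d1. total_degree_le a e" "\<forall>e\<ge>d2. total_degree_le b e"
    using total_degree_le_exists by metis
  hence td: "total_degree_le a (max d1 d2)" "total_degree_le b (max d1 d2)" by auto
  show ?thesis
  proof (rule that[of "max d1 d2" "form_value (max d1 d2) a" "form_value (max d1 d2) b"])
    show "form (max d1 d2) (form_value (max d1 d2) a)" and fb: "form (max d1 d2) (form_value (max d1 d2) b)"
      using td unfolding form_def by auto
    show "\<exists>v. form_value (max d1 d2) b v \<noteq> 0"
      using dehom_eq_0_iff[OF fb] g(2) dehom_form_value[OF td(2)] by auto
    show "g = fr (form_value (max d1 d2) a) (form_value (max d1 d2) b)"
      unfolding fr_def g by (simp add: dehom_form_value td)
  qed
qed

lemma fr_mult:
  assumes "form d A" "form d B" "form e A'" "form e B'"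
  shows "fr A B * fr A' B' = fr (\<lambda>v. A v * A' v) (\<lambda>v. B v * B' v)"
  unfolding fr_def using assms by (simp add: dehom_mult)

lemma fr_add:
  assumes "form d A" "form d B" "form e A'" "form e B'" "\<exists>v. B v \<noteq> 0" "\<exists>v. B' v \<noteq> 0"
  shows "fr A B + fr A' B' = fr (\<lambda>v. A v * B' v + A' v * B v) (\<lambda>v. B v * B' v)"
proof -
  have "dehom (\<lambda>v. A v * B' v + A' v * B v) = dehom A * dehom B' + dehom A' * dehom B"
    using assms by (simp add: dehom_mult dehom_add[OF form_mult form_mult])
  thus ?thesis unfolding fr_def using assms
    by (simp add: dehom_mult dehom_eq_0_iff[of d] dehom_eq_0_iff[of e])
qed

lemma fr_minus: "form d A \<Longrightarrow> form d B \<Longrightarrow> - fr A B = fr (\<lambda>v. - A v) B"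
proof -
  assume "form d A" "form d B"
  hence "dehom (\<lambda>v. - A v) = - dehom A" by (intro dehomI) (simp add: dehom_form)
  thus ?thesis unfolding fr_def by simp
qed

lemma fr_inverse: "form d A \<Longrightarrow> form d B \<Longrightarrow> inverse (fr A B) = fr B A"
  unfolding fr_def by simp

lemma fr_cancel:
  assumes "form d A" "form d B" "form e C" "\<exists>v. B v \<noteq> 0" "\<exists>v. C v \<noteq> 0"
  shows "fr (\<lambda>v. A v * C v) (\<lambda>v. B v * C v) = fr A B"
  by (subst fr_eq_iff[OF form_mult[OF assms(1,3)] form_mult[OF assms(2,3)] assms(1,2)])
     (use assms form_mult_nonzero[OF assms(2,3)] in auto)

lemma fr_eq_0_iff: "form d A \<Longrightarrow> form d B \<Longrightarrow> \<exists>v. B v \<noteq> 0 \<Longrightarrow> fr A B = 0 \<longleftrightarrow> (\<forall>v. A v = 0)"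
  unfolding fr_def using eq_fract(1)[of "dehom B" 1 "dehom A" 0]
  by (simp add: dehom_eq_0_iff flip: Zero_fract_def)

lemma const_fun_fr: "const_fun c = fr (\<lambda>v. c) (\<lambda>v. 1)"
  unfolding const_fun_def fr_def by (simp add: dehom_const one_pCons)

lemma const_fun_simps:
  "const_fun 0 = 0" "const_fun 1 = 1" "const_fun (a + b) = const_fun a + const_fun b"
  "const_fun (a * b) = const_fun a * const_fun b" "const_fun (- a) = - const_fun a"
  "const_fun (a - b) = const_fun a - const_fun b"
  unfolding const_fun_def by (simp_all add: Zero_fract_def One_fract_def one_pCons)

lemma const_fun_eq_0_iff [simp]: "const_fun c = 0 \<longleftrightarrow> c = 0"
  unfolding const_fun_def by (simp add: Zero_fract_def eq_fract)

lemma dehom_coord: "dehom (\<lambda>v. v $ 1) = [:[:0, 1:]:]" "dehom (\<lambda>v. v $ 2) = [:0, 1:]" "dehom (\<lambda>v. v $ 3) = 1"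
  by (intro dehomI; simp)+

lemma xy_fun_fr: "x_fun = fr (\<lambda>v. v $ 1) (\<lambda>v. v $ 3)" "y_fun = fr (\<lambda>v. v $ 2) (\<lambda>v. v $ 3)"
  unfolding x_fun_def y_fun_def fr_def dehom_coord by simp_all

lemma coord_nonzero: "\<exists>v::complex^3. v $ i \<noteq> 0"
  by (intro exI[of _ "\<chi> i. 1"]) simp

lemma pt_fr: "pt v = {fr A B | A B d. form d A \<and> form d B \<and> B v \<noteq> 0}"
proof -
  have "\<exists>A B d. Fract a b = fr A B \<and> form d A \<and> form d B \<and> B v \<noteq> 0"
    if "total_degree_le a d" "total_degree_le b d" "form_value d b v \<noteq> 0" for a b d
    using that by (intro exI[of _ "form_value d a"] exI[of _ "form_value d b"] exI[of _ d])
      (auto simp: fr_def dehom_form_value form_def)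
  moreover have "\<exists>a b. fr A B = Fract a b \<and> (\<exists>d. total_degree_le a d \<and> total_degree_le b d \<and> form_value d b v \<noteq> 0)"
    if "form d A" "form d B" "B v \<noteq> 0" for d A B
    using that by (intro exI[of _ "dehom A"] exI[of _ "dehom B"] conjI exI[of _ d])
      (auto simp: fr_def dehom_form)
  ultimately show ?thesis unfolding pt_def by blast
qed

lemma form_scale: "form d A \<Longrightarrow> A (c *s v) = c ^ d * A v"
  unfolding form_def using form_value_scale by auto

lemma pt_scale: "c \<noteq> 0 \<Longrightarrow> pt (c *s v) = pt v"
  unfolding pt_fr using form_scale by (intro Collect_cong) (metis mult_eq_0_iff power_not_zero)

lemma form_line_poly:
  assumes "form d A"
  shows "\<exists>P. \<forall>t. poly P t = A (p + t *s q)"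
proof -
  obtain a where A: "A = form_value d a" using assms unfolding form_def by auto
  define P where "P = (\<Sum>j\<le>d. \<Sum>i\<le>d - j. [:coeff (coeff a j) i:] * [:p$1, q$1:]^i * [:p$2, q$2:]^j * [:p$3, q$3:]^(d - i - j))"
  have "poly P t = A (p + t *s q)" for t
    unfolding P_def A form_value_def by (simp add: poly_sum poly_power mult_ac)
  thus ?thesis by blast
qed

section \<open>Pullback of rational functions along maps given by forms\<close>

definition form_map :: "nat \<Rightarrow> (complex^3 \<Rightarrow> complex^3) \<Rightarrow> bool" where
  "form_map e F \<longleftrightarrow> (\<forall>i. form e (\<lambda>v. F v $ i))
     \<and> (\<forall>d A. form d A \<longrightarrow> (\<exists>v. A v \<noteq> 0) \<longrightarrow> (\<exists>v. A (F v) \<noteq> 0))"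

text \<open>The pullback by \<open>F\<close>; meaningful only for \<open>form_map e F\<close>.\<close>

definition sub :: "(complex^3 \<Rightarrow> complex^3) \<Rightarrow> ratmap" where
  "sub F g = (SOME h. \<exists>d A B. form d A \<and> form d B \<and> (\<exists>v. B v \<noteq> 0) \<and> g = fr A B
     \<and> h = fr (\<lambda>v. A (F v)) (\<lambda>v. B (F v)))"

lemma form_map_nonzero: "form_map e F \<Longrightarrow> form d A \<Longrightarrow> \<exists>v. A v \<noteq> 0 \<Longrightarrow> \<exists>v. A (F v) \<noteq> 0"
  unfolding form_map_def by blast

lemma form_map_form: "form_map e F \<Longrightarrow> form d A \<Longrightarrow> form (d * e) (\<lambda>v. A (F v))"
  unfolding form_map_def by (blast intro: form_comp)

lemma sub_fr:
  assumes F: "form_map e F" and AB: "form d A" "form d B" "\<exists>v. B v \<noteq> 0"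
  shows "sub F (fr A B) = fr (\<lambda>v. A (F v)) (\<lambda>v. B (F v))"
  unfolding sub_def
proof (rule some_equality)
  fix h assume "\<exists>d' A' B'. form d' A' \<and> form d' B' \<and> (\<exists>v. B' v \<noteq> 0) \<and> fr A B = fr A' B'
     \<and> h = fr (\<lambda>v. A' (F v)) (\<lambda>v. B' (F v))"
  then obtain d' A' B' where *: "form d' A'" "form d' B'" "\<exists>v. B' v \<noteq> 0" "fr A B = fr A' B'"
    "h = fr (\<lambda>v. A' (F v)) (\<lambda>v. B' (F v))" by blast
  have "\<forall>v. A v * B' v = A' v * B v"
    using *(4) fr_eq_iff[OF AB(1,2) *(1,2) AB(3) *(3)] by blast
  thus "h = fr (\<lambda>v. A (F v)) (\<lambda>v. B (F v))"
    unfolding *(5) using fr_eq_iff[OF form_map_form[OF F *(1)] form_map_form[OF F *(2)]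
      form_map_form[OF F AB(1)] form_map_form[OF F AB(2)] form_map_nonzero[OF F *(2,3)]
      form_map_nonzero[OF F AB(2,3)]] by simp
qed (use AB in blast)

lemma form_map_comp:
  assumes "form_map e F" "form_map e' G"
  shows "form_map (e * e') (\<lambda>v. F (G v))"
  unfolding form_map_def
proof (intro conjI allI impI)
  show "form (e * e') (\<lambda>v. F (G v) $ i)" for i
    using form_map_form[OF assms(2), of e "\<lambda>v. F v $ i"] assms(1) unfolding form_map_def by blast
  show "\<exists>v. A (F (G v)) \<noteq> 0" if "form d A" "\<exists>v. A v \<noteq> 0" for d A
    by (rule form_map_nonzero[OF assms(2) form_map_form[OF assms(1) that(1)] form_map_nonzero[OF assms(1) that]])
qed

lemma sub_sub:
  assumes "form_map e F" "form_map e' G"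
  shows "sub G (sub F g) = sub (\<lambda>v. F (G v)) g"
proof -
  obtain d A B where g: "form d A" "form d B" "\<exists>v. B v \<noteq> 0" "g = fr A B" by (rule ex_fr)
  show ?thesis unfolding g(4) sub_fr[OF assms(1) g(1-3)] sub_fr[OF form_map_comp[OF assms] g(1-3)]
    by (rule sub_fr[OF assms(2) form_map_form[OF assms(1) g(1)] form_map_form[OF assms(1) g(2)]
          form_map_nonzero[OF assms(1) g(2,3)]])
qed

text \<open>A common factor c of the components multiplies numerator and denominator of a fraction
  of forms of degree d by the same c^d. Homogeneous formulas for a map may therefore be rescaled by
  any non-zero form.\<close>

lemma sub_scale:
  assumes "form_map e F" "form_map e' F'" "form k c" "\<exists>v. c v \<noteq> 0" "\<And>v. F' v = c v *s F v"
  shows "sub F' g = sub F g"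
proof -
  obtain d A B where g: "form d A" "form d B" "\<exists>v. B v \<noteq> 0" "g = fr A B" by (rule ex_fr)
  have "(\<lambda>v. A (F' v)) = (\<lambda>v. A (F v) * c v ^ d)" "(\<lambda>v. B (F' v)) = (\<lambda>v. B (F v) * c v ^ d)"
    using form_scale g(1,2) unfolding assms(5) by (auto simp: mult.commute)
  thus ?thesis unfolding g(4) sub_fr[OF assms(1) g(1-3)] sub_fr[OF assms(2) g(1-3)]
    using fr_cancel[OF form_map_form[OF assms(1) g(1)] form_map_form[OF assms(1) g(2)] form_power[OF assms(3), of d]]
      form_map_nonzero[OF assms(1) g(2,3)] assms(4) by auto
qed

lemma form_map_id: "form_map 1 (\<lambda>v. v)" unfolding form_map_def using form_coord by auto

lemma sub_id: "sub (\<lambda>v. v) g = g"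
  by (rule ex_fr[of g]) (simp add: sub_fr[OF form_map_id])

lemma sub_add: "form_map e F \<Longrightarrow> sub F (g + h) = sub F g + sub F h"
proof -
  assume F: "form_map e F"
  obtain d A B where g: "form d A" "form d B" "\<exists>v. B v \<noteq> 0" "g = fr A B" by (rule ex_fr)
  obtain d' A' B' where h: "form d' A'" "form d' B'" "\<exists>v. B' v \<noteq> 0" "h = fr A' B'" by (rule ex_fr)
  have 1: "form (d + d') (\<lambda>v. A v * B' v + A' v * B v)"
    using form_add[OF form_mult[OF g(1) h(2)]] form_mult[OF h(1) g(2)] by (simp add: add.commute)
  note fm = form_map_form[OF F g(1)] form_map_form[OF F g(2)] form_map_form[OF F h(1)] form_map_form[OF F h(2)]
    form_map_nonzero[OF F g(2,3)] form_map_nonzero[OF F h(2,3)]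
  show ?thesis unfolding g(4) h(4)
    by (subst fr_add[OF g(1,2) h(1,2) g(3) h(3)],
        subst sub_fr[OF F 1 form_mult[OF g(2) h(2)] form_mult_nonzero[OF g(2) h(2) g(3) h(3)]],
        subst (1 2) sub_fr[OF F], (rule g h)+, rule fr_add[symmetric], rule fm)
       (rule fm)+
qed

lemma sub_mult: "form_map e F \<Longrightarrow> sub F (g * h) = sub F g * sub F h"
proof -
  assume F: "form_map e F"
  obtain d A B where g: "form d A" "form d B" "\<exists>v. B v \<noteq> 0" "g = fr A B" by (rule ex_fr)
  obtain d' A' B' where h: "form d' A'" "form d' B'" "\<exists>v. B' v \<noteq> 0" "h = fr A' B'" by (rule ex_fr)
  note fm = form_map_form[OF F g(1)] form_map_form[OF F g(2)] form_map_form[OF F h(1)] form_map_form[OF F h(2)]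
  show ?thesis unfolding g(4) h(4)
    by (subst fr_mult[OF g(1,2) h(1,2)],
        subst sub_fr[OF F form_mult[OF g(1) h(1)] form_mult[OF g(2) h(2)] form_mult_nonzero[OF g(2) h(2) g(3) h(3)]],
        subst (1 2) sub_fr[OF F], (rule g h)+, rule fr_mult[symmetric], rule fm)
       (rule fm)+
qed

lemma sub_const: "form_map e F \<Longrightarrow> sub F (const_fun c) = const_fun c"
  unfolding const_fun_fr by (subst sub_fr) (auto intro: form_const)

text \<open>The composites are the identity only up to a non-zero form as a factor, which is what
  homogeneous formulas of mutually inverse birational maps give.\<close>

definition inverse_maps :: "(complex^3 \<Rightarrow> complex^3) \<Rightarrow> (complex^3 \<Rightarrow> complex^3) \<Rightarrow> bool" where
  "inverse_maps F G \<longleftrightarrow> (\<exists>e e' k l c c'. (\<forall>i. form e (\<lambda>v. F v $ i)) \<and> (\<forall>i. form e' (\<lambda>v. G v $ i))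
     \<and> form k c \<and> form l c' \<and> (\<exists>v. c v \<noteq> 0) \<and> (\<exists>v. c' v \<noteq> 0)
     \<and> (\<forall>v. F (G v) = c v *s v) \<and> (\<forall>v. G (F v) = c' v *s v))"

lemma inverse_maps_sym: "inverse_maps F G \<Longrightarrow> inverse_maps G F"
  unfolding inverse_maps_def by blast

text \<open>Dominance, the second half of \<open>form_map\<close>, is automatic for invertible maps:
  A (F (G v)) is c(v)^d A(v), and a product of non-zero forms is non-zero.\<close>

lemma inverse_maps_form_map:
  assumes "inverse_maps F G"
  shows "\<exists>e. form_map e F"
proof -
  obtain e k c where F: "\<forall>i. form e (\<lambda>v. F v $ i)" and c: "form k c" "\<exists>v. c v \<noteq> 0"
    and FG: "\<forall>v. F (G v) = c v *s v"
    using assms unfolding inverse_maps_def by metis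
  have "\<exists>v. A (F v) \<noteq> 0" if "form d A" "\<exists>v. A v \<noteq> 0" for d A
    using form_mult_nonzero[OF form_power[OF c(1), of d] that(1) _ that(2)] c(2) FG
      form_scale[OF that(1)] by (metis power_not_zero)
  thus ?thesis using F unfolding form_map_def by blast
qed

lemma sub_inverse:
  assumes "inverse_maps F G"
  shows "sub F (sub G g) = g"
proof -
  obtain e e' where F: "form_map e F" and G: "form_map e' G"
    using inverse_maps_form_map assms inverse_maps_sym by metis
  obtain l c' where c: "form l c'" "\<exists>v. c' v \<noteq> 0" "\<And>v. G (F v) = c' v *s v"
    using assms unfolding inverse_maps_def by metis
  have "sub F (sub G g) = sub (\<lambda>v. G (F v)) g" by (rule sub_sub[OF G F])
  also have "\<dots> = sub (\<lambda>v. v) g"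
    by (rule sub_scale[OF form_map_id form_map_comp[OF G F] c])
  finally show ?thesis by (simp add: sub_id)
qed

lemma birational_sub:
  assumes "inverse_maps F G"
  shows "birational_map (sub F)"
proof -
  obtain e where F: "form_map e F" using inverse_maps_form_map assms by metis
  have "bij (sub F)"
    by (rule o_bij[of "sub G"]) (auto simp: fun_eq_iff sub_inverse assms inverse_maps_sym)
  thus ?thesis unfolding birational_map_def using sub_add[OF F] sub_mult[OF F] sub_const[OF F] by auto
qed

section \<open>Local rings\<close>

text \<open>Maximal ideals, domination, blowups, prime divisors and valuations are defined by the
  field operations of K alone, so every automorphism of K transports them. Statements about a smooth
  point are thereby reduced to the origin.\<close>

locale birational =
  fixes \<phi> :: ratmap
  assumes birational_map: "birational_map \<phi>"
begin

lemma bij: "bij \<phi>" and hom_add: "\<phi> (a + b) = \<phi> a + \<phi> b" and hom_mult: "\<phi> (a * b) = \<phi> a * \<phi> b"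
  and hom_const: "\<phi> (const_fun c) = const_fun c"
  using birational_map unfolding birational_map_def by auto

lemma hom_0: "\<phi> 0 = 0" and hom_1: "\<phi> 1 = 1"
  using hom_const[of 0] hom_const[of 1] by (simp_all add: const_fun_simps)

lemma hom_eq_iff: "\<phi> a = \<phi> b \<longleftrightarrow> a = b" using bij by (auto simp: bij_def inj_def)
lemma hom_eq_0_iff: "\<phi> a = 0 \<longleftrightarrow> a = 0" using hom_eq_iff[of a 0] hom_0 by simp
lemma hom_minus: "\<phi> (- a) = - \<phi> a" using hom_add[of a "- a"] hom_0 by (simp add: eq_neg_iff_add_eq_0 add.commute)
lemma hom_diff: "\<phi> (a - b) = \<phi> a - \<phi> b" using hom_add[of a "- b"] hom_minus by simp
lemma hom_inverse: "\<phi> (inverse a) = inverse (\<phi> a)"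
  by (cases "a = 0") (use hom_mult[of a "inverse a"] hom_0 hom_1 in \<open>auto simp: inverse_unique\<close>)
lemma hom_divide: "\<phi> (a / b) = \<phi> a / \<phi> b" by (simp add: divide_inverse hom_mult hom_inverse)
lemma hom_power: "\<phi> (a ^ k) = \<phi> a ^ k" by (induction k) (simp_all add: hom_1 hom_mult)
lemma hom_powi: "\<phi> (a powi k) = \<phi> a powi k" by (simp add: power_int_def hom_power hom_inverse)
lemma hom_poly: "\<phi> (poly p w) = poly (map_poly \<phi> p) (\<phi> w)"
  by (induction p) (simp_all add: map_poly_pCons hom_0 hom_add hom_mult)

lemmas hom = hom_add hom_mult hom_0 hom_1 hom_minus hom_diff hom_inverse hom_divide hom_power hom_powi
  hom_const hom_eq_0_iff

lemma inj: "inj \<phi>" using bij by (simp add: bij_def)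
lemma in_image_iff: "\<phi> a \<in> \<phi> ` R \<longleftrightarrow> a \<in> R" using hom_eq_iff by auto
lemma image_eq_iff: "\<phi> ` R = \<phi> ` S \<longleftrightarrow> R = S" using inj by (simp add: inj_image_eq_iff)
lemma surjE: obtains b where "a = \<phi> b" using bij by (meson bij_pointE)
lemma image_inv: "\<phi> ` (inv_into UNIV \<phi> ` R) = R" "inv_into UNIV \<phi> ` (\<phi> ` R) = R"
  using bij by (simp_all add: bij_def image_f_inv_f image_inv_f_f)
lemma ball_image: "(\<forall>b\<in>\<phi> ` R. P b) \<longleftrightarrow> (\<forall>b\<in>R. P (\<phi> b))" by auto

lemma units_image: "units_of_ring (\<phi> ` R) = \<phi> ` units_of_ring R"
  unfolding units_of_ring_def using in_image_iff by (auto simp: hom_eq_0_iff hom_0 hom_eq_iff simp flip: hom_inverse)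

lemma max_ideal_image: "max_ideal (\<phi> ` R) = \<phi> ` max_ideal R"
  unfolding max_ideal_def units_image using inj by (simp add: image_set_diff)

lemma dominates_image: "dominates (\<phi> ` S) (\<phi> ` R) \<longleftrightarrow> dominates S R"
  unfolding dominates_def max_ideal_image using inj by (simp add: inj_image_subset_iff)

lemma coeffs_in_image: "(\<forall>i. coeff p i \<in> \<phi> ` R) \<longleftrightarrow> (\<exists>q. p = map_poly \<phi> q \<and> (\<forall>i. coeff q i \<in> R))"
proof
  assume *: "\<forall>i. coeff p i \<in> \<phi> ` R"
  show "\<exists>q. p = map_poly \<phi> q \<and> (\<forall>i. coeff q i \<in> R)"
  proof (intro exI[of _ "map_poly (inv_into UNIV \<phi>) p"] conjI allI)
    have i0: "inv_into UNIV \<phi> 0 = 0" by (metis hom_0 inj inv_f_f)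
    show "p = map_poly \<phi> (map_poly (inv_into UNIV \<phi>) p)"
      by (intro poly_eqI) (simp add: coeff_map_poly hom_0 i0 bij bij_is_surj surj_f_inv_f)
    fix i show "coeff (map_poly (inv_into UNIV \<phi>) p) i \<in> R"
      using * by (simp add: coeff_map_poly i0) (metis image_iff inj inv_f_f)
  qed
qed (auto simp: coeff_map_poly hom_0)

lemma local_ring_over_image: "local_ring_over (\<phi> ` R) (\<phi> w) = \<phi> ` local_ring_over R w"
proof -
  have "local_ring_over (\<phi> ` R) (\<phi> w) = {poly (map_poly \<phi> p) (\<phi> w) / poly (map_poly \<phi> q) (\<phi> w) | p q.
      (\<forall>i. coeff p i \<in> R) \<and> (\<forall>i. coeff q i \<in> R) \<and> coeff (map_poly \<phi> q) 0 \<in> units_of_ring (\<phi> ` R)}"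
    unfolding local_ring_over_def coeffs_in_image by blast
  also have "\<dots> = {\<phi> (poly p w / poly q w) | p q. (\<forall>i. coeff p i \<in> R) \<and> (\<forall>i. coeff q i \<in> R) \<and> coeff q 0 \<in> units_of_ring R}"
    unfolding units_image by (simp add: hom_divide hom_poly coeff_map_poly hom_0 in_image_iff)
  also have "\<dots> = \<phi> ` local_ring_over R w"
    unfolding local_ring_over_def by blast
  finally show ?thesis .
qed

lemma exceptional_points_image: "exceptional_points (\<phi> ` R) = (`) \<phi> ` exceptional_points R"
proof -
  have 1: "max_ideal (\<phi> ` R) = {a * \<phi> u + b * \<phi> v | a b. a \<in> \<phi> ` R \<and> b \<in> \<phi> ` R}
      \<longleftrightarrow> max_ideal R = {a * u + b * v | a b. a \<in> R \<and> b \<in> R}" for u v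
  proof -
    have "{a * \<phi> u + b * \<phi> v | a b. a \<in> \<phi> ` R \<and> b \<in> \<phi> ` R} = \<phi> ` {a * u + b * v | a b. a \<in> R \<and> b \<in> R}"
    proof -
      have "{a * \<phi> u + b * \<phi> v | a b. a \<in> \<phi> ` R \<and> b \<in> \<phi> ` R} = {\<phi> (a * u + b * v) | a b. a \<in> R \<and> b \<in> R}"
        unfolding hom_add hom_mult by blast
      thus ?thesis by blast
    qed
    thus ?thesis unfolding max_ideal_image by (simp add: image_eq_iff)
  qed
  have "exceptional_points (\<phi> ` R) = {local_ring_over (\<phi> ` R) (\<phi> v / \<phi> u) | u v.
      max_ideal (\<phi> ` R) = {a * \<phi> u + b * \<phi> v | a b. a \<in> \<phi> ` R \<and> b \<in> \<phi> ` R}}"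
  proof -
    have "\<exists>u' v'. S = local_ring_over (\<phi> ` R) (\<phi> v' / \<phi> u') \<and>
        max_ideal (\<phi> ` R) = {a * \<phi> u' + b * \<phi> v' | a b. a \<in> \<phi> ` R \<and> b \<in> \<phi> ` R}"
      if "S = local_ring_over (\<phi> ` R) (v / u)" "max_ideal (\<phi> ` R) = {a * u + b * v | a b. a \<in> \<phi> ` R \<and> b \<in> \<phi> ` R}"
      for S u v
    proof -
      obtain u' v' where "u = \<phi> u'" "v = \<phi> v'" by (metis surjE)
      show ?thesis by (intro exI[of _ u'] exI[of _ v']) (use that \<open>u = \<phi> u'\<close> \<open>v = \<phi> v'\<close> in simp)
    qed
    hence "exceptional_points (\<phi> ` R) \<subseteq> {local_ring_over (\<phi> ` R) (\<phi> v / \<phi> u) | u v.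
      max_ideal (\<phi> ` R) = {a * \<phi> u + b * \<phi> v | a b. a \<in> \<phi> ` R \<and> b \<in> \<phi> ` R}}"
      unfolding exceptional_points_def by (intro subsetI) (elim CollectE exE conjE, rule CollectI)
    moreover have "{local_ring_over (\<phi> ` R) (\<phi> v / \<phi> u) | u v.
      max_ideal (\<phi> ` R) = {a * \<phi> u + b * \<phi> v | a b. a \<in> \<phi> ` R \<and> b \<in> \<phi> ` R}} \<subseteq> exceptional_points (\<phi> ` R)"
      unfolding exceptional_points_def by (intro subsetI) (elim CollectE exE conjE, intro CollectI exI conjI)
    ultimately show ?thesis by (rule subset_antisym)
  qed
  also have "\<dots> = {\<phi> ` local_ring_over R (v / u) | u v. max_ideal R = {a * u + b * v | a b. a \<in> R \<and> b \<in> R}}"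
    by (simp only: 1 local_ring_over_image hom_divide[symmetric])
  also have "\<dots> = (`) \<phi> ` exceptional_points R"
  proof -
    have "{h (g u v) | u v. P u v} = h ` {g u v | u v. P u v}"
      for h :: "point \<Rightarrow> point" and g :: "ratfun \<Rightarrow> ratfun \<Rightarrow> point" and P by blast
    thus ?thesis unfolding exceptional_points_def .
  qed
  finally show ?thesis .
qed

lemma blowup_image: "blowup ((`) \<phi> ` B) ((`) \<phi> ` X) = (`) \<phi> ` blowup B X"
proof -
  have "inj ((`) \<phi>)" using inj by (simp add: inj_def inj_image_eq_iff)
  thus ?thesis unfolding blowup_def by (auto simp: exceptional_points_image image_Un image_set_diff image_UN)
qed

end

lemma birational_map_inv: "birational_map \<phi> \<Longrightarrow> birational_map (inv_into UNIV \<phi>)"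
proof -
  assume "birational_map \<phi>"
  then interpret birational \<phi> by unfold_locales
  have s: "\<phi> (inv_into UNIV \<phi> a) = a" for a using bij by (simp add: bij_is_surj surj_f_inv_f)
  have "inv_into UNIV \<phi> (a + b) = inv_into UNIV \<phi> a + inv_into UNIV \<phi> b" "inv_into UNIV \<phi> (a * b) = inv_into UNIV \<phi> a * inv_into UNIV \<phi> b" for a b
    by (simp_all flip: hom_eq_iff add: s hom)
  moreover have "inv_into UNIV \<phi> (const_fun c) = const_fun c" for c by (simp flip: hom_eq_iff add: s hom)
  ultimately show ?thesis unfolding birational_map_def using bij bij_imp_bij_inv by auto
qed

lemma birational_map_comp: "birational_map \<phi> \<Longrightarrow> birational_map \<psi> \<Longrightarrow> birational_map (\<phi> \<circ> \<psi>)"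
  unfolding birational_map_def by (auto intro: bij_comp)

lemma birational_map_id: "birational_map id"
  unfolding birational_map_def by auto

definition const_subring :: "ratfun set \<Rightarrow> bool" where
  "const_subring R \<longleftrightarrow> (\<forall>c. const_fun c \<in> R) \<and> (\<forall>a\<in>R. \<forall>b\<in>R. a + b \<in> R) \<and> (\<forall>a\<in>R. \<forall>b\<in>R. a * b \<in> R)"

lemma const_subringD:
  assumes "const_subring R"
  shows "const_fun c \<in> R" "0 \<in> R" "1 \<in> R" "a \<in> R \<Longrightarrow> b \<in> R \<Longrightarrow> a + b \<in> R" "a \<in> R \<Longrightarrow> b \<in> R \<Longrightarrow> a * b \<in> R"
    "a \<in> R \<Longrightarrow> - a \<in> R" "a \<in> R \<Longrightarrow> b \<in> R \<Longrightarrow> a - b \<in> R" "a \<in> R \<Longrightarrow> a ^ k \<in> R"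
proof -
  show c: "const_fun c \<in> R" "0 \<in> R" "1 \<in> R" for c
    using assms unfolding const_subring_def by (metis const_fun_simps(1,2))+
  show *: "a \<in> R \<Longrightarrow> b \<in> R \<Longrightarrow> a + b \<in> R" "a \<in> R \<Longrightarrow> b \<in> R \<Longrightarrow> a * b \<in> R" for a b
    using assms unfolding const_subring_def by blast+
  show m: "a \<in> R \<Longrightarrow> - a \<in> R" for a
    using *(2)[OF c(1)[of "- 1"], of a] by (simp add: const_fun_simps)
  show "a \<in> R \<Longrightarrow> b \<in> R \<Longrightarrow> a - b \<in> R" using *(1)[OF _ m, of a b] by simp
  show "a \<in> R \<Longrightarrow> a ^ k \<in> R" by (induction k) (auto intro: c *)
qed

lemma const_subring_poly:
  assumes "const_subring R" "\<And>i. coeff p i \<in> R" "w \<in> R"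
  shows "poly p w \<in> R"
  unfolding poly_altdef
proof -
  have "(\<Sum>i\<in>I. coeff p i * w ^ i) \<in> R" for I
    by (induction I rule: infinite_finite_induct) (use assms in \<open>auto intro!: const_subringD\<close>)
  thus "(\<Sum>i\<le>degree p. coeff p i * w ^ i) \<in> R" .
qed

text \<open>A local algebra with residue field \<complex>: every element has a value, the constant
  to which it is congruent modulo the non-units. These residues replace evaluation at a point when
  the rings are those of places.\<close>

definition res_local :: "ratfun set \<Rightarrow> bool" where
  "res_local R \<longleftrightarrow> const_subring R \<and> (\<forall>a\<in>R. \<exists>c. a - const_fun c \<in> max_ideal R)
     \<and> (\<forall>a\<in>max_ideal R. \<forall>b\<in>max_ideal R. a + b \<in> max_ideal R)"

lemma max_ideal_iff: "a \<in> max_ideal R \<longleftrightarrow> a \<in> R \<and> (a = 0 \<or> inverse a \<notin> R)"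
  unfolding max_ideal_def units_of_ring_def by auto

lemma units_iff: "a \<in> units_of_ring R \<longleftrightarrow> a \<in> R \<and> a \<noteq> 0 \<and> inverse a \<in> R"
  unfolding units_of_ring_def by auto

lemma res_localD:
  assumes "res_local R"
  shows "const_subring R" "a \<in> R \<Longrightarrow> \<exists>c. a - const_fun c \<in> max_ideal R"
    "a \<in> max_ideal R \<Longrightarrow> b \<in> max_ideal R \<Longrightarrow> a + b \<in> max_ideal R"
  using assms unfolding res_local_def by auto

lemma max_ideal_mult:
  assumes "res_local R" "a \<in> max_ideal R" "b \<in> R"
  shows "a * b \<in> max_ideal R" "b * a \<in> max_ideal R"
proof -
  have "inverse (a * b) \<notin> R" if "a * b \<noteq> 0"
  proof
    assume "inverse (a * b) \<in> R"
    hence "b * inverse (a * b) \<in> R" using assms res_localD const_subringD(5) by blast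
    moreover have "b * inverse (a * b) = inverse a" using that by (simp add: field_simps)
    ultimately have "inverse a \<in> R" by (simp only:)
    thus False using assms(2) that by (auto simp: max_ideal_iff)
  qed
  thus "a * b \<in> max_ideal R" using assms const_subringD(5)[OF res_localD(1)] by (auto simp: max_ideal_iff)
  thus "b * a \<in> max_ideal R" by (simp add: mult.commute)
qed

lemma max_ideal_minus: "res_local R \<Longrightarrow> a \<in> max_ideal R \<Longrightarrow> - a \<in> max_ideal R"
  using max_ideal_mult(1)[of R a "- 1"] const_subringD(3)[OF res_localD(1)] const_subringD(6)[OF res_localD(1)]
  by simp

lemma max_ideal_diff: "res_local R \<Longrightarrow> a \<in> max_ideal R \<Longrightarrow> b \<in> max_ideal R \<Longrightarrow> a - b \<in> max_ideal R"
  using res_localD(3)[of R a "- b"] max_ideal_minus by simp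

lemma max_ideal_0: "res_local R \<Longrightarrow> 0 \<in> max_ideal R"
  using const_subringD(2)[OF res_localD(1)] by (simp add: max_ideal_iff)

lemma max_ideal_const_iff: "res_local R \<Longrightarrow> const_fun c \<in> max_ideal R \<longleftrightarrow> c = 0"
proof -
  assume R: "res_local R"
  have "inverse (const_fun c) = const_fun (inverse c)" if "c \<noteq> 0"
    using that const_fun_simps(4)[of c "inverse c"] const_fun_simps(2) by (auto intro: inverse_unique)
  hence "inverse (const_fun c) \<in> R" if "c \<noteq> 0" using that const_subringD(1)[OF res_localD(1)[OF R]] by simp
  thus ?thesis using const_subringD(1,2)[OF res_localD(1)[OF R]] by (auto simp: max_ideal_iff const_fun_simps)
qed

lemma units_or_max: "a \<in> R \<Longrightarrow> a \<in> units_of_ring R \<longleftrightarrow> a \<notin> max_ideal R"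
  unfolding max_ideal_def units_of_ring_def by auto

lemma max_subset: "a \<in> max_ideal R \<Longrightarrow> a \<in> R" by (simp add: max_ideal_iff)

lemma units_subset:
  "a \<in> units_of_ring R \<Longrightarrow> a \<in> R" "a \<in> units_of_ring R \<Longrightarrow> a \<noteq> 0"
  "a \<in> units_of_ring R \<Longrightarrow> inverse a \<in> R" "a \<in> units_of_ring R \<Longrightarrow> inverse a \<in> units_of_ring R"
  by (simp_all add: units_iff)

lemma units_add_max:
  assumes "res_local R" "a \<in> units_of_ring R" "m \<in> max_ideal R"
  shows "a + m \<in> units_of_ring R" "m + a \<in> units_of_ring R" "a - m \<in> units_of_ring R"
proof -
  have *: "a + m \<in> units_of_ring R" if "m \<in> max_ideal R" for m
  proof (rule ccontr)
    assume "a + m \<notin> units_of_ring R"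
    moreover have "a + m \<in> R"
      using const_subringD(4)[OF res_localD(1)[OF assms(1)] units_subset(1)[OF assms(2)] max_subset[OF that]] .
    ultimately have "a + m \<in> max_ideal R" using units_or_max by blast
    from max_ideal_diff[OF assms(1) this that] have "a \<in> max_ideal R" by simp
    thus False using assms(2) units_or_max[OF units_subset(1)[OF assms(2)]] by blast
  qed
  show "a + m \<in> units_of_ring R" "m + a \<in> units_of_ring R" "a - m \<in> units_of_ring R"
    using *[OF assms(3)] *[OF max_ideal_minus[OF assms(1,3)]] by (simp_all add: add.commute)
qed

lemma units_mult: "res_local R \<Longrightarrow> a \<in> units_of_ring R \<Longrightarrow> b \<in> units_of_ring R \<Longrightarrow> a * b \<in> units_of_ring R"
  using const_subringD(5)[OF res_localD(1)] by (auto simp: units_iff)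

lemma res_unique:
  assumes "res_local R" "a - const_fun c \<in> max_ideal R" "a - const_fun d \<in> max_ideal R"
  shows "c = d"
proof -
  have "(a - const_fun d) - (a - const_fun c) \<in> max_ideal R" using assms max_ideal_diff by blast
  hence "const_fun (c - d) \<in> max_ideal R" by (simp add: const_fun_simps)
  thus ?thesis using max_ideal_const_iff[OF assms(1)] by simp
qed

lemma res_mult:
  assumes "res_local R" "a - const_fun c \<in> max_ideal R" "b - const_fun d \<in> max_ideal R"
  shows "a * b - const_fun (c * d) \<in> max_ideal R"
proof -
  note cs = res_localD(1)[OF assms(1)]
  have "(b - const_fun d) + const_fun d \<in> R"
    by (rule const_subringD(4)[OF cs max_subset[OF assms(3)] const_subringD(1)[OF cs]])
  hence "(a - const_fun c) * b + (b - const_fun d) * const_fun c \<in> max_ideal R"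
    by (intro res_localD(3) max_ideal_mult(1) assms const_subringD(1) cs) simp
  thus ?thesis by (simp add: const_fun_simps algebra_simps)
qed

lemma res_add:
  assumes "res_local R" "a - const_fun c \<in> max_ideal R" "b - const_fun d \<in> max_ideal R"
  shows "a + b - const_fun (c + d) \<in> max_ideal R"
  using res_localD(3)[OF assms] by (simp add: const_fun_simps algebra_simps)

lemma dominatesD:
  assumes "dominates S R"
  shows "a \<in> R \<Longrightarrow> a \<in> S" "a \<in> max_ideal R \<Longrightarrow> a \<in> max_ideal S" "a \<in> units_of_ring R \<Longrightarrow> a \<in> units_of_ring S"
    "a \<in> R \<Longrightarrow> a \<in> units_of_ring S \<Longrightarrow> a \<in> units_of_ring R" "a \<in> R \<Longrightarrow> a \<in> max_ideal S \<Longrightarrow> a \<in> max_ideal R"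
  using assms unfolding dominates_def max_ideal_def units_of_ring_def by auto

lemma dominates_trans: "dominates A B \<Longrightarrow> dominates B C \<Longrightarrow> dominates A C"
  unfolding dominates_def by blast

lemma dominates_refl: "dominates A A" unfolding dominates_def by blast

lemma (in birational) image_closed_iff:
  "\<phi> a + \<phi> b \<in> \<phi> ` R \<longleftrightarrow> a + b \<in> R" "\<phi> a * \<phi> b \<in> \<phi> ` R \<longleftrightarrow> a * b \<in> R"
  "const_fun c \<in> \<phi> ` R \<longleftrightarrow> const_fun c \<in> R" "\<phi> a - const_fun c \<in> \<phi> ` R \<longleftrightarrow> a - const_fun c \<in> R"
  using in_image_iff[of "a + b" R] in_image_iff[of "a * b" R] in_image_iff[of "const_fun c" R]
    in_image_iff[of "a - const_fun c" R] by (simp_all only: hom_add hom_mult hom_const hom_diff)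

lemma (in birational) const_subring_image: "const_subring R \<Longrightarrow> const_subring (\<phi> ` R)"
  unfolding const_subring_def ball_image image_closed_iff .

lemma (in birational) res_local_image: "res_local R \<Longrightarrow> res_local (\<phi> ` R)"
  unfolding res_local_def max_ideal_image ball_image image_closed_iff using const_subring_image by blast

subsection \<open>Local rings over a local ring\<close>

lemma poly_split0:
  assumes "const_subring R" "\<And>i. coeff p i \<in> R" "R \<subseteq> S" "const_subring S" "w \<in> S"
  obtains r where "r \<in> S" "poly p w = coeff p 0 + w * r"
proof (cases p)
  case (pCons a q)
  have "poly q w \<in> S"
  proof (rule const_subring_poly[OF assms(4) _ assms(5)])
    fix i show "coeff q i \<in> S" using assms(2)[of "Suc i"] assms(3) pCons by auto
  qed
  thus ?thesis using that[of "poly q w"] pCons by simp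
qed

context
  fixes R W w
  assumes R: "res_local R" and W: "res_local W" and WR: "dominates W R" and w: "w \<in> max_ideal W"
begin

lemma lro_unit_iff:
  assumes "\<forall>i. coeff p i \<in> R"
  shows "poly p w \<in> W" "poly p w \<in> units_of_ring W \<longleftrightarrow> coeff p 0 \<in> units_of_ring R"
proof -
  obtain r where r: "r \<in> W" "poly p w = coeff p 0 + w * r"
    by (rule poly_split0[OF res_localD(1)[OF R] assms[rule_format] _ res_localD(1)[OF W] max_subset[OF w]])
       (use dominatesD(1)[OF WR] in auto)
  have wr: "w * r \<in> max_ideal W" using max_ideal_mult(1)[OF W w r(1)] .
  show "poly p w \<in> W" unfolding r(2)
    by (rule const_subringD(4)[OF res_localD(1)[OF W] dominatesD(1)[OF WR assms[rule_format]] max_subset[OF wr]])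
  show "poly p w \<in> units_of_ring W \<longleftrightarrow> coeff p 0 \<in> units_of_ring R"
  proof
    assume "poly p w \<in> units_of_ring W"
    hence "coeff p 0 \<in> units_of_ring W" unfolding r(2) using units_add_max(3)[OF W _ wr] by fastforce
    thus "coeff p 0 \<in> units_of_ring R" by (rule dominatesD(4)[OF WR assms[rule_format]])
  next
    assume "coeff p 0 \<in> units_of_ring R"
    thus "poly p w \<in> units_of_ring W" unfolding r(2) by (intro units_add_max(1)[OF W _ wr] dominatesD(3)[OF WR])
  qed
qed

lemma lroI: "(\<And>i. coeff p i \<in> R) \<Longrightarrow> (\<And>i. coeff q i \<in> R) \<Longrightarrow> coeff q 0 \<in> units_of_ring R
   \<Longrightarrow> poly p w / poly q w \<in> local_ring_over R w"
  unfolding local_ring_over_def by blast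

lemma lroE:
  assumes "a \<in> local_ring_over R w"
  obtains p q where "\<forall>i. coeff p i \<in> R" "\<forall>i. coeff q i \<in> R" "coeff q 0 \<in> units_of_ring R"
    "a = poly p w / poly q w" "poly q w \<in> units_of_ring W" "poly q w \<noteq> 0"
proof -
  obtain p q where "\<forall>i. coeff p i \<in> R" "\<forall>i. coeff q i \<in> R" "coeff q 0 \<in> units_of_ring R"
    "a = poly p w / poly q w" using assms unfolding local_ring_over_def by blast
  moreover from this have "poly q w \<in> units_of_ring W" using lro_unit_iff(2) by blast
  ultimately show ?thesis using that units_subset(2) by blast
qed

lemma coeff_closed:
  assumes "\<And>i. coeff p i \<in> R" "\<And>i. coeff q i \<in> R"
  shows "coeff (p * q) i \<in> R" "coeff (p + q) i \<in> R"
proof -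
  have "(\<Sum>i\<in>I. coeff p i * coeff q (n - i)) \<in> R" for I n
    by (induction I rule: infinite_finite_induct)
       (use assms const_subringD[OF res_localD(1)[OF R]] in auto)
  thus "coeff (p * q) i \<in> R" by (simp add: coeff_mult)
  show "coeff (p + q) i \<in> R" using assms const_subringD[OF res_localD(1)[OF R]] by simp
qed

lemma lro_base: "a \<in> R \<Longrightarrow> a \<in> local_ring_over R w" and lro_self: "w \<in> local_ring_over R w"
proof -
  note cs = const_subringD[OF res_localD(1)[OF R]]
  have 1: "1 \<in> units_of_ring R" using cs(3) by (simp add: units_iff)
  have c: "coeff [:a:] i \<in> R" if "a \<in> R" for a i using that cs(2) by (auto simp: coeff_pCons split: nat.splits)
  have c': "coeff [:0, 1:] i \<in> R" for i using cs(2,3) by (auto simp: coeff_pCons split: nat.splits)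
  show "a \<in> R \<Longrightarrow> a \<in> local_ring_over R w"
    using lroI[of "[:a:]" "[:1:]", OF c c] cs(3) 1 by simp
  show "w \<in> local_ring_over R w"
    using lroI[of "[:0, 1:]" "[:1:]", OF c' c] cs(3) 1 by simp
qed

lemma lro_subring: "const_subring (local_ring_over R w)"
proof -
  have "a + b \<in> local_ring_over R w \<and> a * b \<in> local_ring_over R w"
    if ab: "a \<in> local_ring_over R w" "b \<in> local_ring_over R w" for a b
  proof -
    obtain p q where a: "\<forall>i. coeff p i \<in> R" "\<forall>i. coeff q i \<in> R" "coeff q 0 \<in> units_of_ring R"
      "a = poly p w / poly q w" "poly q w \<noteq> 0" by (rule lroE[OF ab(1)])
    obtain r s where b: "\<forall>i. coeff r i \<in> R" "\<forall>i. coeff s i \<in> R" "coeff s 0 \<in> units_of_ring R"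
      "b = poly r w / poly s w" "poly s w \<noteq> 0" by (rule lroE[OF ab(2)])
    have "a + b = poly (p * s + r * q) w / poly (q * s) w" "a * b = poly (p * r) w / poly (q * s) w"
      unfolding a(4) b(4) using a(5) b(5) by (simp_all add: add_frac_eq)
    moreover have "coeff (q * s) 0 \<in> units_of_ring R"
      using a(3) b(3) units_mult[OF R] by (simp add: coeff_mult)
    ultimately show ?thesis
      using lroI[of "p * s + r * q" "q * s"] lroI[of "p * r" "q * s"]
        coeff_closed a(1,2) b(1,2) by simp
  qed
  moreover have "const_fun c \<in> local_ring_over R w" for c
    using lro_base const_subringD(1)[OF res_localD(1)[OF R]] by blast
  ultimately show ?thesis unfolding const_subring_def by blast
qed

lemma lro_subset: "local_ring_over R w \<subseteq> W"
proof
  fix a assume "a \<in> local_ring_over R w"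
  then obtain p q where a: "\<forall>i. coeff p i \<in> R" "a = poly p w / poly q w" "poly q w \<in> units_of_ring W"
    by (rule lroE)
  thus "a \<in> W" unfolding divide_inverse
    by (simp add: const_subringD(5)[OF res_localD(1)[OF W]] lro_unit_iff(1) units_subset(3))
qed

lemma lro_inverse:
  assumes "a \<in> local_ring_over R w" "a \<in> units_of_ring W"
  shows "inverse a \<in> local_ring_over R w"
proof -
  obtain p q where a: "\<forall>i. coeff p i \<in> R" "\<forall>i. coeff q i \<in> R" "coeff q 0 \<in> units_of_ring R"
    "a = poly p w / poly q w" "poly q w \<in> units_of_ring W" "poly q w \<noteq> 0"
    by (rule lroE[OF assms(1)])
  have "a * poly q w \<in> units_of_ring W" by (rule units_mult[OF W assms(2) a(5)])
  hence "coeff p 0 \<in> units_of_ring R" using lro_unit_iff(2) a(1,4,6) by simp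
  thus ?thesis using lroI[of q p] a(1,2,4) by simp
qed

lemma dominates_lro: "dominates W (local_ring_over R w)"
  unfolding dominates_def
proof (intro conjI subsetI)
  show "a \<in> local_ring_over R w \<Longrightarrow> a \<in> W" for a using lro_subset by blast
  fix a assume "a \<in> max_ideal (local_ring_over R w)"
  hence a: "a \<in> local_ring_over R w" "a = 0 \<or> inverse a \<notin> local_ring_over R w" by (auto simp: max_ideal_iff)
  show "a \<in> max_ideal W"
    using lro_inverse[OF a(1)] a(2) lro_subset units_or_max[of a W] a(1) units_subset(2)[of a W] by blast
qed

lemma lro_moebius_subset:
  assumes "a \<in> units_of_ring R" "b \<in> R" "c \<in> max_ideal R" "d \<in> R"
  shows "local_ring_over R ((c + d * w) / (a + b * w)) \<subseteq> local_ring_over R w"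
    "(c + d * w) / (a + b * w) \<in> max_ideal W" "a + b * w \<noteq> 0"
proof -
  define w' where "w' = (c + d * w) / (a + b * w)"
  note cs = const_subringD[OF res_localD(1)[OF R]] and csW = const_subringD[OF res_localD(1)[OF W]]
    and S = const_subringD[OF lro_subring]
  have ab: "a + b * w \<in> units_of_ring W"
    by (intro units_add_max W max_ideal_mult w) (use assms dominatesD[OF WR] in auto)
  thus nz: "a + b * w \<noteq> 0" using units_subset(2) by blast
  have cd: "c + d * w \<in> max_ideal W"
    by (intro res_localD(3) W max_ideal_mult w) (use assms dominatesD[OF WR] in auto)
  show w'W: "(c + d * w) / (a + b * w) \<in> max_ideal W"
    unfolding divide_inverse by (intro max_ideal_mult W cd units_subset(3) ab)
  have abS: "a + b * w \<in> local_ring_over R w" "c + d * w \<in> local_ring_over R w"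
    by (intro S(4,5) lro_base lro_self assms(2,4) units_subset(1)[OF assms(1)] max_subset[OF assms(3)])+
  have w'S: "w' \<in> local_ring_over R w"
    unfolding w'_def divide_inverse by (intro S(5) abS lro_inverse ab)
  show "local_ring_over R ((c + d * w) / (a + b * w)) \<subseteq> local_ring_over R w"
    unfolding w'_def[symmetric]
  proof
    fix t assume "t \<in> local_ring_over R w'"
    then obtain p q where t: "\<forall>i. coeff p i \<in> R" "\<forall>i. coeff q i \<in> R" "coeff q 0 \<in> units_of_ring R"
      "t = poly p w' / poly q w'" unfolding local_ring_over_def by blast
    have 1: "poly p w' \<in> local_ring_over R w" "poly q w' \<in> local_ring_over R w"
      by (intro const_subring_poly lro_subring w'S lro_base, use t in blast)+
    obtain r where r: "r \<in> local_ring_over R w" "poly q w' = coeff q 0 + w' * r"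
      by (rule poly_split0[OF res_localD(1)[OF R] t(2)[rule_format] _ lro_subring w'S]) (use lro_base in auto)
    have "poly q w' \<in> units_of_ring W" unfolding r(2)
      by (intro units_add_max W max_ideal_mult dominatesD(3)[OF WR] t(3))
         (use w'W w'_def r(1) lro_subset in auto)
    thus "t \<in> local_ring_over R w" unfolding t(4) divide_inverse
      by (intro S(5) 1 lro_inverse)
  qed
qed

end

text \<open>Another pair of generators of the maximal ideal of R changes w = v/u by a Moebius
  transformation over R. If it fixes the point w = 0 of the exceptional curve, which is the
  condition on c, the local ring there does not change; the inverse transformation has the same
  shape and yields the other inclusion.\<close>

lemma lro_moebius:
  assumes R: "res_local R" and W: "res_local W" and WR: "dominates W R" and w: "w \<in> max_ideal W"
    and "a \<in> units_of_ring R" "b \<in> R" "c \<in> max_ideal R" "d \<in> units_of_ring R"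
  shows "local_ring_over R ((c + d * w) / (a + b * w)) = local_ring_over R w"
proof
  note 1 = lro_moebius_subset[OF R W WR w assms(5,6,7) units_subset(1)[OF assms(8)]]
  show "local_ring_over R ((c + d * w) / (a + b * w)) \<subseteq> local_ring_over R w" by (rule 1(1))
  define w' where "w' = (c + d * w) / (a + b * w)"
  have mb: "- b \<in> R" using assms(6) const_subringD(6)[OF res_localD(1)[OF R]] by blast
  have mc: "- c \<in> max_ideal R" by (rule max_ideal_minus[OF R assms(7)])
  note 2 = lro_moebius_subset[OF R W WR 1(2) assms(8) mb mc units_subset(1)[OF assms(5)], folded w'_def]
  have "w' * (a + b * w) = c + d * w" unfolding w'_def using 1(3) by simp
  hence "w * (d + - b * w') = - c + a * w'" by (simp add: algebra_simps)
  hence "(- c + a * w') / (d + - b * w') = w" using 2(3) nonzero_divide_eq_eq[OF 2(3)] by (simp only:)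
  thus "local_ring_over R w \<subseteq> local_ring_over R ((c + d * w) / (a + b * w))"
    using 2(1) unfolding w'_def by simp
qed

subsection \<open>Points of the plane\<close>

lemma ptE:
  assumes "a \<in> pt v"
  obtains d A B where "form d A" "form d B" "B v \<noteq> 0" "a = fr A B"
proof -
  have "\<exists>A B d. a = fr A B \<and> form d A \<and> form d B \<and> B v \<noteq> 0"
    using assms unfolding pt_fr by (rule CollectD)
  thus ?thesis using that by blast
qed

lemma fr_in_pt: "form d A \<Longrightarrow> form d B \<Longrightarrow> B v \<noteq> 0 \<Longrightarrow> fr A B \<in> pt v"
  unfolding pt_fr by blast

lemma fr_in_max_pt:
  assumes "form d A" "form d B" "B v \<noteq> 0"
  shows "fr A B \<in> max_ideal (pt v) \<longleftrightarrow> A v = 0"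
proof
  assume *: "fr A B \<in> max_ideal (pt v)"
  show "A v = 0"
  proof (rule ccontr)
    assume "A v \<noteq> 0"
    hence "inverse (fr A B) \<in> pt v" "fr A B \<noteq> 0"
      using fr_in_pt[OF assms(2,1)] assms fr_inverse[OF assms(1,2)] fr_eq_0_iff[OF assms(1,2)] by auto
    thus False using * by (simp add: max_ideal_iff)
  qed
next
  assume A: "A v = 0"
  have "inverse (fr A B) \<notin> pt v" if "fr A B \<noteq> 0"
  proof
    assume "inverse (fr A B) \<in> pt v"
    then obtain A' B' e where *: "form e A'" "form e B'" "B' v \<noteq> 0" "inverse (fr A B) = fr A' B'"
      by (elim ptE)
    have "\<exists>v. A v \<noteq> 0" using that fr_eq_0_iff[OF assms(1,2)] assms(3) by blast
    hence "B v * B' v = A' v * A v"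
      using fr_eq_iff[OF assms(2,1) *(1,2)] *(3,4) fr_inverse[OF assms(1,2)] by auto
    thus False using A assms(3) *(3) by simp
  qed
  thus "fr A B \<in> max_ideal (pt v)" using fr_in_pt[OF assms] by (auto simp: max_ideal_iff)
qed

lemma res_local_pt: "res_local (pt v)"
proof -
  have sum: "fr A B + fr A' B' \<in> pt v" "A v = 0 \<Longrightarrow> A' v = 0 \<Longrightarrow> fr A B + fr A' B' \<in> max_ideal (pt v)"
    if "form d A" "form d B" "B v \<noteq> 0" "form e A'" "form e B'" "B' v \<noteq> 0" for d e A B A' B'
  proof -
    have f: "form (d + e) (\<lambda>v. A v * B' v + A' v * B v)" "form (d + e) (\<lambda>v. B v * B' v)"
      using form_add[OF form_mult[OF that(1,5)]] form_mult[OF that(4,2)] form_mult[OF that(2,5)]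
      by (simp_all add: add.commute)
    have eq: "fr A B + fr A' B' = fr (\<lambda>v. A v * B' v + A' v * B v) (\<lambda>v. B v * B' v)"
      using that by (intro fr_add) auto
    show "fr A B + fr A' B' \<in> pt v" unfolding eq by (rule fr_in_pt[OF f]) (use that in simp)
    show "A v = 0 \<Longrightarrow> A' v = 0 \<Longrightarrow> fr A B + fr A' B' \<in> max_ideal (pt v)"
      unfolding eq using that by (subst fr_in_max_pt[OF f]) auto
  qed
  have c: "const_fun c \<in> pt v" for c unfolding const_fun_fr
    by (rule fr_in_pt[OF form_const form_const]) simp
  have cs: "const_subring (pt v)"
    unfolding const_subring_def
  proof (intro conjI ballI allI c)
    fix a b assume "a \<in> pt v" "b \<in> pt v"
    then obtain A B d A' B' e where *: "form d A" "form d B" "B v \<noteq> 0" "a = fr A B"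
      "form e A'" "form e B'" "B' v \<noteq> 0" "b = fr A' B'" by (elim ptE)
    show "a + b \<in> pt v" using sum(1) * by blast
    show "a * b \<in> pt v" unfolding *(4,8) fr_mult[OF *(1,2,5,6)]
      by (rule fr_in_pt[OF form_mult[OF *(1,5)] form_mult[OF *(2,6)]]) (use * in simp)
  qed
  have "\<exists>c. a - const_fun c \<in> max_ideal (pt v)" if "a \<in> pt v" for a
  proof -
    obtain d A B where a: "form d A" "form d B" "B v \<noteq> 0" "a = fr A B" by (rule ptE[OF \<open>a \<in> pt v\<close>])
    define c where "c = A v / B v"
    have "form d (\<lambda>v. A v - c * B v)" by (intro form_diff form_const_mult a)
    moreover have "a - const_fun c = fr (\<lambda>v. A v - c * B v) B"
    proof -
      have "a - const_fun c = fr A B + fr (\<lambda>v. - c) (\<lambda>v. 1)"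
        unfolding a(4) const_fun_fr[symmetric] by (simp add: const_fun_simps)
      also have "\<dots> = fr (\<lambda>v. A v - c * B v) B"
        using a(3) by (subst fr_add[OF a(1,2) form_const form_const]) auto
      finally show ?thesis .
    qed
    ultimately show ?thesis using fr_in_max_pt[of d "\<lambda>v. A v - c * B v" B v] a
      by (intro exI[of _ c]) (simp add: c_def)
  qed
  moreover have "a + b \<in> max_ideal (pt v)" if ab: "a \<in> max_ideal (pt v)" "b \<in> max_ideal (pt v)" for a b
  proof -
    obtain A B d A' B' e where *: "form d A" "form d B" "B v \<noteq> 0" "a = fr A B"
      "form e A'" "form e B'" "B' v \<noteq> 0" "b = fr A' B'"
      using max_subset[OF ab(1)] max_subset[OF ab(2)] by (elim ptE)
    thus ?thesis using sum(2)[OF *(1-3,5-7)] fr_in_max_pt[OF *(1-3)] fr_in_max_pt[OF *(5-7)] ab by auto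
  qed
  ultimately show ?thesis unfolding res_local_def using cs by blast
qed

lemma dominates_sub_pt:
  assumes "form_map e F"
  shows "dominates (pt v) (sub F ` pt (F v))"
proof -
  have *: "sub F a \<in> pt v \<and> (a \<in> max_ideal (pt (F v)) \<longrightarrow> sub F a \<in> max_ideal (pt v))" if "a \<in> pt (F v)" for a
  proof -
    obtain d A B where a: "form d A" "form d B" "B (F v) \<noteq> 0" "a = fr A B" by (rule ptE[OF \<open>a \<in> pt (F v)\<close>])
    have eq: "sub F a = fr (\<lambda>v. A (F v)) (\<lambda>v. B (F v))"
      unfolding a(4) using a(3) by (intro sub_fr[OF assms a(1,2)]) blast
    note f = form_map_form[OF assms a(1)] form_map_form[OF assms a(2)]
    show ?thesis unfolding eq using fr_in_pt[OF f a(3)] fr_in_max_pt[OF f a(3)] fr_in_max_pt[OF a(1-3)] a(4) by auto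
  qed
  have "max_ideal (sub F ` pt (F v)) \<subseteq> max_ideal (pt v)"
  proof
    fix b assume b: "b \<in> max_ideal (sub F ` pt (F v))"
    then obtain a where a: "a \<in> pt (F v)" "b = sub F a" using max_subset by blast
    have "a \<in> max_ideal (pt (F v))"
    proof (rule ccontr)
      assume "a \<notin> max_ideal (pt (F v))"
      hence u: "a \<noteq> 0" "inverse a \<in> pt (F v)" using a by (auto simp: max_ideal_iff)
      have "sub F a * sub F (inverse a) = 1"
        using u sub_mult[OF assms, of a "inverse a"] sub_const[OF assms, of 1] by (simp add: const_fun_simps)
      hence "inverse b = sub F (inverse a)" "b \<noteq> 0" using a(2) inverse_unique by auto
      thus False using b u by (auto simp: max_ideal_iff)
    qed
    thus "b \<in> max_ideal (pt v)" using * a by blast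
  qed
  thus ?thesis unfolding dominates_def using * by blast
qed

text \<open>F is regular at v and its inverse G at F v, so the two local homomorphisms between the
  rings are mutually inverse: F is a local isomorphism at v.\<close>

lemma sub_pt_eq:
  assumes "inverse_maps F G" "G (F v) = c *s v" "c \<noteq> 0"
  shows "sub F ` pt (F v) = pt v"
proof -
  obtain e e' where FG: "form_map e F" "form_map e' G"
    using inverse_maps_form_map assms inverse_maps_sym by metis
  have "sub G ` pt v \<subseteq> pt (F v)"
    using dominates_sub_pt[OF FG(2), of "F v"] assms(2,3) pt_scale unfolding dominates_def by auto
  hence "sub F ` sub G ` pt v \<subseteq> sub F ` pt (F v)" by (rule image_mono)
  moreover have "sub F ` sub G ` pt v = pt v" by (simp add: image_comp o_def sub_inverse[OF assms(1)])
  ultimately have "pt v \<subseteq> sub F ` pt (F v)" by (simp only:)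
  moreover have "sub F ` pt (F v) \<subseteq> pt v" using dominates_sub_pt[OF FG(1), of v] unfolding dominates_def by (rule conjunct1)
  ultimately show ?thesis by (rule subset_antisym[rotated])
qed

text \<open>Separatedness of the plane: the residues in W of the quotients of coordinates determine
  the homogeneous coordinates. A coordinate that is non-zero at u is non-zero at v as well, because
  the residues of two mutually inverse quotients have product 1.\<close>

lemma pt_separated:
  assumes "res_local W" "dominates W (pt u)" "dominates W (pt v)" "u \<noteq> 0" "v \<noteq> 0"
  shows "\<exists>c. c \<noteq> 0 \<and> u = c *s v"
proof -
  have res: "fr (\<lambda>v. v$i) (\<lambda>v. v$k) - const_fun (u$i / u$k) \<in> max_ideal W"
    if "dominates W (pt u)" "u$k \<noteq> 0" for u :: "complex^3" and i k
  proof -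
    let ?c = "u$i / u$k"
    have f: "form 1 (\<lambda>v::complex^3. v$i - ?c * v$k)" by (intro form_diff form_const_mult form_coord)
    have "fr (\<lambda>v. v$i) (\<lambda>v. v$k) - const_fun ?c = fr (\<lambda>v. v$i) (\<lambda>v. v$k) + fr (\<lambda>v. - ?c) (\<lambda>v. 1)"
      unfolding const_fun_fr[symmetric] by (simp add: const_fun_simps)
    also have "\<dots> = fr (\<lambda>v. v$i - ?c * v$k) (\<lambda>v. v$k)"
      using coord_nonzero[of k] by (subst fr_add[OF form_coord form_coord form_const form_const]) auto
    finally show ?thesis using fr_in_max_pt[OF f form_coord that(2)] that dominatesD(2)[OF that(1)] by simp
  qed
  obtain k where k: "u$k \<noteq> 0" using assms(4) by (metis Finite_Cartesian_Product.vec_eq_iff zero_index)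
  obtain l where l: "v$l \<noteq> 0" using assms(5) by (metis Finite_Cartesian_Product.vec_eq_iff zero_index)
  have one: "fr (\<lambda>v::complex^3. v$l) (\<lambda>v. v$k) * fr (\<lambda>v. v$k) (\<lambda>v. v$l) = const_fun 1"
    unfolding const_fun_fr fr_mult[OF form_coord form_coord form_coord form_coord]
    using form_mult_nonzero[OF form_coord[of k] form_coord[of l] coord_nonzero coord_nonzero]
    by (subst fr_eq_iff[OF form_mult[OF form_coord form_coord] form_mult[OF form_coord form_coord] form_const form_const]) auto
  have "const_fun 1 - const_fun (u$l / u$k * (v$k / v$l)) \<in> max_ideal W"
    using res_mult[OF assms(1) res[OF assms(2) k] res[OF assms(3) l], of l k] unfolding one .
  hence "1 - u$l / u$k * (v$k / v$l) = 0"
    using max_ideal_const_iff[OF assms(1)] by (simp flip: const_fun_simps(6))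
  hence vk: "v$k \<noteq> 0" by auto
  have "u$i / u$k = v$i / v$k" for i
    by (rule res_unique[OF assms(1) res[OF assms(2) k] res[OF assms(3) vk]])
  hence "u$i = (u$k / v$k) * v$i" for i using k vk by (simp add: field_simps)
  hence "u = (u$k / v$k) *s v" unfolding Finite_Cartesian_Product.vec_eq_iff vector_smult_component by blast
  thus ?thesis using k vk by (intro exI[of _ "u$k / v$k"]) simp
qed

section \<open>The local ring of the origin, its blowup, and smooth points\<close>

definition R0 :: point where "R0 = pt (vector [0, 0, 1])"

lemma res_local_R0: "res_local R0" unfolding R0_def by (rule res_local_pt)

lemma form_vector:
  "form e A \<Longrightarrow> form e B \<Longrightarrow> form e C \<Longrightarrow> form e (\<lambda>v. vector [A v, B v, C v] $ (i::3))"
  using exhaust_3[of i] by auto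

definition crd :: "3 \<Rightarrow> 3 \<Rightarrow> ratfun" where "crd i k = fr (\<lambda>v. v $ i) (\<lambda>v. v $ k)"

lemma crd_self: "crd k k = 1"
proof -
  have "fr (\<lambda>v. v $ k) (\<lambda>v. v $ k) = fr (\<lambda>v. 1) (\<lambda>v. 1)"
    using coord_nonzero[of k] by (subst fr_eq_iff[OF form_coord form_coord form_const form_const]) auto
  thus ?thesis unfolding crd_def using const_fun_fr[of 1] const_fun_simps(2) by simp
qed

lemma crd_inverse: "inverse (crd i k) = crd k i"
  unfolding crd_def by (rule fr_inverse[OF form_coord form_coord])

lemma crd_nonzero: "crd i k \<noteq> 0"
  unfolding crd_def using coord_nonzero[of i] coord_nonzero[of k]
  by (subst fr_eq_0_iff[OF form_coord form_coord]) auto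

lemma crd_mult: "crd i k * crd k l = crd i l"
  unfolding crd_def fr_mult[OF form_coord form_coord form_coord form_coord]
  using form_mult_nonzero[OF form_coord[of k] form_coord[of l] coord_nonzero coord_nonzero] coord_nonzero
  by (subst fr_eq_iff[OF form_mult[OF form_coord form_coord] form_mult[OF form_coord form_coord] form_coord form_coord]) auto

lemma crd_divide: "crd i k / crd j k = crd i j"
  unfolding divide_inverse crd_inverse crd_mult ..

lemma xy_crd: "x_fun = crd 1 3" "y_fun = crd 2 3" unfolding crd_def by (rule xy_fun_fr)+

lemma xy_nonzero: "x_fun \<noteq> 0" "y_fun \<noteq> 0" unfolding xy_crd by (rule crd_nonzero)+

lemma crd_in_pt: "v $ k \<noteq> 0 \<Longrightarrow> crd i k \<in> pt v"
  unfolding crd_def by (rule fr_in_pt[OF form_coord form_coord])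

lemma crd_res: "v $ k \<noteq> 0 \<Longrightarrow> crd i k - const_fun (v $ i / v $ k) \<in> max_ideal (pt v)"
proof -
  assume vk: "v $ k \<noteq> 0"
  let ?c = "v$i / v$k"
  have f: "form 1 (\<lambda>v::complex^3. v$i - ?c * v$k)" by (intro form_diff form_const_mult form_coord)
  have "crd i k - const_fun ?c = fr (\<lambda>v. v$i) (\<lambda>v. v$k) + fr (\<lambda>v. - ?c) (\<lambda>v. 1)"
    unfolding const_fun_fr[symmetric] crd_def by (simp add: const_fun_simps)
  also have "\<dots> = fr (\<lambda>v. v$i - ?c * v$k) (\<lambda>v. v$k)"
    using coord_nonzero[of k] by (subst fr_add[OF form_coord form_coord form_const form_const]) auto
  finally show ?thesis using fr_in_max_pt[OF f form_coord vk] vk by simp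
qed

lemma Fract_fr:
  obtains d where "form d (form_value d p)" "form d (form_value d q)" "Fract p q = fr (form_value d p) (form_value d q)"
    "\<And>x y. form_value d p (vector [x, y, 1]) = peval p x y" "\<And>x y. form_value d q (vector [x, y, 1]) = peval q x y"
proof -
  obtain d1 d2 where "\<forall>e\<ge>d1. total_degree_le p e" "\<forall>e\<ge>d2. total_degree_le q e"
    using total_degree_le_exists by metis
  hence "total_degree_le p (max d1 d2)" "total_degree_le q (max d1 d2)" by auto
  thus ?thesis using that[of "max d1 d2"]
    by (auto simp: form_def fr_def dehom_form_value form_value_affine)
qed

lemma Fract_in_pt:
  assumes "peval q x y \<noteq> 0"
  shows "Fract p q \<in> pt (vector [x, y, 1])"
    "Fract p q \<in> max_ideal (pt (vector [x, y, 1])) \<longleftrightarrow> peval p x y = 0"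
proof -
  obtain d where d: "form d (form_value d p)" "form d (form_value d q)" "Fract p q = fr (form_value d p) (form_value d q)"
    "\<And>x y. form_value d p (vector [x, y, 1]) = peval p x y" "\<And>x y. form_value d q (vector [x, y, 1]) = peval q x y"
    by (rule Fract_fr[of p q]) blast
  have nz: "form_value d q (vector [x, y, 1]) \<noteq> 0" using d(5) assms by simp
  show "Fract p q \<in> pt (vector [x, y, 1])"
    "Fract p q \<in> max_ideal (pt (vector [x, y, 1])) \<longleftrightarrow> peval p x y = 0"
    unfolding d(3) using fr_in_pt[OF d(1,2) nz] fr_in_max_pt[OF d(1,2) nz] d(4) by auto
qed

lemma pt_affineE:
  assumes "a \<in> pt (vector [x, y, 1])"
  obtains p q where "a = Fract p q" "peval q x y \<noteq> 0"
proof -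
  obtain d A B where "form d A" "form d B" "B (vector [x, y, 1]) \<noteq> 0" "a = fr A B" by (rule ptE[OF assms])
  thus ?thesis using that[of "dehom A" "dehom B"] by (simp add: fr_def dehom_form)
qed

lemmas R0_Fract = Fract_in_pt[of _ 0 0, folded R0_def]
lemmas R0E = pt_affineE[of _ 0 0, folded R0_def]

lemma Fract_nonzero: "q \<noteq> 0 \<Longrightarrow> Fract p q = Fract p 1 / Fract q (1::complex poly poly)" by simp

lemma peval_nonzero: "peval q x y \<noteq> 0 \<Longrightarrow> q \<noteq> 0" by auto

lemma max_R0: "max_ideal R0 = {a * x_fun + b * y_fun | a b. a \<in> R0 \<and> b \<in> R0}"
proof
  show "max_ideal R0 \<subseteq> {a * x_fun + b * y_fun | a b. a \<in> R0 \<and> b \<in> R0}"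
  proof
    fix t assume t: "t \<in> max_ideal R0"
    then obtain p q where pq: "t = Fract p q" "peval q 0 0 \<noteq> 0" using R0E max_subset by metis
    have p0: "peval p 0 0 = 0" using R0_Fract(2)[OF pq(2), of p] t pq(1) by simp
    obtain c p' where p: "p = pCons c p'" by (cases p)
    obtain e c' where c: "c = pCons e c'" by (cases c)
    have "e = 0" using p0 unfolding p c peval_def by simp
    hence p': "p = [:c':] * [:[:0,1:]:] + p' * [:0,1:]" unfolding p c by simp
    have "Fract (a + b) q = Fract a q + Fract b q" for a b
      using peval_nonzero[OF pq(2)] by (simp add: eq_fract algebra_simps)
    from this[of "[:c':] * [:[:0,1:]:]" "p' * [:0,1:]"] have "t = Fract ([:c':] * [:[:0,1:]:]) q + Fract (p' * [:0,1:]) q"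
      unfolding pq(1) p' .
    hence "t = Fract [:c':] q * x_fun + Fract p' q * y_fun"
      unfolding x_fun_def y_fun_def mult_fract by (simp only: mult_1_right)
    thus "t \<in> {a * x_fun + b * y_fun | a b. a \<in> R0 \<and> b \<in> R0}" using R0_Fract(1)[OF pq(2)] by blast
  qed
  have "x_fun \<in> max_ideal R0" "y_fun \<in> max_ideal R0" unfolding x_fun_def y_fun_def
    by (subst R0_Fract(2); simp)+
  thus "{a * x_fun + b * y_fun | a b. a \<in> R0 \<and> b \<in> R0} \<subseteq> max_ideal R0"
    using max_ideal_mult(2)[OF res_local_R0] res_localD(3)[OF res_local_R0] by blast
qed

lemma xy_max_R0: "x_fun \<in> max_ideal R0" "y_fun \<in> max_ideal R0"
  unfolding x_fun_def y_fun_def by (subst R0_Fract(2); simp)+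

text \<open>x and y are independent modulo the square of the maximal ideal. After clearing
  denominators, the relation is restricted to the axes y = 0 and x = 0, where one summand disappears
  and the remaining coordinate can be divided out.\<close>

lemma R0_indep:
  assumes "a \<in> R0" "b \<in> R0" "a * x_fun + b * y_fun = 0"
  shows "a \<in> max_ideal R0" "b \<in> max_ideal R0"
proof -
  obtain p q where a: "a = Fract p q" "peval q 0 0 \<noteq> 0" using R0E assms(1) by metis
  obtain r s where b: "b = Fract r s" "peval s 0 0 \<noteq> 0" using R0E assms(2) by metis
  note nz = peval_nonzero[OF a(2)] peval_nonzero[OF b(2)]
  have "Fract (p * [:[:0,1:]:]) q + Fract (r * [:0,1:]) s = 0"
    using assms(3) unfolding a b x_fun_def y_fun_def by simp
  hence "Fract (p * [:[:0,1:]:] * s + r * [:0,1:] * q) (q * s) = 0" unfolding add_fract[OF nz] .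
  hence eq: "p * [:[:0,1:]:] * s + r * [:0,1:] * q = 0"
    using nz eq_fract(1)[of "q * s" 1 _ 0] by (simp add: Zero_fract_def)
  have ev: "peval p x y * x * peval s x y + peval r x y * y * peval q x y = 0" for x y
  proof -
    have "peval (p * [:[:0,1:]:] * s + r * [:0,1:] * q) x y = 0" unfolding eq by simp
    thus ?thesis unfolding peval_simps by simp
  qed
  have "peval p 0 0 * peval s 0 0 = 0"
  proof -
    define P where "P = poly (p * s) 0"
    have "poly ([:0, 1:] * P) x = 0" for x
      using ev[of x 0] unfolding P_def peval_def by (simp add: algebra_simps)
    hence "[:0, 1:] * P = 0" using poly_all_0_iff_0 by blast
    hence "poly P 0 = 0" by simp
    thus ?thesis unfolding P_def peval_def by simp
  qed
  thus "a \<in> max_ideal R0" using R0_Fract(2)[OF a(2), of p] a b by simp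
  have "peval r 0 0 * peval q 0 0 = 0"
  proof -
    \<comment> \<open>The restriction to x = 0, as a polynomial in y.\<close>
    define P where "P = poly (map_poly (\<lambda>c. [:poly c 0:]) (r * q)) [:0, 1:]"
    have P: "poly (poly (map_poly (\<lambda>c. [:poly c 0:]) u) [:0, 1:]) y = peval u 0 y" for u :: "complex poly poly" and y
      unfolding peval_def by (induction u) (simp_all add: map_poly_pCons)
    have "poly ([:0, 1:] * P) y = 0" for y
      using ev[of 0 y] P[of "r * q" y] unfolding P_def by (simp add: algebra_simps)
    hence "[:0, 1:] * P = 0" using poly_all_0_iff_0 by blast
    hence "poly P 0 = 0" by simp
    thus ?thesis using P[of "r * q" 0] unfolding P_def by simp
  qed
  thus "b \<in> max_ideal R0" using R0_Fract(2)[OF b(2), of r] a b by simp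
qed

text \<open>\<open>(x, y) \<mapsto> (x, y / x)\<close> and its inverse\<close>

definition blow :: "complex^3 \<Rightarrow> complex^3" where
  "blow v = vector [v$1 * v$1, v$2 * v$3, v$1 * v$3]"
definition blow_inv :: "complex^3 \<Rightarrow> complex^3" where
  "blow_inv v = vector [v$1 * v$3, v$1 * v$2, v$3 * v$3]"

lemma form_coord2: "form 2 (\<lambda>v. v$i * v$j)"
  using form_mult[OF form_coord form_coord] by (simp add: numeral_2_eq_2)

lemma inverse_mapsI:
  assumes "\<And>i. form e (\<lambda>v. F v $ i)" "\<And>i. form e' (\<lambda>v. G v $ i)" "form k c" "form l c'"
    "\<And>v. F (G v) = c v *s v" "\<And>v. G (F v) = c' v *s v" "\<exists>v. c v \<noteq> 0" "\<exists>v. c' v \<noteq> 0"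
  shows "inverse_maps F G"
  unfolding inverse_maps_def
  by (rule exI[of _ e], rule exI[of _ e'], rule exI[of _ k], rule exI[of _ l], rule exI[of _ c], rule exI[of _ c'])
     (use assms in blast)

lemma inverse_maps_blow: "inverse_maps blow blow_inv"
proof (rule inverse_mapsI)
  show "form 2 (\<lambda>v. blow v $ i)" for i unfolding blow_def by (intro form_vector form_coord2)
  show "form 2 (\<lambda>v. blow_inv v $ i)" for i unfolding blow_inv_def by (intro form_vector form_coord2)
  show "form (1 + (1 + 1)) (\<lambda>v. v$1 * (v$3 * v$3))" "form (1 + (1 + 1)) (\<lambda>v. v$1 * (v$1 * v$3))"
    by (intro form_mult form_coord)+
  show "\<exists>v::complex^3. v$1 * (v$3 * v$3) \<noteq> 0" "\<exists>v::complex^3. v$1 * (v$1 * v$3) \<noteq> 0"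
    by (rule exI[of _ "\<chi> i. 1"], simp)+
  show "blow (blow_inv v) = (v$1 * (v$3 * v$3)) *s v" "blow_inv (blow v) = (v$1 * (v$1 * v$3)) *s v" for v
    unfolding blow_def blow_inv_def vec3_eq_iff by simp_all
qed

lemma sub_blow: "sub blow x_fun = x_fun" "sub blow y_fun = y_fun / x_fun"
proof -
  obtain e where F: "form_map e blow" using inverse_maps_form_map inverse_maps_blow by blast
  have nz: "\<exists>v::complex^3. v$1 * v$3 \<noteq> 0" by (rule exI[of _ "\<chi> i. 1"]) simp
  show "sub blow x_fun = x_fun" unfolding xy_fun_fr
    by (subst sub_fr[OF F form_coord form_coord coord_nonzero])
       (subst fr_eq_iff[OF _ _ form_coord form_coord], use nz coord_nonzero in \<open>auto simp: blow_def intro: form_coord2\<close>)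
  have "sub blow (crd 2 3) = crd 2 1" unfolding crd_def
    by (subst sub_fr[OF F form_coord form_coord coord_nonzero])
       (subst fr_eq_iff[OF _ _ form_coord form_coord], use nz coord_nonzero in \<open>auto simp: blow_def intro: form_coord2\<close>)
  thus "sub blow y_fun = y_fun / x_fun" unfolding xy_crd crd_divide .
qed

lemma sub_Fract1:
  assumes "birational_map \<phi>" "\<phi> x_fun = x_fun"
  shows "\<phi> (Fract p 1) = poly (map_poly (\<lambda>c. Fract [:c:] 1) p) (\<phi> y_fun)"
proof -
  interpret birational \<phi> by unfold_locales fact
  have 1: "\<phi> (Fract [:c:] 1) = Fract [:c:] 1" for c
  proof (induction c)
    case 0
    thus ?case by (simp add: hom_0 flip: Zero_fract_def)
  next
    case (pCons e c)
    have "Fract [:pCons e c:] 1 = const_fun e + x_fun * Fract [:c:] 1"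
      unfolding const_fun_def x_fun_def by simp
    thus ?case using pCons assms(2) by (simp add: hom_add hom_mult hom_const)
  qed
  have z: "Fract 0 (1::complex poly poly) = 0" by (simp add: Zero_fract_def)
  show ?thesis
  proof (induction p)
    case 0
    thus ?case by (simp add: hom_0 z)
  next
    case (pCons c p)
    have "Fract (pCons c p) 1 = Fract [:c:] 1 + y_fun * Fract p 1"
      unfolding y_fun_def by simp
    thus ?case using pCons by (simp add: hom_add hom_mult 1 map_poly_pCons z)
  qed
qed

text \<open>The automorphism (x, y) -> (x, y/x) of K carries the local ring of the origin to that of
  the origin in the first chart of the blowup. In this way exceptional points become images of
  \<open>R0\<close> again.\<close>

lemma blow_R0:
  "local_ring_over R0 (y_fun / x_fun) = sub blow ` R0" "y_fun / x_fun \<in> max_ideal (sub blow ` R0)"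
  "dominates (sub blow ` R0) R0"
proof -
  interpret birational "sub blow" by unfold_locales (rule birational_sub[OF inverse_maps_blow])
  let ?T = "sub blow ` R0"
  have T: "res_local ?T" by (rule res_local_image[OF res_local_R0])
  show w: "y_fun / x_fun \<in> max_ideal ?T"
    unfolding max_ideal_image using xy_max_R0(2) sub_blow(2) by force
  obtain e where F: "form_map e blow_inv" using inverse_maps_form_map inverse_maps_blow inverse_maps_sym by blast
  have "blow_inv (vector [0,0,1]) = vector [0,0,1]" unfolding blow_inv_def vec3_eq_iff by simp
  hence "dominates R0 (sub blow_inv ` R0)" using dominates_sub_pt[OF F, of "vector [0,0,1]"] unfolding R0_def by simp
  hence "dominates ?T (sub blow ` sub blow_inv ` R0)" unfolding dominates_image .
  thus dom: "dominates ?T R0"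
    by (simp add: image_comp o_def sub_inverse[OF inverse_maps_blow])
  have "local_ring_over R0 (y_fun / x_fun) \<subseteq> ?T"
    using dominates_lro[OF res_local_R0 T dom w] unfolding dominates_def by blast
  moreover have "?T \<subseteq> local_ring_over R0 (y_fun / x_fun)"
  proof
    fix t assume "t \<in> ?T"
    then obtain p q where t: "t = sub blow (Fract p q)" "peval q 0 0 \<noteq> 0" using R0E by (metis imageE)
    let ?m = "map_poly (\<lambda>c. Fract [:c:] (1::complex poly poly))"
    have z: "Fract 0 (1::complex poly poly) = 0" by (simp add: Zero_fract_def)
    have "t = sub blow (Fract p 1) / sub blow (Fract q 1)"
      unfolding t(1) hom_divide[symmetric] using peval_nonzero[OF t(2)] by simp
    also have "\<dots> = poly (?m p) (y_fun / x_fun) / poly (?m q) (y_fun / x_fun)"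
      unfolding sub_Fract1[OF birational_map sub_blow(1)] sub_blow(2) ..
    also have "\<dots> \<in> local_ring_over R0 (y_fun / x_fun)"
    proof -
      have i: "Fract [:c:] 1 \<in> R0" for c by (rule R0_Fract(1)) simp
      have "\<forall>i. coeff (?m p) i \<in> R0" "\<forall>i. coeff (?m q) i \<in> R0" by (simp_all add: coeff_map_poly z i)
      moreover have "peval [:coeff q 0:] 0 0 \<noteq> 0" using t(2) unfolding peval_def by (cases q) simp
      hence "Fract [:coeff q 0:] 1 \<notin> max_ideal R0" using R0_Fract(2)[of 1 "[:coeff q 0:]"] by simp
      hence "coeff (?m q) 0 \<in> units_of_ring R0" using units_or_max[OF i[of "coeff q 0"]] by (simp add: coeff_map_poly z)
      ultimately show ?thesis unfolding local_ring_over_def by blast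
    qed
    finally show "t \<in> local_ring_over R0 (y_fun / x_fun)" .
  qed
  ultimately show "local_ring_over R0 (y_fun / x_fun) = ?T" by blast
qed

text \<open>Together with \<open>swap\<close>, linear maps that fix the origin and move the
  direction y = c x, respectively the vertical one, to the horizontal direction treated in
  \<open>blow_R0\<close>.\<close>

definition shear :: "complex \<Rightarrow> complex^3 \<Rightarrow> complex^3" where
  "shear c v = vector [v$1, v$2 - c * v$1, v$3]"
definition swap :: "complex^3 \<Rightarrow> complex^3" where
  "swap v = vector [v$2, v$1, v$3]"

lemma inverse_mapsI_exact:
  assumes "\<And>i. form e (\<lambda>v. F v $ i)" "\<And>i. form e' (\<lambda>v. G v $ i)" "\<And>v. F (G v) = v" "\<And>v. G (F v) = v"
  shows "inverse_maps F G"
  by (rule inverse_mapsI[OF assms(1,2) form_const[of 1] form_const[of 1]]) (use assms in auto)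

lemma inverse_maps_shear: "inverse_maps (shear c) (shear (- c))"
proof (rule inverse_mapsI_exact)
  show "form 1 (\<lambda>v. shear c v $ i)" for i c
    unfolding shear_def by (intro form_vector form_coord form_diff form_const_mult)
  thus "form 1 (\<lambda>v. shear (- c) v $ i)" for i .
qed (simp_all add: shear_def vec3_eq_iff)

lemma inverse_maps_swap: "inverse_maps swap swap"
proof (rule inverse_mapsI_exact)
  show "form 1 (\<lambda>v. swap v $ i)" for i unfolding swap_def by (intro form_vector form_coord)
  thus "form 1 (\<lambda>v. swap v $ i)" for i .
qed (simp_all add: swap_def vec3_eq_iff)

lemma fr_diff:
  assumes "form d A" "form d B" "form d C" "\<exists>v. C v \<noteq> 0"
  shows "fr (\<lambda>v. A v - B v) C = fr A C - fr B C"
proof -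
  have 1: "dehom (\<lambda>v. A v - B v) = dehom A - dehom B"
    by (intro dehomI) (simp add: dehom_form(3)[OF assms(1)] dehom_form(3)[OF assms(2)])
  have 2: "dehom C \<noteq> 0" using assms(4) dehom_eq_0_iff[OF assms(3)] by simp
  have 3: "Fract (a - b) c = Fract a c - Fract b c" if "c \<noteq> 0" for a b c :: "complex poly poly"
    using that by (simp add: eq_fract algebra_simps)
  show ?thesis unfolding fr_def 1 by (rule 3[OF 2])
qed

lemma fr_const_mult: "form d A \<Longrightarrow> form d C \<Longrightarrow> fr (\<lambda>v. c * A v) C = const_fun c * fr A C"
  unfolding const_fun_fr using fr_mult[OF form_const[of c] form_const[of 1], of d A C] by simp

lemma sub_shear: "sub (shear c) x_fun = x_fun" "sub (shear c) y_fun = y_fun - const_fun c * x_fun"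
proof -
  obtain e where F: "form_map e (shear c)" using inverse_maps_form_map inverse_maps_shear by blast
  show "sub (shear c) x_fun = x_fun" "sub (shear c) y_fun = y_fun - const_fun c * x_fun"
    unfolding xy_fun_fr
    by (simp_all add: sub_fr[OF F form_coord form_coord coord_nonzero] shear_def
        fr_diff[OF form_coord form_const_mult[OF form_coord] form_coord coord_nonzero] fr_const_mult[OF form_coord form_coord])
qed

lemma sub_swap: "sub swap x_fun = y_fun" "sub swap y_fun = x_fun"
proof -
  obtain e where F: "form_map e swap" using inverse_maps_form_map inverse_maps_swap by blast
  show "sub swap x_fun = y_fun" "sub swap y_fun = x_fun"
    unfolding xy_fun_fr by (simp_all add: sub_fr[OF F form_coord form_coord coord_nonzero] swap_def)
qed

lemma shear_swap_R0: "sub (shear c) ` R0 = R0" "sub swap ` R0 = R0"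
proof -
  have "shear c (vector [0,0,1]) = vector [0,0,1]" "shear (- c) (vector [0,0,1]) = 1 *s vector [0,0,1]"
    "swap (vector [0,0,1]) = vector [0,0,1]" "swap (vector [0,0,1]) = 1 *s vector [0,0,1]"
    unfolding shear_def swap_def vec3_eq_iff by simp_all
  thus "sub (shear c) ` R0 = R0" "sub swap ` R0 = R0"
    using sub_pt_eq[OF inverse_maps_shear[of c], of "vector [0,0,1]" 1]
      sub_pt_eq[OF inverse_maps_swap, of "vector [0,0,1]" 1] unfolding R0_def by simp_all
qed

text \<open>Regularity is encoded as being the image of the local ring of the origin under an
  automorphism of K. This is preserved by blowups (\<open>smooth_pt_exceptional\<close>), and every
  local statement can be transported from \<open>R0\<close>.\<close>

definition smooth_pt :: "point \<Rightarrow> bool" where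
  "smooth_pt R \<longleftrightarrow> (\<exists>\<phi>. birational_map \<phi> \<and> R = \<phi> ` R0)"

lemma smooth_pt_R0: "smooth_pt R0" unfolding smooth_pt_def by (rule exI[of _ id]) (simp add: birational_map_id)

lemma smooth_pt_image: "birational_map \<phi> \<Longrightarrow> smooth_pt R \<Longrightarrow> smooth_pt (\<phi> ` R)"
  unfolding smooth_pt_def by (metis birational_map_comp image_comp)

lemma smooth_pt_res_local: "smooth_pt R \<Longrightarrow> res_local R"
  unfolding smooth_pt_def using birational.res_local_image[OF birational.intro] res_local_R0 by blast

lemma exc_R0_chart:
  assumes "w = y_fun / x_fun - const_fun c \<or> w = x_fun / y_fun"
  shows "smooth_pt (local_ring_over R0 w)" "w \<in> max_ideal (local_ring_over R0 w)"
    "dominates (local_ring_over R0 w) R0" "local_ring_over R0 w \<in> exceptional_points R0"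
proof -
  have img: "smooth_pt (local_ring_over R0 (\<phi> (y_fun / x_fun)))"
    "\<phi> (y_fun / x_fun) \<in> max_ideal (local_ring_over R0 (\<phi> (y_fun / x_fun)))"
    "dominates (local_ring_over R0 (\<phi> (y_fun / x_fun))) R0"
    if b: "birational_map \<phi>" "\<phi> ` R0 = R0" for \<phi>
  proof -
    interpret birational \<phi> by unfold_locales (rule b)
    interpret bl: birational "sub blow" by unfold_locales (rule birational_sub[OF inverse_maps_blow])
    have eq: "local_ring_over R0 (\<phi> (y_fun / x_fun)) = \<phi> ` sub blow ` R0"
      using local_ring_over_image[of R0] b(2) blow_R0(1) by simp
    show "smooth_pt (local_ring_over R0 (\<phi> (y_fun / x_fun)))" unfolding eq
      by (intro smooth_pt_image b bl.birational_map smooth_pt_R0)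
    show "\<phi> (y_fun / x_fun) \<in> max_ideal (local_ring_over R0 (\<phi> (y_fun / x_fun)))"
      unfolding eq max_ideal_image[of "sub blow ` R0"] using blow_R0(2) by blast
    show "dominates (local_ring_over R0 (\<phi> (y_fun / x_fun))) R0"
      unfolding eq using dominates_image[of "sub blow ` R0" R0] b(2) blow_R0(3) by simp
  qed
  interpret sh: birational "sub (shear c)" by unfold_locales (rule birational_sub[OF inverse_maps_shear])
  interpret sw: birational "sub swap" by unfold_locales (rule birational_sub[OF inverse_maps_swap])
  have "sub (shear c) (y_fun / x_fun) = y_fun / x_fun - const_fun c" "sub swap (y_fun / x_fun) = x_fun / y_fun"
    unfolding sh.hom_divide sw.hom_divide sub_shear sub_swap using xy_nonzero by (simp_all add: field_simps)
  thus "smooth_pt (local_ring_over R0 w)" "w \<in> max_ideal (local_ring_over R0 w)" "dominates (local_ring_over R0 w) R0"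
    using assms img[OF sh.birational_map shear_swap_R0(1)] img[OF sw.birational_map shear_swap_R0(2)] by auto
  note cs = const_subringD[OF res_localD(1)[OF res_local_R0]]
  have "max_ideal R0 = {a * x_fun + b * (y_fun - const_fun c * x_fun) | a b. a \<in> R0 \<and> b \<in> R0}"
  proof -
    have "\<exists>a' b'. a * x_fun + b * y_fun = a' * x_fun + b' * (y_fun - const_fun c * x_fun) \<and> a' \<in> R0 \<and> b' \<in> R0"
      if "a \<in> R0" "b \<in> R0" for a b
      by (rule exI[of _ "a + b * const_fun c"], rule exI[of _ b]) (simp add: that cs algebra_simps)
    hence "{a * x_fun + b * y_fun | a b. a \<in> R0 \<and> b \<in> R0}
        \<subseteq> {a * x_fun + b * (y_fun - const_fun c * x_fun) | a b. a \<in> R0 \<and> b \<in> R0}" (is "?A \<subseteq> ?B")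
      by (intro subsetI) (elim CollectE exE conjE, simp only: mem_Collect_eq)
    moreover have "\<exists>a' b'. a * x_fun + b * (y_fun - const_fun c * x_fun) = a' * x_fun + b' * y_fun \<and> a' \<in> R0 \<and> b' \<in> R0"
      if "a \<in> R0" "b \<in> R0" for a b
      by (rule exI[of _ "a - b * const_fun c"], rule exI[of _ b]) (simp add: that cs algebra_simps)
    hence "?B \<subseteq> ?A"
      by (intro subsetI) (elim CollectE exE conjE, simp only: mem_Collect_eq)
    ultimately show ?thesis unfolding max_R0 by (rule subset_antisym)
  qed
  moreover have "max_ideal R0 = {a * y_fun + b * x_fun | a b. a \<in> R0 \<and> b \<in> R0}"
    unfolding max_R0 by (intro Collect_cong, subst ex_comm) (simp only: add.commute conj_commute)
  moreover have "y_fun / x_fun - const_fun c = (y_fun - const_fun c * x_fun) / x_fun"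
    using xy_nonzero by (simp add: field_simps)
  ultimately show "local_ring_over R0 w \<in> exceptional_points R0"
    unfolding exceptional_points_def using assms by (elim disjE) (intro CollectI exI conjI, simp, assumption)+
qed

lemma unit_of_res:
  assumes "res_local R" "a - const_fun c \<in> max_ideal R" "c \<noteq> 0"
  shows "a \<in> units_of_ring R"
proof -
  have "const_fun c \<in> units_of_ring R"
    using units_or_max max_ideal_const_iff[OF assms(1)] const_subringD(1)[OF res_localD(1)[OF assms(1)]] assms(3) by blast
  from units_add_max(1)[OF assms(1) this assms(2)] show ?thesis by simp
qed

text \<open>Generators u, v are combinations of x, y and vice versa, and the two matrices of
  residues are mutually inverse. So v/u is a Moebius transform of y/x with invertible residue
  matrix. It vanishes in one direction, k = - c0 / d0 or the vertical one, and
  \<open>lro_moebius\<close> replaces it by the standard parameter of this direction.\<close>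

lemma exc_R0:
  assumes "S \<in> exceptional_points R0"
  shows "(\<exists>c. S = local_ring_over R0 (y_fun / x_fun - const_fun c)) \<or> S = local_ring_over R0 (x_fun / y_fun)"
proof -
  note R = res_local_R0
  note cs = const_subringD[OF res_localD(1)[OF R]]
  obtain u v where S: "S = local_ring_over R0 (v / u)" and gen: "max_ideal R0 = {a * u + b * v | a b. a \<in> R0 \<and> b \<in> R0}"
    using assms unfolding exceptional_points_def by blast
  have uv: "u \<in> max_ideal R0" "v \<in> max_ideal R0" unfolding gen
    by (rule CollectI, rule exI[of _ 1], rule exI[of _ 0], simp add: cs)
       (rule CollectI, rule exI[of _ 0], rule exI[of _ 1], simp add: cs)
  obtain a b where ab: "a \<in> R0" "b \<in> R0" "u = a * x_fun + b * y_fun" using uv(1) unfolding max_R0 by blast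
  obtain c d where cd: "c \<in> R0" "d \<in> R0" "v = c * x_fun + d * y_fun" using uv(2) unfolding max_R0 by blast
  obtain a' b' where ab': "a' \<in> R0" "b' \<in> R0" "x_fun = a' * u + b' * v" using xy_max_R0(1) unfolding gen by blast
  obtain c' d' where cd': "c' \<in> R0" "d' \<in> R0" "y_fun = c' * u + d' * v" using xy_max_R0(2) unfolding gen by blast
  have "(a' * a + b' * c - 1) * x_fun + (a' * b + b' * d) * y_fun = 0"
    using ab'(3) unfolding ab(3) cd(3) by (simp add: algebra_simps)
  note 1 = R0_indep[OF _ _ this]
  have "(c' * a + d' * c) * x_fun + (c' * b + d' * d - 1) * y_fun = 0"
    using cd'(3) unfolding ab(3) cd(3) by (simp add: algebra_simps)
  note 2 = R0_indep[OF _ _ this]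
  obtain a0 b0 c0 d0 where r: "a - const_fun a0 \<in> max_ideal R0" "b - const_fun b0 \<in> max_ideal R0"
    "c - const_fun c0 \<in> max_ideal R0" "d - const_fun d0 \<in> max_ideal R0"
    using res_localD(2)[OF R] ab cd by metis
  obtain a1 b1 c1 d1 where r': "a' - const_fun a1 \<in> max_ideal R0" "b' - const_fun b1 \<in> max_ideal R0"
    "c' - const_fun c1 \<in> max_ideal R0" "d' - const_fun d1 \<in> max_ideal R0"
    using res_localD(2)[OF R] ab' cd' by metis
  have e1: "a1 * a0 + b1 * c0 = 1"
    by (rule res_unique[OF R res_add[OF R res_mult[OF R r'(1) r(1)] res_mult[OF R r'(2) r(3)]]])
       (simp add: const_fun_simps 1(1) ab(1,2) cd(1,2) ab'(1,2) cs)
  have e2: "a1 * b0 + b1 * d0 = 0"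
    by (rule res_unique[OF R res_add[OF R res_mult[OF R r'(1) r(2)] res_mult[OF R r'(2) r(4)]]])
       (simp add: const_fun_simps 1(2) ab(1,2) cd(1,2) ab'(1,2) cs)
  have e3: "c1 * a0 + d1 * c0 = 0"
    by (rule res_unique[OF R res_add[OF R res_mult[OF R r'(3) r(1)] res_mult[OF R r'(4) r(3)]]])
       (simp add: const_fun_simps 2(1) ab(1,2) cd(1,2) cd'(1,2) cs)
  have e4: "c1 * b0 + d1 * d0 = 1"
    by (rule res_unique[OF R res_add[OF R res_mult[OF R r'(3) r(2)] res_mult[OF R r'(4) r(4)]]])
       (simp add: const_fun_simps 2(2) ab(1,2) cd(1,2) cd'(1,2) cs)
  have det: "a0 * d0 - b0 * c0 \<noteq> 0"
  proof
    assume "a0 * d0 - b0 * c0 = 0"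
    moreover have "(a1 * d1 - b1 * c1) * (a0 * d0 - b0 * c0) =
      (a1 * a0 + b1 * c0) * (c1 * b0 + d1 * d0) - (a1 * b0 + b1 * d0) * (c1 * a0 + d1 * c0)"
      by (simp add: algebra_simps)
    ultimately show False using e1 e2 e3 e4 by simp
  qed
  show ?thesis
  proof (cases "d0 = 0")
    case False
    define k where "k = - c0 / d0"
    define w where "w = y_fun / x_fun - const_fun k"
    note ch = exc_R0_chart[OF disjI1[OF w_def]]
    have kk: "const_fun k - const_fun k \<in> max_ideal R0" using max_ideal_0[OF R] by simp
    have A: "a + b * const_fun k \<in> units_of_ring R0"
      by (rule unit_of_res[OF R res_add[OF R r(1) res_mult[OF R r(2) kk]]])
         (use det False in \<open>simp add: k_def field_simps\<close>)
    have "c + d * const_fun k - const_fun (c0 + d0 * k) \<in> max_ideal R0"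
      by (rule res_add[OF R r(3) res_mult[OF R r(4) kk]])
    hence C: "c + d * const_fun k \<in> max_ideal R0" using False by (simp add: k_def const_fun_simps)
    have "v / u = (c + d * (y_fun / x_fun)) / (a + b * (y_fun / x_fun))"
    proof -
      have "v = (c + d * (y_fun / x_fun)) * x_fun" "u = (a + b * (y_fun / x_fun)) * x_fun"
        unfolding ab(3) cd(3) using xy_nonzero by (simp_all add: field_simps)
      thus ?thesis using xy_nonzero by simp
    qed
    also have "\<dots> = ((c + d * const_fun k) + d * w) / ((a + b * const_fun k) + b * w)"
      unfolding w_def by (simp add: algebra_simps)
    finally have "S = local_ring_over R0 w" unfolding S
      using lro_moebius[OF R smooth_pt_res_local[OF ch(1)] ch(3,2) A ab(2) C unit_of_res[OF R r(4) False]] by simp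
    thus ?thesis unfolding w_def by blast
  next
    case True
    define w where "w = x_fun / y_fun"
    note ch = exc_R0_chart[OF disjI2[OF w_def]]
    have bc: "b0 \<noteq> 0" "c0 \<noteq> 0" using det True by auto
    have D: "d \<in> max_ideal R0" using r(4) True by (simp add: const_fun_simps)
    have "v / u = (d + c * w) / (b + a * w)"
    proof -
      have "v = (d + c * w) * y_fun" "u = (b + a * w) * y_fun"
        unfolding ab(3) cd(3) w_def using xy_nonzero by (simp_all add: field_simps)
      thus ?thesis using xy_nonzero by simp
    qed
    hence "S = local_ring_over R0 w" unfolding S
      using lro_moebius[OF R smooth_pt_res_local[OF ch(1)] ch(3,2) unit_of_res[OF R r(2) bc(1)] ab(1) D
          unit_of_res[OF R r(3) bc(2)]] by simp
    thus ?thesis unfolding w_def by blast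
  qed
qed

lemma smooth_pt_exceptional:
  assumes "smooth_pt R" "S \<in> exceptional_points R"
  shows "smooth_pt S" "dominates S R"
proof -
  obtain \<phi> where p: "birational_map \<phi>" "R = \<phi> ` R0" using assms(1) unfolding smooth_pt_def by blast
  interpret birational \<phi> by unfold_locales (rule p)
  obtain T where T: "T \<in> exceptional_points R0" "S = \<phi> ` T"
    using assms(2) unfolding p(2) exceptional_points_image by blast
  have "smooth_pt T" "dominates T R0" using exc_R0[OF T(1)] exc_R0_chart by metis+
  thus "smooth_pt S" "dominates S R" unfolding T(2) p(2) dominates_image using smooth_pt_image p(1) by blast+
qed

text \<open>Such a ring has exactly one centre on every blowup of the plane. So it distinguishes a point
  of the plane from the points of the exceptional curves lying over it.\<close>

definition valuation_place :: "ratfun set \<Rightarrow> bool" where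
  "valuation_place W \<longleftrightarrow> res_local W \<and> (\<forall>g. g \<in> W \<or> inverse g \<in> W)"

lemma (in birational) valuation_place_image: "valuation_place W \<Longrightarrow> valuation_place (\<phi> ` W)"
  unfolding valuation_place_def using res_local_image by (metis surjE hom_inverse in_image_iff)

text \<open>A finite direction is the residue of y/x in W. In the vertical direction x/y has residue
  0, and then y/x cannot have a residue, as the product of both is 1.\<close>

lemma exceptional_point_unique_R0:
  assumes "res_local W" "S \<in> exceptional_points R0" "S' \<in> exceptional_points R0" "dominates W S" "dominates W S'"
  shows "S = S'"
proof -
  have 1: "c = d" if "dominates W (local_ring_over R0 (y_fun / x_fun - const_fun c))"
    "dominates W (local_ring_over R0 (y_fun / x_fun - const_fun d))" for c d
    using res_unique[OF assms(1)] dominatesD(2)[OF that(1) exc_R0_chart(2)] dominatesD(2)[OF that(2) exc_R0_chart(2)] by blast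
  have 2: False if "dominates W (local_ring_over R0 (y_fun / x_fun - const_fun c))"
    "dominates W (local_ring_over R0 (x_fun / y_fun))" for c
  proof -
    have a: "x_fun / y_fun - const_fun 0 \<in> max_ideal W" "y_fun / x_fun - const_fun c \<in> max_ideal W"
      using dominatesD(2)[OF that(1) exc_R0_chart(2)] dominatesD(2)[OF that(2) exc_R0_chart(2)] by (auto simp: const_fun_simps)
    have "const_fun 1 \<in> max_ideal W"
      using res_mult[OF assms(1) a] xy_nonzero by (simp add: const_fun_simps)
    thus False using max_ideal_const_iff[OF assms(1), of 1] by simp
  qed
  show ?thesis using exc_R0[OF assms(2)] exc_R0[OF assms(3)] 1 2 assms(4,5) by metis
qed

text \<open>The valuative criterion for the blowup: a valuation ring contains y/x, whose residue is
  a direction, or else x/y lies in its maximal ideal and the direction is vertical.\<close>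

lemma place_exceptional_R0:
  assumes "valuation_place W" "dominates W R0"
  shows "\<exists>S\<in>exceptional_points R0. dominates W S"
proof -
  have W: "res_local W" using assms(1) unfolding valuation_place_def by blast
  have "\<exists>w. (\<exists>c. w = y_fun / x_fun - const_fun c \<or> w = x_fun / y_fun) \<and> w \<in> max_ideal W"
  proof (cases "y_fun / x_fun \<in> W")
    case True
    thus ?thesis using res_localD(2)[OF W] by blast
  next
    case False
    hence "x_fun / y_fun \<in> W" "inverse (x_fun / y_fun) \<notin> W"
      using assms(1) unfolding valuation_place_def by (metis inverse_divide, simp)
    thus ?thesis by (auto simp: max_ideal_iff)
  qed
  then obtain w c where w: "w = y_fun / x_fun - const_fun c \<or> w = x_fun / y_fun" "w \<in> max_ideal W" by blast
  thus ?thesis using exc_R0_chart(4)[OF w(1)] dominates_lro[OF res_local_R0 W assms(2) w(2)] by blast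
qed

lemma place_exceptional:
  assumes "valuation_place W" "dominates W R" "smooth_pt R"
  shows "\<exists>!S. S \<in> exceptional_points R \<and> dominates W S"
proof -
  obtain \<phi> where p: "birational_map \<phi>" "R = \<phi> ` R0" using assms(3) unfolding smooth_pt_def by blast
  interpret birational \<phi> by unfold_locales (rule p)
  interpret i: birational "inv_into UNIV \<phi>" by unfold_locales (rule birational_map_inv[OF p(1)])
  let ?W = "inv_into UNIV \<phi> ` W"
  have W: "valuation_place ?W" by (rule i.valuation_place_image[OF assms(1)])
  have eq: "dominates W (\<phi> ` T) \<longleftrightarrow> dominates ?W T" for T
    using dominates_image[of ?W T] image_inv(1)[of W] by simp
  have "res_local ?W" using W unfolding valuation_place_def by blast
  moreover have "dominates ?W R0" using assms(2) p(2) eq by simp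
  then obtain T where T: "T \<in> exceptional_points R0" "dominates ?W T"
    using place_exceptional_R0[OF W] by blast
  show ?thesis unfolding p(2) exceptional_points_image
  proof (rule ex1I[of _ "\<phi> ` T"])
    show "\<phi> ` T \<in> (`) \<phi> ` exceptional_points R0 \<and> dominates W (\<phi> ` T)" using T eq by blast
    fix S assume "S \<in> (`) \<phi> ` exceptional_points R0 \<and> dominates W S"
    then obtain T' where "T' \<in> exceptional_points R0" "S = \<phi> ` T'" "dominates ?W T'" using eq by blast
    thus "S = \<phi> ` T" using exceptional_point_unique_R0[OF \<open>res_local ?W\<close> _ T(1) _ T(2)] by blast
  qed
qed

section \<open>Charts of the plane, and surfaces on which centres are unique\<close>

lemma idx3: "i = k \<or> i = k + 1 \<or> i = k + 2" "k + 1 \<noteq> k" "k + 2 \<noteq> k" "k + 1 \<noteq> k + 2" "k + 2 \<noteq> k + 1"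
  "k + 1 + 1 = k + 2" "k + 1 + 2 = k" "k + 2 + 1 = k" "k + 2 + 2 = k + 1" for i k :: 3
  using exhaust_3[of k] exhaust_3[of i] by auto

text \<open>Affine coordinates of the k-th standard chart, translated so that v becomes the
  origin.\<close>

definition chart :: "3 \<Rightarrow> complex^3 \<Rightarrow> complex^3 \<Rightarrow> complex^3" where
  "chart k v x = vector [x$(k+1) - (v$(k+1) / v$k) * x$k, x$(k+2) - (v$(k+2) / v$k) * x$k, x$k]"

definition unchart :: "3 \<Rightarrow> complex^3 \<Rightarrow> complex^3 \<Rightarrow> complex^3" where
  "unchart k v y = (\<chi> i. if i = k then y$3 else if i = k + 1 then y$1 + (v$(k+1) / v$k) * y$3 else y$2 + (v$(k+2) / v$k) * y$3)"

lemma inverse_maps_chart: "inverse_maps (chart k v) (unchart k v)"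
proof (rule inverse_mapsI_exact)
  show "form 1 (\<lambda>x. chart k v x $ i)" for i
    unfolding chart_def by (intro form_vector form_coord form_diff form_const_mult)
  show "form 1 (\<lambda>x. unchart k v x $ i)" for i
    unfolding unchart_def vec_lambda_beta
    by (cases "i = k"; cases "i = k + 1")
       (auto intro!: form_coord[unfolded One_nat_def] form_add form_const_mult simp del: times_divide_eq_left)
  show "chart k v (unchart k v x) = x" for x
    unfolding chart_def unchart_def vec3_eq_iff by (simp add: idx3)
  have "unchart k v (chart k v x) $ i = x $ i" for x i
    unfolding chart_def unchart_def vec_lambda_beta vector_3 using idx3(1)[of i k] by (auto simp: idx3(2-))
  thus "unchart k v (chart k v x) = x" for x unfolding Finite_Cartesian_Product.vec_eq_iff by blast
qed

lemma chart_R0: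
  assumes "v$k \<noteq> 0"
  shows "sub (chart k v) ` R0 = pt v"
proof -
  have c: "chart k v v = v$k *s vector [0, 0, 1]" unfolding chart_def vec3_eq_iff using assms by simp
  have u: "unchart k v (chart k v v) = 1 *s v"
    using inverse_maps_chart unfolding c unchart_def Finite_Cartesian_Product.vec_eq_iff
    by (auto simp: assms) (metis idx3(1))
  show ?thesis using sub_pt_eq[OF inverse_maps_chart u] pt_scale[OF assms] unfolding c R0_def by simp
qed

lemma vec_nonzeroE: assumes "(v::complex^3) \<noteq> 0" obtains k where "v$k \<noteq> 0"
  using assms by (metis Finite_Cartesian_Product.vec_eq_iff zero_index)

lemma smooth_pt_pt: "v \<noteq> 0 \<Longrightarrow> smooth_pt (pt v)"
  using chart_R0 vec_nonzeroE smooth_pt_image[OF birational_sub[OF inverse_maps_chart] smooth_pt_R0] by metis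

lemma P2_iff: "R \<in> P2 \<longleftrightarrow> (\<exists>v. v \<noteq> 0 \<and> R = pt v)" unfolding P2_def by auto

lemma P2_separated: "res_local W \<Longrightarrow> R \<in> P2 \<Longrightarrow> S \<in> P2 \<Longrightarrow> dominates W R \<Longrightarrow> dominates W S \<Longrightarrow> R = S"
  unfolding P2_iff using pt_separated pt_scale by metis

definition centred :: "ratfun set \<Rightarrow> bool" where
  "centred W \<longleftrightarrow> valuation_place W \<and> (\<exists>R\<in>P2. dominates W R)"

text \<open>The part of the notion of a smooth projective surface over the plane on which orbit
  tracking rests: smooth points, a map to the plane, and one centre for every place that is centred
  in the plane. Existence of the centre stands for properness, uniqueness for separatedness.\<close>

definition surface :: "point set \<Rightarrow> bool" where
  "surface X \<longleftrightarrow> (\<forall>R\<in>X. smooth_pt R \<and> (\<exists>R'\<in>P2. dominates R R')) \<and> (\<forall>W. centred W \<longrightarrow> (\<exists>!R. R \<in> X \<and> dominates W R))"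

lemma surfaceD:
  assumes "surface X"
  shows "R \<in> X \<Longrightarrow> smooth_pt R" "R \<in> X \<Longrightarrow> \<exists>R'\<in>P2. dominates R R'"
    "centred W \<Longrightarrow> \<exists>R\<in>X. dominates W R"
    "centred W \<Longrightarrow> R \<in> X \<Longrightarrow> S \<in> X \<Longrightarrow> dominates W R \<Longrightarrow> dominates W S \<Longrightarrow> R = S"
  using assms unfolding surface_def by metis+

lemma surface_P2: "surface P2"
  unfolding surface_def
proof (intro conjI ballI allI impI)
  fix R assume R: "R \<in> P2"
  then obtain v where "v \<noteq> 0" "R = pt v" unfolding P2_iff by blast
  thus "smooth_pt R" using smooth_pt_pt by simp
  show "\<exists>R'\<in>P2. dominates R R'" using R dominates_refl by (rule bexI[rotated])
next
  fix W assume "centred W"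
  thus "\<exists>!R. R \<in> P2 \<and> dominates W R"
    unfolding centred_def valuation_place_def using P2_separated by metis
qed

text \<open>The centre R of a place stays if it is not blown up; otherwise it is replaced by the
  only point of its exceptional curve which the place dominates. Points over other centres do not
  interfere, since the place dominates no point of X but R.\<close>

lemma surface_blowup:
  assumes X: "surface X" and B: "B \<subseteq> X"
  shows "surface (blowup B X)"
  unfolding surface_def
proof (intro conjI ballI allI impI)
  fix R assume "R \<in> blowup B X"
  hence "R \<in> X \<or> (\<exists>S\<in>X. R \<in> exceptional_points S)" unfolding blowup_def using B by blast
  thus "smooth_pt R" "\<exists>R'\<in>P2. dominates R R'"
    using surfaceD(1,2)[OF X] smooth_pt_exceptional dominates_trans by metis+
next
  fix W assume W: "centred W"
  obtain R where R: "R \<in> X" "dominates W R" using surfaceD(3)[OF X W] by blast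
  have uniq: "S = R" if "S \<in> X" "dominates W S" for S using surfaceD(4)[OF X W] R that by blast
  have exc: "S = R" if "S \<in> X" "T \<in> exceptional_points S" "dominates W T" for S T
    using uniq that dominates_trans smooth_pt_exceptional(2)[OF surfaceD(1)[OF X that(1)] that(2)] by blast
  show "\<exists>!S. S \<in> blowup B X \<and> dominates W S"
  proof (cases "R \<in> B")
    case False
    thus ?thesis unfolding blowup_def using R uniq exc B by (intro ex1I[of _ R]) blast+
  next
    case True
    obtain S where S: "S \<in> exceptional_points R" "dominates W S"
      and u: "\<And>T. T \<in> exceptional_points R \<Longrightarrow> dominates W T \<Longrightarrow> T = S"
      using place_exceptional[of W R] W R surfaceD(1)[OF X] unfolding centred_def by metis
    show ?thesis unfolding blowup_def using S u uniq exc True B by (intro ex1I[of _ S]) blast+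
  qed
qed

text \<open>Valuation rings are maximal for domination: an element outside V has its inverse in the
  maximal ideal of V, hence in that of W, and so does not lie in W.\<close>

lemma place_eq:
  assumes "valuation_place V" "res_local W" "dominates W V"
  shows "W = V"
proof
  show "V \<subseteq> W" using assms(3) unfolding dominates_def by blast
  show "W \<subseteq> V"
  proof
    fix a assume a: "a \<in> W"
    show "a \<in> V"
    proof (rule ccontr)
      assume n: "a \<notin> V"
      hence "inverse a \<in> V" using assms(1) unfolding valuation_place_def by blast
      hence "inverse a \<in> max_ideal V" using n by (auto simp: max_ideal_iff)
      hence "inverse a \<in> max_ideal W" using assms(3) dominatesD(2) by blast
      moreover have "a \<noteq> 0" using n \<open>inverse a \<in> V\<close> by auto
      ultimately show False using a by (auto simp: max_ideal_iff)
    qed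
  qed
qed

subsection \<open>Places along a line of the triangle\<close>

definition evec :: "3 \<Rightarrow> complex \<Rightarrow> complex^3" where
  "evec j t = (\<chi> i. if i = j then 0 else if i = j + 1 then 1 else t)"

lemma edge_pt_evec: "edge_pt j s = pt (evec j s)" unfolding edge_pt_def evec_def ..

lemma evec_nth [simp]: "evec j t $ j = 0" "evec j t $ (j + 1) = 1" "evec j t $ (j + 2) = t"
  unfolding evec_def by (simp_all add: idx3)

lemma evec_nonzero [simp]: "evec j t \<noteq> 0"
  using evec_nth(2)[of j t] by (metis zero_index zero_neq_one)

lemma form_evec_poly:
  assumes "form d A"
  obtains P where "\<And>t. A (evec j t) = poly P t"
proof -
  obtain P where P: "\<forall>t. poly P t = A (evec j 0 + t *s axis (j + 2) 1)" using form_line_poly[OF assms] by blast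
  have "evec j 0 + t *s axis (j + 2) 1 = evec j t" for t
  proof -
    have "(evec j 0 + t *s axis (j + 2) 1) $ i = evec j t $ i" for i
      using idx3(1)[of i j] by (auto simp: evec_def axis_def idx3(2-))
    thus ?thesis unfolding Finite_Cartesian_Product.vec_eq_iff by blast
  qed
  thus ?thesis using P that by metis
qed

lemma poly_eventually_nonzero: "p \<noteq> 0 \<Longrightarrow> \<forall>\<^sub>F t in at (s::complex). poly p t \<noteq> 0"
proof -
  assume p: "p \<noteq> 0"
  have "finite ({t. poly p t = 0} - {s})" using poly_roots_finite[OF p] by simp
  hence "open (- ({t. poly p t = 0} - {s}))" by (intro open_Compl finite_imp_closed)
  hence "\<forall>\<^sub>F t in at s. t \<in> - ({t. poly p t = 0} - {s}) - {s}" by (intro eventually_at_in_open) auto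
  thus ?thesis by eventually_elim auto
qed

lemma poly_ratio_limit:
  fixes a b :: "complex poly"
  assumes "b \<noteq> 0"
  shows "(\<exists>l. ((\<lambda>t. poly a t / poly b t) \<longlongrightarrow> l) (at s)) \<or> (a \<noteq> 0 \<and> ((\<lambda>t. poly b t / poly a t) \<longlongrightarrow> 0) (at s))"
proof (cases "a = 0")
  case True
  thus ?thesis by (auto intro: exI[of _ 0])
next
  case False
  define m n where "m = Polynomial.order s a" and "n = Polynomial.order s b"
  obtain a' where a: "a = [:-s, 1:]^m * a'" "\<not> [:-s, 1:] dvd a'"
    using order_decomp[OF False, of s] unfolding m_def by blast
  obtain b' where b: "b = [:-s, 1:]^n * b'" "\<not> [:-s, 1:] dvd b'"
    using order_decomp[OF assms, of s] unfolding n_def by blast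
  have nz: "poly a' s \<noteq> 0" "poly b' s \<noteq> 0" using a(2) b(2) by (auto simp: poly_eq_0_iff_dvd)
  have ne: "\<forall>\<^sub>F t in at s. t \<noteq> s" by (simp add: eventually_at_filter)
  have pa: "poly a t = (t - s)^m * poly a' t" for t unfolding a(1) by (simp add: poly_power)
  have pb: "poly b t = (t - s)^n * poly b' t" for t unfolding b(1) by (simp add: poly_power)
  show ?thesis
  proof (cases "n \<le> m")
    case True
    have "((\<lambda>t. (t - s)^(m - n) * (poly a' t / poly b' t)) \<longlongrightarrow> (s - s)^(m - n) * (poly a' s / poly b' s)) (at s)"
      by (intro tendsto_intros nz)
    moreover have "\<forall>\<^sub>F t in at s. (t - s)^(m - n) * (poly a' t / poly b' t) = poly a t / poly b t"
      using ne by eventually_elim (use True in \<open>simp add: pa pb power_diff\<close>)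
    ultimately show ?thesis using tendsto_cong by fast
  next
    case f: False
    have "((\<lambda>t. (t - s)^(n - m) * (poly b' t / poly a' t)) \<longlongrightarrow> (s - s)^(n - m) * (poly b' s / poly a' s)) (at s)"
      by (intro tendsto_intros nz)
    moreover have "\<forall>\<^sub>F t in at s. (t - s)^(n - m) * (poly b' t / poly a' t) = poly b t / poly a t"
      using ne by eventually_elim (use f in \<open>simp add: pa pb power_diff\<close>)
    ultimately have "((\<lambda>t. poly b t / poly a t) \<longlongrightarrow> 0) (at s)" using f tendsto_cong[of _ _ "at s"] by (fastforce simp: power_0_left)
    thus ?thesis using False by blast
  qed
qed

text \<open>After a rotation of the indices the line is \<open>v$3 = 0\<close>, where only
  coefficients with i + k = d contribute. These vanish, so the same polynomial is the
  dehomogenization of a form of degree d - 1, and the two homogenizations differ by the factor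
  \<open>v$3\<close>.\<close>

lemma form_vanish_line:
  assumes "form d A" "\<And>t. A (evec j t) = 0"
  shows "\<exists>A'. form (d - 1) A' \<and> (\<forall>v. A v = v$j * A' v)"
proof -
  define p where "p v = (\<chi> i. v $ (i + j)) " for v :: "complex^3"
  define p' where "p' v = (\<chi> i. v $ (i - j)) " for v :: "complex^3"
  have pp: "p (p' v) = v" "p' (p v) = v" for v
    unfolding p_def p'_def Finite_Cartesian_Product.vec_eq_iff by simp_all
  have "form (d * 1) (\<lambda>v. A (p' v))"
    by (rule form_comp[OF assms(1)]) (simp add: p'_def form_coord[unfolded One_nat_def])
  then obtain a where a: "total_degree_le a d" "(\<lambda>v. A (p' v)) = form_value d a" unfolding form_def by auto
  have e: "p' (evec 3 t) = evec j t" for t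
    unfolding p'_def evec_def Finite_Cartesian_Product.vec_eq_iff by (simp add: diff_eq_eq add.commute)
  define c where "c k = coeff (coeff a k) (d - k)" for k
  have top: "form_value d a v = (\<Sum>k\<le>d. c k * v$1^(d - k) * v$2^k)" if "v$3 = 0" for v
    unfolding form_value_def
  proof (rule sum.cong[OF refl])
    fix k assume "k \<in> {..d}"
    have "(\<Sum>i\<le>d - k. coeff (coeff a k) i * v$1^i * v$2^k * v$3^(d - i - k)) =
       (\<Sum>i\<in>{d - k}. coeff (coeff a k) i * v$1^i * v$2^k * v$3^(d - i - k))"
      by (rule sum.mono_neutral_right) (use that in \<open>auto simp: power_0_left\<close>)
    thus "(\<Sum>i\<le>d - k. coeff (coeff a k) i * v$1^i * v$2^k * v$3^(d - i - k)) = c k * v$1^(d - k) * v$2^k"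
      using \<open>k \<in> {..d}\<close> by (simp add: c_def)
  qed
  have "poly (\<Sum>k\<le>d. monom (c k) k) t = 0" for t
  proof -
    have "form_value d a (evec 3 t) = 0" using assms(2)[of t] e[of t] fun_cong[OF a(2), of "evec 3 t"] by simp
    moreover have "evec 3 t $ 3 = 0" "evec 3 t $ 1 = 1" "evec 3 t $ 2 = t" unfolding evec_def by simp_all
    ultimately show ?thesis using top[of "evec 3 t"] by (simp add: poly_sum poly_monom)
  qed
  hence "(\<Sum>k\<le>d. monom (c k) k) = 0" using poly_all_0_iff_0 by blast
  hence c0: "c k = 0" if "k \<le> d" for k
  proof -
    have "coeff (\<Sum>k\<le>d. monom (c k) k) k = c k" using that by (simp add: coeff_sum sum.delta)
    thus ?thesis using \<open>(\<Sum>k\<le>d. monom (c k) k) = 0\<close> by simp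
  qed
  have coeff_top: "i + k \<le> d - 1" if "coeff (coeff a k) i \<noteq> 0" for i k
  proof -
    have le: "i + k \<le> d" using that a(1) unfolding total_degree_le_def by blast
    moreover have "i + k \<noteq> d" using c0[of k] that unfolding c_def by auto
    ultimately show ?thesis by linarith
  qed
  hence td: "total_degree_le a (d - 1)" unfolding total_degree_le_def by blast
  have key: "form_value d a v = v$3 * form_value (d - 1) a v" for v
  proof (cases "v$3 = 0")
    case True
    thus ?thesis using top[OF True] c0 by simp
  next
    case False
    show ?thesis
    \<comment> \<open>For d = 0 the degree d - 1 is again 0 and the bound alone does not help; but
      the only possible coefficient vanishes.\<close>
    proof (cases "d = 0")
      case True
      have "a = 0" using c0[of 0] coeff_top a(1) True unfolding c_def total_degree_le_def
        by (intro poly_eqI) (metis add_is_0 coeff_0 diff_zero le_zero_eq)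
      thus ?thesis by (simp add: form_value_def)
    next
      case d: False
      thus ?thesis unfolding form_value_chart[OF a(1) False] form_value_chart[OF td False]
        by (cases d) simp_all
    qed
  qed
  have "form ((d - 1) * 1) (\<lambda>v. form_value (d - 1) a (p v))"
  proof (rule form_comp)
    show "form (d - 1) (form_value (d - 1) a)" unfolding form_def using td by blast
    show "form 1 (\<lambda>v. p v $ i)" for i unfolding p_def vec_lambda_beta by (rule form_coord)
  qed
  moreover have "A v = v$j * form_value (d - 1) a (p v)" for v
  proof -
    have "A v = form_value d a (p v)" using fun_cong[OF a(2), of "p v"] pp(2) by simp
    moreover have three: "3 + j = j" using exhaust_3[of j] by auto
    have "p v $ 3 = v $ j" unfolding p_def vec_lambda_beta three ..
    ultimately show ?thesis using key[of "p v"] by simp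
  qed
  ultimately show ?thesis by (intro exI[of _ "\<lambda>v. form_value (d - 1) a (p v)"]) simp
qed

text \<open>\<open>line_place j s\<close> is the composite of the valuation along the \<open>j\<close>-th line and the one of its point \<open>s\<close>.\<close>

definition line_limit :: "3 \<Rightarrow> complex \<Rightarrow> ratfun \<Rightarrow> complex \<Rightarrow> bool" where
  "line_limit j s g l \<longleftrightarrow> (\<exists>d A B. form d A \<and> form d B \<and> g = fr A B \<and> (\<exists>t. B (evec j t) \<noteq> 0)
     \<and> ((\<lambda>t. A (evec j t) / B (evec j t)) \<longlongrightarrow> l) (at s))"

definition line_place :: "3 \<Rightarrow> complex \<Rightarrow> ratfun set" where
  "line_place j s = {g. \<exists>l. line_limit j s g l}"

lemma line_limitE:
  assumes "line_limit j s g l"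
  obtains d A B where "form d A" "form d B" "g = fr A B" "\<exists>t. B (evec j t) \<noteq> 0"
    "((\<lambda>t. A (evec j t) / B (evec j t)) \<longlongrightarrow> l) (at s)"
  using assms that unfolding line_limit_def by metis

lemma form_evec_eventually:
  assumes "form d B" "\<exists>t. B (evec j t) \<noteq> 0"
  shows "\<forall>\<^sub>F t in at s. B (evec j t) \<noteq> 0"
proof -
  obtain P where P: "\<And>t. B (evec j t) = poly P t" using form_evec_poly[OF assms(1)] by metis
  hence "P \<noteq> 0" using assms(2) by auto
  thus ?thesis unfolding P by (rule poly_eventually_nonzero)
qed

lemma line_limit_unique:
  assumes "line_limit j s g l" "line_limit j s g m"
  shows "l = m"
proof -
  obtain d A B where 1: "form d A" "form d B" "g = fr A B" "\<exists>t. B (evec j t) \<noteq> 0"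
    "((\<lambda>t. A (evec j t) / B (evec j t)) \<longlongrightarrow> l) (at s)" by (rule line_limitE[OF assms(1)])
  obtain d' A' B' where 2: "form d' A'" "form d' B'" "g = fr A' B'" "\<exists>t. B' (evec j t) \<noteq> 0"
    "((\<lambda>t. A' (evec j t) / B' (evec j t)) \<longlongrightarrow> m) (at s)" by (rule line_limitE[OF assms(2)])
  have eq: "A v * B' v = A' v * B v" for v
    using fr_eq_iff[OF 1(1,2) 2(1,2)] 1(3,4) 2(3,4) by blast
  have "\<forall>\<^sub>F t in at s. A (evec j t) / B (evec j t) = A' (evec j t) / B' (evec j t)"
    using form_evec_eventually[OF 1(2,4)] form_evec_eventually[OF 2(2,4)]
    by eventually_elim (simp add: frac_eq_eq eq)
  hence "((\<lambda>t. A' (evec j t) / B' (evec j t)) \<longlongrightarrow> l) (at s)" using 1(5) tendsto_cong by fast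
  thus ?thesis using tendsto_unique[OF _ _ 2(5)] by simp
qed

lemma line_limit_const: "line_limit j s (const_fun c) c"
  unfolding line_limit_def const_fun_fr
  by (intro exI[of _ 0] exI[of _ "\<lambda>v. c"] exI[of _ "\<lambda>v. 1"]) (auto intro: form_const)

lemma line_limit_add_mult:
  assumes "line_limit j s g l" "line_limit j s h m"
  shows "line_limit j s (g + h) (l + m)" "line_limit j s (g * h) (l * m)"
proof -
  obtain d A B where 1: "form d A" "form d B" "g = fr A B" "\<exists>t. B (evec j t) \<noteq> 0"
    "((\<lambda>t. A (evec j t) / B (evec j t)) \<longlongrightarrow> l) (at s)" by (rule line_limitE[OF assms(1)])
  obtain d' A' B' where 2: "form d' A'" "form d' B'" "h = fr A' B'" "\<exists>t. B' (evec j t) \<noteq> 0"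
    "((\<lambda>t. A' (evec j t) / B' (evec j t)) \<longlongrightarrow> m) (at s)" by (rule line_limitE[OF assms(2)])
  note ev = form_evec_eventually[OF 1(2,4)] form_evec_eventually[OF 2(2,4)]
  have "\<forall>\<^sub>F t in at s. B (evec j t) * B' (evec j t) \<noteq> 0" using ev by eventually_elim simp
  hence nz: "\<exists>t. B (evec j t) * B' (evec j t) \<noteq> 0" by (rule eventually_happens'[rotated]) simp
  have "form (d + d') (\<lambda>v. A v * B' v + A' v * B v)"
    using form_add[OF form_mult[OF 1(1) 2(2)]] form_mult[OF 2(1) 1(2)] by (simp add: add.commute)
  moreover have "g + h = fr (\<lambda>v. A v * B' v + A' v * B v) (\<lambda>v. B v * B' v)"
    unfolding 1(3) 2(3) using 1(4) 2(4) by (intro fr_add[OF 1(1,2) 2(1,2)]) blast+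
  moreover have "((\<lambda>t. (A (evec j t) * B' (evec j t) + A' (evec j t) * B (evec j t)) / (B (evec j t) * B' (evec j t))) \<longlongrightarrow> l + m) (at s)"
    by (rule Lim_transform_eventually[OF tendsto_add[OF 1(5) 2(5)]])
       (use ev in eventually_elim, simp add: add_frac_eq)
  ultimately show "line_limit j s (g + h) (l + m)"
    unfolding line_limit_def using form_mult[OF 1(2) 2(2)] nz
    by (intro exI[of _ "d + d'"] exI[of _ "\<lambda>v. A v * B' v + A' v * B v"] exI[of _ "\<lambda>v. B v * B' v"]) simp
  have "((\<lambda>t. (A (evec j t) * A' (evec j t)) / (B (evec j t) * B' (evec j t))) \<longlongrightarrow> l * m) (at s)"
    using tendsto_mult[OF 1(5) 2(5)] by (simp add: times_divide_times_eq)
  thus "line_limit j s (g * h) (l * m)"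
    unfolding line_limit_def using form_mult[OF 1(2) 2(2)] form_mult[OF 1(1) 2(1)] nz fr_mult[OF 1(1,2) 2(1,2)]
    by (intro exI[of _ "d + d'"] exI[of _ "\<lambda>v. A v * A' v"] exI[of _ "\<lambda>v. B v * B' v"]) (simp add: 1(3) 2(3))
qed

lemma line_limit_inverse:
  assumes "line_limit j s g l" "l \<noteq> 0"
  shows "line_limit j s (inverse g) (inverse l)"
proof -
  obtain d A B where 1: "form d A" "form d B" "g = fr A B" "\<exists>t. B (evec j t) \<noteq> 0"
    "((\<lambda>t. A (evec j t) / B (evec j t)) \<longlongrightarrow> l) (at s)" by (rule line_limitE[OF assms(1)])
  have "\<forall>\<^sub>F t in at s. A (evec j t) / B (evec j t) \<noteq> 0" by (rule tendsto_imp_eventually_ne[OF 1(5) assms(2)])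
  hence "\<exists>t. A (evec j t) / B (evec j t) \<noteq> 0" by (rule eventually_happens'[rotated]) simp
  hence "\<exists>t. A (evec j t) \<noteq> 0" by auto
  moreover have "((\<lambda>t. B (evec j t) / A (evec j t)) \<longlongrightarrow> inverse l) (at s)"
    using tendsto_inverse[OF 1(5) assms(2)] by simp
  ultimately show ?thesis unfolding line_limit_def 1(3) fr_inverse[OF 1(1,2)] using 1(1,2) by blast
qed

text \<open>In a representation of least degree, numerator and denominator do not both vanish along
  the line, since \<open>v$j\<close> could be cancelled otherwise. So the restricted quotient, or
  its inverse, is a quotient of polynomials in t with a limit.\<close>

lemma line_limit_total: "(\<exists>l. line_limit j s g l) \<or> line_limit j s (inverse g) 0"
proof -
  define Q where "Q d \<longleftrightarrow> (\<exists>A B. form d A \<and> form d B \<and> (\<exists>v. B v \<noteq> 0) \<and> g = fr A B)" for d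
  have "\<exists>d. Q d" unfolding Q_def by (rule ex_fr[of g]) blast
  then obtain d where d: "Q d" "\<And>e. e < d \<Longrightarrow> \<not> Q e" by (metis exists_least_iff)
  obtain A B where AB: "form d A" "form d B" "\<exists>v. B v \<noteq> 0" "g = fr A B" using d(1) unfolding Q_def by blast
  have nz: "(\<exists>t. A (evec j t) \<noteq> 0) \<or> (\<exists>t. B (evec j t) \<noteq> 0)"
  proof (rule ccontr)
    assume "\<not> ?thesis"
    then obtain A' B' where A': "form (d - 1) A'" "\<forall>v. A v = v$j * A' v" and B': "form (d - 1) B'" "\<forall>v. B v = v$j * B' v"
      using form_vanish_line[OF AB(1)] form_vanish_line[OF AB(2)] by metis
    have nzB': "\<exists>v. B' v \<noteq> 0" using AB(3) B'(2) by auto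
    have "d \<noteq> 0"
    proof
      assume "d = 0"
      then obtain b where "B = form_value 0 b" using AB(2) unfolding form_def by blast
      hence "B v = B 0" for v by (simp add: form_value_def)
      moreover have "B 0 = 0" using B'(2) by simp
      ultimately show False using AB(3) by metis
    qed
    moreover have "g = fr A' B'"
    proof -
      have "A = (\<lambda>v. A' v * v$j)" "B = (\<lambda>v. B' v * v$j)" using A'(2) B'(2) by (auto simp: mult.commute)
      thus ?thesis unfolding AB(4) using fr_cancel[OF A'(1) B'(1) form_coord nzB' coord_nonzero] by simp
    qed
    ultimately show False using d(2)[of "d - 1"] A'(1) B'(1) nzB' unfolding Q_def by auto
  qed
  obtain P where P: "\<And>t. A (evec j t) = poly P t" using form_evec_poly[OF AB(1)] by metis
  obtain R where R: "\<And>t. B (evec j t) = poly R t" using form_evec_poly[OF AB(2)] by metis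
  show ?thesis
  proof (cases "R = 0")
    case True
    hence "\<exists>t. A (evec j t) \<noteq> 0" using nz R by simp
    moreover have "((\<lambda>t. B (evec j t) / A (evec j t)) \<longlongrightarrow> 0) (at s)" using True R by simp
    ultimately have "line_limit j s (inverse g) 0"
      unfolding line_limit_def AB(4) fr_inverse[OF AB(1,2)] using AB(1,2) by blast
    thus ?thesis ..
  next
    case False
    hence Bnz: "\<exists>t. B (evec j t) \<noteq> 0" using R poly_all_0_iff_0 by metis
    show ?thesis using poly_ratio_limit[OF False, of P s]
    proof
      assume "\<exists>l. ((\<lambda>t. poly P t / poly R t) \<longlongrightarrow> l) (at s)"
      thus ?thesis unfolding line_limit_def P[symmetric] R[symmetric] using AB Bnz by blast
    next
      assume *: "P \<noteq> 0 \<and> ((\<lambda>t. poly R t / poly P t) \<longlongrightarrow> 0) (at s)"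
      hence "\<exists>t. A (evec j t) \<noteq> 0" using P poly_all_0_iff_0 by metis
      thus ?thesis using * unfolding line_limit_def P[symmetric] R[symmetric] AB(4) fr_inverse[OF AB(1,2)]
        using AB(1,2) by blast
    qed
  qed
qed

lemma line_place_max: "g \<in> max_ideal (line_place j s) \<longleftrightarrow> line_limit j s g 0"
proof
  assume g: "g \<in> max_ideal (line_place j s)"
  then obtain l where l: "line_limit j s g l" unfolding max_ideal_iff line_place_def by blast
  have "l = 0"
  proof (rule ccontr)
    assume "l \<noteq> 0"
    hence "inverse g \<in> line_place j s" "g \<noteq> 0" using line_limit_inverse[OF l] l line_limit_const[of j s 0]
        line_limit_unique const_fun_simps(1) unfolding line_place_def by (blast, metis)
    thus False using g by (simp add: max_ideal_iff)
  qed
  thus "line_limit j s g 0" using l by simp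
next
  assume g: "line_limit j s g 0"
  have "inverse g \<notin> line_place j s" if "g \<noteq> 0"
  proof
    assume "inverse g \<in> line_place j s"
    then obtain l where "line_limit j s (inverse g) l" unfolding line_place_def by blast
    from line_limit_add_mult(2)[OF g this] have "line_limit j s (const_fun 1) 0" using that by (simp add: const_fun_simps)
    thus False using line_limit_unique[OF line_limit_const] by fastforce
  qed
  thus "g \<in> max_ideal (line_place j s)" using g unfolding max_ideal_iff line_place_def by blast
qed

lemma valuation_place_line: "valuation_place (line_place j s)"
proof -
  have cs: "const_subring (line_place j s)"
    unfolding const_subring_def line_place_def
    using line_limit_const line_limit_add_mult by blast
  have "\<exists>c. a - const_fun c \<in> max_ideal (line_place j s)" if "a \<in> line_place j s" for a
  proof -
    obtain l where l: "line_limit j s a l" using \<open>a \<in> line_place j s\<close> unfolding line_place_def by blast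
    from line_limit_add_mult(1)[OF l line_limit_const[of j s "- l"]] show ?thesis
      unfolding line_place_max by (intro exI[of _ l]) (simp add: const_fun_simps)
  qed
  moreover have "\<forall>a\<in>max_ideal (line_place j s). \<forall>b\<in>max_ideal (line_place j s). a + b \<in> max_ideal (line_place j s)"
    using line_limit_add_mult(1)[of j s _ 0 _ 0] by (auto simp: line_place_max)
  moreover have "\<forall>g. g \<in> line_place j s \<or> inverse g \<in> line_place j s"
    unfolding line_place_def using line_limit_total by blast
  ultimately show ?thesis unfolding valuation_place_def res_local_def using cs by blast
qed

lemma line_limit_pt:
  assumes "form d A" "form d B" "B (evec j s) \<noteq> 0"
  shows "line_limit j s (fr A B) (A (evec j s) / B (evec j s))"
proof -
  obtain P where P: "\<And>t. A (evec j t) = poly P t" using form_evec_poly[OF assms(1)] by metis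
  obtain R where R: "\<And>t. B (evec j t) = poly R t" using form_evec_poly[OF assms(2)] by metis
  have "((\<lambda>t. poly P t / poly R t) \<longlongrightarrow> poly P s / poly R s) (at s)"
    using assms(3) R by (intro tendsto_intros) auto
  thus ?thesis unfolding line_limit_def P[symmetric] R[symmetric] using assms by blast
qed

lemma line_place_dominates: "dominates (line_place j s) (edge_pt j s)"
  unfolding dominates_def edge_pt_evec
proof (intro conjI subsetI)
  fix a assume "a \<in> pt (evec j s)"
  then obtain d A B where "form d A" "form d B" "B (evec j s) \<noteq> 0" "a = fr A B" by (rule ptE)
  thus "a \<in> line_place j s" unfolding line_place_def using line_limit_pt by blast
next
  fix a assume a: "a \<in> max_ideal (pt (evec j s))"
  then obtain d A B where 1: "form d A" "form d B" "B (evec j s) \<noteq> 0" "a = fr A B" using ptE max_subset by metis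
  hence "A (evec j s) = 0" using a fr_in_max_pt[OF 1(1-3)] by simp
  thus "a \<in> max_ideal (line_place j s)" unfolding line_place_max using line_limit_pt[OF 1(1-3)] 1(4) by simp
qed

lemma edge_pt_P2: "edge_pt j s \<in> P2" unfolding edge_pt_evec P2_iff using evec_nonzero by blast

lemma centred_line: "centred (line_place j s)"
  unfolding centred_def using valuation_place_line line_place_dominates edge_pt_P2 by blast

text \<open>Only a punctured neighbourhood of s enters, so F may be undefined at the point s itself:
  places follow the map through base points. Both sides are valuation rings, so by
  \<open>place_eq\<close> domination is enough.\<close>

lemma line_place_pullback:
  assumes F: "form_map e F" "birational_map (sub F)"
    and ev: "\<forall>\<^sub>F t in at s. c t \<noteq> 0 \<and> F (evec j t) = c t *s evec k (h t)"
    and h: "filterlim h (at s') (at s)"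
  shows "line_place j s = sub F ` line_place k s'"
proof -
  interpret birational "sub F" by unfold_locales (rule F(2))
  have lim: "line_limit j s (sub F g) l" if gl: "line_limit k s' g l" for g l
  proof -
    obtain d A B where 1: "form d A" "form d B" "g = fr A B" "\<exists>t. B (evec k t) \<noteq> 0"
      "((\<lambda>t. A (evec k t) / B (evec k t)) \<longlongrightarrow> l) (at s')" by (rule line_limitE[OF gl])
    have eq: "sub F g = fr (\<lambda>v. A (F v)) (\<lambda>v. B (F v))" unfolding 1(3) using 1(4) by (intro sub_fr[OF F(1) 1(1,2)]) blast
    have "\<forall>\<^sub>F t in at s. B (evec k (h t)) \<noteq> 0"
      by (rule h[unfolded filterlim_iff, rule_format, OF form_evec_eventually[OF 1(2,4)]])
    with ev have "\<forall>\<^sub>F t in at s. B (F (evec j t)) \<noteq> 0"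
      by eventually_elim (auto simp: form_scale[OF 1(2)])
    hence nz: "\<exists>t. B (F (evec j t)) \<noteq> 0" by (rule eventually_happens'[rotated]) simp
    have "((\<lambda>t. A (evec k (h t)) / B (evec k (h t))) \<longlongrightarrow> l) (at s)"
      by (rule filterlim_compose[OF 1(5) h])
    moreover have "\<forall>\<^sub>F t in at s. A (evec k (h t)) / B (evec k (h t)) = A (F (evec j t)) / B (F (evec j t))"
      using ev by eventually_elim (auto simp: form_scale[OF 1(1)] form_scale[OF 1(2)])
    ultimately have "((\<lambda>t. A (F (evec j t)) / B (F (evec j t))) \<longlongrightarrow> l) (at s)" using tendsto_cong by fast
    thus ?thesis unfolding eq line_limit_def
      using form_map_form[OF F(1) 1(1)] form_map_form[OF F(1) 1(2)] nz
      by (intro exI[of _ "d * e"] exI[of _ "\<lambda>v. A (F v)"] exI[of _ "\<lambda>v. B (F v)"]) simp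
  qed
  have "dominates (line_place j s) (sub F ` line_place k s')"
    unfolding dominates_def max_ideal_image using lim
    by (auto simp: line_place_max) (auto simp: line_place_def)
  thus ?thesis using place_eq valuation_place_image[OF valuation_place_line] valuation_place_line
    unfolding valuation_place_def by blast
qed

subsection \<open>Orbits on blown-up surfaces\<close>

text \<open>A place W centred at R makes the value of f unique: every candidate is dominated by the
  image of W under the inverse automorphism. This image is a centred place too and has only one
  centre on X.\<close>

lemma map_pt_eqI:
  assumes "birational_map f" "surface X" "centred W" "R \<in> X" "dominates W R" "S \<in> X" "dominates R (f ` S)"
  shows "map_pt f X R = S" "dominates (inv_into UNIV f ` W) S"
proof -
  interpret birational f by unfold_locales (rule assms(1))
  interpret i: birational "inv_into UNIV f" by unfold_locales (rule birational_map_inv[OF assms(1)])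
  let ?W = "inv_into UNIV f ` W"
  have dom: "dominates ?W T" if "dominates R (f ` T)" for T
  proof -
    have "dominates W (f ` T)" using that assms(5) dominates_trans by blast
    thus ?thesis using dominates_image[of ?W T] image_inv(1)[of W] by simp
  qed
  show "dominates ?W S" using dom assms(7) .
  obtain S' where S': "S' \<in> P2" "dominates S S'" using surfaceD(2)[OF assms(2,6)] by blast
  have "valuation_place ?W" using i.valuation_place_image assms(3) unfolding centred_def by blast
  hence W: "centred ?W" unfolding centred_def
    using S'(1) dominates_trans[OF dom[OF assms(7)] S'(2)] by blast
  show "map_pt f X R = S" unfolding map_pt_def
  proof (rule the_equality)
    show "S \<in> X \<and> dominates R (f ` S)" using assms(6,7) by blast
    show "T = S" if "T \<in> X \<and> dominates R (f ` T)" for T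
      using surfaceD(4)[OF assms(2) W _ assms(6) dom dom[OF assms(7)]] that by blast
  qed
qed

text \<open>A value on X would dominate a point of the plane, and that point would be a value in the
  plane.\<close>

lemma indeterminacy_lift:
  assumes "birational_map f" "surface X" "R \<in> indeterminacy f P2" "R \<in> X"
  shows "R \<in> indeterminacy f X"
proof -
  interpret birational f by unfold_locales (rule assms(1))
  have "\<not> dominates R (f ` S)" if "S \<in> X" for S
    using surfaceD(2)[OF assms(2) that] assms(3) dominates_trans dominates_image unfolding indeterminacy_def by blast
  thus ?thesis unfolding indeterminacy_def using assms(4) by blast
qed

text \<open>The points \<open>P a\<close> of the plane are accompanied by places \<open>Pl a\<close>
  centred there. The map \<Phi> of labels describes f on the places without exception, on the points
  only where f is regular. As f stands for the pullback, \<open>push\<close> carries the ring at the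
  image back to the ring at a.\<close>

locale place_family =
  fixes f :: ratmap and A :: "'a set" and Pl :: "'a \<Rightarrow> ratfun set" and P :: "'a \<Rightarrow> point" and \<Phi> :: "'a \<Rightarrow> 'a"
  assumes birational_f: "birational_map f"
    and place: "a \<in> A \<Longrightarrow> valuation_place (Pl a)" and P_P2: "a \<in> A \<Longrightarrow> P a \<in> P2"
    and dom: "a \<in> A \<Longrightarrow> dominates (Pl a) (P a)" and closed: "a \<in> A \<Longrightarrow> \<Phi> a \<in> A"
    and push: "a \<in> A \<Longrightarrow> f ` Pl (\<Phi> a) = Pl a" and P_inj: "inj_on P A"
begin

lemma centred: "a \<in> A \<Longrightarrow> centred (Pl a)"
  unfolding centred_def using place P_P2 dom by blast

lemma funpow_closed: "a \<in> A \<Longrightarrow> (\<Phi> ^^ m) a \<in> A"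
  by (induction m) (auto intro: closed)

text \<open>On any blown-up surface, the orbit of a point consists of the centres of the orbit of
  its place, as long as f is regular along it. Labels thus control the orbit even when it runs
  through infinitely near points.\<close>

lemma orbit_centre:
  assumes X: "surface X" and a: "a \<in> A" "P a \<in> X"
    and reg: "\<And>k. k < m \<Longrightarrow> (map_pt f X ^^ k) (P a) \<notin> indeterminacy f X"
  shows "(map_pt f X ^^ m) (P a) \<in> X \<and> dominates (Pl ((\<Phi> ^^ m) a)) ((map_pt f X ^^ m) (P a))"
  using reg
proof (induction m)
  case 0
  thus ?case using a dom by simp
next
  case (Suc m)
  interpret birational f by unfold_locales (rule birational_f)
  let ?R = "(map_pt f X ^^ m) (P a)" and ?b = "(\<Phi> ^^ m) a"
  have IH: "?R \<in> X" "dominates (Pl ?b) ?R" using Suc by simp_all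
  have b: "?b \<in> A" using funpow_closed a by blast
  obtain S where S: "S \<in> X" "dominates ?R (f ` S)" using Suc.prems[of m] IH(1) unfolding indeterminacy_def by blast
  have "inv_into UNIV f ` Pl ?b = Pl (\<Phi> ?b)" using push[OF b] image_inv(2) by metis
  thus ?case using map_pt_eqI[OF birational_f X centred[OF b] IH S] S(1) by simp
qed

text \<open>If the centre on X is the plane point \<open>P c\<close>, then it is also the centre in
  the plane, and points determine their labels. Conversely, a plane point that still lies on X is
  the centre of its own place.\<close>

lemma centre_eq:
  assumes "surface X" "b \<in> A" "c \<in> A" "R \<in> X" "P c \<in> X" "dominates (Pl b) R"
  shows "R = P c \<longleftrightarrow> b = c"
proof
  assume "R = P c"
  hence "P b = P c" using P2_separated[of "Pl b"] place[OF assms(2)] P_P2 assms dom unfolding valuation_place_def by blast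
  thus "b = c" using P_inj assms(2,3) by (simp add: inj_on_eq_iff)
next
  assume "b = c"
  thus "R = P c" using surfaceD(4)[OF assms(1) centred[OF assms(2)] assms(4,5,6)] dom[OF assms(2)] by simp
qed

text \<open>Translates a stage of a realization into statements about \<Phi>. A base point that has
  not been blown up is still indeterminate on X, so the orbit must not meet it before its end. The
  last claim passes this on to the next stage: of these base points, only the end point b of the
  present orbit is lost.\<close>

lemma realization_step_orbit:
  assumes X: "surface X" and step: "realization_step f p q n \<sigma> i X X'"
    and a: "a \<in> A" "q i = P a" and b: "b \<in> A" "p (\<sigma> i) = P b"
  shows "(\<Phi> ^^ (n i - 1)) a = b"
    "\<And>m c. m < n i - 1 \<Longrightarrow> c \<in> A \<Longrightarrow> P c \<in> X \<Longrightarrow> P c \<in> indeterminacy f P2 \<Longrightarrow> (\<Phi> ^^ m) a \<noteq> c"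
    "surface X'"
    "\<And>c. c \<in> A \<Longrightarrow> P c \<in> X \<Longrightarrow> P c \<in> indeterminacy f P2 \<Longrightarrow> c \<noteq> b \<Longrightarrow> P c \<in> X'"
proof -
  have st: "P a \<in> X" "P b \<in> X" "(map_pt f X ^^ (n i - 1)) (P a) = P b"
    "\<And>m. m < n i - 1 \<Longrightarrow> (map_pt f X ^^ m) (P a) \<notin> indeterminacy f X"
    "X' = blowup ((\<lambda>m. (map_pt f X ^^ m) (P a)) ` {..n i - 1}) X"
    using step unfolding realization_step_def a(2) b(2) by blast+
  have orb: "(map_pt f X ^^ m) (P a) \<in> X \<and> dominates (Pl ((\<Phi> ^^ m) a)) ((map_pt f X ^^ m) (P a))"
    if "m \<le> n i - 1" for m
    by (rule orbit_centre[OF X a(1) st(1)]) (use st(4) that in auto)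
  have hit: "(map_pt f X ^^ m) (P a) = P c \<longleftrightarrow> (\<Phi> ^^ m) a = c" if "m \<le> n i - 1" "c \<in> A" "P c \<in> X" for m c
    using centre_eq[OF X funpow_closed[OF a(1)] that(2) _ that(3)] orb[OF that(1)] by blast
  show last: "(\<Phi> ^^ (n i - 1)) a = b" using hit[of "n i - 1" b] b(1) st(2,3) by blast
  show no: "(\<Phi> ^^ m) a \<noteq> c" if "m < n i - 1" "c \<in> A" "P c \<in> X" "P c \<in> indeterminacy f P2" for m c
    using hit[of m c] that st(4)[OF that(1)] indeterminacy_lift[OF birational_f X that(4,3)] by auto
  show "surface X'" unfolding st(5) by (rule surface_blowup[OF X]) (use orb in auto)
  show "P c \<in> X'" if "c \<in> A" "P c \<in> X" "P c \<in> indeterminacy f P2" "c \<noteq> b" for c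
  proof -
    have "(map_pt f X ^^ m) (P a) \<noteq> P c" if "m \<le> n i - 1" for m
      using hit[OF that \<open>c \<in> A\<close> \<open>P c \<in> X\<close>] no[of m c] last \<open>c \<noteq> b\<close> \<open>c \<in> A\<close> \<open>P c \<in> X\<close> \<open>P c \<in> indeterminacy f P2\<close> that
      by (cases "m = n i - 1") auto
    thus ?thesis unfolding st(5) blowup_def using \<open>P c \<in> X\<close> by auto
  qed
qed

end

subsection \<open>Valuations of prime divisors\<close>

definition dvr :: "ratfun set \<Rightarrow> ratfun \<Rightarrow> bool" where
  "dvr V t \<longleftrightarrow> const_subring V \<and> t \<noteq> 0 \<and> max_ideal V = {t * a | a. a \<in> V}
     \<and> (\<forall>g. g \<noteq> 0 \<longrightarrow> (\<exists>k. \<exists>u\<in>units_of_ring V. g = t powi k * u))"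

lemma units_mult': "const_subring V \<Longrightarrow> a \<in> units_of_ring V \<Longrightarrow> b \<in> units_of_ring V \<Longrightarrow> a * b \<in> units_of_ring V"
  using const_subringD(5) by (auto simp: units_iff)

lemma units_powi: "const_subring V \<Longrightarrow> a \<in> units_of_ring V \<Longrightarrow> a powi k \<in> units_of_ring V"
proof -
  assume V: "const_subring V" and a: "a \<in> units_of_ring V"
  have 1: "1 \<in> units_of_ring V" using const_subringD(3)[OF V] by (simp add: units_iff)
  have "b ^ n \<in> units_of_ring V" if "b \<in> units_of_ring V" for b n
    by (induction n) (use 1 units_mult'[OF V that] in auto)
  thus ?thesis using a units_subset(4)[OF a] unfolding power_int_def by auto
qed

context
  fixes V t
  assumes dvr: "dvr V t"
begin

lemma dvrD: "const_subring V" "t \<noteq> 0" "max_ideal V = {t * a | a. a \<in> V}"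
  "g \<noteq> 0 \<Longrightarrow> \<exists>k. \<exists>u\<in>units_of_ring V. g = t powi k * u"
  using dvr unfolding dvr_def by auto

lemma dvr_t_max: "t \<in> max_ideal V"
  unfolding dvrD(3) using const_subringD(3)[OF dvrD(1)] by (intro CollectI exI[of _ 1]) simp

lemma dvr_pow_in: "k \<ge> 0 \<Longrightarrow> a \<in> V \<Longrightarrow> t powi k * a \<in> V"
  using const_subringD(5,8)[OF dvrD(1)] max_subset[OF dvr_t_max] by (simp add: power_int_def)

lemma dvr_pow_unit: "t powi k \<in> units_of_ring V \<Longrightarrow> k = 0"
proof (rule ccontr)
  have pos: False if "t powi k \<in> units_of_ring V" "k > 0" for k
  proof -
    have "t powi k = t * t powi (k - 1)" using that(2) dvrD(2) power_int_add[of t 1 "k - 1"] by simp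
    moreover have "t powi (k - 1) \<in> V" using dvr_pow_in[of "k - 1" 1] that(2) const_subringD(3)[OF dvrD(1)] by simp
    ultimately have "t powi k \<in> max_ideal V" unfolding dvrD(3) by blast
    thus False using units_or_max units_subset(1) that(1) by blast
  qed
  assume "t powi k \<in> units_of_ring V" "k \<noteq> 0"
  thus False using pos[of k] pos[of "- k"] units_subset(4)[of "t powi k" V] power_int_minus[of t k] by (cases "k > 0") auto
qed

text \<open>\<open>val\<close> allows any generator of the maximal ideal as uniformizer. Two of them
  differ by a unit, whose power is absorbed into the unit factor.\<close>

lemma val_eq: "u \<in> units_of_ring V \<Longrightarrow> val V (t powi k * u) = k"
  unfolding val_def
proof (rule the_equality)
  assume u: "u \<in> units_of_ring V"
  show "\<exists>t'. \<exists>u'\<in>units_of_ring V. max_ideal V = {t' * a | a. a \<in> V} \<and> t powi k * u = t' powi k * u'"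
    using u dvrD(3) by blast
  fix k' assume "\<exists>t'. \<exists>u'\<in>units_of_ring V. max_ideal V = {t' * a | a. a \<in> V} \<and> t powi k * u = t' powi k' * u'"
  then obtain t' u' where *: "u' \<in> units_of_ring V" "max_ideal V = {t' * a | a. a \<in> V}" "t powi k * u = t' powi k' * u'" by blast
  have "t' \<in> max_ideal V" unfolding *(2) using const_subringD(3)[OF dvrD(1)] by (intro CollectI exI[of _ 1]) simp
  then obtain w where w: "w \<in> V" "t' = t * w" unfolding dvrD(3) by blast
  obtain w' where w': "w' \<in> V" "t = t' * w'" using dvr_t_max unfolding *(2) by blast
  have "t * w * w' = t" using w(2) w'(2) by simp
  hence "w * w' = 1" using dvrD(2) by (simp add: mult.assoc)
  hence wu: "w \<in> units_of_ring V" unfolding units_iff using w(1) w'(1) inverse_unique by force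
  have "t powi k = t powi k' * (w powi k' * u' * inverse u)"
    using *(3) units_subset(2)[OF u] unfolding w(2) power_int_mult_distrib by (simp add: field_simps)
  hence "t powi (k - k') = w powi k' * u' * inverse u"
    using dvrD(2) by (simp add: power_int_diff field_simps)
  moreover have "w powi k' * u' * inverse u \<in> units_of_ring V"
    by (intro units_mult' dvrD(1) units_powi wu *(1) units_subset(4) u)
  ultimately show "k' = k" using dvr_pow_unit[of "k - k'"] by simp
qed

lemma dvr_rep:
  assumes "g \<noteq> 0"
  obtains u where "u \<in> units_of_ring V" "g = t powi (val V g) * u"
  using dvrD(4)[OF assms] val_eq by metis

lemma val_mult: "g \<noteq> 0 \<Longrightarrow> h \<noteq> 0 \<Longrightarrow> val V (g * h) = val V g + val V h"
proof -
  assume "g \<noteq> 0" "h \<noteq> 0"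
  then obtain u w where u: "u \<in> units_of_ring V" "g = t powi (val V g) * u"
    and w: "w \<in> units_of_ring V" "h = t powi (val V h) * w" using dvr_rep by metis
  have "g * h = t powi (val V g) * u * (t powi (val V h) * w)" using u(2) w(2) by simp
  also have "\<dots> = t powi (val V g + val V h) * (u * w)" using dvrD(2) by (simp add: power_int_add)
  finally show ?thesis using val_eq[OF units_mult'[OF dvrD(1) u(1) w(1)]] by simp
qed

lemma val_unit: "u \<in> units_of_ring V \<Longrightarrow> val V u = 0" using val_eq[of u 0] by simp

lemma val_const: "c \<noteq> 0 \<Longrightarrow> val V (const_fun c) = 0"
proof -
  assume "c \<noteq> 0"
  hence "const_fun c * const_fun (inverse c) = 1" by (simp flip: const_fun_simps(4) add: const_fun_simps(2))
  hence "inverse (const_fun c) = const_fun (inverse c)" by (rule inverse_unique)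
  thus ?thesis using \<open>c \<noteq> 0\<close> const_subringD(1)[OF dvrD(1)] by (intro val_unit) (simp add: units_iff)
qed

lemma val_inverse: "g \<noteq> 0 \<Longrightarrow> val V (inverse g) = - val V g"
  using val_mult[of g "inverse g"] val_const[of 1] by (simp add: const_fun_simps)

lemma val_divide: "g \<noteq> 0 \<Longrightarrow> h \<noteq> 0 \<Longrightarrow> val V (g / h) = val V g - val V h"
  using val_mult[of g "inverse h"] val_inverse[of h] by (simp add: divide_inverse)

lemma in_dvr_iff: "g \<noteq> 0 \<Longrightarrow> g \<in> V \<longleftrightarrow> val V g \<ge> 0"
proof -
  assume "g \<noteq> 0"
  then obtain u where u: "u \<in> units_of_ring V" "g = t powi (val V g) * u" by (rule dvr_rep)
  have "val V g \<ge> 0" if "g \<in> V"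
  proof (rule ccontr)
    assume neg: "\<not> val V g \<ge> 0"
    define n where "n = val V g"
    have g: "g = t powi n * u" using u(2) unfolding n_def .
    have "t powi (- n) * t powi n = 1" using dvrD(2) by (simp add: power_int_minus)
    hence "t powi (- n) * g = u" unfolding g mult.assoc[symmetric] by simp
    moreover have "t powi (- n) * g \<in> max_ideal V"
    proof -
      have "t powi (- n) = t * t powi (- n - 1)" using dvrD(2) power_int_add[of t 1 "- n - 1"] by simp
      hence "t powi (- n) * g = t * (t powi (- n - 1) * g)" by (simp only: mult.assoc)
      moreover have "t powi (- n - 1) * g \<in> V" using dvr_pow_in[of "- n - 1" g] \<open>g \<in> V\<close> neg n_def by simp
      ultimately show ?thesis unfolding dvrD(3) by blast
    qed
    ultimately show False using u(1) units_or_max[OF units_subset(1)[OF u(1)]] by simp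
  qed
  moreover have "g \<in> V" if "val V g \<ge> 0" using dvr_pow_in[OF that units_subset(1)[OF u(1)]] u(2) by simp
  ultimately show ?thesis by blast
qed

lemma in_max_dvr_iff: "g \<noteq> 0 \<Longrightarrow> g \<in> max_ideal V \<longleftrightarrow> val V g \<ge> 1"
  using in_dvr_iff[of g] in_dvr_iff[of "inverse g"] val_inverse[of g] by (auto simp: max_ideal_iff)

lemma val_add:
  assumes "g = 0 \<or> val V g \<ge> m" "h = 0 \<or> val V h \<ge> m"
  shows "g + h = 0 \<or> val V (g + h) \<ge> m"
proof (cases "g = 0 \<or> h = 0 \<or> g + h = 0")
  case True
  thus ?thesis using assms by auto
next
  case False
  have tm: "t powi (- m) \<noteq> 0" "val V (t powi (- m)) = - m"
    using dvrD(2) val_eq[of 1 "- m"] const_subringD(3)[OF dvrD(1)] by (auto simp: units_iff)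
  have "t powi (- m) * g \<in> V" "t powi (- m) * h \<in> V"
    using False assms in_dvr_iff[of "t powi (- m) * g"] in_dvr_iff[of "t powi (- m) * h"] tm val_mult by auto
  hence "t powi (- m) * (g + h) \<in> V" using const_subringD(4)[OF dvrD(1)] by (simp add: distrib_left)
  thus ?thesis using in_dvr_iff[of "t powi (- m) * (g + h)"] False tm val_mult[of "t powi (- m)" "g + h"] by auto
qed

lemma val_const_mult: "g = 0 \<or> val V g \<ge> m \<Longrightarrow> const_fun c * g = 0 \<or> val V (const_fun c * g) \<ge> m"
  using val_mult[of "const_fun c" g] val_const[of c] by (cases "c = 0"; cases "g = 0") (auto simp: const_fun_simps)

end

lemma (in birational) max_ideal_gen_image: "max_ideal (\<phi> ` V) = {\<phi> t * a | a. a \<in> \<phi> ` V} \<longleftrightarrow> max_ideal V = {t * a | a. a \<in> V}"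
proof -
  have "{\<phi> t * a | a. a \<in> \<phi> ` V} = {\<phi> t * \<phi> a | a. a \<in> V}" by blast
  also have "\<dots> = {\<phi> (t * a) | a. a \<in> V}" by (simp only: hom_mult)
  also have "\<dots> = \<phi> ` {t * a | a. a \<in> V}" by blast
  finally have "{\<phi> t * a | a. a \<in> \<phi> ` V} = \<phi> ` {t * a | a. a \<in> V}" .
  thus ?thesis unfolding max_ideal_image by (simp add: image_eq_iff)
qed

lemma (in birational) ex_image: "(\<exists>t. P t) \<longleftrightarrow> (\<exists>t. P (\<phi> t))"
  by (metis surjE)

lemma (in birational) val_image: "val (\<phi> ` V) (\<phi> g) = val V g"
proof -
  have "(\<exists>t. \<exists>u\<in>units_of_ring (\<phi> ` V). max_ideal (\<phi> ` V) = {t * a | a. a \<in> \<phi> ` V} \<and> \<phi> g = t powi k * u)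
    \<longleftrightarrow> (\<exists>t. \<exists>u\<in>units_of_ring V. max_ideal V = {t * a | a. a \<in> V} \<and> g = t powi k * u)" for k
  proof -
    have "(\<exists>u\<in>units_of_ring (\<phi> ` V). max_ideal (\<phi> ` V) = {\<phi> t * a | a. a \<in> \<phi> ` V} \<and> \<phi> g = \<phi> t powi k * u)
      \<longleftrightarrow> (\<exists>u\<in>units_of_ring V. max_ideal V = {t * a | a. a \<in> V} \<and> g = t powi k * u)" for t
      unfolding max_ideal_gen_image units_image by (simp flip: hom_powi hom_mult add: hom_eq_iff)
    thus ?thesis
      unfolding ex_image[of "\<lambda>t. \<exists>u\<in>units_of_ring (\<phi> ` V). max_ideal (\<phi> ` V) = {t * a | a. a \<in> \<phi> ` V} \<and> \<phi> g = t powi k * u"]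
      by (rule iff_exI)
  qed
  thus ?thesis unfolding val_def by (simp only:)
qed

lemma (in birational) prime_in_image: "prime_in (\<phi> ` R) (\<phi> q) \<longleftrightarrow> prime_in R q"
  unfolding prime_in_def max_ideal_image ball_image in_image_iff hom_eq_0_iff
  by (simp add: in_image_iff flip: hom_mult hom_divide)

lemma (in birational) prime_divisors_image: "prime_divisors ((`) \<phi> ` X) = (`) \<phi> ` prime_divisors X"
proof -
  have loc: "{a / b | a b. a \<in> \<phi> ` R \<and> b \<in> \<phi> ` R \<and> b / \<phi> q \<notin> \<phi> ` R} = \<phi> ` {a / b | a b. a \<in> R \<and> b \<in> R \<and> b / q \<notin> R}" for R q
  proof -
    have "{a / b | a b. a \<in> \<phi> ` R \<and> b \<in> \<phi> ` R \<and> b / \<phi> q \<notin> \<phi> ` R} = {\<phi> a / \<phi> b | a b. a \<in> R \<and> b \<in> R \<and> \<phi> b / \<phi> q \<notin> \<phi> ` R}"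
      by blast
    also have "\<dots> = {\<phi> (a / b) | a b. a \<in> R \<and> b \<in> R \<and> b / q \<notin> R}" by (simp only: hom_divide[symmetric] in_image_iff)
    also have "\<dots> = \<phi> ` {a / b | a b. a \<in> R \<and> b \<in> R \<and> b / q \<notin> R}" by blast
    finally show ?thesis .
  qed
  have "W \<in> prime_divisors ((`) \<phi> ` X) \<longleftrightarrow> (\<exists>V\<in>prime_divisors X. W = \<phi> ` V)" for W
  proof -
    have "W \<in> prime_divisors ((`) \<phi> ` X) \<longleftrightarrow> (\<exists>R q. R \<in> X \<and> prime_in (\<phi> ` R) (\<phi> q)
        \<and> W = {a / b | a b. a \<in> \<phi> ` R \<and> b \<in> \<phi> ` R \<and> b / \<phi> q \<notin> \<phi> ` R})"
      unfolding prime_divisors_def mem_Collect_eq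
    proof (intro iffI; elim exE conjE)
      fix R' q' assume *: "W = {a / b |a b. a \<in> R' \<and> b \<in> R' \<and> b / q' \<notin> R'}" "R' \<in> (`) \<phi> ` X" "prime_in R' q'"
      obtain q R where "q' = \<phi> q" "R \<in> X" "R' = \<phi> ` R" using *(2) by (metis imageE surjE)
      thus "\<exists>R q. R \<in> X \<and> prime_in (\<phi> ` R) (\<phi> q) \<and> W = {a / b |a b. a \<in> \<phi> ` R \<and> b \<in> \<phi> ` R \<and> b / \<phi> q \<notin> \<phi> ` R}"
        using *(1,3) by (intro exI[of _ R] exI[of _ q]) simp
    next
      fix R q assume "R \<in> X" "prime_in (\<phi> ` R) (\<phi> q)" "W = {a / b |a b. a \<in> \<phi> ` R \<and> b \<in> \<phi> ` R \<and> b / \<phi> q \<notin> \<phi> ` R}"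
      thus "\<exists>R q. W = {a / b |a b. a \<in> R \<and> b \<in> R \<and> b / q \<notin> R} \<and> R \<in> (`) \<phi> ` X \<and> prime_in R q"
        by (intro exI[of _ "\<phi> ` R"] exI[of _ "\<phi> q"]) simp
    qed
    also have "\<dots> \<longleftrightarrow> (\<exists>V\<in>prime_divisors X. W = \<phi> ` V)"
      unfolding loc prime_in_image prime_divisors_def by blast
    finally show ?thesis .
  qed
  thus ?thesis by blast
qed

lemma (in birational) total_exceptional_image: "total_exceptional (\<phi> ` R) (\<phi> ` V) = total_exceptional R V"
proof -
  have "max_ideal (\<phi> ` R) - {0} = \<phi> ` (max_ideal R - {0})"
    unfolding max_ideal_image using hom_eq_0_iff hom_0 by auto
  thus ?thesis unfolding total_exceptional_def dominates_image by (simp add: image_comp o_def val_image)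
qed

lemma (in birational) lin_equiv_image:
  "lin_equiv ((`) \<phi> ` X) D D' \<longleftrightarrow> lin_equiv X (\<lambda>V. D (\<phi> ` V)) (\<lambda>V. D' (\<phi> ` V))"
proof -
  have "(\<forall>V\<in>prime_divisors ((`) \<phi> ` X). D V - D' V = val V (\<phi> g)) \<longleftrightarrow> (\<forall>V\<in>prime_divisors X. D (\<phi> ` V) - D' (\<phi> ` V) = val V g)" for g
    unfolding prime_divisors_image by (simp add: val_image)
  thus ?thesis unfolding lin_equiv_def
      ex_image[of "\<lambda>g. g \<noteq> 0 \<and> (\<forall>V\<in>prime_divisors ((`) \<phi> ` X). D V - D' V = val V g)"] hom_eq_0_iff
    by simp
qed

lemma (in birational) dvr_image: "dvr V t \<Longrightarrow> dvr (\<phi> ` V) (\<phi> t)"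
  unfolding dvr_def max_ideal_gen_image units_image hom_eq_0_iff
proof (elim conjE, intro conjI allI impI const_subring_image, assumption+)
  fix g :: ratfun assume *: "\<forall>g. g \<noteq> 0 \<longrightarrow> (\<exists>k. \<exists>u\<in>units_of_ring V. g = t powi k * u)" "g \<noteq> 0"
  obtain h where h: "g = \<phi> h" by (rule surjE)
  have "h \<noteq> 0" using h *(2) hom_0 by auto
  then obtain k u where "u \<in> units_of_ring V" "h = t powi k * u" using *(1) by blast
  thus "\<exists>k. \<exists>u\<in>\<phi> ` units_of_ring V. g = \<phi> t powi k * u" unfolding h by (auto simp flip: hom_powi hom_mult)
qed

lemma Fract_power: "Fract p q ^ k = Fract (p ^ k) (q ^ k)"
  by (induction k) (simp_all add: One_fract_def)

text \<open>Krull's intersection theorem at the origin. On a line y = b x along which the numerator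
  of a is not identically zero, a has a finite order at the origin, whereas \<open>q ^ N\<close> has
  order at least N.\<close>

lemma krull_R0:
  assumes "a \<in> R0" "a \<noteq> 0" "q \<in> max_ideal R0" "q \<noteq> 0"
  shows "\<exists>k. a / q ^ k \<notin> R0"
proof -
  obtain a1 a2 where a: "a = Fract a1 a2" "peval a2 0 0 \<noteq> 0" using R0E assms(1) by metis
  obtain q1 q2 where q: "q = Fract q1 q2" "peval q2 0 0 \<noteq> 0" using R0E max_subset[OF assms(3)] by metis
  have q10: "peval q1 0 0 = 0" using assms(3) R0_Fract(2)[OF q(2), of q1] q(1) by simp
  have "a1 \<noteq> 0" using assms(2) a(1) peval_nonzero[OF a(2)] by (auto simp: Zero_fract_def eq_fract)
  \<comment> \<open>Restriction of a polynomial to the line y = b x.\<close>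
  define ln where "ln b p = poly p [:0, b:]" for b and p :: "complex poly poly"
  have ln: "poly (ln b p) x = peval p x (b * x)" for b p x
    unfolding ln_def peval_def by (induction p) (simp_all add: algebra_simps)
  have "\<exists>b. ln b a1 \<noteq> 0"
  proof (rule ccontr)
    assume "\<not> ?thesis"
    hence *: "peval a1 x (b * x) = 0" for b x using ln[of b a1 x] by simp
    have z: "peval a1 x y = 0" if "x \<noteq> 0" for x y using *[of x "y / x"] that by simp
    have "poly ([:0, 1:] * poly a1 [:y:]) x = 0" for x y
      using z[of x y] unfolding peval_def by (cases "x = 0") auto
    hence "[:0, 1:] * poly a1 [:y:] = 0" for y using poly_all_0_iff_0 by blast
    hence "peval a1 x y = 0" for x y unfolding peval_def by simp
    thus False using peval_eq_0D \<open>a1 \<noteq> 0\<close> by blast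
  qed
  then obtain b where b: "ln b a1 \<noteq> 0" by blast
  have lnm: "ln b (p * r) = ln b p * ln b r" "ln b (p ^ k) = ln b p ^ k" for p r k
    unfolding ln_def by (simp_all add: poly_power)
  define N where "N = Suc (Polynomial.order 0 (ln b a1))"
  have "a / q ^ N \<notin> R0"
  proof
    assume "a / q ^ N \<in> R0"
    then obtain r1 r2 where r: "a / q ^ N = Fract r1 r2" "peval r2 0 0 \<noteq> 0" using R0E by metis
    from assms(4) have "a = a / q ^ N * q ^ N" by simp
      hence "a = Fract r1 r2 * q ^ N" unfolding r(1) .
      hence "Fract a1 a2 = Fract (r1 * q1 ^ N) (r2 * q2 ^ N)" unfolding a(1) q(1) Fract_power by simp
      hence "a1 * (r2 * q2 ^ N) = (r1 * q1 ^ N) * a2"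
        using peval_nonzero[OF a(2)] peval_nonzero[OF q(2)] peval_nonzero[OF r(2)] by (simp add: eq_fract)
      hence eq: "ln b a1 * (ln b r2 * ln b q2 ^ N) = ln b q1 ^ N * (ln b r1 * ln b a2)"
      proof -
        have "ln b (a1 * (r2 * q2 ^ N)) = ln b (r1 * q1 ^ N * a2)"
          unfolding \<open>a1 * (r2 * q2 ^ N) = (r1 * q1 ^ N) * a2\<close> ..
        thus ?thesis unfolding lnm by (simp only: mult_ac)
      qed
      have nz: "poly (ln b r2 * ln b q2 ^ N) 0 \<noteq> 0" using r(2) q(2) ln[of b r2 0] ln[of b q2 0] by (simp add: poly_power)
      have "[:-0, 1:] dvd ln b q1" using ln[of b q1 0] q10 by (simp add: poly_eq_0_iff_dvd)
      hence "[:-0, 1:] ^ N dvd ln b a1 * (ln b r2 * ln b q2 ^ N)"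
        unfolding eq by (intro dvd_mult2 dvd_power_same)
      moreover have "ln b a1 * (ln b r2 * ln b q2 ^ N) \<noteq> 0" using b nz by (metis mult_eq_0_iff poly_0)
      ultimately have "N \<le> Polynomial.order 0 (ln b a1 * (ln b r2 * ln b q2 ^ N))" using order_divides by blast
      also have "\<dots> = Polynomial.order 0 (ln b a1)"
        using order_mult[OF \<open>ln b a1 * (ln b r2 * ln b q2 ^ N) \<noteq> 0\<close>] order_0I[OF nz] by simp
      finally show False unfolding N_def by simp
  qed
  thus ?thesis by blast
qed

lemma krull:
  assumes "smooth_pt R" "a \<in> R" "a \<noteq> 0" "q \<in> max_ideal R" "q \<noteq> 0"
  shows "\<exists>k b. b \<in> R \<and> b / q \<notin> R \<and> a = q ^ k * b"
proof -
  obtain \<phi> where p: "birational_map \<phi>" "R = \<phi> ` R0" using assms(1) unfolding smooth_pt_def by blast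
  interpret birational \<phi> by unfold_locales (rule p)
  obtain a' where a': "a = \<phi> a'" "a' \<in> R0" using assms(2) p(2) by blast
  obtain q' where q': "q = \<phi> q'" "q' \<in> max_ideal R0" using assms(4) unfolding p(2) max_ideal_image by blast
  have "\<exists>k. a' / q' ^ k \<notin> R0" using krull_R0[of a' q'] a' q' assms(3,5) hom_eq_0_iff by blast
  hence "\<exists>k. a / q ^ k \<notin> R" unfolding a'(1) q'(1) p(2) hom_power[symmetric] hom_divide[symmetric] in_image_iff .
  then obtain k where k: "a / q ^ k \<notin> R" "\<And>l. l < k \<Longrightarrow> a / q ^ l \<in> R"
    using LeastI_ex[of "\<lambda>k. a / q ^ k \<notin> R"] not_less_Least[of _ "\<lambda>k. a / q ^ k \<notin> R"] by blast
  have "k \<noteq> 0" using k(1) assms(2) by (intro notI) simp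
  then obtain m where m: "k = Suc m" by (cases k) auto
  have "a / q ^ m / q = a / q ^ k" unfolding m by (simp add: field_simps)
  hence "a / q ^ m / q \<notin> R" using k(1) by (simp only: not_False_eq_True)
  moreover have "a / q ^ m \<in> R" using k(2)[of m] m by simp
  moreover have "a = q ^ m * (a / q ^ m)" using assms(5) by simp
  ultimately show ?thesis by blast
qed

lemma smooth_pt_fraction: "smooth_pt R \<Longrightarrow> \<exists>a\<in>R. \<exists>b\<in>R. b \<noteq> 0 \<and> g = a / b"
proof -
  assume "smooth_pt R"
  then obtain \<phi> where p: "birational_map \<phi>" "R = \<phi> ` R0" unfolding smooth_pt_def by blast
  interpret birational \<phi> by unfold_locales (rule p)
  obtain h where h: "g = \<phi> h" by (rule surjE)
  obtain a b where ab: "h = Fract a b" "b \<noteq> 0" by (cases h) auto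
  have "Fract c 1 \<in> R0" for c by (rule R0_Fract(1)) simp
  moreover have "h = Fract a 1 / Fract b 1" using ab by simp
  moreover have "Fract b 1 \<noteq> 0" using ab(2) by (simp add: Zero_fract_def eq_fract)
  ultimately have "\<phi> (Fract a 1) \<in> R" "\<phi> (Fract b 1) \<in> R" "\<phi> (Fract b 1) \<noteq> 0" "g = \<phi> (Fract a 1) / \<phi> (Fract b 1)"
    unfolding h p(2) hom_eq_0_iff by (simp_all only: imageI hom_divide not_False_eq_True)
  thus ?thesis by blast
qed

text \<open>By \<open>krull\<close>, numerator and denominator of a fraction are powers of q times
  elements not divisible by q, and the latter are units of the localization at q.\<close>

lemma dvr_prime:
  assumes R: "smooth_pt R" and q: "prime_in R q"
  shows "dvr {a / b | a b. a \<in> R \<and> b \<in> R \<and> b / q \<notin> R} q" (is "dvr ?V q")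
proof -
  note cs = const_subringD[OF res_localD(1)[OF smooth_pt_res_local[OF R]]]
  have q': "q \<in> max_ideal R" "q \<noteq> 0" and pr: "\<And>a b. a \<in> R \<Longrightarrow> b \<in> R \<Longrightarrow> a * b / q \<in> R \<Longrightarrow> a / q \<in> R \<or> b / q \<in> R"
    using q unfolding prime_in_def by blast+
  have nz: "b \<noteq> 0" if "b / q \<notin> R" for b using that cs(2) by auto
  have one: "1 / q \<notin> R" using q' by (simp add: max_ideal_iff inverse_eq_divide)
  have VI: "a / b \<in> ?V" if "a \<in> R" "b \<in> R" "b / q \<notin> R" for a b using that by blast
  have VR: "a \<in> ?V" if "a \<in> R" for a using VI[OF that cs(3) one] by simp
  have prod: "b * d / q \<notin> R" if "b \<in> R" "d \<in> R" "b / q \<notin> R" "d / q \<notin> R" for b d using pr[of b d] that by blast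
  have V: "const_subring ?V"
    unfolding const_subring_def
  proof (intro conjI allI ballI)
    show "const_fun c \<in> ?V" for c using VR cs(1) by blast
    fix x y assume "x \<in> ?V" "y \<in> ?V"
    then obtain a b c d where *: "x = a / b" "a \<in> R" "b \<in> R" "b / q \<notin> R" "y = c / d" "c \<in> R" "d \<in> R" "d / q \<notin> R" by blast
    have "x + y = (a * d + c * b) / (b * d)" "x * y = (a * c) / (b * d)"
      unfolding *(1,5) using nz[OF *(4)] nz[OF *(8)] by (simp_all add: add_frac_eq)
    moreover have "b * d / q \<notin> R" using prod[OF *(3,7,4,8)] .
    ultimately show "x + y \<in> ?V" "x * y \<in> ?V"
      using VI[OF cs(4)[OF cs(5)[OF *(2,7)] cs(5)[OF *(6,3)]] cs(5)[OF *(3,7)]] VI[OF cs(5)[OF *(2,6)] cs(5)[OF *(3,7)]]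
      by metis+
  qed
  have iq: "inverse q \<notin> ?V"
  proof
    assume "inverse q \<in> ?V"
    then obtain a b where ab: "inverse q = a / b" "a \<in> R" "b / q \<notin> R" by blast
    have "b / q = a" unfolding divide_inverse[of b] ab(1) using nz[OF ab(3)] by simp
    thus False using ab(2,3) by simp
  qed
  have max: "max_ideal ?V = {q * a | a. a \<in> ?V}"
  proof (intro subset_antisym subsetI)
    fix x assume x: "x \<in> max_ideal ?V"
    then obtain a b where ab: "x = a / b" "a \<in> R" "b \<in> R" "b / q \<notin> R" unfolding max_ideal_iff by blast
    have "a / q \<in> R"
    proof (rule ccontr)
      assume "a / q \<notin> R"
      hence "b / a \<in> ?V" "a \<noteq> 0" using VI[OF ab(3,2)] nz by blast+
      hence "inverse x \<in> ?V" "x \<noteq> 0" using ab(1) nz[OF ab(4)] by auto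
      thus False using x by (simp add: max_ideal_iff)
    qed
    hence "a / q / b \<in> ?V" using VI[OF _ ab(3,4)] by blast
    moreover have "x = q * (a / q / b)" using ab(1) q'(2) by simp
    ultimately show "x \<in> {q * a | a. a \<in> ?V}" by blast
  next
    fix x assume "x \<in> {q * a | a. a \<in> ?V}"
    then obtain a where a: "x = q * a" "a \<in> ?V" by blast
    have "x \<in> ?V" unfolding a(1) by (rule const_subringD(5)[OF V VR[OF max_subset[OF q'(1)]] a(2)])
    moreover have "inverse x \<notin> ?V" if "x \<noteq> 0"
    proof
      assume "inverse x \<in> ?V"
      hence "a * inverse x \<in> ?V" using const_subringD(5)[OF V a(2)] by blast
      moreover have "a * inverse x = inverse q" using that unfolding a(1) by (simp add: field_simps)
      ultimately show False using iq by simp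
    qed
    ultimately show "x \<in> max_ideal ?V" by (auto simp only: max_ideal_iff)
  qed
  have "\<exists>k. \<exists>u\<in>units_of_ring ?V. g = q powi k * u" if g: "g \<noteq> 0" for g
  proof -
    obtain a b where ab: "a \<in> R" "b \<in> R" "b \<noteq> 0" "g = a / b" using smooth_pt_fraction[OF R] by blast
    have "a \<noteq> 0" using ab(4) g by auto
    then obtain k a' where a': "a' \<in> R" "a' / q \<notin> R" "a = q ^ k * a'" using krull[OF R ab(1) _ q'] by blast
    obtain l b' where b': "b' \<in> R" "b' / q \<notin> R" "b = q ^ l * b'" using krull[OF R ab(2,3) q'] by blast
    have "a' / b' \<in> ?V" "b' / a' \<in> ?V" "a' / b' \<noteq> 0"
      using VI[OF a'(1) b'(1,2)] VI[OF b'(1) a'(1,2)] nz[OF a'(2)] nz[OF b'(2)] by auto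
    hence "a' / b' \<in> units_of_ring ?V" unfolding units_iff inverse_divide by blast
    moreover have "g = q powi (int k - int l) * (a' / b')"
      unfolding ab(4) a'(3) b'(3) using q'(2) nz[OF b'(2)] by (simp add: power_int_diff field_simps)
    ultimately show ?thesis by blast
  qed
  thus ?thesis unfolding dvr_def using V q'(2) max by blast
qed

lemma dvr_prime_divisors: "(\<And>R. R \<in> X \<Longrightarrow> smooth_pt R) \<Longrightarrow> V \<in> prime_divisors X \<Longrightarrow> \<exists>t. dvr V t"
  unfolding prime_divisors_def using dvr_prime by blast

text \<open>The ideal of the origin is generated by x and y, so its multiplicity along V is the
  least of their valuations. If one of these is not positive, V does not dominate the origin, and
  the maximum with 0 gives the right value. Relations between divisors thus become statements about
  minima of integers.\<close>

lemma total_exceptional_R0: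
  assumes V: "dvr V t"
  shows "total_exceptional R0 V = max 0 (min (val V x_fun) (val V y_fun))"
proof -
  note cs = const_subringD[OF dvrD(1)[OF V]]
  have mx: "a \<in> max_ideal V \<Longrightarrow> b \<in> V \<Longrightarrow> b * a \<in> max_ideal V" for a b
  proof -
    assume "a \<in> max_ideal V" "b \<in> V"
    then obtain c where "a = t * c" "c \<in> V" unfolding dvrD(3)[OF V] by blast
    hence "b * a = t * (b * c)" "b * c \<in> V" using cs(5) \<open>b \<in> V\<close> by (simp_all add: mult_ac)
    thus "b * a \<in> max_ideal V" unfolding dvrD(3)[OF V] by blast
  qed
  have ma: "a \<in> max_ideal V \<Longrightarrow> b \<in> max_ideal V \<Longrightarrow> a + b \<in> max_ideal V" for a b
  proof -
    assume "a \<in> max_ideal V" "b \<in> max_ideal V"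
    then obtain c d where "a = t * c" "c \<in> V" "b = t * d" "d \<in> V" unfolding dvrD(3)[OF V] by blast
    hence "a + b = t * (c + d)" "c + d \<in> V" using cs(4) by (simp_all add: distrib_left)
    thus "a + b \<in> max_ideal V" unfolding dvrD(3)[OF V] by blast
  qed
  \<comment> \<open>Once x and y are in the maximal ideal of V, every polynomial is congruent to its
    value at the origin, so the denominators of \<open>R0\<close> are units of V.\<close>
  have dom: "dominates V R0" if "val V x_fun \<ge> 1" "val V y_fun \<ge> 1"
  proof -
    have xy: "x_fun \<in> max_ideal V" "y_fun \<in> max_ideal V" using that in_max_dvr_iff[OF V] xy_nonzero by blast+
    have c: "Fract [:c:] 1 \<in> V \<and> Fract [:c:] 1 - const_fun (poly c 0) \<in> max_ideal V" for c :: "complex poly"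
    proof (induction c)
      case 0
      have "const_fun 0 - const_fun 0 = x_fun * const_fun 0" by (simp add: const_fun_simps)
      thus ?case using cs(2) mx[OF xy(1) cs(2)] by (simp add: const_fun_simps flip: Zero_fract_def)
    next
      case (pCons e c)
      have e: "Fract [:pCons e c:] 1 = const_fun e + Fract [:c:] 1 * x_fun"
        unfolding const_fun_def x_fun_def by simp
      show ?case unfolding e using cs pCons(2) mx[OF xy(1)] max_subset by auto
    qed
    have p: "Fract p 1 \<in> V \<and> Fract p 1 - const_fun (peval p 0 0) \<in> max_ideal V" for p
    proof (induction p)
      case 0
      thus ?case using c[of 0] by simp
    next
      case (pCons c p)
      have e: "Fract (pCons c p) 1 = Fract [:c:] 1 + Fract p 1 * y_fun"
        unfolding y_fun_def by simp
      have "Fract p 1 * y_fun \<in> max_ideal V" using pCons(2) mx[OF xy(2)] by blast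
      moreover from this c have "Fract [:c:] 1 - const_fun (poly c 0) + Fract p 1 * y_fun \<in> max_ideal V" using ma by blast
      ultimately show ?case unfolding e using cs(4) c max_subset by (simp add: peval_def algebra_simps)
    qed
    have u: "Fract q 1 \<in> units_of_ring V" if "peval q 0 0 \<noteq> 0" for q
    proof (rule ccontr)
      assume "Fract q 1 \<notin> units_of_ring V"
      hence "Fract q 1 \<in> max_ideal V" using units_or_max p by blast
      moreover have "(- 1) * (Fract q 1 - const_fun (peval q 0 0)) \<in> max_ideal V" using mx p cs(3,6) by blast
      ultimately have "Fract q 1 + (- 1) * (Fract q 1 - const_fun (peval q 0 0)) \<in> max_ideal V" by (rule ma)
      hence "const_fun (peval q 0 0) \<in> max_ideal V" by simp
      thus False using in_max_dvr_iff[OF V] val_const[OF V that] that by simp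
    qed
    have R0V: "R0 \<subseteq> V"
    proof
      fix a assume "a \<in> R0"
      then obtain r s where "a = Fract r s" "peval s 0 0 \<noteq> 0" by (rule R0E)
      moreover from this have "a = Fract r 1 * inverse (Fract s 1)" using peval_nonzero by simp
      moreover have "Fract r 1 * inverse (Fract s 1) \<in> V"
        using cs(5)[OF conjunct1[OF p[of r]] units_subset(3)[OF u]] calculation(2) .
      ultimately show "a \<in> V" by (simp only:)
    qed
    moreover have "max_ideal R0 \<subseteq> max_ideal V"
    proof
      fix a assume "a \<in> max_ideal R0"
      then obtain b c where "a = b * x_fun + c * y_fun" "b \<in> R0" "c \<in> R0" unfolding max_R0 by blast
      thus "a \<in> max_ideal V" using ma mx xy R0V by blast
    qed
    ultimately show ?thesis unfolding dominates_def by blast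
  qed
  show ?thesis
  proof (cases "dominates V R0")
    case True
    have xy: "val V x_fun \<ge> 1" "val V y_fun \<ge> 1"
      using dominatesD(2)[OF True] xy_max_R0 in_max_dvr_iff[OF V] xy_nonzero by blast+
    let ?m = "min (val V x_fun) (val V y_fun)"
    have "(INF a\<in>max_ideal R0 - {0}. val V a) = ?m"
    proof (rule cInf_eq_minimum)
      show "?m \<in> val V ` (max_ideal R0 - {0})"
        using xy_max_R0 xy_nonzero by (cases "val V x_fun \<le> val V y_fun") (auto simp: min_def)
      fix k assume "k \<in> val V ` (max_ideal R0 - {0})"
      then obtain a where a: "a \<in> max_ideal R0" "a \<noteq> 0" "k = val V a" by blast
      obtain b c where bc: "a = b * x_fun + c * y_fun" "b \<in> R0" "c \<in> R0" using a(1) unfolding max_R0 by blast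
      have nn: "d \<noteq> 0 \<Longrightarrow> val V d \<ge> 0" if "d \<in> R0" for d
        using in_dvr_iff[OF V] dominatesD(1)[OF True that] by blast
      have "b * x_fun = 0 \<or> val V (b * x_fun) \<ge> ?m"
        using nn[OF bc(2)] val_mult[OF V _ xy_nonzero(1), of b] by (cases "b = 0") auto
      moreover have "c * y_fun = 0 \<or> val V (c * y_fun) \<ge> ?m"
        using nn[OF bc(3)] val_mult[OF V _ xy_nonzero(2), of c] by (cases "c = 0") auto
      ultimately have "b * x_fun + c * y_fun = 0 \<or> val V (b * x_fun + c * y_fun) \<ge> ?m" by (rule val_add[OF V])
      thus "?m \<le> k" using a(2,3) bc(1) by simp
    qed
    thus ?thesis unfolding total_exceptional_def using True xy by simp
  next
    case False
    hence "val V x_fun < 1 \<or> val V y_fun < 1" using dom by force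
    thus ?thesis unfolding total_exceptional_def using False by auto
  qed
qed

lemma total_exceptional_chart:
  assumes "birational_map \<phi>" "dvr V t"
  shows "total_exceptional (\<phi> ` R0) V = max 0 (min (val V (\<phi> x_fun)) (val V (\<phi> y_fun)))"
proof -
  interpret birational \<phi> by unfold_locales fact
  interpret i: birational "inv_into UNIV \<phi>" by unfold_locales (rule birational_map_inv[OF assms(1)])
  let ?V = "inv_into UNIV \<phi> ` V"
  have V: "dvr ?V (inv_into UNIV \<phi> t)" by (rule i.dvr_image[OF assms(2)])
  have eq: "\<phi> ` ?V = V" by (rule image_inv)
  show ?thesis using total_exceptional_R0[OF V] total_exceptional_image[of R0 ?V] val_image[of ?V] unfolding eq by simp
qed

lemma birational_eqI:
  assumes "birational_map \<phi>" "birational_map \<psi>" "\<phi> x_fun = \<psi> x_fun" "\<phi> y_fun = \<psi> y_fun"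
  shows "\<phi> = \<psi>"
proof
  interpret a: birational \<phi> by unfold_locales fact
  interpret b: birational \<psi> by unfold_locales fact
  have 1: "\<phi> (Fract [:c:] 1) = \<psi> (Fract [:c:] 1)" for c :: "complex poly"
  proof (induction c)
    case 0
    thus ?case by (simp add: a.hom_0 b.hom_0 flip: Zero_fract_def)
  next
    case (pCons e c)
    have "Fract [:pCons e c:] 1 = const_fun e + x_fun * Fract [:c:] 1"
      unfolding const_fun_def x_fun_def by simp
    thus ?case using pCons assms(3) by (simp add: a.hom_add a.hom_mult a.hom_const b.hom_add b.hom_mult b.hom_const)
  qed
  have 2: "\<phi> (Fract p 1) = \<psi> (Fract p 1)" for p
  proof (induction p)
    case 0
    thus ?case using 1[of 0] by simp
  next
    case (pCons c p)
    have "Fract (pCons c p) 1 = Fract [:c:] 1 + y_fun * Fract p 1"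
      unfolding y_fun_def by simp
    thus ?case using pCons assms(4) 1 by (simp add: a.hom_add a.hom_mult b.hom_add b.hom_mult)
  qed
  fix g :: ratfun
  obtain p q where g: "g = Fract p q" "q \<noteq> 0" by (cases g) auto
  hence "g = Fract p 1 / Fract q 1" by simp
  thus "\<phi> g = \<psi> g" using 2 by (simp only: a.hom_divide b.hom_divide)
qed

subsection \<open>The standard quadratic involution\<close>

definition ep :: "3 \<Rightarrow> point" where "ep k = pt (axis k 1)"

text \<open>Carries the origin to the k-th vertex of the triangle.\<close>

definition echart :: "3 \<Rightarrow> ratmap" where "echart k = sub (chart k (axis k 1))"

lemma axis3 [simp]: "axis k (1::complex) $ k = 1" "axis k (1::complex) $ (k + 1) = 0" "axis k (1::complex) $ (k + 2) = 0"
  for k :: 3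
  by (auto simp: axis_def idx3)

lemma echart: "birational_map (echart k)" "echart k ` R0 = ep k"
  "echart k x_fun = crd (k + 1) k" "echart k y_fun = crd (k + 2) k"
proof -
  show "birational_map (echart k)" unfolding echart_def by (rule birational_sub[OF inverse_maps_chart])
  show "echart k ` R0 = ep k" unfolding echart_def ep_def by (rule chart_R0) simp
  obtain e where F: "form_map e (chart k (axis k 1))" using inverse_maps_form_map inverse_maps_chart by blast
  show "echart k x_fun = crd (k + 1) k" "echart k y_fun = crd (k + 2) k"
    unfolding echart_def xy_fun_fr crd_def
    by (simp_all add: sub_fr[OF F form_coord form_coord coord_nonzero] chart_def)
qed

definition cremona :: "complex^3 \<Rightarrow> complex^3" where
  "cremona v = vector [v$2 * v$3, v$1 * v$3, v$1 * v$2]"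

lemma idx_num: "(1::3) + 1 = 2" "(1::3) + 2 = 3" "(2::3) + 1 = 3" "(2::3) + 2 = 1" "(3::3) + 1 = 1" "(3::3) + 2 = 2"
  by simp_all

lemma cremona_nth: "cremona v $ k = v$(k+1) * v$(k+2)"
  unfolding cremona_def using exhaust_3[of k] by (elim disjE; simp only: idx_num vector_3 mult.commute)

lemma prod3: "v$k * (v$(k+1) * v$(k+2)) = v$1 * v$2 * v$(3::3)" for v :: "complex^3"
  using exhaust_3[of k] by (elim disjE; simp only: idx_num mult_ac)

lemma inverse_maps_cremona: "inverse_maps cremona cremona"
proof (rule inverse_mapsI)
  show "form 2 (\<lambda>v. cremona v $ i)" for i unfolding cremona_def by (intro form_vector form_coord2)
  thus "form 2 (\<lambda>v. cremona v $ i)" for i .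
  show "form (1 + 1 + 1) (\<lambda>v. v$1 * v$2 * v$3)" by (intro form_mult form_coord)
  thus "form (1 + 1 + 1) (\<lambda>v. v$1 * v$2 * v$3)" .
  show "\<exists>v::complex^3. v$1 * v$2 * v$3 \<noteq> 0" by (rule exI[of _ "\<chi> i. 1"]) simp
  thus "\<exists>v::complex^3. v$1 * v$2 * v$3 \<noteq> 0" .
  show "cremona (cremona v) = (v$1 * v$2 * v$3) *s v" for v
    unfolding cremona_def vec3_eq_iff by simp
  thus "cremona (cremona v) = (v$1 * v$2 * v$3) *s v" for v .
qed

abbreviation J :: ratmap where "J \<equiv> sub cremona"

lemma birational_J: "birational_map J" by (rule birational_sub[OF inverse_maps_cremona])
lemma J_J: "J (J g) = g" by (rule sub_inverse[OF inverse_maps_cremona])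
lemma J_J_image: "J ` J ` R = R" by (simp add: image_comp o_def J_J)

lemma J_crd: "J (crd i k) = crd k i"
proof -
  obtain e where F: "form_map e cremona" using inverse_maps_form_map inverse_maps_cremona by blast
  have f: "form 2 (\<lambda>v. cremona v $ i)" for i unfolding cremona_def by (intro form_vector form_coord2)
  have "\<exists>v. cremona v $ k \<noteq> 0" unfolding cremona_nth by (rule exI[of _ "\<chi> i. 1"]) simp
  thus ?thesis unfolding crd_def sub_fr[OF F form_coord form_coord coord_nonzero]
    by (subst fr_eq_iff[OF f f form_coord form_coord _ coord_nonzero]) (simp_all add: cremona_nth prod3 mult.commute[of "_ * _"])
qed

text \<open>The del Pezzo surface of degree six: the exceptional curves and the strict transforms of
  the three lines form a hexagon, and the standard involution becomes an automorphism.\<close>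

definition hexagon :: "point set" where "hexagon = blowup (range ep) P2"

lemma ep_P2: "ep k \<in> P2" unfolding ep_def P2_iff
  by (intro exI[of _ "axis k 1"]) (simp add: axis_eq_0_iff)

lemma surface_hexagon: "surface hexagon"
  unfolding hexagon_def by (rule surface_blowup[OF surface_P2]) (use ep_P2 in blast)

lemma exceptional_ep: "exceptional_points (ep k) = (`) (echart k) ` exceptional_points R0"
  unfolding echart(2)[symmetric] by (rule birational.exceptional_points_image) (unfold_locales, rule echart)

lemma lro_shear: "local_ring_over R0 (y_fun / x_fun - const_fun c) = sub (shear c) ` sub blow ` R0"
  "local_ring_over R0 (x_fun / y_fun) = sub swap ` sub blow ` R0"
proof -
  interpret sh: birational "sub (shear c)" by unfold_locales (rule birational_sub[OF inverse_maps_shear])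
  interpret sw: birational "sub swap" by unfold_locales (rule birational_sub[OF inverse_maps_swap])
  have 1: "sub (shear c) (y_fun / x_fun) = y_fun / x_fun - const_fun c"
    unfolding sh.hom_divide sub_shear using xy_nonzero by (simp add: field_simps)
  have 2: "sub swap (y_fun / x_fun) = x_fun / y_fun" unfolding sw.hom_divide sub_swap ..
  show "local_ring_over R0 (y_fun / x_fun - const_fun c) = sub (shear c) ` sub blow ` R0"
    using sh.local_ring_over_image[of R0 "y_fun / x_fun"] unfolding 1 shear_swap_R0 blow_R0(1) .
  show "local_ring_over R0 (x_fun / y_fun) = sub swap ` sub blow ` R0"
    using sw.local_ring_over_image[of R0 "y_fun / x_fun"] unfolding 2 shear_swap_R0 blow_R0(1) .
qed

text \<open>Affine coordinates at a point of the k-th line: x pulls back to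
  \<open>v$k / v$(k+1)\<close> and y to \<open>v$(k+1) / v$(k+2)\<close> minus c. This is the
  involution composed with the chart of the exceptional curve at the direction c, written as a
  single map.\<close>

definition edge_map :: "3 \<Rightarrow> complex \<Rightarrow> complex^3 \<Rightarrow> complex^3" where
  "edge_map k c v = vector [v$k * v$(k+2), v$(k+1) * v$(k+1) - c * (v$(k+1) * v$(k+2)), v$(k+1) * v$(k+2)]"
definition edge_inv :: "3 \<Rightarrow> complex \<Rightarrow> complex^3 \<Rightarrow> complex^3" where
  "edge_inv k c u = (\<chi> i. if i = k then u$1 * (u$2 + c * u$3) else if i = k + 1 then (u$2 + c * u$3) * u$3 else u$3 * u$3)"

lemma inverse_maps_edge: "inverse_maps (edge_map k c) (edge_inv k c)"
  and edge_inv_map: "edge_inv k c (edge_map k c v) = (v$(k+1) * (v$(k+1) * v$(k+2))) *s v"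
proof -
  have e: "edge_inv k c (edge_map k c v) $ i = ((v$(k+1) * (v$(k+1) * v$(k+2))) *s v) $ i" for i v
    unfolding edge_map_def edge_inv_def vec_lambda_beta vector_3 using idx3(1)[of i k]
    by (auto simp: idx3(2-) algebra_simps)
  thus inv: "edge_inv k c (edge_map k c v) = (v$(k+1) * (v$(k+1) * v$(k+2))) *s v" for v
    unfolding Finite_Cartesian_Product.vec_eq_iff by blast
  show "inverse_maps (edge_map k c) (edge_inv k c)"
  proof (rule inverse_mapsI)
    show "form 2 (\<lambda>v. edge_map k c v $ i)" for i
      unfolding edge_map_def by (intro form_vector form_coord2 form_diff form_const_mult)
    have l: "form 1 (\<lambda>u::complex^3. u$2 + c * u$3)" by (intro form_add form_coord form_const_mult)
    show "form (1 + 1) (\<lambda>u. edge_inv k c u $ i)" for i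
      unfolding edge_inv_def vec_lambda_beta
      by (cases "i = k"; cases "i = k + 1"; simp only: if_True if_False refl; intro form_mult form_coord l)
    show "form (1 + (1 + 1)) (\<lambda>u::complex^3. u$3 * (u$3 * (u$2 + c * u$3)))" by (intro form_mult form_coord l)
    show "form (1 + (1 + 1)) (\<lambda>v::complex^3. v$(k+1) * (v$(k+1) * v$(k+2)))" by (intro form_mult form_coord)
    show "edge_map k c (edge_inv k c u) = (u$3 * (u$3 * (u$2 + c * u$3))) *s u" for u
      unfolding edge_map_def edge_inv_def vec3_eq_iff by (simp add: idx3(2-) algebra_simps)
    show "edge_inv k c (edge_map k c v) = (v$(k+1) * (v$(k+1) * v$(k+2))) *s v" for v by (rule inv)
    show "\<exists>u::complex^3. u$3 * (u$3 * (u$2 + c * u$3)) \<noteq> 0"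
      by (rule exI[of _ "vector [0, 1 - c, 1]"]) simp
    show "\<exists>v::complex^3. v$(k+1) * (v$(k+1) * v$(k+2)) \<noteq> 0" by (rule exI[of _ "\<chi> i. 1"]) simp
  qed
qed

lemma sub_edge: "sub (edge_map k c) x_fun = crd k (k + 1)" "sub (edge_map k c) y_fun = crd (k + 1) (k + 2) - const_fun c"
proof -
  obtain e where F: "form_map e (edge_map k c)" using inverse_maps_form_map inverse_maps_edge by blast
  have nz: "\<exists>v::complex^3. v$(k+1) * v$(k+2) \<noteq> 0" by (rule exI[of _ "\<chi> i. 1"]) simp
  show "sub (edge_map k c) x_fun = crd k (k + 1)"
    unfolding crd_def xy_fun_fr sub_fr[OF F form_coord form_coord coord_nonzero]
    unfolding edge_map_def vector_3
    by (subst fr_eq_iff[OF form_coord2 form_coord2 form_coord form_coord nz coord_nonzero]) simp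
  have "sub (edge_map k c) y_fun = fr (\<lambda>v. v$(k+1) * v$(k+1)) (\<lambda>v. v$(k+1) * v$(k+2)) - const_fun c * fr (\<lambda>v. v$(k+1) * v$(k+2)) (\<lambda>v. v$(k+1) * v$(k+2))"
    unfolding xy_fun_fr sub_fr[OF F form_coord form_coord coord_nonzero]
    unfolding edge_map_def vector_3
    by (subst fr_diff[OF form_coord2 form_const_mult[OF form_coord2] form_coord2 nz])
       (simp only: fr_const_mult[OF form_coord2 form_coord2])
  moreover have "fr (\<lambda>v::complex^3. v$(k+1) * v$(k+2)) (\<lambda>v. v$(k+1) * v$(k+2)) = const_fun 1"
    unfolding const_fun_fr using nz by (subst fr_eq_iff[OF form_coord2 form_coord2 form_const form_const]) auto
  moreover have "fr (\<lambda>v. v$(k+1) * v$(k+1)) (\<lambda>v. v$(k+1) * v$(k+2)) = crd (k + 1) (k + 2)"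
    unfolding crd_def by (subst fr_eq_iff[OF form_coord2 form_coord2 form_coord form_coord nz coord_nonzero]) simp
  ultimately show "sub (edge_map k c) y_fun = crd (k + 1) (k + 2) - const_fun c" by (simp add: const_fun_simps)
qed

text \<open>The involution exchanges the exceptional curve over the k-th vertex with the opposite
  line, the direction c being the coordinate there. The directions 0 and infinity belong to the
  sides through the vertex and correspond to corners of the hexagon. Each equation is an identity of
  automorphisms of K, checked on x and y.\<close>

lemma J_exceptional:
  "c \<noteq> 0 \<Longrightarrow> J ` echart k ` local_ring_over R0 (y_fun / x_fun - const_fun c) = pt (\<chi> i. if i = k then 0 else if i = k + 1 then c else 1)"
  "J ` echart k ` local_ring_over R0 (y_fun / x_fun) = echart (k + 2) ` local_ring_over R0 (x_fun / y_fun)"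
proof -
  interpret J: birational J by unfold_locales (rule birational_J)
  interpret E: birational "echart k" for k by unfold_locales (rule echart)
  interpret sh: birational "sub (shear c)" by unfold_locales (rule birational_sub[OF inverse_maps_shear])
  interpret sw: birational "sub swap" by unfold_locales (rule birational_sub[OF inverse_maps_swap])
  interpret bl: birational "sub blow" by unfold_locales (rule birational_sub[OF inverse_maps_blow])
  have q: "crd (k + 2) k / crd (k + 1) k = crd (k + 2) (k + 1)" "crd (k + 1) k / crd (k + 2) k = crd (k + 1) (k + 2)" for k
    by (rule crd_divide)+
  show "J ` echart k ` local_ring_over R0 (y_fun / x_fun - const_fun c) = pt (\<chi> i. if i = k then 0 else if i = k + 1 then c else 1)"
    if c: "c \<noteq> 0"
  proof -
    let ?v = "(\<chi> i. if i = k then 0 else if i = k + 1 then c else 1) :: complex^3"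
    have "J \<circ> (echart k \<circ> (sub (shear c) \<circ> sub blow)) = sub (edge_map k c)"
    proof (rule birational_eqI)
      show "birational_map (J \<circ> (echart k \<circ> (sub (shear c) \<circ> sub blow)))"
        by (intro birational_map_comp birational_J echart(1) sh.birational_map bl.birational_map)
      show "birational_map (sub (edge_map k c))" by (rule birational_sub[OF inverse_maps_edge])
      show "(J \<circ> (echart k \<circ> (sub (shear c) \<circ> sub blow))) x_fun = sub (edge_map k c) x_fun"
        by (simp add: sub_blow sub_shear echart J_crd sub_edge)
      have "sub (shear c) (y_fun / x_fun) = y_fun / x_fun - const_fun c"
        unfolding sh.hom_divide sub_shear using xy_nonzero by (simp add: field_simps)
      thus "(J \<circ> (echart k \<circ> (sub (shear c) \<circ> sub blow))) y_fun = sub (edge_map k c) y_fun"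
        by (simp add: sub_blow E.hom_diff E.hom_divide E.hom_const echart q J.hom_diff J.hom_const J_crd sub_edge)
    qed
    hence "J ` echart k ` local_ring_over R0 (y_fun / x_fun - const_fun c) = sub (edge_map k c) ` R0"
      unfolding lro_shear(1) image_comp by (simp add: comp_assoc)
    moreover have v: "?v $ k = 0" "?v $ (k+1) = c" "?v $ (k+2) = 1" by (simp_all add: idx3)
    have "edge_map k c ?v = c *s vector [0, 0, 1]"
      unfolding edge_map_def vec3_eq_iff v by simp
    hence "pt (edge_map k c ?v) = R0" using pt_scale[OF c] unfolding R0_def by simp
    moreover have "sub (edge_map k c) ` pt (edge_map k c ?v) = pt ?v"
      by (rule sub_pt_eq[OF inverse_maps_edge edge_inv_map]) (unfold v, use c in simp)
    ultimately show ?thesis by simp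
  qed
  have "J \<circ> (echart k \<circ> (sub blow \<circ> sub swap)) = echart (k + 2) \<circ> (sub swap \<circ> sub blow)"
  proof (rule birational_eqI)
    show "birational_map (J \<circ> (echart k \<circ> (sub blow \<circ> sub swap)))" "birational_map (echart (k + 2) \<circ> (sub swap \<circ> sub blow))"
      by (intro birational_map_comp birational_J echart(1) sw.birational_map bl.birational_map)+
    have k2: "k + 2 + 1 = k" "k + 2 + 2 = k + 1" by (simp_all add: idx3)
    show "(J \<circ> (echart k \<circ> (sub blow \<circ> sub swap))) x_fun = (echart (k + 2) \<circ> (sub swap \<circ> sub blow)) x_fun"
      by (simp add: sub_blow sub_swap E.hom_divide echart q J_crd idx3 del: add_2_eq_Suc add_2_eq_Suc')
    show "(J \<circ> (echart k \<circ> (sub blow \<circ> sub swap))) y_fun = (echart (k + 2) \<circ> (sub swap \<circ> sub blow)) y_fun"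
      using crd_divide[of k "k + 2" "k + 1"]
      by (simp add: sub_blow sub_swap E.hom_divide sw.hom_divide echart q J_crd idx3)
  qed
  hence "(J \<circ> (echart k \<circ> (sub blow \<circ> sub swap))) ` R0 = (echart (k + 2) \<circ> (sub swap \<circ> sub blow)) ` R0"
    by (simp only:)
  thus "J ` echart k ` local_ring_over R0 (y_fun / x_fun) = echart (k + 2) ` local_ring_over R0 (x_fun / y_fun)"
    unfolding lro_shear(2) blow_R0(1) image_comp[symmetric] shear_swap_R0 .
qed

text \<open>As J is an involution, one inclusion suffices. Directions other than 0 and infinity are
  exchanged with smooth points of the triangle, the six corners are permuted, and a point off the
  triangle goes to such a point.\<close>

lemma J_hexagon: "(`) J ` hexagon = hexagon"
proof -
  have exc: "echart k ` local_ring_over R0 (x_fun / y_fun) \<in> hexagon" "echart k ` local_ring_over R0 (y_fun / x_fun - const_fun c) \<in> hexagon" for k c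
    unfolding hexagon_def blowup_def using exceptional_ep[of k] exc_R0_chart(4)[OF disjI1[OF refl]] exc_R0_chart(4)[OF disjI2[OF refl]] by blast+
  have pt: "pt v \<in> hexagon" if "v \<noteq> 0" "\<And>k. \<not> (v$(k+1) = 0 \<and> v$(k+2) = 0)" for v
  proof -
    have "pt v \<noteq> ep k" for k
    proof
      assume "pt v = ep k"
      hence "dominates (pt v) (pt (axis k 1))" unfolding ep_def using dominates_refl[of "pt v"] by simp
      moreover have "axis k (1::complex) \<noteq> 0" by (simp add: axis_eq_0_iff)
      ultimately obtain c where "v = c *s axis k 1"
        using pt_separated[OF res_local_pt dominates_refl _ \<open>v \<noteq> 0\<close>, of "axis k 1"] by blast
      hence "v$(k+1) = 0 \<and> v$(k+2) = 0" by simp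
      thus False using that(2) by blast
    qed
    hence "pt v \<in> P2 - range ep" using that(1) by (auto simp: P2_iff)
    thus ?thesis unfolding hexagon_def blowup_def by (rule UnI1)
  qed
  have J: "J ` S \<in> hexagon" if S: "S \<in> hexagon" for S
  proof -
    have "(\<exists>k. S \<in> exceptional_points (ep k)) \<or> (\<exists>v. v \<noteq> 0 \<and> S = pt v \<and> (\<forall>k. S \<noteq> ep k))"
      using S by (auto simp: hexagon_def blowup_def P2_iff)
    then consider k where "S \<in> exceptional_points (ep k)" | v where "v \<noteq> 0" "S = pt v" "\<forall>k. S \<noteq> ep k"
      by metis
    thus ?thesis
    proof cases
      case (1 k)
      then obtain T where T: "T \<in> exceptional_points R0" "S = echart k ` T" unfolding exceptional_ep by (elim imageE)
      consider "S = echart k ` local_ring_over R0 (x_fun / y_fun)" | c where "S = echart k ` local_ring_over R0 (y_fun / x_fun - const_fun c)"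
        using exc_R0[OF T(1)] unfolding T(2) by (elim disjE exE) simp_all
      thus ?thesis
      proof cases
        case 1
        have "J ` echart (k + 1) ` local_ring_over R0 (y_fun / x_fun) = S"
          unfolding 1 J_exceptional(2) by (simp add: idx3)
        hence "J ` S = echart (k + 1) ` local_ring_over R0 (y_fun / x_fun)" using J_J_image by metis
        thus ?thesis using exc(2)[of "k + 1" 0] by (simp add: const_fun_simps)
      next
        case (2 c)
        show ?thesis
        proof (cases "c = 0")
          case True
          hence "J ` S = echart (k + 2) ` local_ring_over R0 (x_fun / y_fun)"
            unfolding 2 using J_exceptional(2) by (simp add: const_fun_simps)
          thus ?thesis using exc(1) by simp
        next
          case False
          define v :: "complex^3" where "v = (\<chi> i. if i = k then 0 else if i = k + 1 then c else 1)"
          have v: "v$(k+1) = c" "v$(k+2) = 1" unfolding v_def vec_lambda_beta by (simp_all add: idx3(2-))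
          have "\<not> (v$(l+1) = 0 \<and> v$(l+2) = 0)" for l
            using idx3(1)[of l k] by (elim disjE) (use False v in \<open>simp_all add: idx3(2-)\<close>)
          moreover have "v \<noteq> 0" using v(2) by (intro notI) simp
          ultimately have "pt v \<in> hexagon" by (intro pt)
          thus ?thesis unfolding 2 J_exceptional(1)[OF False] v_def .
        qed
      qed
    next
      case (2 v)
      show ?thesis
      proof (cases "\<exists>k. v$k = 0")
        case False
        have c: "cremona (cremona v) = (v$1 * v$2 * v$3) *s v" unfolding cremona_def vec3_eq_iff by simp
        have nz: "v$1 * v$2 * v$3 \<noteq> 0" using False by simp
        have "J ` pt (cremona v) = pt v" by (rule sub_pt_eq[OF inverse_maps_cremona c nz])
        hence "J ` S = pt (cremona v)" unfolding 2(2) using J_J_image by metis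
        moreover have "cremona v $ k \<noteq> 0" for k unfolding cremona_nth using False by simp
        moreover from this have "cremona v \<noteq> 0" by (metis zero_index)
        ultimately show ?thesis using pt by metis
      next
        case True
        then obtain k where k: "v$k = 0" by blast
        have nz: "v$(k+1) \<noteq> 0" "v$(k+2) \<noteq> 0"
        proof -
          have ep_eq: "S = ep l" if "v$(l+1) = 0" "v$(l+2) = 0" for l
          proof -
            have "v$l \<noteq> 0" using that 2(1) idx3(1)[of _ l] unfolding Finite_Cartesian_Product.vec_eq_iff by (metis zero_index)
            moreover have "v = v$l *s axis l 1"
            proof -
              have "v $ i = (v$l *s axis l 1) $ i" for i using idx3(1)[of i l] that by auto
              thus ?thesis unfolding Finite_Cartesian_Product.vec_eq_iff by blast
            qed
            ultimately show ?thesis unfolding 2(2) ep_def using pt_scale by metis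
          qed
          show "v$(k+1) \<noteq> 0" using ep_eq[of "k+2"] k 2(3) by (auto simp: idx3)
          show "v$(k+2) \<noteq> 0" using ep_eq[of "k+1"] k 2(3) by (auto simp: idx3)
        qed
        define c where "c = v$(k+1) / v$(k+2)"
        have c: "c \<noteq> 0" using nz by (simp add: c_def)
        have "v = v$(k+2) *s (\<chi> i. if i = k then 0 else if i = k + 1 then c else 1)"
        proof -
          have "v $ i = (v$(k+2) *s (\<chi> i. if i = k then 0 else if i = k + 1 then c else 1)) $ i" for i
            using idx3(1)[of i k] k nz by (auto simp: c_def idx3(2-))
          thus ?thesis unfolding Finite_Cartesian_Product.vec_eq_iff by blast
        qed
        hence "S = pt (\<chi> i. if i = k then 0 else if i = k + 1 then c else 1)" unfolding 2(2) using pt_scale[OF nz(2)] by metis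
        hence "J ` S = echart k ` local_ring_over R0 (y_fun / x_fun - const_fun c)"
          using J_exceptional(1)[OF c] J_J_image by metis
        thus ?thesis using exc(2) by simp
      qed
    qed
  qed
  have "S \<in> (`) J ` hexagon" if "S \<in> hexagon" for S
    using J[OF that] J_J_image[of S] by (metis image_eqI)
  thus ?thesis using J by blast
qed

lemma total_exceptional_ep:
  assumes "dvr V t"
  shows "total_exceptional (ep k) V = max 0 (min (val V (crd (k + 1) k)) (val V (crd (k + 2) k)))"
    "total_exceptional (J ` ep k) V = max 0 (min (val V (crd k (k + 1))) (val V (crd k (k + 2))))"
  using total_exceptional_chart[OF echart(1) assms, of k]
    total_exceptional_chart[OF birational_map_comp[OF birational_J echart(1)] assms, of k]
  by (simp_all only: echart o_def image_image[symmetric] J_crd)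

lemma val_crd:
  assumes "dvr V t"
  shows "val V (crd i k) = val V (crd i 3) - val V (crd k 3)" "val V (crd 3 3) = 0"
  using val_divide[OF assms crd_nonzero crd_nonzero, of i 3 k 3] val_const[OF assms, of 1]
  by (simp_all add: crd_divide crd_self const_fun_simps)

text \<open>The function is the equation of the j-th line divided by that of the line Z = 0. The
  total transform of the j-th line consists of its strict transform, which J contracts to the j-th
  vertex, and the exceptional curves over the two vertices on it. All multiplicities are expressed
  by the valuations a of x and b of y.\<close>

lemma lin_equiv_J:
  "lin_equiv hexagon (total_exceptional (J ` ep j)) (\<lambda>V. line_pullback V - (\<Sum>i\<in>UNIV - {j}. total_exceptional (ep i) V))"
  unfolding lin_equiv_def
proof (intro exI[of _ "crd j 3"] conjI ballI crd_nonzero)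
  fix V assume "V \<in> prime_divisors hexagon"
  then obtain t where V: "dvr V t" using dvr_prime_divisors surfaceD(1)[OF surface_hexagon] by metis
  have s: "(\<Sum>i\<in>UNIV - {j}. total_exceptional (ep i) V) = total_exceptional (ep (j + 1)) V + total_exceptional (ep (j + 2)) V"
  proof -
    have "UNIV - {j} = {j + 1, j + 2}"
    proof (intro equalityI subsetI)
      fix x show "x \<in> UNIV - {j} \<Longrightarrow> x \<in> {j + 1, j + 2}" using idx3(1)[of x j] by auto
    qed (auto simp: idx3(2-))
    thus ?thesis by (simp add: idx3)
  qed
  define a b where "a = val V (crd 1 3)" and "b = val V (crd 2 3)"
  have c: "val V (crd 1 2) = a - b" "val V (crd 2 1) = b - a" "val V (crd 3 1) = - a" "val V (crd 3 2) = - b"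
    "val V (crd 1 3) = a" "val V (crd 2 3) = b" "val V (crd 3 3) = 0"
    using val_crd(1)[OF V, of 1 2] val_crd(1)[OF V, of 2 1] val_crd(1)[OF V, of 3 1] val_crd(1)[OF V, of 3 2] val_crd(2)[OF V] unfolding a_def b_def by simp_all
  show "total_exceptional (J ` ep j) V - (line_pullback V - (\<Sum>i\<in>UNIV - {j}. total_exceptional (ep i) V)) = val V (crd j 3)"
    unfolding s unfolding total_exceptional_ep[OF V] line_pullback_def xy_crd
    using exhaust_3[of j] by (elim disjE; simp only: idx_num c; linarith)
qed

subsection \<open>The exceptional curves are not linearly equivalent\<close>

lemma prime_in_affine:
  assumes q: "prime_elem q" "peval q \<alpha> \<beta> = 0"
  defines "R \<equiv> pt (vector [\<alpha>, \<beta>, 1])"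
  shows "prime_in R (Fract q 1)" "Fract c 1 \<in> R" "Fract c 1 / Fract q 1 \<in> R \<longleftrightarrow> q dvd c"
proof -
  have q0: "q \<noteq> 0" using q(1) by auto
  have ns: "\<not> q dvd s" if "peval s \<alpha> \<beta> \<noteq> 0" for s using that q(2) by (auto elim!: dvdE)
  have in_R: "Fract c d \<in> R" if "peval d \<alpha> \<beta> \<noteq> 0" for c d unfolding R_def by (rule Fract_in_pt(1)[OF that])
  show "Fract c 1 \<in> R" for c by (rule in_R) simp
  have div_iff: "Fract c d / Fract q 1 \<in> R \<longleftrightarrow> q dvd c" if d: "peval d \<alpha> \<beta> \<noteq> 0" for c d
  proof
    assume "Fract c d / Fract q 1 \<in> R"
    then obtain r s where rs: "Fract c d / Fract q 1 = Fract r s" "peval s \<alpha> \<beta> \<noteq> 0" unfolding R_def by (rule pt_affineE)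
    have "Fract c (d * q) = Fract r s" using rs(1) by simp
    hence "c * s = r * (d * q)" using eq_fract(1)[of "d * q" s c r] q0 peval_nonzero[OF d] peval_nonzero[OF rs(2)] by simp
    hence "q dvd c * s" by simp
    thus "q dvd c" using prime_elem_dvd_mult_iff[OF q(1)] ns[OF rs(2)] by blast
  next
    assume "q dvd c"
    then obtain e where "c = q * e" by (rule dvdE)
    hence "Fract c d / Fract q 1 = Fract e d" using q0 peval_nonzero[OF d] by (simp add: eq_fract)
    thus "Fract c d / Fract q 1 \<in> R" using in_R[OF d] by simp
  qed
  show "Fract c 1 / Fract q 1 \<in> R \<longleftrightarrow> q dvd c" by (rule div_iff) simp
  show "prime_in R (Fract q 1)" unfolding prime_in_def
  proof (intro conjI ballI impI)
    show "Fract q 1 \<in> max_ideal R" unfolding R_def by (subst Fract_in_pt(2)) (simp_all add: q)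
    show "Fract q 1 \<noteq> 0" using q0 by (simp add: Zero_fract_def eq_fract)
    fix a b assume a: "a \<in> R" and b: "b \<in> R" and ab: "a * b / Fract q 1 \<in> R"
    obtain a1 a2 where a12: "a = Fract a1 a2" "peval a2 \<alpha> \<beta> \<noteq> 0" using a unfolding R_def by (rule pt_affineE)
    obtain b1 b2 where b12: "b = Fract b1 b2" "peval b2 \<alpha> \<beta> \<noteq> 0" using b unfolding R_def by (rule pt_affineE)
    have "q dvd a1 * b1" using ab div_iff[of "a2 * b2" "a1 * b1"] a12 b12 by simp
    thus "a / Fract q 1 \<in> R \<or> b / Fract q 1 \<in> R"
      unfolding a12(1) b12(1) div_iff[OF a12(2)] div_iff[OF b12(2)] using prime_elem_dvd_mult_iff[OF q(1)] by blast
  qed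
qed

text \<open>The valuation ring of the affine curve q = 0, formed at one of its points, as
  \<open>prime_divisors\<close> asks for a point of the surface.\<close>

definition curve :: "complex \<Rightarrow> complex \<Rightarrow> complex poly poly \<Rightarrow> ratfun set" where
  "curve \<alpha> \<beta> q = {a / b | a b. a \<in> pt (vector [\<alpha>, \<beta>, 1]) \<and> b \<in> pt (vector [\<alpha>, \<beta>, 1]) \<and> b / Fract q 1 \<notin> pt (vector [\<alpha>, \<beta>, 1])}"

lemma smooth_pt_affine: "smooth_pt (pt (vector [\<alpha>, \<beta>, 1]))"
  by (rule smooth_pt_pt) (metis vector_3(3) zero_index zero_neq_one)

lemma dvr_curve:
  assumes q: "prime_elem q" "peval q \<alpha> \<beta> = 0"
  shows "dvr (curve \<alpha> \<beta> q) (Fract q 1)"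
    "\<not> q dvd c \<Longrightarrow> val (curve \<alpha> \<beta> q) (Fract c 1) = 0"
    "c \<noteq> 0 \<Longrightarrow> val (curve \<alpha> \<beta> q) (Fract c 1) \<ge> 0"
    "q dvd c \<Longrightarrow> c \<noteq> 0 \<Longrightarrow> val (curve \<alpha> \<beta> q) (Fract c 1) \<ge> 1"
proof -
  let ?V = "curve \<alpha> \<beta> q" and ?R = "pt (vector [\<alpha>, \<beta>, 1])"
  show V: "dvr ?V (Fract q 1)" unfolding curve_def by (rule dvr_prime[OF smooth_pt_affine prime_in_affine(1)[OF q]])
  note inR = prime_in_affine(2)[OF q] and dv = prime_in_affine(3)[OF q]
  have nz: "Fract c 1 \<noteq> 0" if "c \<noteq> 0" for c :: "complex poly poly" using that by (simp add: Zero_fract_def eq_fract)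
  have VI: "Fract c 1 / Fract d 1 \<in> ?V" if "\<not> q dvd d" for c d
    unfolding curve_def using inR that dv by blast
  have q1: "\<not> q dvd 1" using q(1) by auto
  have inV: "Fract c 1 \<in> ?V" for c using VI[OF q1, of c] by (simp add: One_fract_def[symmetric])
  show nn: "val ?V (Fract c 1) \<ge> 0" if "c \<noteq> 0" for c
    using in_dvr_iff[OF V nz[OF that]] inV by blast
  show "val ?V (Fract c 1) = 0" if "\<not> q dvd c"
  proof (rule val_unit[OF V])
    have "c \<noteq> 0" using that by auto
    thus "Fract c 1 \<in> units_of_ring ?V" unfolding units_iff
      using inV nz VI[OF that, of 1] by (simp add: One_fract_def[symmetric] inverse_eq_divide)
  qed
  show "val ?V (Fract c 1) \<ge> 1" if c: "q dvd c" "c \<noteq> 0"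
  proof -
    obtain e where e: "c = q * e" using c(1) by (rule dvdE)
    have ne: "q \<noteq> 0" "e \<noteq> 0" using c(2) e by auto
    have "val ?V (Fract q 1) = 1" using val_eq[OF V, of 1 1] const_subringD(3)[OF dvrD(1)[OF V]] by (simp add: units_iff)
    moreover have "Fract c 1 = Fract q 1 * Fract e 1" unfolding e by simp
    ultimately show ?thesis using val_mult[OF V nz[OF ne(1)] nz[OF ne(2)]] nn[OF ne(2)] by simp
  qed
qed

text \<open>A zero off the origin is asked for because the origin is blown up in
  \<open>hexagon\<close>. If the degree in y is positive, a non-zero \<alpha> that is no root of the
  leading coefficient preserves this degree, and \<complex> is algebraically closed.\<close>

lemma poly_poly_zero:
  fixes q :: "complex poly poly"
  assumes "q \<noteq> 0" "\<not> q dvd 1"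
  shows "\<exists>\<alpha> \<beta>. peval q \<alpha> \<beta> = 0 \<and> (\<alpha> \<noteq> 0 \<or> \<beta> \<noteq> 0)"
proof (cases "degree q = 0")
  case True
  then obtain c where c: "q = [:c:]" by (metis degree_eq_zeroE)
  have "degree c \<noteq> 0"
  proof
    assume "degree c = 0"
    then obtain e where e: "c = [:e:]" by (metis degree_eq_zeroE)
    hence "e \<noteq> 0" using assms(1) c by auto
    hence "q * [:[:inverse e:]:] = 1" unfolding c e by (simp add: one_pCons)
    thus False using assms(2) by (metis dvdI)
  qed
  then obtain \<alpha> where "poly c \<alpha> = 0" using alg_closed_imp_poly_has_root by blast
  thus ?thesis unfolding c by (intro exI[of _ \<alpha>] exI[of _ 1]) simp
next
  case False
  have "lead_coeff q \<noteq> 0" using assms(1) by simp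
  hence "finite ({a. poly (lead_coeff q) a = 0} \<union> {0})" using poly_roots_finite by blast
  then obtain \<alpha> where "\<alpha> \<notin> {a. poly (lead_coeff q) a = 0} \<union> {0}"
    using ex_new_if_finite[OF infinite_UNIV_char_0] by blast
  hence \<alpha>: "poly (lead_coeff q) \<alpha> \<noteq> 0" "\<alpha> \<noteq> 0" by simp_all
  define P where "P = map_poly (\<lambda>c. poly c \<alpha>) q"
  have P: "poly P y = peval q \<alpha> y" for y
  proof -
    have "poly (map_poly (\<lambda>c. poly c \<alpha>) q) y = peval q \<alpha> y" unfolding peval_def
      by (induction q) (simp_all add: map_poly_pCons)
    thus ?thesis unfolding P_def .
  qed
  have "coeff P (degree q) \<noteq> 0" unfolding P_def using \<alpha>(1) by (simp add: coeff_map_poly)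
  hence "degree P \<noteq> 0" using False le_degree by fastforce
  then obtain \<beta> where "poly P \<beta> = 0" using alg_closed_imp_poly_has_root by blast
  thus ?thesis using P \<alpha>(2) by (intro exI[of _ \<alpha>] exI[of _ \<beta>]) simp
qed

lemma affine_in_hexagon: "\<alpha> \<noteq> 0 \<or> \<beta> \<noteq> 0 \<Longrightarrow> pt (vector [\<alpha>, \<beta>, 1]) \<in> hexagon"
proof -
  assume nz: "\<alpha> \<noteq> 0 \<or> \<beta> \<noteq> 0"
  let ?v = "vector [\<alpha>, \<beta>, 1] :: complex^3"
  have v: "?v \<noteq> 0" by (metis vector_3(3) zero_index zero_neq_one)
  have "pt ?v \<noteq> ep k" for k
  proof
    assume "pt ?v = ep k"
    hence "dominates (pt ?v) (pt (axis k 1))" unfolding ep_def using dominates_refl[of "pt ?v"] by simp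
    moreover have "axis k (1::complex) \<noteq> 0" by (simp add: axis_eq_0_iff)
    ultimately obtain c where "?v = c *s axis k 1"
      using pt_separated[OF res_local_pt dominates_refl _ v, of "axis k 1"] by blast
    hence "\<alpha> = c * axis k 1 $ 1" "\<beta> = c * axis k 1 $ 2" "1 = c * axis k 1 $ 3"
      unfolding vec3_eq_iff by simp_all
    thus False using nz by (auto simp: axis_def split: if_splits)
  qed
  hence "pt ?v \<in> P2 - range ep" using v by (auto simp: P2_iff)
  thus ?thesis unfolding hexagon_def blowup_def by (rule UnI1)
qed

text \<open>The curve passes through an affine point other than the origin. So x and y have
  non-negative valuations along it that are not both positive, and the generators of the ideal of a
  vertex, which are quotients of 1, x, y, cannot both have positive valuation.\<close>

lemma curve_disjoint:
  assumes q: "prime_elem q" "peval q \<alpha> \<beta> = 0" "\<alpha> \<noteq> 0 \<or> \<beta> \<noteq> 0"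
  shows "curve \<alpha> \<beta> q \<in> prime_divisors hexagon" "total_exceptional (ep k) (curve \<alpha> \<beta> q) = 0"
proof -
  let ?V = "curve \<alpha> \<beta> q"
  show "?V \<in> prime_divisors hexagon"
    unfolding prime_divisors_def curve_def using affine_in_hexagon[OF q(3)] prime_in_affine(1)[OF q(1,2)] by blast
  note V = dvr_curve[OF q(1,2)]
  have x: "x_fun = Fract [:[:0, 1:]:] 1" and y: "y_fun = Fract [:0, 1:] 1" by (simp_all add: x_fun_def y_fun_def)
  have a: "val ?V (crd 1 3) \<ge> 0" "val ?V (crd 2 3) \<ge> 0"
    unfolding xy_crd[symmetric] x y by (rule V(3), simp)+
  have b: "val ?V (crd 1 3) = 0 \<or> val ?V (crd 2 3) = 0"
  proof (rule ccontr)
    assume "\<not> ?thesis"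
    hence "q dvd [:[:0, 1:]:]" "q dvd [:0, 1:]"
      unfolding xy_crd[symmetric] x y using V(2) by blast+
    then obtain c d where cd: "[:[:0, 1:]:] = q * c" "[:0, 1:] = q * d" by (metis dvdE)
    have "\<alpha> = peval q \<alpha> \<beta> * peval c \<alpha> \<beta>" "\<beta> = peval q \<alpha> \<beta> * peval d \<alpha> \<beta>"
      using arg_cong[OF cd(1), of "\<lambda>p. peval p \<alpha> \<beta>"] arg_cong[OF cd(2), of "\<lambda>p. peval p \<alpha> \<beta>"] by simp_all
    thus False using q(2,3) by simp
  qed
  have c: "val ?V (crd i k) = val ?V (crd i 3) - val ?V (crd k 3)" "val ?V (crd 3 3) = 0" for i k
    using val_crd[OF V(1)] by blast+
  show "total_exceptional (ep k) ?V = 0"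
    unfolding total_exceptional_ep(1)[OF V(1)] using exhaust_3[of k] a b c(1)[of 2 1] c(1)[of 3 1] c(1)[of 3 2] c(1)[of 1 2] c(2)
    by (elim disjE; simp only: idx_num; linarith)
qed

text \<open>The valuation ring of the exceptional curve over the k-th vertex; in the chart (x, y/x)
  of the blowup its equation is x = 0.\<close>

definition exc_divisor :: "3 \<Rightarrow> ratfun set" where
  "exc_divisor k = echart k ` sub blow ` curve 0 0 [:[:0, 1:]:]"

lemma prime_elem_X: "prime_elem [:[:0, 1:]:: complex poly:]"
  unfolding prime_elem_const_poly_iff
  using prime_elem_linear_field_poly[of "1::complex" 0] by simp

lemma exc_divisor:
  "exc_divisor k \<in> prime_divisors hexagon" "\<exists>t. dvr (exc_divisor k) t"
  "total_exceptional (ep k) (exc_divisor k) = 1" "l \<noteq> k \<Longrightarrow> total_exceptional (ep l) (exc_divisor k) = 0"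
proof -
  interpret E: birational "echart k" by unfold_locales (rule echart)
  interpret bl: birational "sub blow" by unfold_locales (rule birational_sub[OF inverse_maps_blow])
  let ?X = "[:[:0, 1:]:] :: complex poly poly" and ?V = "curve 0 0 [:[:0, 1:]:]"
  have z: "peval ?X 0 0 = 0" by simp
  note V = dvr_curve[OF prime_elem_X z]
  have "?V \<in> prime_divisors {R0}"
    unfolding prime_divisors_def curve_def R0_def using prime_in_affine(1)[OF prime_elem_X z] by blast
  hence "sub blow ` ?V \<in> prime_divisors ((`) (sub blow) ` {R0})" unfolding bl.prime_divisors_image by (rule imageI)
  hence "exc_divisor k \<in> prime_divisors ((`) (echart k) ` (`) (sub blow) ` {R0})"
    unfolding exc_divisor_def E.prime_divisors_image by (rule imageI)
  moreover have "(`) (echart k) ` (`) (sub blow) ` {R0} \<subseteq> hexagon"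
  proof -
    have "sub blow ` R0 \<in> exceptional_points R0"
      using exc_R0_chart(4)[of "y_fun / x_fun" 0] unfolding blow_R0(1) by (simp add: const_fun_simps)
    hence "echart k ` sub blow ` R0 \<in> exceptional_points (ep k)" unfolding exceptional_ep by (rule imageI)
    thus ?thesis unfolding hexagon_def blowup_def by auto
  qed
  ultimately show "exc_divisor k \<in> prime_divisors hexagon" unfolding prime_divisors_def by blast
  have dv: "dvr (exc_divisor k) (echart k (sub blow (Fract ?X 1)))"
    unfolding exc_divisor_def by (intro E.dvr_image bl.dvr_image V)
  thus "\<exists>t. dvr (exc_divisor k) t" ..
  have vX: "val ?V x_fun = 1" unfolding x_fun_def
    using val_eq[OF V(1), of 1 1] const_subringD(3)[OF dvrD(1)[OF V(1)]] by (simp add: units_iff)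
  have "\<not> ?X dvd [:0, 1:]"
  proof
    assume "?X dvd [:0, 1:]"
    then obtain c where "[:0, 1:] = ?X * c" by (rule dvdE)
    hence "peval [:0, 1:] 0 1 = peval (?X * c) 0 1" by (simp only:)
    thus False unfolding peval_simps by simp
  qed
  hence vY: "val ?V y_fun = 0" unfolding y_fun_def by (rule V(2))
  have 1: "val (exc_divisor k) (crd (k + 1) k) = 1"
    unfolding exc_divisor_def echart(3)[symmetric] E.val_image using bl.val_image[of ?V x_fun] sub_blow(1) vX by simp
  have "echart k (y_fun / x_fun) = crd (k + 2) (k + 1)" unfolding E.hom_divide echart crd_divide ..
  hence 2: "val (exc_divisor k) (crd (k + 2) (k + 1)) = 0"
    using E.val_image[of "sub blow ` ?V" "y_fun / x_fun"] bl.val_image[of ?V y_fun] sub_blow(2) vY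
    unfolding exc_divisor_def by simp
  have 3: "val (exc_divisor k) (crd i j) = - val (exc_divisor k) (crd j i)" for i j
    using val_inverse[OF dv crd_nonzero[of j i]] unfolding crd_inverse .
  have 4: "val (exc_divisor k) (crd (k + 2) k) = 1"
    using val_mult[OF dv crd_nonzero[of "k+2" "k+1"] crd_nonzero[of "k+1" k]] 1 2 unfolding crd_mult by simp
  show "total_exceptional (ep k) (exc_divisor k) = 1"
    unfolding total_exceptional_ep(1)[OF dv] using 1 4 by simp
  show "total_exceptional (ep l) (exc_divisor k) = 0" if "l \<noteq> k"
    unfolding total_exceptional_ep(1)[OF dv] using idx3(1)[of l k] that 1 2 4 3[of k "k+1"] 3[of k "k+2"] 3[of "k+1" "k+2"]
    by (elim disjE) (simp_all add: idx3(2-))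
qed

text \<open>A function with this difference as divisor would have neither zeros nor poles along
  curves in the affine plane. By unique factorization its numerator and denominator would be
  constants, and its order along the exceptional curve over a would be 0 instead of 1.\<close>

lemma ep_not_lin_equiv:
  assumes "a \<noteq> b"
  shows "\<not> lin_equiv hexagon (total_exceptional (ep a)) (total_exceptional (ep b))"
proof
  assume "lin_equiv hexagon (total_exceptional (ep a)) (total_exceptional (ep b))"
  then obtain g where g: "g \<noteq> 0" and H: "\<And>V. V \<in> prime_divisors hexagon \<Longrightarrow> total_exceptional (ep a) V - total_exceptional (ep b) V = val V g"
    unfolding lin_equiv_def by blast
  obtain A0 B0 where AB0: "g = Fract A0 B0" "B0 \<noteq> 0" by (cases g) auto
  have A0: "A0 \<noteq> 0" using g AB0 by (auto simp: Zero_fract_def eq_fract)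
  define A B where "A = A0 div gcd A0 B0" and "B = B0 div gcd A0 B0"
  have cop: "coprime A B" unfolding A_def B_def using AB0(2) by (intro div_gcd_coprime) simp
  have eqs: "A0 = A * gcd A0 B0" "B0 = B * gcd A0 B0" unfolding A_def B_def by simp_all
  have nz: "A \<noteq> 0" "B \<noteq> 0" using eqs A0 AB0(2) by auto
  have gAB: "g = Fract A 1 / Fract B 1"
    using eqs nz AB0(2) unfolding AB0(1) by (metis (no_types, lifting) Fract_nonzero eq_fract(1) mult.assoc mult.commute)
  have frnz: "Fract c 1 \<noteq> 0" if "c \<noteq> 0" for c :: "complex poly poly" using that by (simp add: Zero_fract_def eq_fract)
  have np: "\<not> q dvd A \<and> \<not> q dvd B" if q: "prime_elem q" for q
  proof -
    have "q \<noteq> 0" "\<not> q dvd 1" using q by auto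
    then obtain \<alpha> \<beta> where z: "peval q \<alpha> \<beta> = 0" "\<alpha> \<noteq> 0 \<or> \<beta> \<noteq> 0" using poly_poly_zero by blast
    have "val (curve \<alpha> \<beta> q) g = 0" using H curve_disjoint[OF q z] by fastforce
    hence v: "val (curve \<alpha> \<beta> q) (Fract A 1) = val (curve \<alpha> \<beta> q) (Fract B 1)"
      unfolding gAB using val_divide[OF dvr_curve(1)[OF q z(1)] frnz[OF nz(1)] frnz[OF nz(2)]] by simp
    have "\<not> (q dvd A \<and> q dvd B)" using cop \<open>\<not> q dvd 1\<close> not_coprimeI by blast
    thus ?thesis using v dvr_curve(2)[OF q z(1)] dvr_curve(4)[OF q z(1)] nz by fastforce
  qed
  have unit: "\<exists>c. C = [:[:c:]:] \<and> c \<noteq> 0" if "C = A \<or> C = B" for C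
  proof -
    have "C dvd 1"
    proof (rule ccontr)
      assume "\<not> C dvd 1"
      moreover have "C \<noteq> 0" using that nz by blast
      ultimately obtain q where "prime q" "q dvd C" using prime_divisor_exists by blast
      thus False using np that prime_imp_prime_elem by blast
    qed
    then obtain c where c: "C = [:c:]" "c dvd 1" unfolding is_unit_poly_iff by blast
    then obtain e where "c = [:e:]" "e dvd 1" unfolding is_unit_poly_iff by blast
    thus ?thesis using c by auto
  qed
  obtain c d where cd: "A = [:[:c:]:]" "c \<noteq> 0" "B = [:[:d:]:]" "d \<noteq> 0" using unit by metis
  obtain t where t: "dvr (exc_divisor a) t" using exc_divisor(2) by blast
  have "val (exc_divisor a) g = 0"
    unfolding gAB cd const_fun_def[symmetric] using val_divide[OF t] val_const[OF t] cd(2,4) by simp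
  moreover have "total_exceptional (ep a) (exc_divisor a) - total_exceptional (ep b) (exc_divisor a) = 1"
    using exc_divisor(3) exc_divisor(4)[of b a] assms by simp
  ultimately show False using H[OF exc_divisor(1)] by fastforce
qed

subsection \<open>Iterated blowups\<close>

lemma surface_successive:
  "surface X \<Longrightarrow> successive_centers rs X \<Longrightarrow> surface (successive_blowup rs X)"
proof (induction rs arbitrary: X)
  case (Cons R rs)
  have "surface (blowup {R} X)" by (rule surface_blowup) (use Cons.prems in auto)
  thus ?case using Cons by simp
qed simp

lemma successive_blowup_keep:
  "R \<in> X \<Longrightarrow> R \<notin> set rs \<Longrightarrow> R \<in> successive_blowup rs X"
  by (induction rs arbitrary: X) (auto simp: blowup_def)

lemma R0_quotient_notin: "y_fun / x_fun \<notin> R0" "x_fun / y_fun \<notin> R0"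
proof -
  have "(1::ratfun) \<notin> max_ideal R0" using max_ideal_const_iff[OF res_local_R0, of 1] by (simp add: const_fun_simps)
  thus "y_fun / x_fun \<notin> R0" "x_fun / y_fun \<notin> R0"
    using R0_indep(2)[OF _ const_subringD(3)[OF res_localD(1)[OF res_local_R0]], of "- (y_fun / x_fun)"]
      R0_indep(1)[OF const_subringD(3)[OF res_localD(1)[OF res_local_R0]], of "- (x_fun / y_fun)"]
      const_subringD(6)[OF res_localD(1)[OF res_local_R0]] xy_nonzero by auto
qed

text \<open>By separatedness, such a point could only be the blown-up point itself; but its ring
  contains a quotient of two generators of the maximal ideal, which is not regular there.\<close>

lemma exceptional_not_P2:
  assumes "R \<in> P2" "S \<in> exceptional_points R"
  shows "S \<notin> P2"
proof
  assume S: "S \<in> P2"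
  have g: "smooth_pt R" by (rule surfaceD(1)[OF surface_P2 assms(1)])
  have "S = R"
    by (rule P2_separated[OF smooth_pt_res_local[OF smooth_pt_exceptional(1)[OF g assms(2)]] S assms(1) dominates_refl smooth_pt_exceptional(2)[OF g assms(2)]])
  obtain \<phi> where p: "birational_map \<phi>" "R = \<phi> ` R0" using g unfolding smooth_pt_def by blast
  interpret birational \<phi> by unfold_locales (rule p)
  obtain T where T: "T \<in> exceptional_points R0" "\<phi> ` R0 = \<phi> ` T"
    using assms(2) unfolding \<open>S = R\<close> p(2) exceptional_points_image by (elim imageE)
  have "R0 = T" using T(2) unfolding image_eq_iff .
  hence "R0 \<in> exceptional_points R0" using T(1) by simp
  then consider c where "R0 = local_ring_over R0 (y_fun / x_fun - const_fun c)" | "R0 = local_ring_over R0 (x_fun / y_fun)"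
    using exc_R0 by blast
  thus False
  proof cases
    case (1 c)
    have "y_fun / x_fun - const_fun c \<in> local_ring_over R0 (y_fun / x_fun - const_fun c)"
      by (rule max_subset[OF exc_R0_chart(2)[OF disjI1[OF refl]]])
    hence "y_fun / x_fun - const_fun c \<in> R0" using 1 by simp
    from const_subringD(4)[OF res_localD(1)[OF res_local_R0] this const_subringD(1)[OF res_localD(1)[OF res_local_R0], of c]]
    show False using R0_quotient_notin(1) by simp
  next
    case 2
    have "x_fun / y_fun \<in> local_ring_over R0 (x_fun / y_fun)"
      by (rule max_subset[OF exc_R0_chart(2)[OF disjI2[OF refl]]])
    hence "x_fun / y_fun \<in> R0" using 2 by simp
    thus False using R0_quotient_notin(2) by simp
  qed
qed

text \<open>Distinct points of the plane are not infinitely near to each other, so blowing them up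
  one by one is the same as blowing them up at once.\<close>

lemma successive_blowup_distinct:
  assumes "distinct rs" "set rs \<subseteq> P2" "B \<subseteq> P2" "set rs \<inter> B = {}"
  shows "successive_centers rs (blowup B P2) \<and> successive_blowup rs (blowup B P2) = blowup (B \<union> set rs) P2"
  using assms
proof (induction rs arbitrary: B)
  case (Cons R rs)
  have R: "R \<in> P2" "R \<notin> B" using Cons.prems by auto
  have "R \<in> blowup B P2" unfolding blowup_def using R by blast
  moreover have "R \<notin> exceptional_points S" if "S \<in> B" for S
    using exceptional_not_P2[of S R] that R(1) Cons.prems(3) by blast
  hence "blowup {R} (blowup B P2) = blowup (insert R B) P2" unfolding blowup_def by auto
  ultimately show ?case using Cons.IH[of "insert R B"] Cons.prems R by auto
qed simp

text \<open>A value with non-zero l-th coordinate would put all \<open>crd l i\<close> into the ring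
  of the vertex, but for every l one of these quotients is not regular there.\<close>

lemma indeterminacy_J: "ep k \<in> indeterminacy J P2"
proof -
  interpret J: birational J by unfold_locales (rule birational_J)
  interpret E: birational "echart k" by unfold_locales (rule echart)
  note ni = R0_quotient_notin
  have n2: "crd (k + 2) (k + 1) \<notin> ep k" "crd (k + 1) (k + 2) \<notin> ep k"
  proof -
    have "echart k (y_fun / x_fun) = crd (k + 2) (k + 1)" "echart k (x_fun / y_fun) = crd (k + 1) (k + 2)"
      unfolding E.hom_divide echart crd_divide by simp_all
    thus "crd (k + 2) (k + 1) \<notin> ep k" "crd (k + 1) (k + 2) \<notin> ep k"
      using ni E.in_image_iff[of "y_fun / x_fun" R0] E.in_image_iff[of "x_fun / y_fun" R0] unfolding echart(2) by simp_all
  qed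
  have n1: "crd k (k + 1) \<notin> ep k"
  proof
    assume c: "crd k (k + 1) \<in> ep k"
    have "crd (k + 1) k \<in> max_ideal (ep k)"
      using crd_res[of "axis k 1" k "k + 1"] unfolding ep_def by (simp add: const_fun_simps)
    from max_ideal_mult(1)[OF _ this c] have "crd (k + 1) (k + 1) \<in> max_ideal (ep k)"
      unfolding crd_mult ep_def using res_local_pt by blast
    thus False using max_ideal_const_iff[OF res_local_pt, of 1] unfolding crd_self ep_def by (simp add: const_fun_simps)
  qed
  have "\<not> dominates (ep k) (J ` S)" if "S \<in> P2" for S
  proof
    assume d: "dominates (ep k) (J ` S)"
    obtain u where u: "u \<noteq> 0" "S = pt u" using \<open>S \<in> P2\<close> unfolding P2_iff by blast
    obtain l where l: "u$l \<noteq> 0" using vec_nonzeroE[OF u(1)] by blast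
    have "crd l i \<in> ep k" for i
    proof -
      have "J (crd i l) \<in> J ` S" unfolding u(2) by (rule imageI[OF crd_in_pt[OF l]])
      thus ?thesis using dominatesD(1)[OF d] unfolding J_crd by blast
    qed
    thus False using n1 n2 idx3(1)[of l k] by (elim disjE) blast+
  qed
  thus ?thesis unfolding indeterminacy_def using ep_P2 by blast
qed

subsection \<open>Quadratic maps with three proper base points\<close>

lemma lin_equivI:
  "g \<noteq> 0 \<Longrightarrow> (\<And>V. V \<in> prime_divisors X \<Longrightarrow> D V - D' V = val V g) \<Longrightarrow> lin_equiv X D D'"
  unfolding lin_equiv_def by blast

lemma form1_coeffs:
  assumes "form 1 A"
  shows "\<exists>c. \<forall>v. A v = (\<Sum>i\<in>UNIV. c i * v$(i::3))"
proof -
  obtain a where a: "A = form_value 1 a" using assms unfolding form_def by blast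
  define c where "c i = (if i = (1::3) then coeff (coeff a 0) 1 else if i = 2 then coeff (coeff a 1) 0 else coeff (coeff a 0) 0)" for i
  have "{..1::nat} = {0, 1}" "{..1 - (0::nat)} = {0, 1}" "{..1 - (1::nat)} = {0}" by auto
  hence "A v = (\<Sum>i\<in>UNIV. c i * v$i)" for v
    unfolding a form_value_def UNIV_3 by (simp add: c_def)
  thus ?thesis by blast
qed

definition linear_iso :: "(complex^3 \<Rightarrow> complex^3) \<Rightarrow> (complex^3 \<Rightarrow> complex^3) \<Rightarrow> bool" where
  "linear_iso L L' \<longleftrightarrow> (\<forall>i. form 1 (\<lambda>v. L v $ i)) \<and> (\<forall>i. form 1 (\<lambda>v. L' v $ i)) \<and> (\<forall>v. L (L' v) = v) \<and> (\<forall>v. L' (L v) = v)"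

lemma linear_isoD:
  assumes "linear_iso L L'"
  shows "form 1 (\<lambda>v. L v $ i)" "form 1 (\<lambda>v. L' v $ i)" "L (L' v) = v" "L' (L v) = v"
    "inverse_maps L L'" "linear_iso L' L" "L (c *s v) = c *s L v" "L v = 0 \<longleftrightarrow> v = 0"
proof -
  show *: "form 1 (\<lambda>v. L v $ i)" "form 1 (\<lambda>v. L' v $ i)" "L (L' v) = v" "L' (L v) = v" for i v
    using assms unfolding linear_iso_def by blast+
  show "inverse_maps L L'" by (rule inverse_mapsI_exact[OF *])
  show "linear_iso L' L" using * unfolding linear_iso_def by blast
  have sc: "L (c *s v) = c *s L v" "L' (c *s v) = c *s L' v" for c v
    unfolding Finite_Cartesian_Product.vec_eq_iff using form_scale[OF *(1)] form_scale[OF *(2)] by simp_all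
  show "L (c *s v) = c *s L v" by (rule sc)
  have "L 0 = 0" "L' 0 = 0" using sc[of 0 0] by simp_all
  thus "L v = 0 \<longleftrightarrow> v = 0" using *(4) by metis
qed

lemma sub_linear_pt: "linear_iso L L' \<Longrightarrow> sub L ` pt (L v) = pt v"
  by (rule sub_pt_eq[OF linear_isoD(5), of L L' v 1]) (simp_all add: linear_isoD)

lemma sub_linear_P2: "linear_iso L L' \<Longrightarrow> (`) (sub L) ` P2 = P2"
proof -
  assume L: "linear_iso L L'"
  note D = linear_isoD[OF L] and D' = linear_isoD[OF linear_isoD(6)[OF L]]
  have "sub L ` pt v = pt (L' v)" for v using sub_linear_pt[OF L, of "L' v"] D(3) by simp
  hence "(`) (sub L) ` P2 = {pt (L' v) | v. v \<noteq> 0}" unfolding P2_def by auto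
  also have "\<dots> = P2" unfolding P2_def using D(4,8) D'(8) by (auto simp: image_iff) metis
  finally show ?thesis .
qed

text \<open>A linear map replaces the line Z = 0 by another line. Both pullbacks involve the least
  valuation in a basis of the linear forms, which is the same for all bases, so they differ by the
  valuation of the quotient of the two equations.\<close>

lemma line_pullback_linear:
  assumes L: "linear_iso L L'"
  obtains g where "g \<noteq> 0" "\<And>V t. dvr V t \<Longrightarrow> line_pullback (sub L ` V) = line_pullback V + val V g"
proof -
  interpret birational "sub L" by unfold_locales (rule birational_sub[OF linear_isoD(5)[OF L]])
  note D = linear_isoD[OF L]
  define h where "h i = fr (\<lambda>v. L' v $ i) (\<lambda>v. v $ 3)" for i
  obtain e where F': "form_map e L'" using inverse_maps_form_map[OF linear_isoD(5)[OF D(6)]] by blast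
  have Lnz: "\<exists>v. L' v $ i \<noteq> 0" for i using D(4) coord_nonzero[of i] by metis
  have hnz: "h i \<noteq> 0" for i
    unfolding h_def by (subst fr_eq_0_iff[OF D(2) form_coord coord_nonzero]) (use Lnz in auto)
  have sL: "crd i 3 = sub L (h i / h 3)" for i
  proof -
    have "sub L' (crd i 3) = fr (\<lambda>v. L' v $ i) (\<lambda>v. L' v $ 3)"
      unfolding crd_def by (rule sub_fr[OF F' form_coord form_coord coord_nonzero])
    also have "\<dots> = h i / h 3"
      unfolding h_def divide_inverse fr_inverse[OF D(2) form_coord] fr_mult[OF D(2) form_coord form_coord D(2)]
      by (subst fr_eq_iff[OF D(2) D(2) form_mult[OF D(2) form_coord] form_mult[OF form_coord D(2)] Lnz
            form_mult_nonzero[OF form_coord D(2) coord_nonzero Lnz]]) simp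
    finally have "sub L (sub L' (crd i 3)) = sub L (h i / h 3)" by simp
    thus ?thesis unfolding sub_inverse[OF D(5)] .
  qed
  have add: "fr (\<lambda>v. P v + Q v) (\<lambda>v. v$3) = fr P (\<lambda>v. v$3) + fr Q (\<lambda>v. v$3)" if "form 1 P" "form 1 Q" for P Q
  proof -
    have "fr (\<lambda>v. P v - - Q v) (\<lambda>v. v$3) = fr P (\<lambda>v. v$3) - fr (\<lambda>v. - Q v) (\<lambda>v. v$3)"
      by (rule fr_diff[OF that(1) form_minus[OF that(2)] form_coord coord_nonzero])
    thus ?thesis unfolding fr_minus[OF that(2) form_coord, symmetric] by simp
  qed
  have lin: "fr A (\<lambda>v. v$3) = const_fun (c 1) * fr (\<lambda>v. B v $ 1) (\<lambda>v. v$3) + const_fun (c 2) * fr (\<lambda>v. B v $ 2) (\<lambda>v. v$3) + const_fun (c 3) * fr (\<lambda>v. B v $ 3) (\<lambda>v. v$3)"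
    if AB: "\<And>v. A v = (\<Sum>i\<in>UNIV. c i * B v $ (i::3))" "\<And>i. form 1 (\<lambda>v. B v $ i)" for A B c
  proof -
    have "A v = c 1 * B v $ 1 + c 2 * B v $ 2 + c 3 * B v $ 3" for v
      unfolding AB(1)[of v] sum_3 ..
    hence A: "A = (\<lambda>v. c 1 * B v $ 1 + c 2 * B v $ 2 + c 3 * B v $ 3)" by (rule ext)
    have f: "form 1 (\<lambda>v. c i * B v $ i)" for i by (rule form_const_mult[OF AB(2)])
    have m: "fr (\<lambda>v. c i * B v $ i) (\<lambda>v. v$3) = const_fun (c i) * fr (\<lambda>v. B v $ i) (\<lambda>v. v$3)" for i
      by (rule fr_const_mult[OF AB(2) form_coord])
    show ?thesis unfolding A add[OF form_add[OF f f] f] add[OF f f] m ..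
  qed
  have hc: "\<exists>c :: 3 \<Rightarrow> complex. h i = const_fun (c 1) * crd 1 3 + const_fun (c 2) * crd 2 3 + const_fun (c 3) * crd 3 3" for i
  proof -
    obtain c where "\<forall>v. L' v $ i = (\<Sum>j\<in>UNIV. c j * v$j)" using form1_coeffs[OF D(2)] by blast
    thus ?thesis unfolding h_def crd_def using lin[of "\<lambda>v. L' v $ i" c "\<lambda>v. v", OF _ form_coord] by blast
  qed
  have ch: "\<exists>c :: 3 \<Rightarrow> complex. crd i 3 = const_fun (c 1) * h 1 + const_fun (c 2) * h 2 + const_fun (c 3) * h 3" for i
  proof -
    obtain c where c: "\<forall>v. L v $ i = (\<Sum>j\<in>UNIV. c j * v$j)" using form1_coeffs[OF D(1)] by blast
    have "v $ i = (\<Sum>j\<in>UNIV. c j * L' v $ j)" for v using c D(3)[of v] by metis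
    thus ?thesis unfolding h_def crd_def using lin[of "\<lambda>v. v $ i" c L', OF _ D(2)] by blast
  qed
  show ?thesis
  proof (rule that[OF hnz[of 3]])
    fix V t assume V: "dvr V t"
    have comb: "val V x \<ge> m" if "x = const_fun (c 1) * y1 + const_fun (c 2) * y2 + const_fun (c 3) * y3" "x \<noteq> 0"
      "val V y1 \<ge> m" "val V y2 \<ge> m" "val V y3 \<ge> m" for x y1 y2 y3 m and c :: "3 \<Rightarrow> complex"
    proof -
      have "const_fun (c 1) * y1 + const_fun (c 2) * y2 = 0 \<or> val V (const_fun (c 1) * y1 + const_fun (c 2) * y2) \<ge> m"
        using that by (intro val_add[OF V] val_const_mult[OF V]) auto
      hence "x = 0 \<or> val V x \<ge> m" unfolding that(1) using that by (intro val_add[OF V] val_const_mult[OF V]) auto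
      thus ?thesis using that(2) by blast
    qed
    define mh where "mh = min (val V (h 3)) (min (val V (h 1)) (val V (h 2)))"
    define mc where "mc = min (val V (crd 3 3)) (min (val V (crd 1 3)) (val V (crd 2 3)))"
    have "val V (h i) \<ge> mc" for i
      using hc[of i] comb[of "h i" _ "crd 1 3" "crd 2 3" "crd 3 3" mc] hnz unfolding mc_def by fastforce
    hence "mh \<ge> mc" unfolding mh_def by simp
    moreover have "val V (crd i 3) \<ge> mh" for i
      using ch[of i] comb[of "crd i 3" _ "h 1" "h 2" "h 3" mh] crd_nonzero unfolding mh_def by fastforce
    hence "mc \<ge> mh" unfolding mc_def by simp
    ultimately have eq: "mh = mc" by simp
    have vi: "val (sub L ` V) (crd i 3) = val V (h i) - val V (h 3)" for i
      unfolding sL val_image by (rule val_divide[OF V hnz hnz])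
    have "line_pullback (sub L ` V) = val V (h 3) - mh"
      unfolding line_pullback_def xy_crd vi mh_def by linarith
    moreover have "line_pullback V = - mc"
      unfolding line_pullback_def xy_crd mc_def using val_crd(2)[OF V] by linarith
    ultimately show "line_pullback (sub L ` V) = line_pullback V + val V (h 3)" using eq by simp
  qed
qed

lemma map_pt_P2:
  assumes "birational_map f" "R \<in> P2" "S \<in> P2" "dominates R (f ` S)"
  shows "map_pt f P2 R = S"
proof -
  interpret birational f by unfold_locales (rule assms(1))
  interpret i: birational "inv_into UNIV f" by unfold_locales (rule birational_map_inv[OF assms(1)])
  let ?R = "inv_into UNIV f ` R"
  have d: "dominates ?R T" if "dominates R (f ` T)" for T
    using that dominates_image[of ?R T] image_inv(1)[of R] by simp
  have "res_local ?R" by (intro i.res_local_image smooth_pt_res_local surfaceD(1)[OF surface_P2] assms)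
  thus ?thesis unfolding map_pt_def
    using P2_separated[OF _ _ assms(3) d d[OF assms(4)]] assms(3,4) by (intro the_equality) blast+
qed

text \<open>Quadratic maps with three distinct base points in the plane, as composites of the
  standard involution with linear isomorphisms. N' and M carry the vertices to the base points of
  the map and of its inverse.\<close>

locale quadratic =
  fixes M M' N N' :: "complex^3 \<Rightarrow> complex^3"
  assumes M: "linear_iso M M'" and N: "linear_iso N N'"
begin

text \<open>Pullback reverses the order of composition: this is the pullback by F.\<close>

definition f :: ratmap where "f = sub N \<circ> J \<circ> sub M"
definition F :: "complex^3 \<Rightarrow> complex^3" where "F v = M (cremona (N v))"
definition p :: "3 \<Rightarrow> point" where "p j = pt (N' (axis j 1))"
definition q :: "3 \<Rightarrow> point" where "q j = pt (M (axis j 1))"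

sublocale sM: birational "sub M" by unfold_locales (rule birational_sub[OF linear_isoD(5)[OF M]])
sublocale sN: birational "sub N" by unfold_locales (rule birational_sub[OF linear_isoD(5)[OF N]])
sublocale sJ: birational J by unfold_locales (rule birational_J)

lemma birational_f: "birational_map f"
  unfolding f_def by (intro birational_map_comp sM.birational_map sN.birational_map birational_J)

sublocale f: birational f by unfold_locales (rule birational_f)

lemma form_map_F: "\<exists>e. form_map e F" and form_F: "form 2 (\<lambda>v. F v $ i)" and f_eq: "f = sub F"
proof -
  obtain e1 e2 e3 where e: "form_map e1 M" "form_map e2 cremona" "form_map e3 N"
    using inverse_maps_form_map linear_isoD(5) M N inverse_maps_cremona by metis
  show "\<exists>e. form_map e F" unfolding F_def using form_map_comp[OF e(1) form_map_comp[OF e(2,3)]] by blast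
  have c: "form 2 (\<lambda>v. cremona v $ i)" for i unfolding cremona_def by (intro form_vector form_coord2)
  have "form (2 * 1) (\<lambda>v. cremona (N v) $ i)" for i by (rule form_comp[OF c linear_isoD(1)[OF N]])
  from form_comp[OF linear_isoD(1)[OF M], of "2 * 1" "\<lambda>v. cremona (N v)", OF this]
  show "form 2 (\<lambda>v. F v $ i)" unfolding F_def by simp
  show "f = sub F" unfolding f_def F_def
    by (rule ext) (simp add: sub_sub[OF e(1) form_map_comp[OF e(2,3)]] sub_sub[OF e(2,3)] sub_sub[OF e(1,2)]
        sub_sub[OF form_map_comp[OF e(1,2)] e(3)])
qed

lemma sub_N_ep: "sub N ` ep j = p j"
  using sub_linear_pt[OF N, of "N' (axis j 1)"] unfolding ep_def p_def linear_isoD(3)[OF N] .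

lemma sub_M_q: "sub M ` q j = ep j" unfolding ep_def q_def by (rule sub_linear_pt[OF M])

lemma p_P2: "p j \<in> P2" and q_P2: "q j \<in> P2"
  unfolding p_def q_def P2_iff using linear_isoD(8)[OF linear_isoD(6)[OF N]] linear_isoD(8)[OF M]
  by (metis axis_eq_0_iff zero_neq_one)+

text \<open>Equal vertices would have equal exceptional divisors, linearly equivalent through the
  function 1, against \<open>ep_not_lin_equiv\<close>.\<close>

lemma inj_p: "inj p" and inj_q: "inj q"
proof -
  have ep: "inj ep"
  proof (rule injI)
    fix a b assume "ep a = ep b"
    have "val V 1 = 0" if V: "V \<in> prime_divisors hexagon" for V
    proof -
      obtain t where "dvr V t" using dvr_prime_divisors surfaceD(1)[OF surface_hexagon] V by metis
      thus ?thesis using val_const[of V t 1] by (simp add: const_fun_simps)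
    qed
    hence "lin_equiv hexagon (total_exceptional (ep a)) (total_exceptional (ep b))"
      unfolding lin_equiv_def \<open>ep a = ep b\<close> by (intro exI[of _ 1]) simp
    thus "a = b" using ep_not_lin_equiv[of a b] by blast
  qed
  show "inj p"
  proof (rule injI)
    fix a b assume "p a = p b"
    thus "a = b" unfolding sub_N_ep[symmetric] sN.image_eq_iff by (rule injD[OF ep])
  qed
  show "inj q"
  proof (rule injI)
    fix a b assume "q a = q b"
    hence "sub M ` q a = sub M ` q b" by simp
    thus "a = b" unfolding sub_M_q by (rule injD[OF ep])
  qed
qed

lemma f_image: "f ` R = sub N ` J ` sub M ` R" unfolding f_def image_comp[symmetric] ..

lemma P2_sub_M: "S \<in> P2 \<Longrightarrow> sub M ` S \<in> P2" using sub_linear_P2[OF M] by blast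

lemma p_indeterminacy: "p j \<in> indeterminacy f P2"
proof -
  have "\<not> dominates (p j) (f ` S)" if "S \<in> P2" for S
    unfolding sub_N_ep[symmetric] f_image sN.dominates_image
    using indeterminacy_J[of j] P2_sub_M[OF that] unfolding indeterminacy_def by blast
  thus ?thesis unfolding indeterminacy_def using p_P2 by blast
qed

lemma inv_f: "inv_into UNIV f = sub M' \<circ> J \<circ> sub N'"
  unfolding f_def
  by (rule inv_unique_comp)
     (auto simp: fun_eq_iff J_J sub_inverse linear_isoD(5)[OF M] linear_isoD(5)[OF N]
        sub_inverse[OF linear_isoD(5)[OF linear_isoD(6)[OF M]]] sub_inverse[OF linear_isoD(5)[OF linear_isoD(6)[OF N]]])

end

text \<open>The inverse map has the same shape with M and N, and p and q, exchanged, so every fact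
  about base points also holds for the inverse.\<close>

sublocale quadratic \<subseteq> inv: quadratic N' N M' M
  rewrites "quadratic.p M = q" and "quadratic.q N' = p" and "quadratic.f N' M' = inv_into UNIV f"
proof -
  show i: "quadratic N' N M' M" using M N by unfold_locales (rule linear_isoD(6); assumption)+
  show "quadratic.p M = q" "quadratic.q N' = p"
    unfolding fun_eq_iff quadratic.p_def[OF i] quadratic.q_def[OF i] p_def q_def by simp_all
  show "quadratic.f N' M' = inv_into UNIV f" unfolding quadratic.f_def[OF i] inv_f ..
qed

context quadratic
begin

lemma q_indeterminacy: "q j \<in> indeterminacy (inv_into UNIV f) P2" by (rule inv.p_indeterminacy)

definition Y :: "point set" where "Y = blowup (range p) P2"

lemma Y_eq: "Y = (`) (sub N) ` hexagon"
proof -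
  have "(`) (sub N) ` range ep = range p" using sub_N_ep by (auto simp: image_iff)
  thus ?thesis unfolding Y_def hexagon_def sN.blowup_image[symmetric] sub_linear_P2[OF N] by simp
qed

lemma f_blowup_q: "(`) f ` blowup (range q) P2 = Y"
proof -
  have 1: "(`) (sub M) ` range q = range ep" using sub_M_q by (auto simp: image_iff)
  have "(`) (sub M) ` blowup (range q) P2 = hexagon"
    unfolding sM.blowup_image[symmetric] 1 sub_linear_P2[OF M] hexagon_def ..
  hence "(`) (sub N) ` (`) J ` (`) (sub M) ` blowup (range q) P2 = Y" unfolding Y_eq by (simp only: J_hexagon)
  moreover have "(`) f ` X = (`) (sub N) ` (`) J ` (`) (sub M) ` X" for X by (simp add: f_image image_comp o_def)
  ultimately show ?thesis by simp
qed

lemma smooth_pt_Y: "R \<in> Y \<Longrightarrow> smooth_pt R"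
  using surfaceD(1)[OF surface_blowup[OF surface_P2]] p_P2 unfolding Y_def by blast

lemma lin_equiv_Y:
  "lin_equiv Y (total_exceptional (f ` q j)) (\<lambda>V. line_pullback V - (\<Sum>i\<in>UNIV - {j}. total_exceptional (p i) V))"
proof -
  obtain g where g: "g \<noteq> 0" "\<And>V t. dvr V t \<Longrightarrow> line_pullback (sub N ` V) = line_pullback V + val V g"
    using line_pullback_linear[OF N] by blast
  obtain h where h: "h \<noteq> 0" "\<And>V. V \<in> prime_divisors hexagon \<Longrightarrow>
      total_exceptional (J ` ep j) V - (line_pullback V - (\<Sum>i\<in>UNIV - {j}. total_exceptional (ep i) V)) = val V h"
    using lin_equiv_J[of j] unfolding lin_equiv_def by blast
  have 1: "total_exceptional (f ` q j) (sub N ` V) = total_exceptional (J ` ep j) V" for V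
    unfolding f_image sub_M_q by (rule sN.total_exceptional_image)
  have 2: "total_exceptional (p i) (sub N ` V) = total_exceptional (ep i) V" for i V
    unfolding sub_N_ep[symmetric] by (rule sN.total_exceptional_image)
  have "h / g \<noteq> 0" using g h by simp
  moreover have "total_exceptional (f ` q j) (sub N ` V) - (line_pullback (sub N ` V) - (\<Sum>i\<in>UNIV - {j}. total_exceptional (p i) (sub N ` V))) = val V (h / g)"
    if V: "V \<in> prime_divisors hexagon" for V
  proof -
    obtain t where t: "dvr V t" using dvr_prime_divisors surfaceD(1)[OF surface_hexagon] V by metis
    show ?thesis
      unfolding 1 2 g(2)[OF t] val_divide[OF t h(1) g(1)] using h(2)[OF V] by linarith
  qed
  ultimately show ?thesis unfolding Y_eq sN.lin_equiv_image by (rule lin_equivI)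
qed

lemma successive_p:
  assumes "distinct is" "set is = UNIV"
  shows "successive_centers (map p is) P2" "successive_blowup (map p is) P2 = Y"
    "successive_centers (map q is) P2" "successive_blowup (map q is) P2 = blowup (range q) P2"
proof -
  have b: "blowup {} P2 = P2" unfolding blowup_def by simp
  have "distinct (map p is)" "distinct (map q is)" using assms inj_p inj_q by (auto simp: distinct_map inj_on_subset)
  moreover have "set (map p is) = range p" "set (map q is) = range q" using assms(2) by auto
  ultimately show "successive_centers (map p is) P2" "successive_blowup (map p is) P2 = Y"
    "successive_centers (map q is) P2" "successive_blowup (map q is) P2 = blowup (range q) P2"
    using successive_blowup_distinct[of "map p is" "{}"] successive_blowup_distinct[of "map q is" "{}"]
      image_subsetI[of UNIV p P2, OF p_P2] image_subsetI[of UNIV q P2, OF q_P2]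
    unfolding b Y_def by simp_all
qed

lemma base_points_f: "base_points f p q"
proof -
  have l: "distinct [1, 2, 3 :: 3]" "set [1, 2, 3 :: 3] = UNIV" by simp (simp only: UNIV_3 list.set)
  show ?thesis unfolding base_points_def
  proof (rule exI[of _ "[1, 2, 3]"], rule exI[of _ "[1, 2, 3]"], rule exI[of _ Y], intro conjI allI)
    show "(\<lambda>S. f ` S) ` successive_blowup (map q [1, 2, 3]) P2 = Y" unfolding successive_p(4)[OF l] by (rule f_blowup_q)
  qed (rule l successive_p[OF l] lin_equiv_Y successive_p(2)[OF l, symmetric])+
qed

lemma inj_3_bij: "inj \<rho> \<Longrightarrow> bij (\<rho> :: 3 \<Rightarrow> 3)"
  by (simp add: finite_UNIV_inj_surj bij_def)

text \<open>A base point of f in the plane must be among the blown-up points, because the lift is an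
  isomorphism between the two blown-up surfaces; three of them leave no room for others. The points
  p' and q' are relabelled by the same permutation: otherwise two descriptions of one class e_j^-
  would make the exceptional curves over two different base points linearly equivalent.\<close>

lemma base_points_unique:
  assumes "base_points f p' q'"
  shows "\<exists>\<rho>. bij \<rho> \<and> p' = p \<circ> \<rho> \<and> q' = q \<circ> \<rho>"
proof -
  obtain "is" js Y' where bp: "distinct is \<and> set is = UNIV \<and> distinct js \<and> set js = UNIV
        \<and> successive_centers (map p' is) P2 \<and> successive_centers (map q' js) P2
        \<and> Y' = successive_blowup (map p' is) P2
        \<and> (\<lambda>S. f ` S) ` successive_blowup (map q' js) P2 = Y'
        \<and> (\<forall>j. lin_equiv Y' (total_exceptional (f ` q' j))
                 (\<lambda>V. line_pullback V - (\<Sum>i\<in>UNIV - {j}. total_exceptional (p' i) V)))"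
    using assms[unfolded base_points_def] by (elim exE)
  have c1: "successive_centers (map p' is) P2" using bp by (elim conjE)
  have c2: "successive_centers (map q' js) P2" using bp by (elim conjE)
  have i1: "distinct is" using bp by (elim conjE)
  have i2: "set is = UNIV" using bp by (elim conjE)
  have i3: "set js = UNIV" using bp by (elim conjE)
  have Y': "Y' = successive_blowup (map p' is) P2" using bp by (elim conjE)
  have eq: "(\<lambda>S. f ` S) ` successive_blowup (map q' js) P2 = Y'" using bp by (elim conjE)
  have "\<forall>j. lin_equiv Y' (total_exceptional (f ` q' j))
         (\<lambda>V. line_pullback V - (\<Sum>i\<in>UNIV - {j}. total_exceptional (p' i) V))" using bp by (elim conjE)
  hence le: "lin_equiv Y' (total_exceptional (f ` q' j))
         (\<lambda>V. line_pullback V - (\<Sum>i\<in>UNIV - {j}. total_exceptional (p' i) V))" for j by (rule spec)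
  note sp = surface_successive[OF surface_P2 c1] and sq = surface_successive[OF surface_P2 c2]
  have "p j \<in> range p'" for j
  proof (rule ccontr)
    assume "p j \<notin> range p'"
    hence "p j \<in> successive_blowup (map p' is) P2" using i2 by (intro successive_blowup_keep p_P2) auto
    then obtain S where S: "S \<in> successive_blowup (map q' js) P2" "p j = f ` S" using eq Y' by blast
    obtain S0 where "S0 \<in> P2" "dominates S S0" using surfaceD(2)[OF sq S(1)] by blast
    hence "dominates (p j) (f ` S0)" unfolding S(2) f.dominates_image by blast
    thus False using p_indeterminacy[of j] \<open>S0 \<in> P2\<close> unfolding indeterminacy_def by blast
  qed
  hence "\<forall>j. \<exists>i. p j = p' i" by blast
  then obtain r where r: "\<And>j. p j = p' (r j)" using choice[of "\<lambda>j i. p j = p' i"] by blast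
  have "q j \<in> range q'" for j
  proof (rule ccontr)
    assume "q j \<notin> range q'"
    hence "q j \<in> successive_blowup (map q' js) P2" using i3 by (intro successive_blowup_keep q_P2) auto
    hence "f ` q j \<in> successive_blowup (map p' is) P2" using eq Y' by blast
    then obtain S0 where S0: "S0 \<in> P2" "dominates (f ` q j) S0" using surfaceD(2)[OF sp] by blast
    have "dominates (q j) (inv_into UNIV f ` S0)"
      using S0(2) f.dominates_image[of "q j" "inv_into UNIV f ` S0"] f.image_inv(1)[of S0] by simp
    thus False using q_indeterminacy[of j] S0(1) unfolding indeterminacy_def by blast
  qed
  hence "\<forall>j. \<exists>i. q j = q' i" by blast
  then obtain s where s: "\<And>j. q j = q' (s j)" using choice[of "\<lambda>j i. q j = q' i"] by blast
  have br: "bij r"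
  proof (intro inj_3_bij injI)
    fix a b assume "r a = r b"
    hence "p a = p b" unfolding r by simp
    thus "a = b" by (rule injD[OF inj_p])
  qed
  have bs: "bij s"
  proof (intro inj_3_bij injI)
    fix a b assume "s a = s b"
    hence "q a = q b" unfolding s by simp
    thus "a = b" by (rule injD[OF inj_q])
  qed
  define \<rho> \<tau> where "\<rho> = inv_into UNIV r" and "\<tau> = inv_into UNIV s"
  have bij: "bij \<rho>" "bij \<tau>" unfolding \<rho>_def \<tau>_def using br bs bij_imp_bij_inv by blast+
  have p': "p' = p \<circ> \<rho>" and q': "q' = q \<circ> \<tau>"
    unfolding fun_eq_iff o_def r s \<rho>_def \<tau>_def using br bs by (simp_all add: bij_is_surj surj_f_inv_f)
  have Y: "Y' = Y"
    using Y'  successive_p(2)[of "map \<rho> is"] bij(1) i1 i2 unfolding p' by (simp add: distinct_map bij_def inj_on_subset)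
  have "\<tau> j = \<rho> j" for j
  proof (rule ccontr)
    assume ne: "\<tau> j \<noteq> \<rho> j"
    have sum: "(\<Sum>i\<in>UNIV - {j}. total_exceptional (p' i) V) = (\<Sum>i\<in>UNIV - {\<rho> j}. total_exceptional (p i) V)" for V
    proof -
      have img: "UNIV - {\<rho> j} = \<rho> ` (UNIV - {j})" using bij(1) by (simp add: image_set_diff bij_def)
      have "inj_on \<rho> (UNIV - {j})" using bij_is_inj[OF bij(1)] by (rule inj_on_subset) simp
      thus ?thesis unfolding img p' by (simp add: sum.reindex)
    qed
    obtain g where g: "g \<noteq> 0" "\<And>V. V \<in> prime_divisors Y \<Longrightarrow> total_exceptional (f ` q (\<tau> j)) V
        - (line_pullback V - (\<Sum>i\<in>UNIV - {\<rho> j}. total_exceptional (p i) V)) = val V g"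
      using le[of j] unfolding Y sum q' o_def lin_equiv_def by blast
    obtain h where h: "h \<noteq> 0" "\<And>V. V \<in> prime_divisors Y \<Longrightarrow> total_exceptional (f ` q (\<tau> j)) V
        - (line_pullback V - (\<Sum>i\<in>UNIV - {\<tau> j}. total_exceptional (p i) V)) = val V h"
      using lin_equiv_Y[of "\<tau> j"] unfolding lin_equiv_def by blast
    have "lin_equiv Y (total_exceptional (p (\<tau> j))) (total_exceptional (p (\<rho> j)))"
      unfolding lin_equiv_def
    proof (intro exI[of _ "g / h"] conjI ballI)
      show "g / h \<noteq> 0" using g h by simp
      fix V assume V: "V \<in> prime_divisors Y"
      then obtain t where t: "dvr V t" using dvr_prime_divisors smooth_pt_Y by metis
      have "(\<Sum>i\<in>UNIV - {k}. total_exceptional (p i) V) = (\<Sum>i\<in>UNIV. total_exceptional (p i) V) - total_exceptional (p k) V" for k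
        by (simp add: sum_diff1)
      thus "total_exceptional (p (\<tau> j)) V - total_exceptional (p (\<rho> j)) V = val V (g / h)"
        unfolding val_divide[OF t g(1) h(1)] using g(2)[OF V] h(2)[OF V] by simp
    qed
    hence "lin_equiv hexagon (total_exceptional (ep (\<tau> j))) (total_exceptional (ep (\<rho> j)))"
      unfolding Y_eq sN.lin_equiv_image sub_N_ep[symmetric] sN.total_exceptional_image .
    thus False using ep_not_lin_equiv[OF ne] by blast
  qed
  hence "\<tau> = \<rho>" by blast
  thus ?thesis using bij(1) p' q' by blast
qed

lemma regular:
  assumes "cremona (N v) \<noteq> 0"
  shows "dominates (pt v) (f ` pt (F v))" "map_pt f P2 (pt v) = pt (F v)" "pt v \<notin> indeterminacy f P2" "pt (F v) \<in> P2"
proof -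
  obtain e where "form_map e F" using form_map_F by blast
  thus d: "dominates (pt v) (f ` pt (F v))" unfolding f_eq by (rule dominates_sub_pt)
  have "v \<noteq> 0"
  proof
    assume "v = 0"
    hence "N v = 0" using linear_isoD(8)[OF N] by blast
    thus False using assms by (simp add: cremona_def vec3_eq_iff)
  qed
  hence v: "pt v \<in> P2" unfolding P2_iff by blast
  show P: "pt (F v) \<in> P2" unfolding P2_iff F_def using linear_isoD(8)[OF M] assms by blast
  show "map_pt f P2 (pt v) = pt (F v)" by (rule map_pt_P2[OF birational_f v P d])
  show "pt v \<notin> indeterminacy f P2" unfolding indeterminacy_def using P d by blast
qed

lemma cremona_zero: "cremona w = 0 \<Longrightarrow> w \<noteq> 0 \<Longrightarrow> \<exists>k c. c \<noteq> 0 \<and> w = c *s axis k 1"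
proof -
  assume c: "cremona w = 0" and w: "w \<noteq> 0"
  obtain k where k: "w$k \<noteq> 0" using vec_nonzeroE[OF w] by blast
  have "w$(k+1) = 0" "w$(k+2) = 0"
    using arg_cong[OF c, of "\<lambda>v. v$(k+1)"] arg_cong[OF c, of "\<lambda>v. v$(k+2)"] k unfolding cremona_nth by (simp_all add: idx3)
  hence "w $ i = (w$k *s axis k 1) $ i" for i using idx3(1)[of i k] by auto
  thus ?thesis using k unfolding Finite_Cartesian_Product.vec_eq_iff by blast
qed

lemma indeterminacy_f: "indeterminacy f P2 = range p"
proof
  show "range p \<subseteq> indeterminacy f P2" using p_indeterminacy by blast
  show "indeterminacy f P2 \<subseteq> range p"
  proof
    fix R assume R: "R \<in> indeterminacy f P2"
    then obtain v where v: "v \<noteq> 0" "R = pt v" unfolding indeterminacy_def P2_iff by blast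
    have "cremona (N v) = 0" using regular(3) R v(2) by blast
    moreover have "N v \<noteq> 0" using linear_isoD(8)[OF N] v(1) by blast
    ultimately obtain k c where "c \<noteq> 0" "N v = c *s axis k 1" using cremona_zero by blast
    moreover from this have "v = c *s N' (axis k 1)"
      using linear_isoD(4)[OF N, of v] linear_isoD(7)[OF linear_isoD(6)[OF N]] by simp
    ultimately have "R = p k" unfolding v(2) p_def using pt_scale by metis
    thus "R \<in> range p" by blast
  qed
qed

end

context quadratic
begin

lemma indeterminacy_inv_f: "indeterminacy (inv_into UNIV f) P2 = range q"
  by (rule inv.indeterminacy_f)

lemma local_iso:
  assumes "\<And>i. N v $ i \<noteq> 0"
  shows "f ` pt (F v) = pt v"
proof -
  let ?w = "N v"
  have c: "cremona (cremona ?w) = (?w$1 * ?w$2 * ?w$3) *s ?w" unfolding cremona_def vec3_eq_iff by simp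
  have "J ` pt (cremona ?w) = pt ?w" by (rule sub_pt_eq[OF inverse_maps_cremona c]) (use assms in simp)
  moreover have "sub M ` pt (F v) = pt (cremona ?w)" unfolding F_def by (rule sub_linear_pt[OF M])
  ultimately show ?thesis unfolding f_image using sub_linear_pt[OF N, of v] by simp
qed

end

section \<open>Orbit data without exponential growth\<close>

lemma set_orbit_basis: "set (orbit_basis n) = insert H (\<Union>i\<in>UNIV. E i ` {..<n i})"
  unfolding orbit_basis_def UNIV_3 by (auto simp: atLeast0LessThan)

lemma distinct_orbit_basis: "distinct (orbit_basis n)"
  unfolding orbit_basis_def by (auto simp: distinct_map inj_on_def)

lemma sum_orbit_basis:
  fixes g :: "basis_elt \<Rightarrow> 'a::comm_monoid_add"
  shows "(\<Sum>c\<in>set (orbit_basis n). g c) = g H + (\<Sum>i\<in>UNIV. \<Sum>m<n i. g (E i m))"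
proof -
  have "(\<Sum>c\<in>(\<Union>i\<in>UNIV. E i ` {..<n i}). g c) = (\<Sum>i\<in>UNIV. \<Sum>c\<in>E i ` {..<n i}. g c)"
    by (rule sum.UNION_disjoint) auto
  also have "\<dots> = (\<Sum>i\<in>UNIV. \<Sum>m<n i. g (E i m))"
    by (intro sum.cong refl) (simp add: sum.reindex inj_on_def)
  finally show ?thesis unfolding set_orbit_basis by (subst sum.insert) auto
qed

lemma orbit_eigenvector:
  assumes "poly (map_poly complex_of_real (orbit_char_poly n \<sigma>)) z = 0"
  obtains v :: "basis_elt \<Rightarrow> complex" where "\<exists>b\<in>set (orbit_basis n). v b \<noteq> 0"
    "\<And>b. b \<in> set (orbit_basis n) \<Longrightarrow> (\<Sum>c\<in>set (orbit_basis n). v c * of_real (orbit_map n \<sigma> c b)) = z * v b"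
proof -
  define B N where "B = orbit_basis n" and "N = length B"
  define A where "A = Matrix.mat N N (\<lambda>(r, c). orbit_map n \<sigma> (B ! c) (B ! r))"
  define C where "C = map_mat complex_of_real A"
  have A: "A \<in> carrier_mat N N" and C: "C \<in> carrier_mat N N" unfolding C_def A_def by auto
  have "orbit_char_poly n \<sigma> = char_poly A" unfolding orbit_char_poly_def A_def N_def B_def Let_def ..
  moreover have "char_poly C = map_poly complex_of_real (char_poly A)"
    unfolding C_def by (rule of_real_hom.char_poly_hom[OF A])
  ultimately have "map_poly complex_of_real (orbit_char_poly n \<sigma>) = char_poly C" by simp
  hence "eigenvalue C z" using assms eigenvalue_root_char_poly[OF C] by simp
  then obtain u where u: "u \<in> carrier_vec N" "u \<noteq> 0\<^sub>v N" "C *\<^sub>v u = z \<cdot>\<^sub>v u"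
    unfolding eigenvalue_def eigenvector_def using C by auto
  define idx where "idx b = (THE c. c < N \<and> B ! c = b)" for b
  have dB: "distinct B" unfolding B_def by (rule distinct_orbit_basis)
  have idx: "idx (B ! c) = c" if "c < N" for c
    unfolding idx_def using that nth_eq_iff_index_eq[OF dB] unfolding N_def by (intro the_equality) auto
  define v where "v b = vec_index u (idx b)" for b
  have v: "v (B ! c) = vec_index u c" if "c < N" for c unfolding v_def using idx[OF that] by simp
  have bij: "bij_betw (nth B) {..<N} (set B)" unfolding N_def by (rule bij_betw_nth[OF dB]) auto
  show ?thesis
  proof (rule that[of v])
    show "\<exists>b\<in>set (orbit_basis n). v b \<noteq> 0"
    proof (rule ccontr)
      assume "\<not> ?thesis"
      hence "vec_index u c = 0" if "c < N" for c using v[OF that] that nth_mem[of c B] unfolding N_def B_def by auto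
      hence "u = 0\<^sub>v N" using u(1) by (intro eq_vecI) auto
      thus False using u(2) by simp
    qed
    fix b assume "b \<in> set (orbit_basis n)"
    then obtain r where r: "r < N" "b = B ! r" unfolding B_def[symmetric] N_def by (metis in_set_conv_nth)
    have "(\<Sum>c\<in>set B. v c * of_real (orbit_map n \<sigma> c b)) = (\<Sum>c<N. v (B ! c) * of_real (orbit_map n \<sigma> (B ! c) b))"
      by (rule sum.reindex_bij_betw[OF bij, symmetric])
    also have "\<dots> = (\<Sum>c<N. C $$ (r, c) * vec_index u c)"
      by (rule sum.cong) (use r v in \<open>auto simp: C_def A_def mult.commute\<close>)
    also have "\<dots> = vec_index (C *\<^sub>v u) r"
      using r(1) C u(1) by (simp add: scalar_prod_def atLeast0LessThan)
    also have "\<dots> = z * v b" unfolding u(3) using r v u(1) by simp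
    finally show "(\<Sum>c\<in>set (orbit_basis n). v c * of_real (orbit_map n \<sigma> c b)) = z * v b" unfolding B_def .
  qed
qed

text \<open>T shifts each chain of the E j m down by one and acts as a quadratic transformation on H
  and the three initial elements. The equations compare the coefficients of H, of an element before
  the end of a chain, and of the last element.\<close>

lemma orbit_eigen_equations:
  assumes n: "\<forall>i. n i \<ge> 1" and \<sigma>: "bij \<sigma>"
    and eig: "\<And>b. b \<in> set (orbit_basis n) \<Longrightarrow> (\<Sum>c\<in>set (orbit_basis n). v c * of_real (orbit_map n \<sigma> c b)) = (z::complex) * v b"
  shows "z * v H = 2 * v H + (\<Sum>k\<in>UNIV. v (E k 0))"
    "m + 1 < n j \<Longrightarrow> z * v (E j m) = v (E j (m + 1))"
    "z * v (E j (n j - 1)) = - v H - (\<Sum>k\<in>UNIV. v (E k 0)) + v (E (\<sigma> j) 0)"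
proof -
  have split: "(\<Sum>m<n i. g m) = g 0 + (\<Sum>m<n i - 1. g (Suc m))" for i and g :: "nat \<Rightarrow> complex"
    using sum.lessThan_Suc_shift[of g "n i - 1"] n[rule_format, of i] by simp
  have inE: "E j m \<in> set (orbit_basis n)" if "m < n j" for j m using that unfolding set_orbit_basis by auto
  have exp: "(\<Sum>c\<in>set (orbit_basis n). v c * of_real (orbit_map n \<sigma> c b)) =
      v H * of_real (orbit_map n \<sigma> H b) + (\<Sum>i\<in>UNIV. v (E i 0) * of_real (orbit_map n \<sigma> (E i 0) b)
        + (\<Sum>m<n i - 1. v (E i (Suc m)) * of_real (orbit_map n \<sigma> (E i (Suc m)) b)))" for b
    unfolding sum_orbit_basis split ..
  have "H \<in> set (orbit_basis n)" unfolding set_orbit_basis by simp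
  from eig[OF this] show "z * v H = 2 * v H + (\<Sum>k\<in>UNIV. v (E k 0))"
    unfolding exp by (simp add: unit_coord_def mult.commute)
  have UN: "(\<Sum>j\<in>S. unit_coord (E j (n j - 1)) (E k m)) = (if k \<in> S \<and> m = n k - 1 then 1 else 0)" for S k m
  proof -
    have "(\<Sum>j\<in>S. unit_coord (E j (n j - 1)) (E k m)) = (\<Sum>j\<in>S. if j = k then (if m = n k - 1 then 1 else 0) else 0)"
      by (intro sum.cong) (auto simp: unit_coord_def)
    thus ?thesis by simp
  qed
  have co: "(\<Sum>m'<n i - 1. v (E i (Suc m')) * of_real (orbit_map n \<sigma> (E i (Suc m')) (E k m))) =
      (if i = k \<and> m < n k - 1 then v (E k (Suc m)) else 0)" for i k m
  proof -
    have "(\<Sum>m'<n i - 1. v (E i (Suc m')) * of_real (orbit_map n \<sigma> (E i (Suc m')) (E k m))) =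
      (\<Sum>m'<n i - 1. if m' = m then (if i = k then v (E k (Suc m)) else 0) else 0)"
      by (intro sum.cong) (auto simp: unit_coord_def)
    thus ?thesis by simp
  qed
  have val: "z * v (E k m) = - (if m = n k - 1 then v H else 0)
      + (\<Sum>i\<in>UNIV. - (if m = n k - 1 \<and> inv_into UNIV \<sigma> i \<noteq> k then v (E i 0) else 0))
      + (if m < n k - 1 then v (E k (Suc m)) else 0)" if "m < n k" for k m
  proof -
    have "(\<Sum>i\<in>UNIV. if i = k \<and> m < n k - 1 then v (E k (Suc m)) else 0) = (if m < n k - 1 then v (E k (Suc m)) else 0)"
      by (cases "m < n k - 1") simp_all
    moreover have "orbit_map n \<sigma> H (E k m) = - (if m = n k - 1 then 1 else 0)"
      by (simp only: orbit_map.simps UN) (simp add: unit_coord_def)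
    hence "v H * of_real (orbit_map n \<sigma> H (E k m)) = - (if m = n k - 1 then v H else 0)" by simp
    moreover have "v (E i 0) * of_real (orbit_map n \<sigma> (E i 0) (E k m)) = - (if m = n k - 1 \<and> inv_into UNIV \<sigma> i \<noteq> k then v (E i 0) else 0)" for i
    proof -
      have "orbit_map n \<sigma> (E i 0) (E k m) = - (if m = n k - 1 \<and> inv_into UNIV \<sigma> i \<noteq> k then 1 else 0)"
        by (simp only: orbit_map.simps UN) (auto simp: unit_coord_def)
      thus ?thesis by simp
    qed
    ultimately have "- (if m = n k - 1 then v H else 0)
      + ((\<Sum>i\<in>UNIV. - (if m = n k - 1 \<and> inv_into UNIV \<sigma> i \<noteq> k then v (E i 0) else 0))
      + (if m < n k - 1 then v (E k (Suc m)) else 0)) = z * v (E k m)"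
      using eig[OF inE[OF that]] unfolding exp co sum.distrib by (simp only:)
    thus ?thesis by (simp only: add.assoc)
  qed
  show "z * v (E j m) = v (E j (m + 1))" if "m + 1 < n j"
    using val[of m j] that by simp
  have "(\<Sum>i\<in>UNIV. - (if inv_into UNIV \<sigma> i \<noteq> j then v (E i 0) else 0)) = - (\<Sum>k\<in>UNIV. v (E k 0)) + v (E (\<sigma> j) 0)"
  proof -
    have "(inv_into UNIV \<sigma> i \<noteq> j) \<longleftrightarrow> i \<noteq> \<sigma> j" for i
      using \<sigma> by (metis bij_inv_eq_iff)
    hence "(\<Sum>i\<in>UNIV. - (if inv_into UNIV \<sigma> i \<noteq> j then v (E i 0) else 0)) = (\<Sum>i\<in>UNIV. (if i = \<sigma> j then v (E i 0) else 0) - v (E i 0))"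
      by (intro sum.cong) auto
    also have "\<dots> = v (E (\<sigma> j) 0) - (\<Sum>k\<in>UNIV. v (E k 0))" unfolding sum_subtractf by simp
    finally show ?thesis by simp
  qed
  thus "z * v (E j (n j - 1)) = - v H - (\<Sum>k\<in>UNIV. v (E k 0)) + v (E (\<sigma> j) 0)"
    using val[of "n j - 1" j] n[rule_format, of j] by simp
qed

text \<open>Apart from the shifts along the chains, T is the action of a quadratic transformation on
  the span of H and three exceptional classes; this is its isometry property for the Hermitian
  Lorentz form.\<close>

lemma lorentz_identity:
  fixes h a b c :: complex
  shows "(cmod (2 * h + (a + b + c)))\<^sup>2 - ((cmod (- h - (a + b + c) + a))\<^sup>2 + (cmod (- h - (a + b + c) + b))\<^sup>2 + (cmod (- h - (a + b + c) + c))\<^sup>2)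
    = (cmod h)\<^sup>2 - ((cmod a)\<^sup>2 + (cmod b)\<^sup>2 + (cmod c)\<^sup>2)"
  unfolding cmod_power2 by (simp add: power2_eq_square algebra_simps)

text \<open>\<open>T\<close> preserves the Lorentz form \<open>\<bar>v\<^sub>H\<bar>\<^sup>2 - \<Sum>\<bar>v\<^sub>E\<bar>\<^sup>2\<close>. An eigenvector for \<open>\<bar>z\<bar> > 1\<close> is isotropic and
  orthogonal to every fixed vector; a fixed vector \<open>w\<close> with \<open>w \<cdot> w \<ge> 0\<close> thus rules it out. Below, \<open>w\<close> is
  the canonical class or \<open>H - E\<^sub>i\<close>.\<close>

lemma orbit_isotropic:
  assumes n: "\<forall>i. n i \<ge> 1" and \<sigma>: "bij \<sigma>" and z: "cmod z > 1"
    and eq: "z * v H = 2 * v H + (\<Sum>k\<in>UNIV. v (E k 0))"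
    "\<And>j m. m + 1 < n j \<Longrightarrow> z * v (E j m) = v (E j (m + 1))"
    "\<And>j. z * v (E j (n j - 1)) = - v H - (\<Sum>k\<in>UNIV. v (E k 0)) + v (E (\<sigma> j) 0)"
  shows "(cmod (v H))\<^sup>2 = (\<Sum>i\<in>UNIV. \<Sum>m<n i. (cmod (v (E i m)))\<^sup>2)"
proof -
  define A where "A = (\<Sum>k\<in>UNIV. v (E k 0))"
  \<comment> \<open>Multiplication by z shifts the j-th chain: its first term drops out, and a new
    last term appears.\<close>
  have S: "(cmod z)\<^sup>2 * (\<Sum>m<n j. (cmod (v (E j m)))\<^sup>2) =
     (\<Sum>m<n j. (cmod (v (E j m)))\<^sup>2) - (cmod (v (E j 0)))\<^sup>2 + (cmod (- v H - A + v (E (\<sigma> j) 0)))\<^sup>2" for j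
  proof -
    obtain k where k: "n j = Suc k" using n[rule_format, of j] by (cases "n j") auto
    have "(cmod z)\<^sup>2 * (\<Sum>m<n j. (cmod (v (E j m)))\<^sup>2) = (\<Sum>m<Suc k. (cmod (z * v (E j m)))\<^sup>2)"
      unfolding k by (simp add: sum_distrib_left norm_mult power_mult_distrib distrib_left)
    also have "\<dots> = (\<Sum>m<k. (cmod (v (E j (Suc m))))\<^sup>2) + (cmod (- v H - A + v (E (\<sigma> j) 0)))\<^sup>2"
      using eq(2)[of _ j] eq(3)[of j] unfolding k A_def by simp
    also have "(\<Sum>m<k. (cmod (v (E j (Suc m))))\<^sup>2) = (\<Sum>m<n j. (cmod (v (E j m)))\<^sup>2) - (cmod (v (E j 0)))\<^sup>2"
      unfolding k sum.lessThan_Suc_shift[of _ k] by simp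
    finally show ?thesis .
  qed
  have re: "(\<Sum>j\<in>UNIV. (cmod (- v H - A + v (E (\<sigma> j) 0)))\<^sup>2) = (\<Sum>j\<in>UNIV. (cmod (- v H - A + v (E j 0)))\<^sup>2)"
    by (rule sum.reindex_bij_betw[OF \<sigma>, of "\<lambda>k. (cmod (- v H - A + v (E k 0)))\<^sup>2"])
  define Q where "Q = (cmod (v H))\<^sup>2 - (\<Sum>i\<in>UNIV. \<Sum>m<n i. (cmod (v (E i m)))\<^sup>2)"
  have "(cmod z)\<^sup>2 * (cmod (v H))\<^sup>2 = (cmod (2 * v H + A))\<^sup>2"
    using eq(1) unfolding A_def by (metis norm_mult power_mult_distrib)
  hence "(cmod z)\<^sup>2 * Q = (cmod (2 * v H + A))\<^sup>2 - (\<Sum>j\<in>UNIV. (cmod (- v H - A + v (E j 0)))\<^sup>2)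
      - (\<Sum>i\<in>UNIV. \<Sum>m<n i. (cmod (v (E i m)))\<^sup>2) + (\<Sum>i\<in>UNIV. (cmod (v (E i 0)))\<^sup>2)"
    unfolding Q_def right_diff_distrib sum_distrib_left[of "(cmod z)\<^sup>2" _ UNIV] S sum.distrib sum_subtractf re by simp
  also have "\<dots> = Q"
    using lorentz_identity[of "v H" "v (E 1 0)" "v (E 2 0)" "v (E 3 0)"] unfolding Q_def A_def sum_3 by simp
  finally have "((cmod z)\<^sup>2 - 1) * Q = 0" by (simp add: algebra_simps)
  moreover have "(cmod z)\<^sup>2 > 1" using z by (simp add: one_less_power)
  ultimately show ?thesis unfolding Q_def by simp
qed

text \<open>Orthogonality to the canonical class means that the entries at the E j m sum to -3h.
  With isotropy, the sum of all |v_E + h/3|^2 equals |h|^2 (N/9 - 1), where N = n 1 + n 2 + n 3. For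
  N at most 9 every term vanishes, so v is a multiple of the canonical class, which T fixes; as z
  \<noteq> 1, v would be zero.\<close>

lemma no_root_small:
  assumes n: "\<forall>i. n i \<ge> 1" and \<sigma>: "bij \<sigma>" and le: "n 1 + n 2 + n 3 \<le> 9" and z: "cmod z > 1"
  shows "poly (map_poly complex_of_real (orbit_char_poly n \<sigma>)) z \<noteq> 0"
proof
  assume "poly (map_poly complex_of_real (orbit_char_poly n \<sigma>)) z = 0"
  then obtain v where v: "\<exists>b\<in>set (orbit_basis n). v b \<noteq> 0"
    "\<And>b. b \<in> set (orbit_basis n) \<Longrightarrow> (\<Sum>c\<in>set (orbit_basis n). v c * of_real (orbit_map n \<sigma> c b)) = z * v b"
    by (rule orbit_eigenvector) blast
  note eq = orbit_eigen_equations[OF n \<sigma> v(2)]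
  note iso = orbit_isotropic[OF n \<sigma> z eq]
  define h A where "h = v H" and "A = (\<Sum>k\<in>UNIV. v (E k 0))"
  define s where "s = (\<Sum>i\<in>UNIV. \<Sum>m<n i. v (E i m))"
  have T: "z * (\<Sum>m<n j. v (E j m)) = (\<Sum>m<n j. v (E j m)) - v (E j 0) - h - A + v (E (\<sigma> j) 0)" for j
  proof -
    obtain k where k: "n j = Suc k" using n[rule_format, of j] by (cases "n j") auto
    have "z * (\<Sum>m<n j. v (E j m)) = (\<Sum>m<k. v (E j (Suc m))) + (- h - A + v (E (\<sigma> j) 0))"
      using eq(2)[of _ j] eq(3)[of j] unfolding k A_def h_def by (simp add: sum_distrib_left distrib_left)
    also have "(\<Sum>m<k. v (E j (Suc m))) = (\<Sum>m<n j. v (E j m)) - v (E j 0)"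
      unfolding k sum.lessThan_Suc_shift[of _ k] by simp
    finally show ?thesis by simp
  qed
  have re: "(\<Sum>j\<in>UNIV. v (E (\<sigma> j) 0)) = A"
    unfolding A_def by (rule sum.reindex_bij_betw[OF \<sigma>, of "\<lambda>k. v (E k 0)"])
  have "z * s = s - A - 3 * h - 3 * A + A"
    unfolding s_def sum_distrib_left[of z _ UNIV] T sum.distrib sum_subtractf re A_def[symmetric] by simp
  moreover have "z * h = 2 * h + A" using eq(1) unfolding h_def A_def .
  moreover have "(z - 1) * (3 * h + s) = 3 * (z * h) + z * s - 3 * h - s" by (simp add: algebra_simps)
  ultimately have "(z - 1) * (3 * h + s) = 0" by simp
  moreover have "z \<noteq> 1" using z by auto
  ultimately have s: "s = - 3 * h" by (simp add: eq_neg_iff_add_eq_0 add.commute)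
  have expand: "(cmod (x + h / 3))\<^sup>2 = (cmod x)\<^sup>2 + 2 / 3 * Re (cnj h * x) + (cmod h)\<^sup>2 / 9" for x
  proof -
    obtain a b c d where "x = Complex a b" "h = Complex c d" by (metis complex_surj)
    thus ?thesis unfolding cmod_power2 by (simp add: power2_eq_square algebra_simps add_divide_distrib)
  qed
  have "(\<Sum>i\<in>UNIV. \<Sum>m<n i. (cmod (v (E i m) + h / 3))\<^sup>2) =
     (\<Sum>i\<in>UNIV. \<Sum>m<n i. (cmod (v (E i m)))\<^sup>2) + 2 / 3 * Re (cnj h * s) + real (n 1 + n 2 + n 3) * ((cmod h)\<^sup>2 / 9)"
    unfolding expand s_def sum.distrib
    by (simp add: sum_distrib_left sum_3 algebra_simps)
  also have "\<dots> = (cmod h)\<^sup>2 * (real (n 1 + n 2 + n 3) / 9 - 1)"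
  proof -
    have "Re (cnj h * s) = - 3 * (cmod h)\<^sup>2" unfolding s cmod_power2 by (simp add: power2_eq_square)
    thus ?thesis using iso unfolding h_def by (simp add: algebra_simps)
  qed
  also have "\<dots> \<le> 0" using le by (intro mult_nonneg_nonpos) (simp_all add: divide_le_eq)
  finally have "(\<Sum>i\<in>UNIV. \<Sum>m<n i. (cmod (v (E i m) + h / 3))\<^sup>2) \<le> 0" .
  moreover have nn: "0 \<le> (\<Sum>m<n i. (cmod (v (E i m) + h / 3))\<^sup>2)" for i by (intro sum_nonneg) simp
  ultimately have "(\<Sum>i\<in>UNIV. \<Sum>m<n i. (cmod (v (E i m) + h / 3))\<^sup>2) = 0"
    by (meson antisym sum_nonneg)
  hence "(\<Sum>m<n i. (cmod (v (E i m) + h / 3))\<^sup>2) = 0" for i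
    using sum_nonneg_eq_0_iff[of UNIV "\<lambda>i. \<Sum>m<n i. (cmod (v (E i m) + h / 3))\<^sup>2"] nn by simp
  hence "(cmod (v (E i m) + h / 3))\<^sup>2 = 0" if "m < n i" for i m
    using sum_nonneg_eq_0_iff[of "{..<n i}" "\<lambda>m. (cmod (v (E i m) + h / 3))\<^sup>2"] that by simp
  hence vE: "v (E i m) = - h / 3" if "m < n i" for i m using that by (simp add: add_eq_0_iff)
  have "A = - h" unfolding A_def sum_3 using vE n by (simp add: Suc_le_eq)
  hence "(z - 1) * h = 0" using \<open>z * h = 2 * h + A\<close> by (simp add: algebra_simps)
  hence "h = 0" using \<open>z \<noteq> 1\<close> by simp
  thus False using v(1) vE unfolding set_orbit_basis h_def by auto
qed

text \<open>H - E l 0 is fixed because the chain of l has length one and \<sigma> l = l.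
  Orthogonality to it gives \<open>v (E l 0) = - v H\<close>, and isotropy then leaves nothing for
  the other entries. So v is a multiple of the fixed class, which is impossible for z \<noteq>
  1.\<close>

lemma no_root_pencil:
  assumes n: "\<forall>i. n i \<ge> 1" and \<sigma>: "bij \<sigma>" and l: "n l = 1" "\<sigma> l = l" and z: "cmod z > 1"
  shows "poly (map_poly complex_of_real (orbit_char_poly n \<sigma>)) z \<noteq> 0"
proof
  assume "poly (map_poly complex_of_real (orbit_char_poly n \<sigma>)) z = 0"
  then obtain v where v: "\<exists>b\<in>set (orbit_basis n). v b \<noteq> 0"
    "\<And>b. b \<in> set (orbit_basis n) \<Longrightarrow> (\<Sum>c\<in>set (orbit_basis n). v c * of_real (orbit_map n \<sigma> c b)) = z * v b"
    by (rule orbit_eigenvector) blast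
  note eq = orbit_eigen_equations[OF n \<sigma> v(2)]
  note iso = orbit_isotropic[OF n \<sigma> z eq]
  have z1: "z \<noteq> 1" using z by auto
  have "(z - 1) * (v H + v (E l 0)) = 0"
    using eq(1) eq(3)[of l] l by (simp add: algebra_simps)
  hence vl: "v (E l 0) = - v H" using z1 by (simp add: eq_neg_iff_add_eq_0 add.commute)
  have "(\<Sum>i\<in>UNIV. \<Sum>m<n i. (cmod (v (E i m)))\<^sup>2) = (\<Sum>m<n l. (cmod (v (E l m)))\<^sup>2) + (\<Sum>i\<in>UNIV - {l}. \<Sum>m<n i. (cmod (v (E i m)))\<^sup>2)"
    by (rule sum.remove) simp_all
  hence "(\<Sum>i\<in>UNIV - {l}. \<Sum>m<n i. (cmod (v (E i m)))\<^sup>2) = 0"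
    using iso vl l(1) by simp
  hence "\<forall>i\<in>UNIV - {l}. (\<Sum>m<n i. (cmod (v (E i m)))\<^sup>2) = 0"
    by (subst (asm) sum_nonneg_eq_0_iff) (auto intro: sum_nonneg)
  hence vi: "v (E i m) = 0" if "i \<noteq> l" "m < n i" for i m
    using that sum_nonneg_eq_0_iff[of "{..<n i}" "\<lambda>m. (cmod (v (E i m)))\<^sup>2"] by simp
  have "(\<Sum>k\<in>UNIV. v (E k 0)) = v (E l 0) + (\<Sum>k\<in>UNIV - {l}. v (E k 0))" by (rule sum.remove) simp_all
  also have "(\<Sum>k\<in>UNIV - {l}. v (E k 0)) = 0" using vi n by (intro sum.neutral) (simp add: Suc_le_eq)
  finally have "(z - 1) * v H = 0" using eq(1) vl by (simp add: algebra_simps)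
  hence h: "v H = 0" using z1 by simp
  have "v (E i m) = 0" if "m < n i" for i m
    by (cases "i = l") (use vi vl h l(1) that in auto)
  thus False using v(1) h unfolding set_orbit_basis by auto
qed

text \<open>The stages of a realization for a map that rotates the three lines: \<open>\<Phi>\<^sup>2 (w i) = v i\<close> forces an
  orbit to end early unless its natural end point has already been blown up.\<close>

lemma rotation_orbit_sum:
  fixes n :: "3 \<Rightarrow> nat" and \<sigma> :: "3 \<Rightarrow> 3" and v w :: "3 \<Rightarrow> 'a"
  assumes ret: "\<And>i. (\<Phi> ^^ 2) (w i) = v i" and n: "\<And>i. n i \<ge> 1" and \<sigma>: "bij \<sigma>" and ijk: "distinct [i, j, k]"
    and hit: "\<And>l. (\<Phi> ^^ (n l - 1)) (w l) = v (\<sigma> l)"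
    and i: "\<And>m l. m < n i - 1 \<Longrightarrow> (\<Phi> ^^ m) (w i) \<noteq> v l"
    and j: "\<And>m l. m < n j - 1 \<Longrightarrow> l \<noteq> \<sigma> i \<Longrightarrow> (\<Phi> ^^ m) (w j) \<noteq> v l"
    and k: "\<And>m. m < n k - 1 \<Longrightarrow> (\<Phi> ^^ m) (w k) \<noteq> v (\<sigma> k)"
  shows "n 1 + n 2 + n 3 \<le> 9"
proof -
  have U: "x = i \<or> x = j \<or> x = k" for x :: 3 using ijk exhaust_3[of i] exhaust_3[of j] exhaust_3[of k] exhaust_3[of x] by auto
  have tot: "n 1 + n 2 + n 3 = n i + n j + n k"
    using ijk exhaust_3[of i] exhaust_3[of j] exhaust_3[of k] by auto
  have inj: "\<sigma> a = \<sigma> b \<longleftrightarrow> a = b" for a b using \<sigma> by (auto simp: bij_def inj_def)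
  have add: "(\<Phi> ^^ (a + b)) x = (\<Phi> ^^ a) ((\<Phi> ^^ b) x)" for a b x by (simp add: funpow_add)
  have I: "n i - 1 \<le> m" if "(\<Phi> ^^ m) (w i) = v l" for m l using i[of m l] that by (meson not_le)
  have J: "n j - 1 \<le> m" if "(\<Phi> ^^ m) (w j) = v l" "l \<noteq> \<sigma> i" for m l using j[of m l] that by (meson not_le)
  have K: "n k - 1 \<le> m" if "(\<Phi> ^^ m) (w k) = v (\<sigma> k)" for m using k[of m] that by (meson not_le)
  have ni: "n i \<le> 3" using I[OF ret] by simp
  \<comment> \<open>The two steps from \<open>w l\<close> to \<open>v l\<close> pass through
    \<open>v (\<sigma> l)\<close> after n l - 1 of them; 3 - n l steps remain.\<close>
  have bk: "(\<Phi> ^^ (3 - n l)) (v (\<sigma> l)) = v l" if "n l \<le> 3" for l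
  proof -
    have "(3 - n l) + (n l - 1) = 2" using that n[of l] by simp
    thus ?thesis using add[of "3 - n l" "n l - 1" "w l"] hit[of l] ret[of l] by simp
  qed
  have via: "(\<Phi> ^^ (a + 2)) (w l) = (\<Phi> ^^ a) (v l)" for a l using add[of a 2 "w l"] ret[of l] by simp
  note bi = bk[OF ni]
  have neq: "i \<noteq> j" "i \<noteq> k" "j \<noteq> k" using ijk by auto
  \<comment> \<open>In each case a base point that is still available is reached within a computable
    number of steps: two steps lead to the own point, and if this one has been used up,
    \<open>bk\<close> leads on to another. The order of the stages decides which points are still
    available.\<close>
  consider "\<sigma> i = i" | "\<sigma> i = j" | "\<sigma> i = k" using U by blast
  thus ?thesis
  proof cases
    case 1
    hence nj: "n j \<le> 3" using J[OF ret[of j]] neq by simp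
    consider "\<sigma> j = j" "\<sigma> k = k" | "\<sigma> j = k" "\<sigma> k = j" using U[of "\<sigma> j"] U[of "\<sigma> k"] 1 neq inj by metis
    thus ?thesis
    proof cases
      case 1
      have "n k \<le> 3" using K[of 2] ret[of k] 1 by simp
      thus ?thesis using ni nj tot by simp
    next
      case 2
      have "n k - 1 \<le> 3 - n j + 2" using K[OF trans[OF via]] bk[OF nj] 2 by simp
      thus ?thesis using ni nj tot by simp
    qed
  next
    case 2
    have nj: "n j - 1 \<le> 3 - n i + 2" using J[OF trans[OF via]] bi 2 neq by simp
    consider "\<sigma> j = i" "\<sigma> k = k" | "\<sigma> j = k" "\<sigma> k = i" using U[of "\<sigma> j"] U[of "\<sigma> k"] 2 neq inj by metis
    thus ?thesis
    proof cases
      case 1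
      have "n k \<le> 3" using K[of 2] ret[of k] 1 by simp
      thus ?thesis using ni nj tot n[of j] by simp
    next
      case b: 2
      \<comment> \<open>The number of steps from \<open>v k\<close> to \<open>v i\<close>: the orbit
        of \<open>w j\<close> is at \<open>v k\<close> after n j - 1 steps and at \<open>v i\<close>
        after 3 - n i + 2.\<close>
      define c where "c = 3 - n i + 2 - (n j - 1)"
      have c: "c + (n j - 1) = 3 - n i + 2" unfolding c_def using nj by simp
      have "(\<Phi> ^^ c) (v k) = v i"
        using add[of c "n j - 1" "w j"] via[of "3 - n i" j] hit[of j] bi 2 b unfolding c by simp
      hence "n k - 1 \<le> c + 2" using K[OF trans[OF via]] b by simp
      thus ?thesis using ni nj tot n[of j] n[of k] n[of i] unfolding c_def by simp
    qed
  next
    case 3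
    hence nj: "n j \<le> 3" using J[OF ret[of j]] neq by simp
    consider "\<sigma> k = i" "\<sigma> j = j" | "\<sigma> k = j" "\<sigma> j = i" using U[of "\<sigma> j"] U[of "\<sigma> k"] 3 neq inj by metis
    thus ?thesis
    proof cases
      case 1
      have "n k - 1 \<le> 3 - n i + 2" using K[OF trans[OF via]] bi 3 1 by simp
      thus ?thesis using ni nj tot by simp
    next
      case b: 2
      have "(\<Phi> ^^ (3 - n j + (3 - n i))) (v k) = v j"
        using add[of "3 - n j" "3 - n i" "v k"] bi bk[OF nj] 3 b by simp
      hence "n k - 1 \<le> 3 - n j + (3 - n i) + 2" using K[OF trans[OF via]] b by simp
      thus ?thesis using ni nj tot by simp
    qed
  qed
qed

section \<open>Quadratic maps fixing the triangle\<close>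

text \<open>The permutations of Z/3 are translations and reflections; a reflection has a fixed
  element and reverses the cyclic order.\<close>

lemma bij_3_cases:
  assumes "bij (\<pi> :: 3 \<Rightarrow> 3)"
  obtains "\<And>j. \<pi> j = j" | "\<And>j. \<pi> j = j + 1" | "\<And>j. \<pi> j = j + 2" | l where "\<pi> l = l" "\<And>j. \<pi> (j + 1) = \<pi> j + 2" "\<And>j. \<pi> (j + 2) = \<pi> j + 1"
proof -
  have ne: "\<pi> 1 \<noteq> \<pi> 2" "\<pi> 1 \<noteq> \<pi> 3" "\<pi> 2 \<noteq> \<pi> 3" using inj_eq[OF bij_is_inj[OF assms]] by simp_all
  have num3: "(1::3) \<noteq> 2" "(1::3) \<noteq> 3" "(2::3) \<noteq> 3" "(2::3) \<noteq> 1" "(3::3) \<noteq> 1" "(3::3) \<noteq> 2" by simp_all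
  have ex3: "(\<exists>l. Q l) \<longleftrightarrow> Q 1 \<or> Q 2 \<or> Q 3" for Q :: "3 \<Rightarrow> bool" using exhaust_3 by metis
  have "(\<forall>j. \<pi> j = j) \<or> (\<forall>j. \<pi> j = j + 1) \<or> (\<forall>j. \<pi> j = j + 2) \<or> (\<exists>l. \<pi> l = l \<and> (\<forall>j. \<pi> (j + 1) = \<pi> j + 2) \<and> (\<forall>j. \<pi> (j + 2) = \<pi> j + 1))"
    unfolding forall_3 ex3 using ne exhaust_3[of "\<pi> 1"] exhaust_3[of "\<pi> 2"] exhaust_3[of "\<pi> 3"]
    by (elim disjE; simp only: idx_num num3 simp_thms)
  thus ?thesis using that by blast
qed

lemma bij_3_rotation_or_reflection:
  assumes "bij (\<pi> :: 3 \<Rightarrow> 3)"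
  obtains "\<And>j. \<pi> (j + 1) = \<pi> j + 1" "\<And>j. \<pi> (j + 2) = \<pi> j + 2" | "\<And>j. \<pi> (j + 1) = \<pi> j + 2" "\<And>j. \<pi> (j + 2) = \<pi> j + 1"
proof -
  have c: "j + 1 + 1 = j + 2" "j + 2 + 1 = j + 1 + 2" for j :: 3 by (simp_all add: idx3)
  show ?thesis by (rule bij_3_cases[OF assms]) (use that c in \<open>simp_all\<close>)
qed

section \<open>Matrices with zero diagonal and the normal form built from them\<close>

definition hollow :: "(3 \<Rightarrow> 3 \<Rightarrow> complex) \<Rightarrow> complex^3 \<Rightarrow> complex^3" where
  "hollow b y = (\<chi> j. b j (j+1) * y$(j+1) + b j (j+2) * y$(j+2))"

definition hollow_det :: "(3 \<Rightarrow> 3 \<Rightarrow> complex) \<Rightarrow> complex" where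
  "hollow_det b = b 1 2 * b 2 3 * b 3 1 + b 1 3 * b 2 1 * b 3 2"

text \<open>The adjugate of the matrix with zero diagonal and off-diagonal entries b, divided by its
  determinant \<open>hollow_det b\<close>.\<close>

definition hollow_inv :: "(3 \<Rightarrow> 3 \<Rightarrow> complex) \<Rightarrow> complex^3 \<Rightarrow> complex^3" where
  "hollow_inv b v = (\<chi> j. (b j (j+2) * b (j+2) (j+1) * v$(j+1) + b j (j+1) * b (j+1) (j+2) * v$(j+2)
     - b (j+1) (j+2) * b (j+2) (j+1) * v$j) / hollow_det b)"

lemma hollow_det_eq: "hollow_det b = b j (j+1) * b (j+1) (j+2) * b (j+2) j + b j (j+2) * b (j+1) j * b (j+2) (j+1)"
  unfolding hollow_det_def using exhaust_3[of j] by (elim disjE; simp only: idx_num mult_ac)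

lemma hollow_nth: "hollow b y $ j = b j (j+1) * y$(j+1) + b j (j+2) * y$(j+2)"
  unfolding hollow_def by simp

lemma hollow_inv_nth:
  "hollow_inv b v $ j = (b j (j+2) * b (j+2) (j+1) * v$(j+1) + b j (j+1) * b (j+1) (j+2) * v$(j+2)
     - b (j+1) (j+2) * b (j+2) (j+1) * v$j) / hollow_det b"
  "hollow_inv b v $ (j+1) = (b (j+1) j * b j (j+2) * v$(j+2) + b (j+1) (j+2) * b (j+2) j * v$j
     - b (j+2) j * b j (j+2) * v$(j+1)) / hollow_det b"
  "hollow_inv b v $ (j+2) = (b (j+2) (j+1) * b (j+1) j * v$j + b (j+2) j * b j (j+1) * v$(j+1)
     - b j (j+1) * b (j+1) j * v$(j+2)) / hollow_det b"
  unfolding hollow_inv_def by (simp_all only: vec_lambda_beta idx3(6-9))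

lemma linear_isoI:
  "(\<And>i. form 1 (\<lambda>v. L v $ i)) \<Longrightarrow> (\<And>i. form 1 (\<lambda>v. L' v $ i)) \<Longrightarrow> (\<And>v. L (L' v) = v) \<Longrightarrow> (\<And>v. L' (L v) = v) \<Longrightarrow> linear_iso L L'"
  unfolding linear_iso_def by blast

lemma linear_iso_comp:
  assumes "linear_iso L L'" "linear_iso K K'"
  shows "linear_iso (L \<circ> K) (K' \<circ> L')"
proof (rule linear_isoI)
  note L = linear_isoD[OF assms(1)] and K = linear_isoD[OF assms(2)]
  show "form 1 (\<lambda>v. (L \<circ> K) v $ i)" for i using form_comp[OF L(1) K(1)] by simp
  show "form 1 (\<lambda>v. (K' \<circ> L') v $ i)" for i using form_comp[OF K(2) L(2)] by simp
qed (simp_all add: linear_isoD(3,4)[OF assms(1)] linear_isoD(3,4)[OF assms(2)])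

lemma hollow_iso:
  assumes "hollow_det b \<noteq> 0"
  shows "linear_iso (hollow_inv b) (hollow b)"
proof (rule linear_isoI)
  show "form 1 (\<lambda>v. hollow b v $ i)" for i unfolding hollow_nth by (intro form_add form_const_mult form_coord)
  have "form 1 (\<lambda>v. (1 / hollow_det b) * (b i (i+2) * b (i+2) (i+1) * v$(i+1) + b i (i+1) * b (i+1) (i+2) * v$(i+2)
     - b (i+1) (i+2) * b (i+2) (i+1) * v$i))" for i by (intro form_add form_minus form_diff form_const_mult form_coord)
  thus "form 1 (\<lambda>v. hollow_inv b v $ i)" for i unfolding hollow_inv_nth(1) by simp
  show "hollow b (hollow_inv b v) = v" for v
    unfolding Finite_Cartesian_Product.vec_eq_iff
  proof
    fix j
    have "hollow b (hollow_inv b v) $ j = (b j (j+1) * (b (j+1) j * b j (j+2) * v$(j+2) + b (j+1) (j+2) * b (j+2) j * v$j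
       - b (j+2) j * b j (j+2) * v$(j+1)) + b j (j+2) * (b (j+2) (j+1) * b (j+1) j * v$j + b (j+2) j * b j (j+1) * v$(j+1)
       - b j (j+1) * b (j+1) j * v$(j+2))) / hollow_det b"
      unfolding hollow_nth hollow_inv_nth(2,3) by (simp add: add_divide_distrib)
    also have "\<dots> = (hollow_det b * v$j) / hollow_det b" unfolding hollow_det_eq[of b j] by (simp add: algebra_simps)
    finally show "hollow b (hollow_inv b v) $ j = v $ j" using assms by simp
  qed
  show "hollow_inv b (hollow b v) = v" for v
    unfolding Finite_Cartesian_Product.vec_eq_iff
  proof
    fix j
    have "hollow b v $ (j+1) = b (j+1) (j+2) * v$(j+2) + b (j+1) j * v$j" "hollow b v $ (j+2) = b (j+2) j * v$j + b (j+2) (j+1) * v$(j+1)"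
      unfolding hollow_nth by (simp_all only: idx3(6-9))
    hence "hollow_inv b (hollow b v) $ j = (hollow_det b * v$j) / hollow_det b"
      unfolding hollow_inv_nth(1) hollow_nth[of b v j] hollow_det_eq[of b j] by (simp add: algebra_simps)
    thus "hollow_inv b (hollow b v) $ j = v $ j" using assms by simp
  qed
qed

definition perm :: "(3 \<Rightarrow> 3) \<Rightarrow> complex^3 \<Rightarrow> complex^3" where
  "perm \<pi> u = (\<chi> k. u $ inv_into UNIV \<pi> k)"

lemma perm_nth: "bij \<pi> \<Longrightarrow> perm \<pi> u $ \<pi> j = u $ j"
  unfolding perm_def by (simp add: bij_def)

lemma perm_iso: "bij \<pi> \<Longrightarrow> linear_iso (perm \<pi>) (perm (inv_into UNIV \<pi>))"
proof (rule linear_isoI)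
  show "form 1 (\<lambda>v. perm \<rho> v $ i)" for \<rho> i unfolding perm_def vec_lambda_beta by (rule form_coord)
  thus "form 1 (\<lambda>v. perm (inv_into UNIV \<pi>) v $ i)" for i .
qed (auto simp: perm_def Finite_Cartesian_Product.vec_eq_iff bij_def surj_f_inv_f inv_inv_eq)

text \<open>For u = \<open>hollow_inv b v\<close> one has v_j u_j = b_{j,j+1} u_j u_{j+1} +
  b_{j,j+2} u_j u_{j+2}, and u_j u_{j+1} is the coordinate of index j+2 of \<open>cremona u\<close>.
  So the linear map that follows the involution has the entries of b with the two of each row
  exchanged.\<close>

definition flip :: "(3 \<Rightarrow> 3 \<Rightarrow> complex) \<Rightarrow> 3 \<Rightarrow> 3 \<Rightarrow> complex" where
  "flip b j k = (if k = j + 1 then b j (j+2) else b j (j+1))"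

lemma hollow_det_flip: "hollow_det (flip b) = hollow_det b"
  unfolding hollow_det_def flip_def idx_num by simp

lemma hollow_flip: "hollow (flip b) y $ j = b j (j+2) * y$(j+1) + b j (j+1) * y$(j+2)"
  unfolding hollow_nth flip_def using idx3(5)[of j] by simp

lemma dc_ne_e_aux:
  fixes x y :: complex
  shows "- x / y * (u / w) = p / q \<Longrightarrow> y \<noteq> 0 \<Longrightarrow> w \<noteq> 0 \<Longrightarrow> q \<noteq> 0 \<Longrightarrow> x * q * u = - (y * w * p)"
  by (simp add: field_simps) (metis minus_minus)

lemma hollow_inv_edge_aux:
  fixes x y :: complex
  shows "x \<noteq> 0 \<Longrightarrow> (x * y * t + z * 0 - w * y * 1) / D = y * x / D * (t - w / x)"
    "x \<noteq> 0 \<Longrightarrow> y \<noteq> 0 \<Longrightarrow> (z * 0 + w * u * 1 - u * x * t) / D = - u / y * (y * x / D * (t - w / x))"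
    "u \<noteq> 0 \<Longrightarrow> q \<noteq> 0 \<Longrightarrow> y \<noteq> 0 \<Longrightarrow> (y * p * 1 + u * q * t - z * 0) / D = u * q / D * (t - (p / q) / (- u / y))"
  by (cases "D = 0"; simp add: field_simps)+

lemma evec_eq_0_iff: "t \<noteq> 0 \<Longrightarrow> evec k t $ i = 0 \<longleftrightarrow> i = k"
  using idx3(1)[of i k] by (elim disjE; simp add: idx3(2-))

text \<open>Here \<open>hollow b\<close> is the inverse of N, and its columns are the base points.
  Their entries off the diagonal are non-zero because the base points avoid the nodes.\<close>

locale triangle_map =
  fixes b :: "3 \<Rightarrow> 3 \<Rightarrow> complex" and \<pi> :: "3 \<Rightarrow> 3"
  assumes offdiag: "j \<noteq> k \<Longrightarrow> b j k \<noteq> 0" and det: "hollow_det b \<noteq> 0" and bij_\<pi>: "bij \<pi>"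
begin

sublocale quadratic "perm \<pi> \<circ> hollow (flip b)" "hollow_inv (flip b) \<circ> perm (inv_into UNIV \<pi>)" "hollow_inv b" "hollow b"
proof
  have "linear_iso (hollow (flip b)) (hollow_inv (flip b))" using linear_isoD(6)[OF hollow_iso] det hollow_det_flip by simp
  thus "linear_iso (perm \<pi> \<circ> hollow (flip b)) (hollow_inv (flip b) \<circ> perm (inv_into UNIV \<pi>))"
    by (rule linear_iso_comp[OF perm_iso[OF bij_\<pi>]])
  show "linear_iso (hollow_inv b) (hollow b)" by (rule hollow_iso[OF det])
qed

lemma off [simp]: "b j (j+1) \<noteq> 0" "b j (j+2) \<noteq> 0" "b (j+1) j \<noteq> 0" "b (j+2) j \<noteq> 0" "b (j+1) (j+2) \<noteq> 0" "b (j+2) (j+1) \<noteq> 0"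
  by (rule offdiag, simp add: idx3(2-))+

lemma F_nth: "F v $ \<pi> j = v $ j * hollow_inv b v $ j"
proof -
  let ?u = "hollow_inv b v"
  have "F v $ \<pi> j = hollow (flip b) (cremona ?u) $ j" by (simp add: F_def perm_nth[OF bij_\<pi>])
  also have "\<dots> = ?u $ j * hollow b ?u $ j"
    unfolding hollow_flip unfolding hollow_nth cremona_nth by (simp only: idx3(6-9)) (simp add: algebra_simps)
  also have "\<dots> = v $ j * ?u $ j" unfolding linear_isoD(4)[OF N] by (rule mult.commute)
  finally show ?thesis .
qed

text \<open>On the j-th line, \<open>c j\<close> is the coordinate of the base point p j, and f
  multiplies the coordinate by \<open>d j\<close>, up to the correction \<open>turn\<close>. With
  the same correction, \<open>e j\<close> is the coordinate of q j on the image line.\<close>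

definition c :: "3 \<Rightarrow> complex" where "c j = b (j+2) j / b (j+1) j"
definition d :: "3 \<Rightarrow> complex" where "d j = - b j (j+1) / b j (j+2)"
definition e :: "3 \<Rightarrow> complex" where "e j = b (j+2) (j+1) / b (j+1) (j+2)"

lemma cde_nonzero [simp]: "c j \<noteq> 0" "d j \<noteq> 0" "e j \<noteq> 0" unfolding c_def d_def e_def by simp_all

text \<open>The relation behind all orbits. If \<pi> is a three-cycle, two steps from q j apply the
  factors of the lines j+1 and j+2 and end at p j. If \<pi> is the identity, it turns
  \<open>d j ^ n j = d 1 * d 2 * d 3\<close> into the arrival of q j at p j after n j - 1
  steps.\<close>

lemma d_return: "d (j+1) * d (j+2) * e j = c j"
proof -
  have "d (j+1) = - b (j+1) (j+2) / b (j+1) j" "d (j+2) = - b (j+2) j / b (j+2) (j+1)"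
    unfolding d_def by (simp_all only: idx3(6-9))
  thus ?thesis unfolding c_def e_def by simp
qed

text \<open>Up to a non-zero factor, the difference of the two sides is
  \<open>hollow_det b\<close>.\<close>

lemma dc_ne_e: "d j * c j \<noteq> e j"
proof
  assume "d j * c j = e j"
  hence "b j (j+1) * b (j+1) (j+2) * b (j+2) j = - (b j (j+2) * b (j+1) j * b (j+2) (j+1))"
    unfolding c_def d_def e_def by (rule dc_ne_e_aux) simp_all
  hence "hollow_det b = 0" unfolding hollow_det_eq[of b j] by simp
  thus False using det by simp
qed

text \<open>The coordinate of \<open>edge_pt\<close> depends on the cyclic order of the lines, which \<open>\<pi>\<close> may reverse.\<close>

definition rot :: bool where "rot \<longleftrightarrow> (\<forall>j. \<pi> (j+1) = \<pi> j + 1)"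
definition turn :: "complex \<Rightarrow> complex" where "turn s = (if rot then s else inverse s)"

lemma turn: "turn (turn s) = s" "turn (s * t) = turn s * turn t" "turn s = 0 \<longleftrightarrow> s = 0" "turn s = turn t \<longleftrightarrow> s = t"
  unfolding turn_def by simp_all

lemma turn_evec:
  assumes "s \<noteq> 0" "v $ \<pi> j = 0" "v $ \<pi> (j+1) = a" "v $ \<pi> (j+2) = a * s"
  shows "v = (if rot then a else a * s) *s evec (\<pi> j) (turn s)"
  unfolding Finite_Cartesian_Product.vec_eq_iff
proof
  fix i
  show "v $ i = ((if rot then a else a * s) *s evec (\<pi> j) (turn s)) $ i"
  proof (rule bij_3_rotation_or_reflection[OF bij_\<pi>])
    assume *: "\<And>j. \<pi> (j + 1) = \<pi> j + 1" "\<And>j. \<pi> (j + 2) = \<pi> j + 2"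
    hence "rot" unfolding rot_def by blast
    thus ?thesis using idx3(1)[of i "\<pi> j"] assms * unfolding turn_def by auto
  next
    assume *: "\<And>j. \<pi> (j + 1) = \<pi> j + 2" "\<And>j. \<pi> (j + 2) = \<pi> j + 1"
    hence "\<not> rot" using idx3(5)[of "\<pi> 1"] unfolding rot_def by metis
    thus ?thesis using idx3(1)[of i "\<pi> j"] assms * unfolding turn_def by auto
  qed
qed

lemma turn_edge_pt:
  assumes "s \<noteq> 0" "a \<noteq> 0" "v $ \<pi> j = 0" "v $ \<pi> (j+1) = a" "v $ \<pi> (j+2) = a * s"
  shows "pt v = edge_pt (\<pi> j) (turn s)"
  unfolding edge_pt_evec by (subst turn_evec[OF assms(1,3-5)], rule pt_scale) (use assms in auto)

lemma p_edge: "p j = edge_pt j (c j)"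
proof -
  have "hollow b (axis j 1) $ j = 0" "hollow b (axis j 1) $ (j+1) = b (j+1) j" "hollow b (axis j 1) $ (j+2) = b (j+2) j"
    unfolding hollow_nth by (simp_all only: idx3(6-9) axis3) (simp_all add: idx3(2-))
  hence "hollow b (axis j 1) $ i = (b (j+1) j *s evec j (c j)) $ i" for i using idx3(1)[of i j] unfolding c_def by auto
  hence "hollow b (axis j 1) = b (j+1) j *s evec j (c j)" unfolding Finite_Cartesian_Product.vec_eq_iff by blast
  thus ?thesis unfolding p_def edge_pt_evec by (simp add: pt_scale)
qed

lemma q_edge: "q j = edge_pt (\<pi> j) (turn (e j))"
proof -
  let ?u = "hollow (flip b) (axis j 1)"
  have "?u $ j = 0" "?u $ (j+1) = b (j+1) (j+2)" "?u $ (j+2) = b (j+2) (j+1)"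
    unfolding hollow_flip by (simp_all only: idx3(6-9) axis3) (simp_all add: idx3(2-))
  thus ?thesis unfolding q_def
    by (intro turn_edge_pt[of _ "b (j+1) (j+2)"]) (simp_all add: perm_nth[OF bij_\<pi>] e_def)
qed

text \<open>Along the j-th line, the linear factors with indices j+1 and j+2 are proportional and
  vanish at \<open>c j\<close>. Cancelling this common zero leaves a map of degree one, with p j as
  the only base point on the line. The third factor vanishes where \<open>d j * t = e j\<close>,
  which is the coordinate whose image is that of q j.\<close>

lemma hollow_inv_edge:
  "hollow_inv b (evec j t) $ (j+1) = b j (j+2) * b (j+1) j / hollow_det b * (t - c j)"
  "hollow_inv b (evec j t) $ (j+2) = d j * hollow_inv b (evec j t) $ (j+1)"
  "hollow_inv b (evec j t) $ j = b j (j+1) * b (j+1) (j+2) / hollow_det b * (t - e j / d j)"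
proof -
  show *: "hollow_inv b (evec j t) $ (j+1) = b j (j+2) * b (j+1) j / hollow_det b * (t - c j)"
    unfolding hollow_inv_nth(2)[of b _ j] evec_nth c_def by (rule hollow_inv_edge_aux) simp
  show "hollow_inv b (evec j t) $ (j+2) = d j * hollow_inv b (evec j t) $ (j+1)"
    unfolding * unfolding hollow_inv_nth(3)[of b _ j] evec_nth c_def d_def by (rule hollow_inv_edge_aux) simp_all
  show "hollow_inv b (evec j t) $ j = b j (j+1) * b (j+1) (j+2) / hollow_det b * (t - e j / d j)"
    unfolding hollow_inv_nth(1)[of b _ j] evec_nth d_def e_def by (rule hollow_inv_edge_aux) simp_all
qed

lemma F_edge:
  assumes "t \<noteq> 0"
  shows "F (evec j t) = (if rot then hollow_inv b (evec j t) $ (j+1) else hollow_inv b (evec j t) $ (j+1) * (d j * t)) *s evec (\<pi> j) (turn (d j * t))"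
  by (rule turn_evec) (use assms hollow_inv_edge(2)[of j t] in \<open>simp_all add: F_nth\<close>)

lemma hollow_inv_edge_nonzero: "t \<noteq> c j \<Longrightarrow> hollow_inv b (evec j t) $ (j+1) \<noteq> 0"
  unfolding hollow_inv_edge(1) using det by simp

lemma pt_F_edge:
  assumes "t \<noteq> 0" "t \<noteq> c j"
  shows "pt (F (evec j t)) = edge_pt (\<pi> j) (turn (d j * t))"
  unfolding F_edge[OF assms(1)] edge_pt_evec by (rule pt_scale) (use assms hollow_inv_edge_nonzero in auto)

lemma edge_regular:
  assumes "t \<noteq> 0" "t \<noteq> c j"
  shows "dominates (edge_pt j t) (f ` edge_pt (\<pi> j) (turn (d j * t)))" "map_pt f P2 (edge_pt j t) = edge_pt (\<pi> j) (turn (d j * t))"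
    "edge_pt j t \<notin> indeterminacy f P2"
proof -
  have "cremona (hollow_inv b (evec j t)) $ j \<noteq> 0"
    unfolding cremona_nth hollow_inv_edge(2) using hollow_inv_edge_nonzero[OF assms(2)] by simp
  hence "cremona (hollow_inv b (evec j t)) \<noteq> 0" by (metis zero_index)
  from regular[OF this] show "dominates (edge_pt j t) (f ` edge_pt (\<pi> j) (turn (d j * t)))" "map_pt f P2 (edge_pt j t) = edge_pt (\<pi> j) (turn (d j * t))"
    "edge_pt j t \<notin> indeterminacy f P2" unfolding pt_F_edge[OF assms] edge_pt_evec by blast+
qed

text \<open>The assumptions keep the point off the three contracted lines, the zero sets of the
  components of \<open>hollow_inv b v\<close>.\<close>

lemma edge_local_iso:
  assumes "t \<noteq> 0" "t \<noteq> c j" "d j * t \<noteq> e j"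
  shows "f ` edge_pt (\<pi> j) (turn (d j * t)) = edge_pt j t"
proof -
  have "t \<noteq> e j / d j" using assms(3) by (auto simp: field_simps)
  hence "hollow_inv b (evec j t) $ j \<noteq> 0" unfolding hollow_inv_edge(3) using det by simp
  hence "hollow_inv b (evec j t) $ i \<noteq> 0" for i
    using idx3(1)[of i j] hollow_inv_edge_nonzero[OF assms(2)] hollow_inv_edge(2)[of j t] by auto
  from local_iso[OF this] show ?thesis unfolding pt_F_edge[OF assms(1,2)] edge_pt_evec .
qed

definition \<Phi> :: "3 \<times> complex \<Rightarrow> 3 \<times> complex" where "\<Phi> a = (\<pi> (fst a), turn (d (fst a) * snd a))"
definition P :: "3 \<times> complex \<Rightarrow> point" where "P a = edge_pt (fst a) (snd a)"
definition Pl :: "3 \<times> complex \<Rightarrow> ratfun set" where "Pl a = line_place (fst a) (snd a)"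
definition A :: "(3 \<times> complex) set" where "A = {a. snd a \<noteq> 0}"

text \<open>This includes s = \<open>c j\<close>, where f is not regular: the formula for f in a
  punctured neighbourhood on the line is enough for \<open>line_place_pullback\<close>.\<close>

lemma push_line:
  assumes "s \<noteq> 0"
  shows "f ` line_place (\<pi> j) (turn (d j * s)) = line_place j s"
proof -
  obtain k where k: "form_map k F" using form_map_F by blast
  have "isCont (\<lambda>t. turn (d j * t)) s" unfolding turn_def using assms by (cases rot) (auto intro!: continuous_intros)
  hence "((\<lambda>t. turn (d j * t)) \<longlongrightarrow> turn (d j * s)) (at s)" by (rule isContD)
  moreover have "\<forall>\<^sub>F t in at s. turn (d j * t) \<noteq> turn (d j * s)"
    unfolding turn(4) by (simp add: eventually_at_filter)
  ultimately have h: "filterlim (\<lambda>t. turn (d j * t)) (at (turn (d j * s))) (at s)" by (simp add: filterlim_at)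
  have "\<forall>\<^sub>F t in at s. t \<noteq> 0" "\<forall>\<^sub>F t in at s. t \<noteq> c j"
    using poly_eventually_nonzero[of "[:0, 1:]" s] poly_eventually_nonzero[of "[:- c j, 1:]" s] by simp_all
  hence "\<forall>\<^sub>F t in at s. (if rot then hollow_inv b (evec j t) $ (j+1) else hollow_inv b (evec j t) $ (j+1) * (d j * t)) \<noteq> 0
      \<and> F (evec j t) = (if rot then hollow_inv b (evec j t) $ (j+1) else hollow_inv b (evec j t) $ (j+1) * (d j * t)) *s evec (\<pi> j) (turn (d j * t))"
    by eventually_elim (use F_edge hollow_inv_edge_nonzero in auto)
  from line_place_pullback[OF k birational_f[unfolded f_eq] this h] show ?thesis unfolding f_eq by (rule sym)
qed

lemma edge_pt_eq_iff: "edge_pt j s = edge_pt k t \<longleftrightarrow> j = k \<and> s = t" if "s \<noteq> 0" "t \<noteq> 0"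
proof
  assume eq: "edge_pt j s = edge_pt k t"
  have "res_local (edge_pt j s)" unfolding edge_pt_evec using evec_nonzero by (auto intro: res_local_pt)
  moreover have "dominates (edge_pt j s) (edge_pt j s)" "dominates (edge_pt j s) (edge_pt k t)" unfolding eq dominates_def by auto
  ultimately obtain c where c: "c \<noteq> 0" "evec j s = c *s evec k t"
    using pt_separated[of "edge_pt j s" "evec j s" "evec k t"] unfolding edge_pt_evec by auto
  have z: "evec k t $ i = 0 \<longleftrightarrow> i = k" "evec j s $ i = 0 \<longleftrightarrow> i = j" for i
    by (rule evec_eq_0_iff[OF that(2)], rule evec_eq_0_iff[OF that(1)])
  have "j = k" using z[of k] c by simp
  moreover have "c = 1" using arg_cong[OF c(2), of "\<lambda>v. v $ (j+1)"] \<open>j = k\<close> by simp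
  ultimately show "j = k \<and> s = t" using arg_cong[OF c(2), of "\<lambda>v. v $ (j+2)"] by simp
next
  assume "j = k \<and> s = t"
  thus "edge_pt j s = edge_pt k t" by blast
qed

sublocale place_family f A Pl P \<Phi>
proof
  show "inj_on P A" unfolding inj_on_def P_def A_def using edge_pt_eq_iff by (auto simp: prod_eq_iff)
qed (auto simp: birational_f valuation_place_line edge_pt_P2 line_place_dominates push_line P_def Pl_def \<Phi>_def A_def turn(3))

lemma P_indeterminacy: "P (j, c j) \<in> indeterminacy f P2" "P a \<in> indeterminacy f P2 \<Longrightarrow> a \<in> A \<Longrightarrow> \<exists>j. a = (j, c j)"
proof -
  show "P (j, c j) \<in> indeterminacy f P2" using p_indeterminacy[of j] unfolding p_edge P_def by simp
  assume "P a \<in> indeterminacy f P2" "a \<in> A"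
  then obtain j where "P a = P (j, c j)" unfolding indeterminacy_f p_edge P_def by auto
  moreover have "(j, c j) \<in> A" unfolding A_def by simp
  ultimately show "\<exists>j. a = (j, c j)" using P_inj \<open>a \<in> A\<close> by (auto dest: inj_onD)
qed

lemma realizes_identity:
  assumes n: "\<forall>i. n i \<ge> 1" and \<sigma>: "bij \<sigma>" and z: "cmod z > 1"
    and root: "poly (map_poly complex_of_real (orbit_char_poly n \<sigma>)) z = 0"
    and "realizes f n \<sigma>"
  shows "\<pi> = id" "\<sigma> = id"
proof -
  obtain p' q' i j k X1 X2 X3 where bp: "base_points f p' q'" and ijk: "distinct [i, j, k]"
    and s1: "realization_step f p' q' n \<sigma> i P2 X1"
    and s2: "realization_step f p' q' n \<sigma> j X1 X2"
    and s3: "realization_step f p' q' n \<sigma> k X2 X3"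
    using assms(5) unfolding realizes_def by (elim exE conjE)
  obtain \<rho> where \<rho>: "bij \<rho>" "p' = p \<circ> \<rho>" "q' = q \<circ> \<rho>" using base_points_unique[OF bp] by blast
  \<comment> \<open>The end points p and starting points q of the realization as pairs of a line and
    a coordinate; \<rho> translates its labels into lines.\<close>
  define v w where "v l = (\<rho> l, c (\<rho> l))" and "w l = (\<pi> (\<rho> l), turn (e (\<rho> l)))" for l
  have vA: "v l \<in> A" and wA: "w l \<in> A" for l unfolding v_def w_def A_def by (simp_all add: turn(3))
  have pv: "p' l = P (v l)" and qw: "q' l = P (w l)" for l
    unfolding \<rho> v_def w_def P_def by (simp_all add: p_edge q_edge)
  have vI: "P (v l) \<in> indeterminacy f P2" for l unfolding v_def by (rule P_indeterminacy)
  have v_inj: "v l = v m \<longleftrightarrow> l = m" for l m unfolding v_def using inj_eq[OF bij_is_inj[OF \<rho>(1)]] by auto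
  have \<sigma>_inj: "\<sigma> l = \<sigma> m \<longleftrightarrow> l = m" for l m using inj_eq[OF bij_is_inj[OF \<sigma>]] .
  note r1 = realization_step_orbit[OF surface_P2 s1 wA qw vA pv]
  have X1: "P (v l) \<in> X1" if "l \<noteq> \<sigma> i" for l by (rule r1(4)[OF vA P_P2[OF vA] vI]) (use that v_inj in simp)
  note r2 = realization_step_orbit[OF r1(3) s2 wA qw vA pv]
  have X2: "P (v l) \<in> X2" if "l \<noteq> \<sigma> i" "l \<noteq> \<sigma> j" for l by (rule r2(4)[OF vA X1 vI]) (use that v_inj in simp_all)
  note r3 = realization_step_orbit[OF r2(3) s3 wA qw vA pv]
  have U: "l = i \<or> l = j \<or> l = k" for l :: 3
    using ijk exhaust_3[of i] exhaust_3[of j] exhaust_3[of k] exhaust_3[of l] by auto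
  have hit: "(\<Phi> ^^ (n l - 1)) (w l) = v (\<sigma> l)" for l using U[of l] r1(1) r2(1) r3(1) by blast
  have ne: "\<sigma> j \<noteq> \<sigma> i" "\<sigma> k \<noteq> \<sigma> i" "\<sigma> k \<noteq> \<sigma> j" unfolding \<sigma>_inj using ijk by auto
  have first1: "(\<Phi> ^^ m) (w i) \<noteq> v l" if "m < n i - 1" for m l by (rule r1(2)[OF that vA P_P2[OF vA] vI])
  have first2: "(\<Phi> ^^ m) (w j) \<noteq> v l" if "m < n j - 1" "l \<noteq> \<sigma> i" for m l by (rule r2(2)[OF that(1) vA X1[OF that(2)] vI])
  have first3: "(\<Phi> ^^ m) (w k) \<noteq> v (\<sigma> k)" if "m < n k - 1" for m by (rule r3(2)[OF that vA X2[OF ne(2,3)] vI])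
  have first: "(\<Phi> ^^ m) (w l) \<noteq> v (\<sigma> l)" if "m < n l - 1" for l m
    using U[of l] that first1 first2[OF _ ne(1)] first3 by blast
  have cycle: False if ret: "\<And>l. (\<Phi> ^^ 2) (w l) = v l"
  proof -
    have "n 1 + n 2 + n 3 \<le> 9"
      by (rule rotation_orbit_sum[where \<Phi> = \<Phi> and v = v and w = w and n = n and \<sigma> = \<sigma> and i = i and j = j and k = k, OF ret n[rule_format] \<sigma> ijk hit]) (use first1 first2 first3 in blast)+
    thus False using no_root_small[OF n \<sigma> _ z] root by blast
  qed
  have two: "(\<Phi> ^^ 2) x = \<Phi> (\<Phi> x)" for x by (simp add: numeral_2_eq_2)
  show \<pi>: "\<pi> = id"
  proof (rule bij_3_cases[OF bij_\<pi>])
    assume "\<And>l. \<pi> l = l" thus ?thesis by auto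
  next
    assume p1: "\<And>l. \<pi> l = l + 1"
    have rot: "rot" unfolding rot_def p1 by blast
    have "(\<Phi> ^^ 2) (w l) = v l" for l
      unfolding two \<Phi>_def w_def v_def using d_return[of "\<rho> l"] rot
      by (simp add: turn_def p1 idx3(6-9) del: d_return mult.assoc) (simp only: mult_ac)
    thus ?thesis using cycle by blast
  next
    assume p1: "\<And>l. \<pi> l = l + 2"
    have rot: "rot" unfolding rot_def p1 by (simp only: idx3(6-9) simp_thms)
    have "(\<Phi> ^^ 2) (w l) = v l" for l
      unfolding two \<Phi>_def w_def v_def using d_return[of "\<rho> l"] rot
      by (simp add: turn_def p1 idx3(6-9) del: d_return mult.assoc) (simp only: mult_ac)
    thus ?thesis using cycle by blast
  next
    fix l assume l: "\<pi> l = l" and refl: "\<And>j. \<pi> (j + 1) = \<pi> j + 2"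
    have nrot: "\<not> rot" unfolding rot_def refl using idx3(5)[of "\<pi> 1"] by metis
    obtain l0 where l0: "l = \<rho> l0" using bij_is_surj[OF \<rho>(1)] by (metis surjD)
    have fl: "fst ((\<Phi> ^^ m) (w l0)) = l" for m
      by (induction m) (simp_all add: w_def \<Phi>_def l l0[symmetric])
    have "\<rho> (\<sigma> l0) = \<rho> l0" using fl[of "n l0 - 1"] hit[of l0] l0 unfolding v_def by simp
    hence \<sigma>l: "\<sigma> l0 = l0" using inj_eq[OF bij_is_inj[OF \<rho>(1)]] by blast
    have w0: "w l0 = (l, inverse (e l))" and w1: "\<Phi> (w l0) = (l, e l / d l)"
      unfolding \<Phi>_def w_def l0[symmetric] using nrot by (simp_all add: turn_def l field_simps)
    have w2: "\<Phi> (\<Phi> (w l0)) = w l0"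
      unfolding w1 unfolding w0 \<Phi>_def using nrot by (simp add: turn_def l)
    \<comment> \<open>On the invariant line, \<Phi> is the involution s -> 1 / (d l s), so the orbit
      of the starting point has at most two elements. The second one is not the base point by
      \<open>dc_ne_e\<close>, so the base points of f and of its inverse on this line
      coincide.\<close>
    have "(\<Phi> ^^ m) (w l0) \<in> {w l0, \<Phi> (w l0)}" for m
      by (induction m) (use w2 in auto)
    moreover have "v l0 \<noteq> \<Phi> (w l0)"
      unfolding w1 v_def l0[symmetric] using dc_ne_e[of l] by (auto simp: field_simps)
    ultimately have v0: "v l0 = w l0" using hit[of l0] \<sigma>l by (metis empty_iff insert_iff)
    have "\<not> 0 < n l0 - 1" using first[of 0 l0] v0 \<sigma>l by auto
    hence "n l0 = 1" using n[rule_format, of l0] by simp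
    thus ?thesis using no_root_pencil[OF n \<sigma> _ \<sigma>l z] root by blast
  qed
  \<comment> \<open>Each orbit now stays on its line and ends at the base point of that line, so it
    ends at its own label.\<close>
  have "\<pi> l = l" for l using \<pi> by simp
  hence "fst ((\<Phi> ^^ m) (w l)) = \<rho> l" for m l
    by (induction m) (simp_all add: w_def \<Phi>_def)
  hence "\<rho> (\<sigma> l) = \<rho> l" for l using hit[of l] unfolding v_def by (metis fst_conv)
  hence "\<sigma> l = l" for l using inj_eq[OF bij_is_inj[OF \<rho>(1)]] by blast
  thus "\<sigma> = id" by auto
qed

end

subsection \<open>Every quadratic map properly fixing the triangle is of this kind\<close>

text \<open>That F is dominant is not known at this point, so \<open>sub_fr\<close> does not apply.
  The image of a polynomial is built by induction as a fraction with a power of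
  \<open>F v $ 3\<close> as denominator, and compared with A (F v) where this coordinate is
  non-zero. Cancelling it as a form extends the identity to all v.\<close>

lemma (in birational) pullback_form:
  assumes F: "\<And>i. form e (\<lambda>v. F v $ i)" and nz: "\<exists>v. F v $ 3 \<noteq> 0"
    and xy: "\<phi> x_fun = fr (\<lambda>v. F v $ 1) (\<lambda>v. F v $ 3)" "\<phi> y_fun = fr (\<lambda>v. F v $ 2) (\<lambda>v. F v $ 3)"
    and A: "form d A"
  shows "\<phi> (fr A (\<lambda>v. v$3 ^ d)) = fr (\<lambda>v. A (F v)) (\<lambda>v. F v $ 3 ^ d)"
proof -
  define Q where "Q a m C \<longleftrightarrow> form (e * m) C \<and> \<phi> (Fract a 1) = fr C (\<lambda>v. F v $ 3 ^ m)
     \<and> (\<forall>v. F v $ 3 \<noteq> 0 \<longrightarrow> C v = F v $ 3 ^ m * peval a (F v $ 1 / F v $ 3) (F v $ 2 / F v $ 3))" for a m C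
  have den: "form (e * m) (\<lambda>v. F v $ 3 ^ m)" "\<exists>v. F v $ 3 ^ m \<noteq> 0" for m
    using form_power[OF F] nz by auto
  have add: "\<exists>m C. Q (a + b) m C" if ab: "\<exists>m C. Q a m C" "\<exists>m C. Q b m C" for a b
  proof -
    obtain m C m' C' where Q: "Q a m C" "Q b m' C'" using ab by blast
    have "Fract (a + b) 1 = Fract a 1 + Fract b 1" by simp
    hence "\<phi> (Fract (a + b) 1) = fr C (\<lambda>v. F v $ 3 ^ m) + fr C' (\<lambda>v. F v $ 3 ^ m')"
      using Q unfolding Q_def by (simp only: hom_add)
    also have "\<dots> = fr (\<lambda>v. C v * F v $ 3 ^ m' + C' v * F v $ 3 ^ m) (\<lambda>v. F v $ 3 ^ (m + m'))"
      unfolding power_add by (rule fr_add) (use Q den in \<open>auto simp: Q_def\<close>)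
    finally have "\<phi> (Fract (a + b) 1) = fr (\<lambda>v. C v * F v $ 3 ^ m' + C' v * F v $ 3 ^ m) (\<lambda>v. F v $ 3 ^ (m + m'))" .
    moreover have "form (e * (m + m')) (\<lambda>v. C v * F v $ 3 ^ m' + C' v * F v $ 3 ^ m)"
    proof (rule form_add)
      show "form (e * (m + m')) (\<lambda>v. C v * F v $ 3 ^ m')"
        using form_mult[OF _ den(1)[of m'], of "e * m" C] Q(1) unfolding Q_def by (simp add: distrib_left)
      show "form (e * (m + m')) (\<lambda>v. C' v * F v $ 3 ^ m)"
        using form_mult[OF _ den(1)[of m], of "e * m'" C'] Q(2) unfolding Q_def by (simp add: distrib_left add.commute)
    qed
    ultimately have "Q (a + b) (m + m') (\<lambda>v. C v * F v $ 3 ^ m' + C' v * F v $ 3 ^ m)"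
      using Q unfolding Q_def by (auto simp: power_add algebra_simps)
    thus ?thesis by blast
  qed
  have mult: "\<exists>m C. Q (a * b) m C" if ab: "\<exists>m C. Q a m C" "\<exists>m C. Q b m C" for a b
  proof -
    obtain m C m' C' where Q: "Q a m C" "Q b m' C'" using ab by blast
    have "Fract (a * b) 1 = Fract a 1 * Fract b 1" by simp
    hence "\<phi> (Fract (a * b) 1) = fr C (\<lambda>v. F v $ 3 ^ m) * fr C' (\<lambda>v. F v $ 3 ^ m')"
      using Q unfolding Q_def by (simp only: hom_mult)
    also have "\<dots> = fr (\<lambda>v. C v * C' v) (\<lambda>v. F v $ 3 ^ (m + m'))"
      unfolding power_add by (rule fr_mult) (use Q den in \<open>auto simp: Q_def\<close>)
    finally have "\<phi> (Fract (a * b) 1) = fr (\<lambda>v. C v * C' v) (\<lambda>v. F v $ 3 ^ (m + m'))" .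
    moreover have "form (e * (m + m')) (\<lambda>v. C v * C' v)"
      using form_mult[of "e * m" C "e * m'" C'] Q unfolding Q_def by (simp add: distrib_left)
    ultimately have "Q (a * b) (m + m') (\<lambda>v. C v * C' v)"
      using Q unfolding Q_def by (auto simp: power_add)
    thus ?thesis by blast
  qed
  have const: "\<exists>m C. Q [:[:c:]:] m C" for c
    using hom_const[of c] form_const[of c] unfolding Q_def const_fun_def
    by (intro exI[of _ 0] exI[of _ "\<lambda>v. c"]) (simp add: const_fun_fr[symmetric] const_fun_def)
  have x: "\<exists>m C. Q [:[:0, 1:]:] m C" using F[of 1] xy(1) unfolding Q_def x_fun_def
    by (intro exI[of _ 1] exI[of _ "\<lambda>v. F v $ 1"]) simp
  have y: "\<exists>m C. Q [:0, 1:] m C" using F[of 2] xy(2) unfolding Q_def y_fun_def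
    by (intro exI[of _ 1] exI[of _ "\<lambda>v. F v $ 2"]) simp
  have 1: "\<exists>m C. Q [:c:] m C" for c
  proof (induction c)
    case 0
    show ?case using const[of 0] by simp
  next
    case (pCons a c)
    have "[:pCons a c:] = [:[:a:]:] + [:[:0, 1:]:] * [:c:]" by simp
    thus ?case using add[OF const mult[OF x pCons(2)]] by metis
  qed
  have "\<exists>m C. Q p m C" for p
  proof (induction p)
    case 0
    show ?case using 1[of 0] by simp
  next
    case (pCons c p)
    have "pCons c p = [:c:] + [:0, 1:] * p" by simp
    thus ?case using add[OF 1 mult[OF y pCons(2)]] by metis
  qed
  then obtain m C where C: "form (e * m) C" "\<phi> (Fract (dehom A) 1) = fr C (\<lambda>v. F v $ 3 ^ m)"
    "\<And>v. F v $ 3 \<noteq> 0 \<Longrightarrow> C v = F v $ 3 ^ m * peval (dehom A) (F v $ 1 / F v $ 3) (F v $ 2 / F v $ 3)"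
    unfolding Q_def by blast
  have "dehom (\<lambda>v. v$3 ^ d) = 1" by (intro dehomI) simp
  hence lhs: "\<phi> (fr A (\<lambda>v. v$3 ^ d)) = fr C (\<lambda>v. F v $ 3 ^ m)" unfolding fr_def[of A] using C(2) by simp
  have eq: "C v * F v $ 3 ^ d = A (F v) * F v $ 3 ^ m" if "F v $ 3 \<noteq> 0" for v
  proof -
    have "F v = F v $ 3 *s vector [F v $ 1 / F v $ 3, F v $ 2 / F v $ 3, 1]"
      using that unfolding vec3_eq_iff by simp
    hence "A (F v) = F v $ 3 ^ d * A (vector [F v $ 1 / F v $ 3, F v $ 2 / F v $ 3, 1])"
      using form_scale[OF A] by metis
    thus ?thesis unfolding C(3)[OF that] dehom_form(3)[OF A] by simp
  qed
  have AF: "form (e * d) (\<lambda>v. A (F v))" using form_comp[OF A F] by (simp add: mult.commute)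
  have "C v * F v $ 3 ^ d = A (F v) * F v $ 3 ^ m" for v
  proof -
    have fm: "form (e * m + e * d) (\<lambda>v. C v * F v $ 3 ^ d)" by (rule form_mult[OF C(1) den(1)])
    have fm': "form (e * m + e * d) (\<lambda>v. A (F v) * F v $ 3 ^ m)" using form_mult[OF AF den(1)[of m]] by (simp add: add.commute)
    show ?thesis by (rule form_cancel[OF F[of 3] fm fm' nz]) (use eq in auto)
  qed
  thus ?thesis unfolding lhs by (subst fr_eq_iff[OF C(1) den(1) AF den(1) den(2) den(2)]) simp
qed

text \<open>An automorphism of K is determined by forms that represent the images of x and y, and
  its injectivity makes these forms dominant.\<close>

lemma (in birational) eq_sub:
  assumes F: "\<And>i. form e (\<lambda>v. F v $ i)" and nz: "\<exists>v. F v $ 3 \<noteq> 0"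
    and xy: "\<phi> x_fun = fr (\<lambda>v. F v $ 1) (\<lambda>v. F v $ 3)" "\<phi> y_fun = fr (\<lambda>v. F v $ 2) (\<lambda>v. F v $ 3)"
  shows "form_map e F" "\<phi> = sub F"
proof -
  note pf = pullback_form[OF F nz xy]
  have Z: "form d (\<lambda>v. v$3 ^ d)" "\<exists>v::complex^3. v$3 ^ d \<noteq> 0" for d
    using form_power[OF form_coord[of 3], of d] coord_nonzero[of 3] by auto
  have AF: "form (e * d) (\<lambda>v. A (F v))" if "form d A" for d A using form_comp[OF that F] by (simp add: mult.commute)
  have Fd: "form (e * d) (\<lambda>v. F v $ 3 ^ d)" "\<exists>v. F v $ 3 ^ d \<noteq> 0" for d using form_power[OF F] nz by auto
  show FM: "form_map e F" unfolding form_map_def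
  proof (intro conjI allI impI)
    fix d A assume A: "form d A" and nzA: "\<exists>v. A v \<noteq> 0"
    have "fr A (\<lambda>v. v$3 ^ d) \<noteq> 0" using fr_eq_0_iff[OF A Z] nzA by simp
    hence "fr (\<lambda>v. A (F v)) (\<lambda>v. F v $ 3 ^ d) \<noteq> 0" unfolding pf[OF A, symmetric] by (metis hom_0 inj_def inj)
    thus "\<exists>v. A (F v) \<noteq> 0" using fr_eq_0_iff[OF AF[OF A] Fd] by simp
  qed (rule F)
  show "\<phi> = sub F"
  proof
    fix g
    obtain d A B where g: "form d A" "form d B" "\<exists>v. B v \<noteq> 0" "g = fr A B" by (rule ex_fr)
    have quot: "fr X W / fr Y W = fr X Y" if "form k X" "form k Y" "form k W" "\<exists>v. Y v \<noteq> 0" "\<exists>v. W v \<noteq> 0" for k X Y W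
    proof -
      have "fr X W / fr Y W = fr (\<lambda>v. X v * W v) (\<lambda>v. W v * Y v)"
        unfolding divide_inverse fr_inverse[OF that(2,3)] by (rule fr_mult[OF that(1,3) that(3,2)])
      also have "(\<lambda>v. W v * Y v) = (\<lambda>v. Y v * W v)" by (simp add: mult.commute)
      also have "fr (\<lambda>v. X v * W v) (\<lambda>v. Y v * W v) = fr X Y" by (rule fr_cancel[OF that])
      finally show ?thesis .
    qed
    have "\<phi> g = \<phi> (fr A (\<lambda>v. v$3 ^ d)) / \<phi> (fr B (\<lambda>v. v$3 ^ d))"
      unfolding g(4) quot[OF g(1,2) Z(1) g(3) Z(2), symmetric] by (rule hom_divide)
    also have "\<dots> = fr (\<lambda>v. A (F v)) (\<lambda>v. B (F v))"
      unfolding pf[OF g(1)] pf[OF g(2)]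
      by (rule quot[OF AF[OF g(1)] AF[OF g(2)] Fd(1) form_map_nonzero[OF FM g(2,3)] Fd(2)])
    also have "\<dots> = sub F g" unfolding g(4) by (rule sub_fr[OF FM g(1-3), symmetric])
    finally show "\<phi> g = sub F g" .
  qed
qed

lemma map_degree_le:
  assumes "form k A" "form k B" "form k C" "\<exists>v. C v \<noteq> 0" "f x_fun = fr A C" "f y_fun = fr B C"
  shows "map_degree f \<le> k"
  unfolding map_degree_def using assms dehom_eq_0_iff[OF assms(3)] unfolding fr_def
  by (intro Least_le exI[of _ "dehom A"] exI[of _ "dehom B"] exI[of _ "dehom C"]) (simp add: dehom_form)

lemma map_degree_forms:
  obtains F :: "complex^3 \<Rightarrow> complex^3" where "\<And>i. form (map_degree f) (\<lambda>v. F v $ i)" "\<exists>v. F v $ 3 \<noteq> 0"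
    "f x_fun = fr (\<lambda>v. F v $ 1) (\<lambda>v. F v $ 3)" "f y_fun = fr (\<lambda>v. F v $ 2) (\<lambda>v. F v $ 3)"
proof -
  let ?R = "\<lambda>d. \<exists>a b c. c \<noteq> 0 \<and> total_degree_le a d \<and> total_degree_le b d
     \<and> total_degree_le c d \<and> f x_fun = Fract a c \<and> f y_fun = Fract b c"
  obtain a c where 1: "f x_fun = Fract a c" "c \<noteq> 0" by (cases "f x_fun") auto
  obtain b c' where 2: "f y_fun = Fract b c'" "c' \<noteq> 0" by (cases "f y_fun") auto
  have e: "f x_fun = Fract (a * c') (c * c')" "f y_fun = Fract (b * c) (c * c')"
    unfolding 1 2 using 1(2) 2(2) by (simp_all add: eq_fract)
  obtain d1 d2 d3 where "\<forall>e\<ge>d1. total_degree_le (a * c') e" "\<forall>e\<ge>d2. total_degree_le (b * c) e" "\<forall>e\<ge>d3. total_degree_le (c * c') e"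
    using total_degree_le_exists by metis
  hence "?R (max d1 (max d2 d3))" using e 1(2) 2(2)
    by (intro exI[of _ "a * c'"] exI[of _ "b * c"] exI[of _ "c * c'"]) simp
  hence "?R (map_degree f)" unfolding map_degree_def by (rule LeastI)
  then obtain a b c where abc: "c \<noteq> 0" "total_degree_le a (map_degree f)" "total_degree_le b (map_degree f)" "total_degree_le c (map_degree f)"
    "f x_fun = Fract a c" "f y_fun = Fract b c" by blast
  define F :: "complex^3 \<Rightarrow> complex^3" where "F v = vector [form_value (map_degree f) a v, form_value (map_degree f) b v, form_value (map_degree f) c v]" for v
  have fm: "form (map_degree f) (form_value (map_degree f) a)" "form (map_degree f) (form_value (map_degree f) b)" "form (map_degree f) (form_value (map_degree f) c)"
    using abc(2-4) unfolding form_def by blast+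
  show ?thesis
  proof (rule that[of F])
    show "form (map_degree f) (\<lambda>v. F v $ i)" for i unfolding F_def by (rule form_vector[OF fm])
    show "\<exists>v. F v $ 3 \<noteq> 0" using abc(1) dehom_eq_0_iff[OF fm(3)] unfolding F_def dehom_form_value[OF abc(4)] by simp
    show "f x_fun = fr (\<lambda>v. F v $ 1) (\<lambda>v. F v $ 3)" "f y_fun = fr (\<lambda>v. F v $ 2) (\<lambda>v. F v $ 3)"
      unfolding abc(5,6) fr_def F_def vector_3 using abc(2-4) by (simp_all add: dehom_form_value)
  qed
qed

lemma pt_eqD: "pt u = pt v \<Longrightarrow> u \<noteq> 0 \<Longrightarrow> v \<noteq> 0 \<Longrightarrow> \<exists>c. c \<noteq> 0 \<and> u = c *s v"
  by (rule pt_separated[OF res_local_pt, of u]) (auto simp: dominates_def)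

lemma sum_3_idx: "(\<Sum>i\<in>UNIV. g i) = g j + g (j+1) + g (j + (2::3))" for g :: "3 \<Rightarrow> complex"
  unfolding sum_3 using exhaust_3[of j] by (elim disjE; simp only: idx_num; simp only: ac_simps)

lemma P2_closure_subset: "A \<subseteq> P2 \<Longrightarrow> A \<subseteq> P2_closure A"
proof
  fix R assume A: "A \<subseteq> P2" "R \<in> A"
  hence "R \<in> P2" by (rule subsetD)
  then obtain v where v: "v \<noteq> 0" "R = pt v" unfolding P2_iff by (elim exE conjE)
  have "v \<in> {v. v \<noteq> 0 \<and> pt v \<in> A}" using v A(2) by simp
  hence "v \<in> closure {v. v \<noteq> 0 \<and> pt v \<in> A}" by (rule subsetD[OF closure_subset])
  hence "v \<in> closure {v. v \<noteq> 0 \<and> pt v \<in> A} - {0}" using v(1) by simp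
  thus "R \<in> P2_closure A" unfolding P2_closure_def v(2) by (rule imageI)
qed

lemma edge_pt_triangle: "edge_pt j t \<in> triangle"
proof -
  have "evec j t $ 1 * evec j t $ 2 * evec j t $ 3 = 0"
    using evec_nth(1)[of j t] exhaust_3[of j] by auto
  thus ?thesis unfolding triangle_def edge_pt_evec using evec_nonzero by blast
qed

section \<open>The components of a quadratic map that fixes the triangle\<close>

locale triangle_fixing =
  fixes f :: ratmap and F :: "complex^3 \<Rightarrow> complex^3"
  assumes quadratic: "quadratic_map f" and F: "form_map 2 F" and f_eq: "f = sub F"
    and fixing: "properly_fixes_triangle f"
begin

lemma birational_f: "birational_map f" using quadratic unfolding quadratic_map_def by blast

sublocale birational f by unfold_locales (rule birational_f)

lemma form_F: "form 2 (\<lambda>v. F v $ i)" using F unfolding form_map_def by blast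

lemma F_nonzero: "\<exists>v. F v $ i \<noteq> 0" by (rule form_map_nonzero[OF F form_coord coord_nonzero])

lemma f_crd: "f (crd i k) = fr (\<lambda>v. F v $ i) (\<lambda>v. F v $ k)"
  unfolding crd_def f_eq by (rule sub_fr[OF F form_coord form_coord coord_nonzero])

text \<open>\<open>map_degree\<close> refers to forms without common factors; if quotients of degree
  at most one remained, it would be less than 2.\<close>

lemma no_common_factor:
  assumes "form m h" "\<And>i. form k (G i)" "\<And>v i. F v $ i = h v * G i v" "k \<le> 1"
  shows False
proof -
  have G: "\<exists>v. G 3 v \<noteq> 0" and h: "\<exists>v. h v \<noteq> 0" using F_nonzero[of 3] unfolding assms(3) by auto
  have "fr (\<lambda>v. F v $ i) (\<lambda>v. F v $ 3) = fr (G i) (G 3)" for i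
    unfolding assms(3) mult.commute[of "h _"] by (rule fr_cancel[OF assms(2,2,1) G h])
  hence "map_degree f \<le> k"
    by (intro map_degree_le[OF assms(2,2,2) G]) (simp_all add: xy_crd f_crd)
  thus False using quadratic assms(4) unfolding quadratic_map_def by simp
qed

lemma not_all_vanish: "\<exists>k t. F (evec j t) $ k \<noteq> 0"
proof (rule ccontr)
  assume "\<not> ?thesis"
  hence "\<exists>A'. form (2 - 1) A' \<and> (\<forall>v. F v $ k = v$j * A' v)" for k by (intro form_vanish_line[OF form_F]) simp
  hence "\<forall>k. \<exists>A'. form 1 A' \<and> (\<forall>v. F v $ k = v$j * A' v)" by simp
  then obtain G where "\<And>k. form 1 (G k)" "\<And>k v. F v $ k = v$j * G k v" by metis
  thus False using no_common_factor[OF form_coord[of j]] by blast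
qed

lemma regular_quotient:
  assumes "dominates (pt v) (f ` pt u)" "u $ k \<noteq> 0"
  obtains d G H where "form d G" "form d H" "H v \<noteq> 0" "\<And>w. F w $ i * H w = G w * F w $ k"
proof -
  have "f (crd i k) \<in> pt v" using crd_in_pt[of u k i, OF assms(2)] assms(1) unfolding dominates_def by blast
  then obtain d G H where GH: "form d G" "form d H" "H v \<noteq> 0" "f (crd i k) = fr G H" by (rule ptE)
  have "\<forall>w. F w $ i * H w = G w * F w $ k"
    using GH fr_eq_iff[OF form_F form_F GH(1,2) F_nonzero] unfolding f_crd by blast
  thus ?thesis using that GH by blast
qed

text \<open>If \<open>u $ k\<close> were non-zero, every component would satisfy F_i H = G F_k with
  H v \<noteq> 0, so H would not vanish identically along the line. As F_k does, all components
  would, and the equation of the line would be a common factor.\<close>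

lemma image_line:
  assumes v: "v $ j = 0" and van: "\<And>t. F (evec j t) $ k = 0" and d: "dominates (pt v) (f ` pt u)"
  shows "u $ k = 0"
proof (rule ccontr)
  assume u: "u $ k \<noteq> 0"
  have "F (evec j t) $ i = 0" for i t
  proof -
    obtain d G H where GH: "form d G" "form d H" "H v \<noteq> 0" "\<And>w. F w $ i * H w = G w * F w $ k"
      using regular_quotient[OF d u] by blast
    have "\<exists>t. H (evec j t) \<noteq> 0"
    proof (rule ccontr)
      assume "\<not> ?thesis"
      then obtain A' where "\<forall>v. H v = v$j * A' v" using form_vanish_line[OF GH(2)] by blast
      thus False using GH(3) v by simp
    qed
    then obtain t0 where t0: "H (evec j t0) \<noteq> 0" by blast
    obtain PH where PH: "\<And>t. H (evec j t) = poly PH t" using form_evec_poly[OF GH(2), where j = j] by blast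
    obtain PF where PF: "\<And>t. F (evec j t) $ i = poly PF t" using form_evec_poly[OF form_F, where j = j] by blast
    have "poly (PF * PH) t = 0" for t using GH(4)[of "evec j t"] van unfolding PF PH by simp
    hence "PF * PH = 0" using poly_all_0_iff_0 by blast
    moreover have "PH \<noteq> 0" using t0 unfolding PH by auto
    ultimately show ?thesis unfolding PF by simp
  qed
  thus False using not_all_vanish by blast
qed

definition image :: "point set" where "image = map_pt f P2 ` (triangle - indeterminacy f P2)"

lemma closure_image: "P2_closure image = triangle"
  using fixing unfolding properly_fixes_triangle_def image_def by blast

lemma map_pt_regular:
  assumes "R \<in> P2" "R \<notin> indeterminacy f P2"
  shows "map_pt f P2 R \<in> P2" "dominates R (f ` map_pt f P2 R)"
proof -
  obtain S where S: "S \<in> P2" "dominates R (f ` S)" using assms unfolding indeterminacy_def by blast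
  have "map_pt f P2 R = S" by (rule map_pt_P2[OF birational_f assms(1) S])
  thus "map_pt f P2 R \<in> P2" "dominates R (f ` map_pt f P2 R)" using S by simp_all
qed

lemma triangle_P2: "triangle \<subseteq> P2" unfolding triangle_def P2_def by blast

lemma image_P2: "image \<subseteq> P2" unfolding image_def using map_pt_regular(1) triangle_P2 by blast

text \<open>Otherwise some point of the line has an image with three non-zero coordinates, which
  lies off the triangle.\<close>

lemma ex_vanish: "\<exists>k. \<forall>t. F (evec j t) $ k = 0"
proof (rule ccontr)
  assume "\<not> ?thesis"
  hence ne: "\<exists>t. F (evec j t) $ k \<noteq> 0" for k by blast
  have "\<forall>k. \<exists>p. \<forall>t. F (evec j t) $ k = poly p t" using form_evec_poly[OF form_F] by metis
  then obtain p where p: "\<And>k t. F (evec j t) $ k = poly (p k) t" by metis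
  have "p k \<noteq> 0" for k using ne[of k] unfolding p by auto
  hence "p 1 * p 2 * p 3 \<noteq> 0" by simp
  then obtain t where "poly (p 1 * p 2 * p 3) t \<noteq> 0" using poly_all_0_iff_0 by blast
  hence nz: "F (evec j t) $ 1 * F (evec j t) $ 2 * F (evec j t) $ 3 \<noteq> 0" unfolding p by simp
  hence F0: "F (evec j t) \<noteq> 0" by auto
  have dom: "dominates (edge_pt j t) (f ` pt (F (evec j t)))" unfolding f_eq edge_pt_evec by (rule dominates_sub_pt[OF F])
  have P: "pt (F (evec j t)) \<in> P2" unfolding P2_def using F0 by blast
  have "edge_pt j t \<notin> indeterminacy f P2" unfolding indeterminacy_def using dom P by blast
  hence "map_pt f P2 (edge_pt j t) \<in> image" unfolding image_def using edge_pt_triangle by blast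
  moreover have "map_pt f P2 (edge_pt j t) = pt (F (evec j t))"
    by (rule map_pt_P2[OF birational_f edge_pt_P2 P dom])
  ultimately have "pt (F (evec j t)) \<in> triangle" using P2_closure_subset[OF image_P2] closure_image by auto
  then obtain u where u: "u \<noteq> 0" "u$1 * u$2 * u$3 = 0" "pt (F (evec j t)) = pt u" unfolding triangle_def by blast
  obtain c where "F (evec j t) = c *s u" using pt_eqD[OF u(3) F0 u(1)] by blast
  thus False using nz u(2) by auto
qed

text \<open>Here the triangle is used as the full closure of the image. If no line went exactly to
  the k-th one, every line would be mapped into one of the other two. Their union is closed and
  misses \<open>edge_pt k 1\<close>.\<close>

lemma ex_line_onto: "\<exists>j. \<forall>i. (\<forall>t. F (evec j t) $ i = 0) \<longleftrightarrow> i = k"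
proof (rule ccontr)
  assume no: "\<not> ?thesis"
  have ex: "\<exists>i. i \<noteq> k \<and> (\<forall>t. F (evec j t) $ i = 0)" for j
  proof -
    obtain i where "\<not> ((\<forall>t. F (evec j t) $ i = 0) \<longleftrightarrow> i = k)" using no by blast
    thus ?thesis using ex_vanish[of j] by metis
  qed
  define C where "C = (\<Union>i\<in>UNIV - {k}. {v :: complex^3. v $ i = 0})"
  have "closed {v :: complex^3. v $ i = 0}" for i
    by (intro closed_Collect_eq continuous_on_component continuous_on_const continuous_on_id)
  hence "closed C" unfolding C_def by (intro closed_UN ballI) simp_all
  moreover have "{v. v \<noteq> 0 \<and> pt v \<in> image} \<subseteq> C"
  proof
    fix u assume "u \<in> {v. v \<noteq> 0 \<and> pt v \<in> image}"
    hence u: "u \<noteq> 0" "pt u \<in> image" by simp_all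
    from u(2) obtain R where R': "pt u = map_pt f P2 R" "R \<in> triangle - indeterminacy f P2" unfolding image_def by (rule imageE)
    hence R: "R \<in> triangle" "R \<notin> indeterminacy f P2" "pt u = map_pt f P2 R" by simp_all
    obtain v where v: "v \<noteq> 0" "v$1 * v$2 * v$3 = 0" "R = pt v" using R(1)[unfolded triangle_def] by (elim CollectE exE conjE)
    obtain j where j: "v $ j = 0" using v(2) by auto
    obtain i where i: "i \<noteq> k" "\<And>t. F (evec j t) $ i = 0" using ex by blast
    have "dominates (pt v) (f ` pt u)"
      using map_pt_regular(2)[OF subsetD[OF triangle_P2 R(1)] R(2)] unfolding R(3) v(3) .
    hence "u $ i = 0" by (rule image_line[OF j i(2)])
    thus "u \<in> C" unfolding C_def using i(1) by blast
  qed
  ultimately have cl: "closure {v. v \<noteq> 0 \<and> pt v \<in> image} \<subseteq> C" by (simp add: closure_minimal)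
  have "edge_pt k 1 \<in> P2_closure image" unfolding closure_image by (rule edge_pt_triangle)
  then obtain u where u: "u \<in> closure {v. v \<noteq> 0 \<and> pt v \<in> image}" "u \<noteq> 0" "pt (evec k 1) = pt u"
    unfolding P2_closure_def edge_pt_evec by blast
  obtain c where c: "evec k 1 = c *s u" using pt_eqD[OF u(3) evec_nonzero u(2)] by blast
  have "u \<in> C" by (rule subsetD[OF cl u(1)])
  then obtain i where "i \<noteq> k" "u $ i = 0" unfolding C_def by blast
  thus False using evec_eq_0_iff[of 1 k i] c by simp
qed

text \<open>Every line of the triangle has a line mapped exactly to it, so counting gives the
  bijection \<kappa>. The component of index \<kappa> j is then divisible by the equation of the
  j-th line, with a linear quotient.\<close>

lemma components:
  obtains \<kappa> m where "bij \<kappa>" "\<And>i j. (\<forall>t. F (evec j t) $ i = 0) \<longleftrightarrow> i = \<kappa> j"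
    "\<And>j v. F v $ \<kappa> j = v $ j * (m j j * v$j + m j (j+1) * v$(j+1) + m j (j+2) * v$(j+2))"
proof -
  obtain \<iota> where \<iota>: "\<And>k i. (\<forall>t. F (evec (\<iota> k) t) $ i = 0) \<longleftrightarrow> i = k" using ex_line_onto by metis
  have "inj \<iota>" by (rule injI) (metis \<iota>)
  hence b: "bij \<iota>" by (simp add: finite_UNIV_inj_surj bij_def)
  define \<kappa> where "\<kappa> = inv_into UNIV \<iota>"
  have \<kappa>: "(\<forall>t. F (evec j t) $ i = 0) \<longleftrightarrow> i = \<kappa> j" for i j
    using \<iota>[of "\<kappa> j" i] b unfolding \<kappa>_def by (simp add: bij_def surj_f_inv_f)
  have "\<exists>c. \<forall>v. F v $ \<kappa> j = v $ j * (c j * v$j + c (j+1) * v$(j+1) + c (j+2) * v$(j+2))" for j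
  proof -
    obtain A' where A': "form (2 - 1) A'" "\<forall>v. F v $ \<kappa> j = v$j * A' v" using form_vanish_line[OF form_F, of j] \<kappa> by blast
    obtain c where "\<forall>v. A' v = (\<Sum>i\<in>UNIV. c i * v$i)" using form1_coeffs[of A'] A'(1) by auto
    thus ?thesis using A'(2) unfolding sum_3_idx[of _ j] by auto
  qed
  then obtain m where "\<And>j v. F v $ \<kappa> j = v $ j * (m j j * v$j + m j (j+1) * v$(j+1) + m j (j+2) * v$(j+2))" by metis
  thus ?thesis using that[of \<kappa> m] \<kappa> bij_imp_bij_inv[OF b] unfolding \<kappa>_def by blast
qed

end

text \<open>A matrix with non-zero diagonal, zero principal 2x2 minors and zero determinant has rank
  one. The two cyclic products X, Y of off-diagonal entries satisfy X + Y = 2 T and X Y = T^2, where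
  T is the product of the diagonal. So X = Y = T, and the remaining minors follow.\<close>

lemma zero_minors_proportional:
  fixes p0 p1 p2 q0 q1 q2 r0 r1 r2 :: complex
  assumes nz: "p0 \<noteq> 0" "q1 \<noteq> 0" "r2 \<noteq> 0"
    and min: "p0 * q1 = p1 * q0" "q1 * r2 = q2 * r1" "p0 * r2 = p2 * r0"
    and D: "(p1 * q2 - p2 * q1) * r0 - (p1 * r2 - p2 * r1) * q0 = 0"
  shows "q2 * p0 = q0 * p2" "r1 * p0 = r0 * p1"
proof -
  define X Y T where "X = p1 * q2 * r0" and "Y = p2 * r1 * q0" and "T = p0 * q1 * r2"
  have T1: "p1 * r2 * q0 = T" unfolding T_def min(1) by (simp only: mult_ac)
  have "T = p0 * r2 * q1" unfolding T_def by (simp only: mult_ac)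
  hence T2: "p2 * q1 * r0 = T" unfolding min(3) by (simp only: mult_ac)
  have S: "X + Y = 2 * T" using D T1 T2 unfolding X_def Y_def by (simp add: algebra_simps)
  have "X * Y = (p1 * q0) * (q2 * r1) * (p2 * r0)" unfolding X_def Y_def by (simp add: mult_ac)
  also have "\<dots> = T * T" unfolding min[symmetric] T_def by (simp add: mult_ac)
  finally have XY: "X * Y = T * T" .
  have "(X - Y) * (X - Y) = (X + Y) * (X + Y) - 4 * (X * Y)" by (simp add: algebra_simps)
  also have "\<dots> = 0" unfolding S XY by (simp add: algebra_simps)
  finally have "X = Y" by simp
  hence XT: "X = T" "Y = T" using S by simp_all
  have nz': "p1 \<noteq> 0" "q0 \<noteq> 0" "q2 \<noteq> 0" "r1 \<noteq> 0" "p2 \<noteq> 0" "r0 \<noteq> 0" using nz min by (metis mult_eq_0_iff)+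
  have "p1 * (q2 * r0) = p1 * (q0 * r2)" using XT(1) unfolding X_def T_def min(1) by (simp only: mult.assoc)
  hence "q2 * r0 = q0 * r2" using nz' by simp
  hence "r0 * (q2 * p0) = r0 * (q0 * p2)" using min(3) by (metis mult.assoc mult.commute mult.left_commute)
  thus "q2 * p0 = q0 * p2" using nz' by simp
  have "p2 * (r1 * q0) = p2 * (q1 * r0)" using XT(2) T2 unfolding Y_def by (simp only: mult.assoc)
  hence "r1 * q0 = q1 * r0" using nz' by simp
  hence "q0 * (r1 * p0) = q0 * (r0 * p1)" using min(1) by (metis mult.assoc mult.commute mult.left_commute)
  thus "r1 * p0 = r0 * p1" using nz' by simp
qed

lemma add_rotate: "x + y + z = z + x + y" "x + y + z = y + z + (x :: complex)"
  by simp_all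

text \<open>The adjugate of m has the principal 2x2 minors on its diagonal, so the inverse of m has
  zero diagonal. Given the vanishing minors, the expression in \<open>D\<close> is the determinant
  expanded along the j-th column. Of the two off-diagonal cofactors in it, neither vanishes without
  the other, and both together would make the determinant zero.\<close>

lemma ex_triangle_matrix:
  fixes m :: "3 \<Rightarrow> 3 \<Rightarrow> complex"
  assumes diag: "\<And>j. m j j \<noteq> 0"
    and minor: "\<And>j. m (j+1) (j+1) * m (j+2) (j+2) = m (j+1) (j+2) * m (j+2) (j+1)"
    and D: "\<And>j. (m j (j+1) * m (j+1) (j+2) - m j (j+2) * m (j+1) (j+1)) * m (j+2) j
       - (m j (j+1) * m (j+2) (j+2) - m j (j+2) * m (j+2) (j+1)) * m (j+1) j \<noteq> 0"
  obtains b where "\<And>j k. j \<noteq> k \<Longrightarrow> b j k \<noteq> 0" "hollow_det b \<noteq> 0"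
    "\<And>v j. hollow_inv b v $ j = m j j * v$j + m j (j+1) * v$(j+1) + m j (j+2) * v$(j+2)"
proof -
  define \<Delta> where "\<Delta> j = (m j (j+1) * m (j+1) (j+2) - m j (j+2) * m (j+1) (j+1)) * m (j+2) j
       - (m j (j+1) * m (j+2) (j+2) - m j (j+2) * m (j+2) (j+1)) * m (j+1) j" for j
  define b1 b2 where "b1 j = - (m j (j+1) * m (j+2) (j+2) - m j (j+2) * m (j+2) (j+1)) / \<Delta> j"
    and "b2 j = (m j (j+1) * m (j+1) (j+2) - m j (j+2) * m (j+1) (j+1)) / \<Delta> j" for j
  define b where "b j k = (if k = j + 1 then b1 j else b2 j)" for j k
  have b: "b j (j+1) = b1 j" "b j (j+2) = b2 j" for j unfolding b_def using idx3(5)[of j] by simp_all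
  have \<Delta>: "\<Delta> j \<noteq> 0" for j unfolding \<Delta>_def by (rule D)
  define L where "L v = (\<chi> j. m j j * v$j + m j (j+1) * v$(j+1) + m j (j+2) * v$(j+2))" for v
  have L: "L v $ j = m j j * v$j + m j (j+1) * v$(j+1) + m j (j+2) * v$(j+2)"
    "L v $ (j+1) = m (j+1) j * v$j + m (j+1) (j+1) * v$(j+1) + m (j+1) (j+2) * v$(j+2)"
    "L v $ (j+2) = m (j+2) j * v$j + m (j+2) (j+1) * v$(j+1) + m (j+2) (j+2) * v$(j+2)" for v j
    unfolding L_def vec_lambda_beta idx3(6-9) by (rule refl, rule add_rotate, rule add_rotate)
  have alg: "- (p1 * r2 - p2 * r1) / e * (q0 * x + q1 * y + q2 * z) + (p1 * q2 - p2 * q1) / e * (r0 * x + r1 * y + r2 * z) = x"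
    if "e = (p1 * q2 - p2 * q1) * r0 - (p1 * r2 - p2 * r1) * q0" "e \<noteq> 0" "q1 * r2 = q2 * r1" for e p1 p2 q0 q1 q2 r0 r1 r2 x y z :: complex
  proof -
    have "- (p1 * r2 - p2 * r1) * (q0 * x + q1 * y + q2 * z) + (p1 * q2 - p2 * q1) * (r0 * x + r1 * y + r2 * z)
       = e * x + p1 * (q2 * r1 - q1 * r2) * y + p2 * (q2 * r1 - q1 * r2) * z"
      unfolding that(1) by (simp add: algebra_simps)
    also have "\<dots> = e * x" using that(3) by simp
    finally have "(- (p1 * r2 - p2 * r1) * (q0 * x + q1 * y + q2 * z) + (p1 * q2 - p2 * q1) * (r0 * x + r1 * y + r2 * z)) / e = x"
      using that(2) by simp
    thus ?thesis by (simp add: add_divide_distrib)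
  qed
  have hollow_L: "hollow b (L v) = v" for v
    unfolding Finite_Cartesian_Product.vec_eq_iff
  proof
    fix j
    show "hollow b (L v) $ j = v $ j"
      unfolding hollow_nth b L(2,3) b1_def b2_def by (rule alg[OF _ \<Delta> minor]) (simp add: \<Delta>_def)
  qed
  have b1: "b1 j \<noteq> 0" and b2: "b2 j \<noteq> 0" for j
  proof -
    have nz: "m (j+1) (j+1) \<noteq> 0" "m (j+2) (j+2) \<noteq> 0" by (rule diag)+
    have aux: "x \<noteq> 0 \<and> y \<noteq> 0" if "x = p1 * q2 - p2 * q1" "y = p1 * r2 - p2 * r1" "x * r0 - y * q0 \<noteq> 0" "q1 * r2 = q2 * r1" "q1 \<noteq> 0" "r2 \<noteq> 0"
      for x y p1 p2 q0 q1 q2 r0 r1 r2 :: complex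
    proof -
      have "x * r2 = y * q2" "y * q1 = x * r1" unfolding that(1,2) left_diff_distrib using that(4) by (simp_all add: mult_ac)
      thus ?thesis using that(3,5,6) by auto
    qed
    have "m j (j+1) * m (j+1) (j+2) - m j (j+2) * m (j+1) (j+1) \<noteq> 0 \<and> m j (j+1) * m (j+2) (j+2) - m j (j+2) * m (j+2) (j+1) \<noteq> 0"
      by (rule aux[OF refl refl D minor nz])
    thus "b1 j \<noteq> 0" "b2 j \<noteq> 0" unfolding b1_def b2_def using \<Delta>[of j] by (simp_all, metis)
  qed
  have off: "b j k \<noteq> 0" if "j \<noteq> k" for j k unfolding b_def using b1 b2 by simp
  have det: "hollow_det b \<noteq> 0"
  proof
    assume z: "hollow_det b = 0"
    have "b 1 2 * b 2 1 * v$3 - b 3 1 * b 1 2 * v$2 - b 3 2 * b 2 1 * v$1 = 0" for v :: "complex^3"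
    proof -
      let ?u = "L v"
      have "v$1 = b 1 2 * ?u$2 + b 1 3 * ?u$3" "v$2 = b 2 3 * ?u$3 + b 2 1 * ?u$1" "v$3 = b 3 1 * ?u$1 + b 3 2 * ?u$2"
        using hollow_nth[of b ?u 1] hollow_nth[of b ?u 2] hollow_nth[of b ?u 3] unfolding hollow_L idx_num .
      hence "b 1 2 * b 2 1 * v$3 - b 3 1 * b 1 2 * v$2 - b 3 2 * b 2 1 * v$1 = - hollow_det b * ?u$3"
        unfolding hollow_det_def by (simp add: algebra_simps)
      thus ?thesis unfolding z by simp
    qed
    from this[of "axis 3 1"] have "b 1 2 * b 2 1 = 0" by (simp add: axis_def)
    thus False using off[of 1 2] off[of 2 1] by simp
  qed
  have "hollow_inv b v $ j = L v $ j" for v j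
    using linear_isoD(3)[OF hollow_iso[OF det], of "L v"] unfolding hollow_L by simp
  thus ?thesis using that[OF off det] unfolding L(1) by blast
qed

lemma pt_in_triangle: "v \<noteq> 0 \<Longrightarrow> pt v \<in> triangle \<longleftrightarrow> v$1 * v$2 * v$3 = 0"
proof
  assume v: "v \<noteq> 0" and "pt v \<in> triangle"
  then obtain u where u: "pt v = pt u" "u \<noteq> 0" "u$1 * u$2 * u$3 = 0" unfolding triangle_def by (elim CollectE exE conjE)
  obtain c where "v = c *s u" using pt_eqD[OF u(1) v u(2)] by blast
  thus "v$1 * v$2 * v$3 = 0" using u(3) by auto
qed (auto simp: triangle_def)

lemma axis_triangle: "pt (axis j 1) \<in> triangle" "pt (axis j 1) \<notin> triangle_reg"
proof -
  have nz: "axis j 1 \<noteq> (0 :: complex^3)" by simp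
  have z: "(axis j 1 :: complex^3)$1 * axis j 1$2 = 0" "(axis j 1 :: complex^3)$1 * axis j 1$3 = 0" "(axis j 1 :: complex^3)$2 * axis j 1$3 = 0"
    unfolding axis_def by simp_all
  show "pt (axis j 1) \<in> triangle" unfolding pt_in_triangle[OF nz] z by simp
  show "pt (axis j 1) \<notin> triangle_reg"
  proof
    assume "pt (axis j 1) \<in> triangle_reg"
    then obtain u where u: "pt (axis j 1) = pt u" "u \<noteq> 0" "(u$2 * u$3, u$1 * u$3, u$1 * u$2) \<noteq> (0, 0, 0)"
      unfolding triangle_reg_def by (elim CollectE exE conjE)
    obtain c where c: "u = c *s axis j 1" using pt_eqD[OF u(1)[symmetric] u(2) nz] by blast
    show False using u(3) z unfolding c by (auto simp: mult_ac)
  qed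
qed

section \<open>The matrix of the linear factors\<close>

locale triangle_fixing_lines = triangle_fixing +
  fixes \<kappa> :: "3 \<Rightarrow> 3" and m :: "3 \<Rightarrow> 3 \<Rightarrow> complex"
  assumes bij_\<kappa>: "bij \<kappa>" and vanish: "(\<forall>t. F (evec j t) $ i = 0) \<longleftrightarrow> i = \<kappa> j"
    and F_nth: "F v $ \<kappa> j = v $ j * (m j j * v$j + m j (j+1) * v$(j+1) + m j (j+2) * v$(j+2))"
begin

definition l :: "3 \<Rightarrow> complex^3 \<Rightarrow> complex" where
  "l j v = m j j * v$j + m j (j+1) * v$(j+1) + m j (j+2) * v$(j+2)"

lemma form_l: "form 1 (l j)"
proof -
  have "form 1 (\<lambda>v. m j j * v$j + m j (j+1) * v$(j+1) + m j (j+2) * v$(j+2))" by (intro form_add form_const_mult form_coord)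
  thus ?thesis unfolding l_def .
qed

lemma l_nth:
  "l (j+1) v = m (j+1) j * v$j + m (j+1) (j+1) * v$(j+1) + m (j+1) (j+2) * v$(j+2)"
  "l (j+2) v = m (j+2) j * v$j + m (j+2) (j+1) * v$(j+1) + m (j+2) (j+2) * v$(j+2)"
  unfolding l_def idx3(6-9) by (rule add_rotate)+

lemma F_l: "F v $ \<kappa> j = v $ j * l j v" unfolding F_nth l_def ..

lemma \<kappa>_eq_iff: "\<kappa> i = \<kappa> j \<longleftrightarrow> i = j" using inj_eq[OF bij_is_inj[OF bij_\<kappa>]] .

text \<open>The common linear form would be a factor of all components and leave a linear
  map.\<close>

lemma not_proportional:
  assumes "\<And>i. \<exists>c. \<forall>v. l i v = c * l j v"
  shows False
proof -
  obtain c where c: "\<And>i v. l i v = c i * l j v" using assms by metis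
  define \<iota> where "\<iota> = inv_into UNIV \<kappa>"
  have \<iota>: "\<kappa> (\<iota> k) = k" for k unfolding \<iota>_def using bij_\<kappa> by (simp add: bij_def surj_f_inv_f)
  have "F v $ k = l j v * (c (\<iota> k) * v $ \<iota> k)" for v k
    using F_l[of v "\<iota> k"] unfolding \<iota> c[of "\<iota> k"] by simp
  thus False using no_common_factor[OF form_l[of j], of 1 "\<lambda>k v. c (\<iota> k) * v $ \<iota> k"] form_const_mult[OF form_coord] by blast
qed

text \<open>The j-th vertex is a node, so f is regular there, and its value lies on the images of
  both lines through it: only the coordinate of index \<kappa> j is non-zero. If
  \<open>m j j\<close> were zero, that component of F would vanish along the line \<open>l j\<close>
  = 0 through the vertex; regularity would make all components vanish along it, and all linear
  factors would be multiples of \<open>l j\<close>.\<close>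

lemma diagonal_nonzero: "m j j \<noteq> 0"
proof
  assume mj: "m j j = 0"
  let ?e = "axis j 1 :: complex^3"
  have e: "?e $ j = 1" "?e $ (j+1) = 0" "?e $ (j+2) = 0" by (simp_all add: axis_def idx3(2-))
  have "pt ?e \<notin> indeterminacy f P2"
    using fixing axis_triangle unfolding properly_fixes_triangle_def by blast
  moreover have eP: "pt ?e \<in> P2" using axis_triangle(1) triangle_P2 by blast
  ultimately obtain S where S: "S \<in> P2" "dominates (pt ?e) (f ` S)" unfolding indeterminacy_def by blast
  obtain u where u: "u \<noteq> 0" "S = pt u" using S(1) unfolding P2_iff by blast
  have "u $ \<kappa> (j+1) = 0" by (rule image_line[OF e(2) _ S(2)[unfolded u(2)]]) (use vanish in blast)
  moreover have "u $ \<kappa> (j+2) = 0" by (rule image_line[OF e(3) _ S(2)[unfolded u(2)]]) (use vanish in blast)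
  ultimately have uj: "u $ \<kappa> j \<noteq> 0"
  proof (intro notI)
    assume 0: "u $ \<kappa> (j+1) = 0" "u $ \<kappa> (j+2) = 0" "u $ \<kappa> j = 0"
    have "u $ \<kappa> i = 0" for i using idx3(1)[of i j] 0 by auto
    hence "u $ k = 0" for k using bij_is_surj[OF bij_\<kappa>] by (metis surjD)
    thus False using u(1) by (simp add: Finite_Cartesian_Product.vec_eq_iff)
  qed
  define \<alpha> \<beta> where "\<alpha> = m j (j+1)" and "\<beta> = m j (j+2)"
  have lj: "l j v = \<alpha> * v$(j+1) + \<beta> * v$(j+2)" for v unfolding l_def mj \<alpha>_def \<beta>_def by simp
  \<comment> \<open>Otherwise the component of index \<kappa> j would vanish along a second line of
    the triangle.\<close>
  have \<alpha>: "\<alpha> \<noteq> 0"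
  proof
    assume 0: "\<alpha> = 0"
    have "F (evec (j+2) t) $ \<kappa> j = 0" for t unfolding F_l lj 0 by simp
    hence "\<kappa> j = \<kappa> (j+2)" using vanish by blast
    thus False using idx3(3)[of j] unfolding \<kappa>_eq_iff by simp
  qed
  have \<beta>: "\<beta> \<noteq> 0"
  proof
    assume 0: "\<beta> = 0"
    have "F (evec (j+1) t) $ \<kappa> j = 0" for t unfolding F_l lj 0 by simp
    hence "\<kappa> j = \<kappa> (j+1)" using vanish by blast
    thus False using idx3(2)[of j] unfolding \<kappa>_eq_iff by simp
  qed
  \<comment> \<open>The direction of the line \<open>l j\<close> = 0 through the vertex.\<close>
  define w :: "complex^3" where "w = (\<chi> i. if i = j then 0 else if i = j + 1 then \<beta> else - \<alpha>)"
  have w: "w $ j = 0" "w $ (j+1) = \<beta>" "w $ (j+2) = - \<alpha>" unfolding w_def by (simp_all add: idx3(2-))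
  have x: "(?e + s *s w) $ j = 1" "(?e + s *s w) $ (j+1) = s * \<beta>" "(?e + s *s w) $ (j+2) = - s * \<alpha>" for s
    using e w by simp_all
  have key: "m i j = 0 \<and> m i (j+1) * \<beta> = m i (j+2) * \<alpha>"
    if i: "\<gamma> \<noteq> 0" "\<And>s. (?e + s *s w) $ i = s * \<gamma>" "\<And>v. l i v = m i j * v$j + m i (j+1) * v$(j+1) + m i (j+2) * v$(j+2)" for i \<gamma>
  proof -
    obtain d G Hf where GH: "form d G" "form d Hf" "Hf ?e \<noteq> 0" "\<And>w. F w $ \<kappa> i * Hf w = G w * F w $ \<kappa> j"
      using regular_quotient[OF S(2)[unfolded u(2)] uj] by blast
    obtain PH where PH: "\<And>s. poly PH s = Hf (?e + s *s w)" using form_line_poly[OF GH(2)] by blast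
    \<comment> \<open>The component of index \<kappa> i along this line, as a polynomial in
      s.\<close>
    define Q where "Q = [:0, \<gamma> * m i j, \<gamma> * (m i (j+1) * \<beta> - m i (j+2) * \<alpha>):]"
    have "poly (Q * PH) s = 0" for s
    proof -
      let ?x = "?e + s *s w"
      have "l j ?x = 0" unfolding lj x by simp
      hence "F ?x $ \<kappa> i * Hf ?x = 0" using GH(4)[of ?x] F_l[of ?x j] by simp
      moreover have "F ?x $ \<kappa> i = poly Q s" unfolding F_l i(2,3) x Q_def by (simp add: algebra_simps)
      ultimately show ?thesis using PH[of s] by simp
    qed
    hence "Q * PH = 0" using poly_all_0_iff_0 by blast
    moreover have "poly PH 0 \<noteq> 0" unfolding PH using GH(3) by simp
    ultimately have "Q = 0" by auto
    thus ?thesis unfolding Q_def using i(1) by simp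
  qed
  have k1: "m (j+1) j = 0 \<and> m (j+1) (j+1) * \<beta> = m (j+1) (j+2) * \<alpha>" by (rule key[OF \<beta> x(2) l_nth(1)])
  have k2: "m (j+2) j = 0 \<and> m (j+2) (j+1) * \<beta> = m (j+2) (j+2) * \<alpha>"
    by (rule key[of "- \<alpha>"]) (use \<alpha> x(3) l_nth(2) in auto)
  have pr: "a * y + b' * z = a / \<alpha> * (\<alpha> * y + \<beta> * z)" if "a * \<beta> = b' * \<alpha>" for a b' y z
  proof -
    have "b' = a * \<beta> / \<alpha>" using that \<alpha> by (simp add: eq_divide_eq)
    thus ?thesis using \<alpha> by (simp add: distrib_left mult.assoc)
  qed
  have "\<exists>c. \<forall>v. l i v = c * l j v" for i
    using idx3(1)[of i j]
  proof (elim disjE)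
    assume i: "i = j"
    show ?thesis unfolding i by (intro exI[of _ 1]) simp
  next
    assume i: "i = j + 1"
    show ?thesis unfolding i l_nth lj conjunct1[OF k1] mult_zero_left add_0_left by (intro exI allI, rule pr[OF conjunct2[OF k1]])
  next
    assume i: "i = j + 2"
    show ?thesis unfolding i l_nth lj conjunct1[OF k2] mult_zero_left add_0_left by (intro exI allI, rule pr[OF conjunct2[OF k2]])
  qed
  thus False by (rule not_proportional)
qed

text \<open>Otherwise \<open>F\<close> would map the \<open>j\<close>-th line with degree two.\<close>

lemma minor_zero: "m (j+1) (j+1) * m (j+2) (j+2) = m (j+1) (j+2) * m (j+2) (j+1)"
proof (rule ccontr)
  define \<alpha> \<beta> \<gamma> \<delta> where "\<alpha> = m (j+2) (j+1)" and "\<beta> = m (j+2) (j+2)" and "\<gamma> = m (j+1) (j+1)" and "\<delta> = m (j+1) (j+2)"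
  assume "\<not> ?thesis"
  hence ne: "\<gamma> * \<beta> \<noteq> \<delta> * \<alpha>" unfolding \<alpha>_def \<beta>_def \<gamma>_def \<delta>_def .
  have \<beta>\<gamma>: "\<beta> \<noteq> 0" "\<gamma> \<noteq> 0" unfolding \<beta>_def \<gamma>_def by (rule diagonal_nonzero)+
  \<comment> \<open>This interpretation serves for \<open>turn\<close> and its properties, which
    depend on the permutation only.\<close>
  interpret T: triangle_map "\<lambda>_ _. 1" \<kappa> by unfold_locales (simp_all add: hollow_det_def bij_\<kappa>)
  \<comment> \<open>As a polynomial in r, this is r times the discriminant of the equation t
    (\<alpha> + \<beta> t) = r (\<gamma> + \<delta> t) for the points t of the line whose image has
    coordinate r. Where it does not vanish, r is non-zero and has two distinct preimages.\<close>
  have "[:0, \<alpha>\<^sup>2, 4 * \<beta> * \<gamma> - 2 * \<alpha> * \<delta>, \<delta>\<^sup>2:] \<noteq> 0" using \<beta>\<gamma> by auto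
  then obtain r where "poly [:0, \<alpha>\<^sup>2, 4 * \<beta> * \<gamma> - 2 * \<alpha> * \<delta>, \<delta>\<^sup>2:] r \<noteq> 0"
    using poly_all_0_iff_0 by blast
  hence "r * ((\<alpha> - r * \<delta>)\<^sup>2 + 4 * \<beta> * (r * \<gamma>)) \<noteq> 0" by (simp add: power2_eq_square algebra_simps)
  hence r: "r \<noteq> 0" "(\<alpha> - r * \<delta>)\<^sup>2 + 4 * \<beta> * (r * \<gamma>) \<noteq> 0" by simp_all
  define w where "w = csqrt ((\<alpha> - r * \<delta>)\<^sup>2 + 4 * \<beta> * (r * \<gamma>))"
  have w: "w\<^sup>2 = (\<alpha> - r * \<delta>)\<^sup>2 + 4 * \<beta> * (r * \<gamma>)" "w \<noteq> 0" unfolding w_def using r(2) by simp_all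
  have quad: "t * (\<alpha> + \<beta> * t) = r * (\<gamma> + \<delta> * t)" if x: "x\<^sup>2 = w\<^sup>2" "t = (x - (\<alpha> - r * \<delta>)) / (2 * \<beta>)" for t x
  proof -
    have "x = 2 * \<beta> * t + (\<alpha> - r * \<delta>)" unfolding x(2) using \<beta>\<gamma> by simp
    hence "(2 * \<beta> * t + (\<alpha> - r * \<delta>))\<^sup>2 = (\<alpha> - r * \<delta>)\<^sup>2 + 4 * \<beta> * (r * \<gamma>)" using x(1) w(1) by simp
    hence "4 * \<beta> * (t * (\<alpha> + \<beta> * t)) = 4 * \<beta> * (r * (\<gamma> + \<delta> * t))" by (simp add: power2_eq_square algebra_simps)
    thus ?thesis using \<beta>\<gamma> by simp
  qed
  define h where "h t = t * (\<alpha> + \<beta> * t) / (\<gamma> + \<delta> * t)" for t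
  have place: "line_place j s = f ` line_place (\<kappa> j) (T.turn r)" if s: "s * (\<alpha> + \<beta> * s) = r * (\<gamma> + \<delta> * s)" for s
  proof -
    have \<gamma>s: "\<gamma> + \<delta> * s \<noteq> 0"
    proof
      assume 0: "\<gamma> + \<delta> * s = 0"
      hence "s = 0 \<or> \<alpha> + \<beta> * s = 0" using s by simp
      thus False
      proof
        assume "s = 0" thus False using 0 \<beta>\<gamma> by simp
      next
        assume 1: "\<alpha> + \<beta> * s = 0"
        have "\<gamma> * \<beta> - \<delta> * \<alpha> = (\<gamma> + \<delta> * s) * \<beta> - \<delta> * (\<alpha> + \<beta> * s)" by (simp add: algebra_simps)
        thus False using 0 1 ne by simp
      qed
    qed
    have hs: "h s = r" unfolding h_def using s \<gamma>s by simp
    have "isCont (\<lambda>t. T.turn (h t)) s"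
      unfolding T.turn_def h_def using \<gamma>s hs r(1) unfolding h_def by (cases T.rot) (auto intro!: continuous_intros)
    hence lim: "((\<lambda>t. T.turn (h t)) \<longlongrightarrow> T.turn r) (at s)" using isContD hs by metis
    have "[:- r * \<gamma>, \<alpha> - r * \<delta>, \<beta>:] \<noteq> 0" "[:\<gamma>, \<delta>:] \<noteq> 0" using \<beta>\<gamma> by auto
    note pn = this[THEN poly_eventually_nonzero, of s]
    have ev1: "\<forall>\<^sub>F t in at s. T.turn (h t) \<noteq> T.turn r" unfolding T.turn(4)
      using pn
    proof eventually_elim
      case (elim t)
      thus ?case unfolding h_def by (auto simp: divide_eq_eq algebra_simps)
    qed
    have h: "filterlim (\<lambda>t. T.turn (h t)) (at (T.turn r)) (at s)" using lim ev1 by (simp add: filterlim_at)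
    have hlim: "(h \<longlongrightarrow> r) (at s)" using T.turn(1) by (cases T.rot) (use hs \<gamma>s in \<open>auto simp: h_def[abs_def] intro!: tendsto_eq_intros\<close>)
    have ev2: "\<forall>\<^sub>F t in at s. h t \<noteq> 0" by (rule tendsto_imp_eventually_ne[OF hlim r(1)])
    define c where "c t = (if T.rot then \<gamma> + \<delta> * t else (\<gamma> + \<delta> * t) * h t)" for t
    have "\<forall>\<^sub>F t in at s. c t \<noteq> 0 \<and> F (evec j t) = c t *s evec (\<kappa> j) (T.turn (h t))"
      using pn(2) ev2
    proof eventually_elim
      case (elim t)
      have g: "\<gamma> + \<delta> * t \<noteq> 0" using elim(1) by (simp add: mult.commute)
      have "F (evec j t) $ \<kappa> j = 0" "F (evec j t) $ \<kappa> (j+1) = \<gamma> + \<delta> * t"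
        unfolding F_l l_nth \<gamma>_def \<delta>_def by simp_all
      moreover have "F (evec j t) $ \<kappa> (j+2) = (\<gamma> + \<delta> * t) * h t"
        unfolding h_def using g unfolding F_l l_nth \<alpha>_def \<beta>_def by simp
      ultimately have "F (evec j t) = c t *s evec (\<kappa> j) (T.turn (h t))"
        unfolding c_def by (rule T.turn_evec[OF elim(2)])
      thus ?case unfolding c_def using g elim(2) by simp
    qed
    from line_place_pullback[OF F birational_f[unfolded f_eq] this h] show ?thesis unfolding f_eq .
  qed
  \<comment> \<open>Both places are the pullback of one place on the image line, so they coincide,
    although their centres on the j-th line are different.\<close>
  define s1 s2 where "s1 = (w - (\<alpha> - r * \<delta>)) / (2 * \<beta>)" and "s2 = (- w - (\<alpha> - r * \<delta>)) / (2 * \<beta>)"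
  have eq: "line_place j s1 = line_place j s2"
    using place[OF quad[of w s1]] place[OF quad[of "- w" s2]] unfolding s1_def s2_def by simp
  have "res_local (line_place j s1)" using valuation_place_line unfolding valuation_place_def by blast
  then obtain c where "evec j s1 = c *s evec j s2"
    using pt_separated[of "line_place j s1" "evec j s1" "evec j s2"] line_place_dominates[of j s1] line_place_dominates[of j s2]
    unfolding eq edge_pt_evec by auto
  hence "1 = c" "s1 = c * s2" using arg_cong[of _ _ "\<lambda>v. v $ (j+1)"] arg_cong[of _ _ "\<lambda>v. v $ (j+2)"]
    by (metis evec_nth(2) mult.right_neutral vector_smult_component, metis evec_nth(3) vector_smult_component)
  hence "s1 = s2" by simp
  thus False unfolding s1_def s2_def using \<beta>\<gamma> w(2) by simp
qed

text \<open>If the determinant of m vanished, m would have rank one and the linear factors would be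
  proportional. So its inverse exists and supplies b, and F agrees with the normal form in every
  component.\<close>

lemma ex_triangle_map: "\<exists>b. triangle_map b \<kappa> \<and> f = quadratic.f (perm \<kappa> \<circ> hollow (flip b)) (hollow_inv b)"
proof -
  have D: "(m j (j+1) * m (j+1) (j+2) - m j (j+2) * m (j+1) (j+1)) * m (j+2) j
       - (m j (j+1) * m (j+2) (j+2) - m j (j+2) * m (j+2) (j+1)) * m (j+1) j \<noteq> 0" for j
  proof
    assume D0: "(m j (j+1) * m (j+1) (j+2) - m j (j+2) * m (j+1) (j+1)) * m (j+2) j
       - (m j (j+1) * m (j+2) (j+2) - m j (j+2) * m (j+2) (j+1)) * m (j+1) j = 0"
    have m1: "m j j * m (j+1) (j+1) = m j (j+1) * m (j+1) j" using minor_zero[of "j+2"] unfolding idx3(6-9) .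
    have m2: "m j j * m (j+2) (j+2) = m j (j+2) * m (j+2) j"
      using minor_zero[of "j+1"] unfolding idx3(6-9) by (simp only: mult.commute)
    note pr = zero_minors_proportional[OF diagonal_nonzero diagonal_nonzero diagonal_nonzero m1 minor_zero m2 D0]
    have "\<exists>c. \<forall>v. l i v = c * l j v" for i
      using idx3(1)[of i j]
    proof (elim disjE)
      assume i: "i = j"
      show ?thesis unfolding i by (intro exI[of _ 1]) simp
    next
      assume i: "i = j + 1"
      show ?thesis unfolding i l_nth l_def[of j]
      proof (intro exI[of _ "m (j+1) j / m j j"] allI)
        have "q0 * x + q1 * y + q2 * z = q0 / p0 * (p0 * x + p1 * y + p2 * z)" if "p0 \<noteq> 0" "p0 * q1 = p1 * q0" "q2 * p0 = q0 * p2"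
          for p0 p1 p2 q0 q1 q2 x y z :: complex
        proof -
          have "q1 = q0 * p1 / p0" "q2 = q0 * p2 / p0" using that by (simp_all add: eq_divide_eq mult.commute)
          thus ?thesis using that(1) by (simp add: distrib_left mult.assoc)
        qed
        from this[OF diagonal_nonzero m1 pr(1)] show "m (j+1) j * v$j + m (j+1) (j+1) * v$(j+1) + m (j+1) (j+2) * v$(j+2)
          = m (j+1) j / m j j * (m j j * v$j + m j (j+1) * v$(j+1) + m j (j+2) * v$(j+2))" for v :: "complex^3" .
      qed
    next
      assume i: "i = j + 2"
      show ?thesis unfolding i l_nth l_def[of j]
      proof (intro exI[of _ "m (j+2) j / m j j"] allI)
        have "r0 * x + r1 * y + r2 * z = r0 / p0 * (p0 * x + p1 * y + p2 * z)" if "p0 \<noteq> 0" "p0 * r2 = p2 * r0" "r1 * p0 = r0 * p1"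
          for p0 p1 p2 r0 r1 r2 x y z :: complex
        proof -
          have "r1 = r0 * p1 / p0" "r2 = r0 * p2 / p0" using that by (simp_all add: eq_divide_eq mult.commute)
          thus ?thesis using that(1) by (simp add: distrib_left mult.assoc)
        qed
        from this[OF diagonal_nonzero m2 pr(2)] show "m (j+2) j * v$j + m (j+2) (j+1) * v$(j+1) + m (j+2) (j+2) * v$(j+2)
          = m (j+2) j / m j j * (m j j * v$j + m j (j+1) * v$(j+1) + m j (j+2) * v$(j+2))" for v :: "complex^3" .
      qed
    qed
    thus False by (rule not_proportional)
  qed
  obtain b where b: "\<And>j k. j \<noteq> k \<Longrightarrow> b j k \<noteq> 0" "hollow_det b \<noteq> 0"
    "\<And>v j. hollow_inv b v $ j = m j j * v$j + m j (j+1) * v$(j+1) + m j (j+2) * v$(j+2)"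
    using ex_triangle_matrix[OF diagonal_nonzero minor_zero D] by blast
  interpret T: triangle_map b \<kappa> by unfold_locales (use b bij_\<kappa> in auto)
  have "F v $ \<kappa> j = T.F v $ \<kappa> j" for v j unfolding T.F_nth b(3) by (rule F_nth)
  hence "F v $ k = T.F v $ k" for v k using bij_is_surj[OF bij_\<kappa>] by (metis surjD)
  hence "F v = T.F v" for v unfolding Finite_Cartesian_Product.vec_eq_iff by blast
  hence "F = T.F" by blast
  hence "f = T.f" unfolding f_eq T.f_eq by simp
  thus ?thesis using T.triangle_map_axioms by blast
qed

end

theorem properly_fixing_triangle_map:
  assumes "quadratic_map f" "properly_fixes_triangle f"
  shows "\<exists>b \<kappa>. triangle_map b \<kappa> \<and> f = quadratic.f (perm \<kappa> \<circ> hollow (flip b)) (hollow_inv b)"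
proof -
  interpret birational f by unfold_locales (use assms(1) quadratic_map_def in blast)
  have d: "map_degree f = 2" using assms(1) unfolding quadratic_map_def by blast
  obtain F :: "complex^3 \<Rightarrow> complex^3" where F: "\<And>i. form 2 (\<lambda>v. F v $ i)" "\<exists>v. F v $ 3 \<noteq> 0"
    "f x_fun = fr (\<lambda>v. F v $ 1) (\<lambda>v. F v $ 3)" "f y_fun = fr (\<lambda>v. F v $ 2) (\<lambda>v. F v $ 3)"
    using map_degree_forms[of f] unfolding d by blast
  interpret t: triangle_fixing f F using assms eq_sub[OF F] by unfold_locales auto
  obtain \<kappa> m where km: "bij \<kappa>" "\<And>i j. (\<forall>t. F (evec j t) $ i = 0) \<longleftrightarrow> i = \<kappa> j"
    "\<And>j v. F v $ \<kappa> j = v $ j * (m j j * v$j + m j (j+1) * v$(j+1) + m j (j+2) * v$(j+2))"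
    using t.components by blast
  interpret triangle_fixing_lines f F \<kappa> m by unfold_locales (rule km)+
  show ?thesis using ex_triangle_map by blast
qed

section \<open>The action on the triangle\<close>

text \<open>Forms of degree at most one representing f would have to vanish at the three base
  points, where f is not regular. These points come from linearly independent vectors, so the forms
  would be zero.\<close>

lemma (in quadratic) quadratic_map_f: "quadratic_map f"
proof -
  have nz: "\<exists>v. F v $ i \<noteq> 0" for i using form_map_F form_map_nonzero[OF _ form_coord coord_nonzero] by metis
  have fx: "f x_fun = fr (\<lambda>v. F v $ 1) (\<lambda>v. F v $ 3)" "f y_fun = fr (\<lambda>v. F v $ 2) (\<lambda>v. F v $ 3)"
    unfolding f_eq xy_fun_fr using form_map_F sub_fr[OF _ form_coord form_coord coord_nonzero] by metis+
  have "map_degree f \<le> 2" by (rule map_degree_le[where A = "\<lambda>v. F v $ 1" and B = "\<lambda>v. F v $ 2" and C = "\<lambda>v. F v $ 3", OF form_F form_F form_F nz fx])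
  moreover have "\<not> map_degree f \<le> 1"
  proof
    assume k: "map_degree f \<le> 1"
    obtain G :: "complex^3 \<Rightarrow> complex^3" where G: "\<And>i. form (map_degree f) (\<lambda>v. G v $ i)" "\<exists>v. G v $ 3 \<noteq> 0"
      "f x_fun = fr (\<lambda>v. G v $ 1) (\<lambda>v. G v $ 3)" "f y_fun = fr (\<lambda>v. G v $ 2) (\<lambda>v. G v $ 3)"
      using map_degree_forms[of f] by blast
    note fG = f.eq_sub[OF G]
    have zero: "G (N' (axis j 1)) = 0" for j
    proof (rule ccontr)
      assume "G (N' (axis j 1)) \<noteq> 0"
      hence "pt (G (N' (axis j 1))) \<in> P2" unfolding P2_iff by blast
      moreover have "dominates (p j) (f ` pt (G (N' (axis j 1))))"
        unfolding fG(2) p_def by (rule dominates_sub_pt[OF fG(1)])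
      ultimately show False using p_indeterminacy[of j] unfolding indeterminacy_def by blast
    qed
    have "G v $ 3 = 0" for v
    proof (cases "map_degree f = 0")
      case True
      have "G (0 *s w) $ 3 = 0 ^ 0 * G w $ 3" for w by (rule form_scale[OF G(1)[of 3, unfolded True]])
      hence "G w $ 3 = G 0 $ 3" for w by (metis vector_smult_lzero power_0 mult_1)
      from this[of v] this[of "N' (axis 1 1)"] show ?thesis unfolding zero by simp
    next
      case False
      hence k1: "map_degree f = 1" using k by simp
      have "form (1 * 1) (\<lambda>u. G (N' u) $ 3)" using form_comp[OF G(1)[of 3, unfolded k1] linear_isoD(2)[OF N]] .
      then obtain c where c: "\<And>u. G (N' u) $ 3 = (\<Sum>i\<in>UNIV. c i * u$(i::3))" using form1_coeffs by fastforce
      have "c j = 0" for j using c[of "axis j 1"] exhaust_3[of j] unfolding zero sum_3 by (auto simp: axis_def)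
      thus ?thesis using c[of "N v"] unfolding linear_isoD(4)[OF N] by simp
    qed
    thus False using G(2) by simp
  qed
  ultimately show ?thesis unfolding quadratic_map_def using birational_f by simp
qed

lemma triangle_reg_iff: "R \<in> triangle_reg \<longleftrightarrow> (\<exists>j s. s \<noteq> 0 \<and> R = edge_pt j s)"
proof
  assume "R \<in> triangle_reg"
  then obtain v where v: "R = pt v" "v \<noteq> 0" "v$1 * v$2 * v$3 = 0" "(v$2 * v$3, v$1 * v$3, v$1 * v$2) \<noteq> (0, 0, 0)"
    unfolding triangle_reg_def by (elim CollectE exE conjE)
  have ex3: "(\<exists>l. Q l) \<longleftrightarrow> Q 1 \<or> Q 2 \<or> Q 3" for Q :: "3 \<Rightarrow> bool" using exhaust_3 by metis
  have "\<exists>j. v$j = 0 \<and> v$(j+1) \<noteq> 0 \<and> v$(j+2) \<noteq> 0" unfolding ex3 idx_num using v(3,4) by auto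
  then obtain j where j: "v$j = 0" "v$(j+1) \<noteq> 0" "v$(j+2) \<noteq> 0" by blast
  have "v $ i = (v$(j+1) *s evec j (v$(j+2) / v$(j+1))) $ i" for i
    using idx3(1)[of i j] j by auto
  hence "v = v$(j+1) *s evec j (v$(j+2) / v$(j+1))" unfolding Finite_Cartesian_Product.vec_eq_iff by blast
  hence "R = edge_pt j (v$(j+2) / v$(j+1))" unfolding v(1) edge_pt_evec using pt_scale[OF j(2)] by metis
  thus "\<exists>j s. s \<noteq> 0 \<and> R = edge_pt j s" using j by (intro exI[of _ j] exI[of _ "v$(j+2) / v$(j+1)"]) simp
next
  assume "\<exists>j s. s \<noteq> 0 \<and> R = edge_pt j s"
  then obtain j s where js: "s \<noteq> 0" "R = edge_pt j s" by blast
  have "evec j s $ 1 * evec j s $ 2 * evec j s $ 3 = 0 \<and> (evec j s $ 2 * evec j s $ 3, evec j s $ 1 * evec j s $ 3, evec j s $ 1 * evec j s $ 2) \<noteq> (0, 0, 0)"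
    using js(1) by (simp add: evec_eq_0_iff) (use exhaust_3[of j] in auto)
  thus "R \<in> triangle_reg" unfolding js(2) edge_pt_evec triangle_reg_def using evec_nonzero[of j s] by blast
qed

lemma triangle_cases:
  assumes "v \<noteq> 0" "v $ j = 0"
  obtains a s where "a \<noteq> 0" "s \<noteq> 0" "v = a *s evec j s" | k a where "a \<noteq> 0" "v = a *s axis k 1"
proof (cases "v $ (j+1) = 0 \<or> v $ (j+2) = 0")
  case True
  then obtain k where k: "k \<noteq> j" "v $ i = 0" if "i \<noteq> k" for i
  proof
    assume z: "v $ (j+1) = 0"
    have "v $ i = 0" if "i \<noteq> j + 2" for i using idx3(1)[of i j] that z assms(2) by auto
    thus ?thesis using that[of "j+2"] idx3(3)[of j] by blast
  next
    assume z: "v $ (j+2) = 0"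
    have "v $ i = 0" if "i \<noteq> j + 1" for i using idx3(1)[of i j] that z assms(2) by auto
    thus ?thesis using that[of "j+1"] idx3(2)[of j] by blast
  qed
  have "v $ i = (v $ k *s axis k 1) $ i" for i using k(2)[of i] by (simp add: axis_def)
  hence v: "v = v $ k *s axis k 1" unfolding Finite_Cartesian_Product.vec_eq_iff by blast
  moreover have "v $ k \<noteq> 0" using v assms(1) by (metis vector_smult_lzero)
  ultimately show ?thesis by (rule that(2)[rotated])
next
  case False
  have "v $ i = (v$(j+1) *s evec j (v$(j+2) / v$(j+1))) $ i" for i
    using idx3(1)[of i j] False assms(2) by auto
  hence "v = v$(j+1) *s evec j (v$(j+2) / v$(j+1))" unfolding Finite_Cartesian_Product.vec_eq_iff by blast
  thus ?thesis using False by (intro that(1)[of "v$(j+1)" "v$(j+2) / v$(j+1)"]) auto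
qed

lemma order_linear_power: "Polynomial.order x ([:- a, 1:] ^ k) = (if a = x then k else 0)" for x :: complex
proof (cases "a = x")
  case True
  thus ?thesis using order_power_n_n by simp
next
  case False
  thus ?thesis by (simp add: order_0I poly_power)
qed

lemma order_prod_linear:
  fixes x :: complex
  assumes "finite S"
  shows "Polynomial.order x (\<Prod>s\<in>S. [:- g s, 1:] ^ k s) = (\<Sum>s\<in>S. if g s = x then k s else 0)"
  using assms
proof induction
  case (insert a S)
  have "(\<Prod>s\<in>S. [:- g s, 1:] ^ k s) \<noteq> 0" "[:- g a, 1:] ^ k a \<noteq> 0" using insert(1) by (simp_all add: prod_zero_iff)
  hence "[:- g a, 1:] ^ k a * (\<Prod>s\<in>S. [:- g s, 1:] ^ k s) \<noteq> 0" by simp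
  thus ?case using insert by (simp add: order_mult order_linear_power del: mult_eq_0_iff)
qed (simp add: order_0I)

section \<open>Maps that leave each line of the triangle invariant\<close>

locale invariant_lines = triangle_map b id for b
begin

lemma turn_id [simp]: "turn s = s" unfolding turn_def rot_def by simp

lemma \<Phi>_id: "\<Phi> a = (fst a, d (fst a) * snd a)" unfolding \<Phi>_def by simp

lemma F_id: "F v $ j = v $ j * hollow_inv b v $ j" using F_nth[of v j] by simp

text \<open>Extends the maps of the lines across the base points. The nodes are fixed, being the
  intersections of invariant lines.\<close>

definition \<tau> :: "point \<Rightarrow> point" where
  "\<tau> R = (if R \<in> triangle_reg then P (\<Phi> (inv_into A P R)) else R)"

lemma P_image: "P ` A = triangle_reg"
proof
  show "P ` A \<subseteq> triangle_reg" unfolding P_def A_def using triangle_reg_iff by fastforce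
  show "triangle_reg \<subseteq> P ` A"
  proof
    fix R assume "R \<in> triangle_reg"
    then obtain j s where "s \<noteq> 0" "R = edge_pt j s" unfolding triangle_reg_iff by blast
    thus "R \<in> P ` A" unfolding P_def A_def by (intro image_eqI[of _ _ "(j, s)"]) simp_all
  qed
qed

lemma bij_P: "bij_betw P A triangle_reg" using P_inj P_image unfolding bij_betw_def by blast

lemma \<tau>_P: "a \<in> A \<Longrightarrow> \<tau> (P a) = P (\<Phi> a)"
  unfolding \<tau>_def using P_image P_inj by (auto simp: inv_into_f_f)

lemma \<tau>_edge: "s \<noteq> 0 \<Longrightarrow> \<tau> (edge_pt j s) = edge_pt j (d j * s)"
  using \<tau>_P[of "(j, s)"] unfolding P_def A_def \<Phi>_id by simp

lemma bij_\<tau>: "bij_betw \<tau> triangle_reg triangle_reg" "bij_betw \<tau> triangle triangle"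
proof -
  have "bij_betw \<Phi> A A"
    by (rule bij_betw_byWitness[where f' = "\<lambda>a. (fst a, snd a / d (fst a))"]) (auto simp: \<Phi>_id A_def)
  hence "bij_betw (P \<circ> (\<Phi> \<circ> inv_into A P)) triangle_reg triangle_reg"
    using bij_betw_trans[OF bij_betw_trans[OF bij_betw_inv_into[OF bij_P]] bij_P] by (simp add: o_assoc)
  thus *: "bij_betw \<tau> triangle_reg triangle_reg"
    by (rule bij_betw_cong[THEN iffD1, rotated]) (simp add: \<tau>_def)
  have "bij_betw id (triangle - triangle_reg) (triangle - triangle_reg)" by simp
  hence "bij_betw \<tau> (triangle - triangle_reg) (triangle - triangle_reg)"
    by (rule bij_betw_cong[THEN iffD1, rotated]) (simp add: \<tau>_def)
  hence "bij_betw \<tau> (triangle_reg \<union> (triangle - triangle_reg)) (triangle_reg \<union> (triangle - triangle_reg))"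
    by (rule bij_betw_combine[OF *]) blast
  moreover have "triangle_reg \<subseteq> triangle" unfolding triangle_reg_def triangle_def by blast
  ultimately show "bij_betw \<tau> triangle triangle" by (simp add: Un_absorb1)
qed

lemma triangle_automorphism_\<tau>: "triangle_automorphism \<tau>"
  unfolding triangle_automorphism_def
proof (intro conjI allI)
  show "bij_betw \<tau> triangle triangle" by (rule bij_\<tau>)
  fix j
  \<comment> \<open>The coordinate on the j-th line is the quotient of the coordinates of index j+2
    and j+1, so scaling the former by \<open>d j\<close> gives the linear map.\<close>
  define D where "D i = (if i = j + 2 then d j else 1)" for i
  define M where "M = (\<chi> i k. if i = k then D i else 0)"
  have M: "(M *v v) $ i = D i * v $ i" for v i
  proof -
    have "(M *v v) $ i = (\<Sum>k\<in>UNIV. (if i = k then D i else 0) * v $ k)"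
      unfolding M_def matrix_vector_mult_def by simp
    also have "\<dots> = (\<Sum>k\<in>UNIV. if k = i then D i * v $ i else 0)" by (intro sum.cong) auto
    finally show ?thesis by simp
  qed
  have D: "D j = 1" "D (j+1) = 1" "D (j+2) = d j" unfolding D_def by (simp_all add: idx3(2-))
  have "M *v v \<noteq> 0 \<and> \<tau> (pt v) = pt (M *v v)" if v: "v \<noteq> 0" "v $ j = 0" for v
    using v
  proof (rule triangle_cases)
    fix a s assume as: "a \<noteq> 0" "s \<noteq> 0" "v = a *s evec j s"
    have "(M *v v) $ i = (a *s evec j (d j * s)) $ i" for i
      unfolding M as(3) using idx3(1)[of i j] D by auto
    hence Mv: "M *v v = a *s evec j (d j * s)" unfolding Finite_Cartesian_Product.vec_eq_iff by blast
    have "\<tau> (pt v) = edge_pt j (d j * s)" unfolding as(3) pt_scale[OF as(1)] using \<tau>_edge[OF as(2)] unfolding edge_pt_evec .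
    thus ?thesis unfolding Mv using as(1) pt_scale[OF as(1)] unfolding edge_pt_evec by simp
  next
    fix k a assume ka: "a \<noteq> 0" "v = a *s axis k 1"
    have "(M *v v) $ i = ((D k * a) *s axis k 1) $ i" for i unfolding M ka(2) by (simp add: axis_def)
    hence Mv: "M *v v = (D k * a) *s axis k 1" unfolding Finite_Cartesian_Product.vec_eq_iff by blast
    have nz: "D k * a \<noteq> 0" unfolding D_def using ka(1) by simp
    have "\<tau> (pt v) = pt (axis k 1)" unfolding ka(2) pt_scale[OF ka(1)] \<tau>_def using axis_triangle(2) by simp
    thus ?thesis unfolding Mv pt_scale[OF nz] using nz by simp
  qed
  thus "\<exists>M :: complex^3^3. \<forall>v. v \<noteq> 0 \<and> v $ j = 0 \<longrightarrow> M *v v \<noteq> 0 \<and> \<tau> (pt v) = pt (M *v v)" by blast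
qed

lemma map_pt_axis: "map_pt f P2 (pt (axis j 1)) = pt (axis j 1)"
proof -
  let ?e = "axis j 1 :: complex^3"
  have e: "?e $ j = 1" "?e $ (j+1) = 0" "?e $ (j+2) = 0" by (simp_all add: axis_def idx3(2-))
  have z: "hollow_inv b ?e $ (j+1) = b (j+1) (j+2) * b (j+2) j / hollow_det b" "hollow_inv b ?e $ (j+2) = b (j+2) (j+1) * b (j+1) j / hollow_det b"
    "hollow_inv b ?e $ j = - (b (j+1) (j+2) * b (j+2) (j+1)) / hollow_det b"
    unfolding hollow_inv_nth(2,3)[of b ?e j] unfolding hollow_inv_nth(1)[of b ?e j] e by simp_all
  have "cremona (hollow_inv b ?e) $ j \<noteq> 0" unfolding cremona_nth z using det by simp
  hence "cremona (hollow_inv b ?e) \<noteq> 0" by (metis zero_index)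
  from regular(2)[OF this] have "map_pt f P2 (pt ?e) = pt (F ?e)" .
  moreover have "F ?e $ i = (hollow_inv b ?e $ j *s ?e) $ i" for i unfolding F_id by (simp add: axis_def)
  hence "F ?e = hollow_inv b ?e $ j *s ?e" unfolding Finite_Cartesian_Product.vec_eq_iff by blast
  moreover have "hollow_inv b ?e $ j \<noteq> 0" unfolding z using det by simp
  ultimately show ?thesis using pt_scale by simp
qed

lemma restricts_to_\<tau>: "restricts_to f \<tau>"
  unfolding restricts_to_def
proof (intro conjI ballI triangle_automorphism_\<tau>)
  fix R assume R: "R \<in> triangle - indeterminacy f P2"
  then obtain v where v: "R = pt v" "v \<noteq> 0" "v$1 * v$2 * v$3 = 0" unfolding triangle_def by blast
  obtain j where j: "v $ j = 0" using v(3) by auto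
  show "\<tau> R = map_pt f P2 R" using v(2) j
  proof (rule triangle_cases)
    fix a s assume as: "a \<noteq> 0" "s \<noteq> 0" "v = a *s evec j s"
    have Re: "R = edge_pt j s" unfolding v(1) as(3) edge_pt_evec by (rule pt_scale[OF as(1)])
    have "s \<noteq> c j" using R p_indeterminacy[of j] unfolding Re p_edge by auto
    thus ?thesis unfolding Re using edge_regular(2)[OF as(2)] \<tau>_edge[OF as(2)] by simp
  next
    fix k a assume ka: "a \<noteq> 0" "v = a *s axis k 1"
    show ?thesis unfolding v(1) ka(2) pt_scale[OF ka(1)] map_pt_axis \<tau>_def using axis_triangle(2) by simp
  qed
qed

lemma properly_fixes: "properly_fixes_triangle f"
proof -
  define I where "I = map_pt f P2 ` (triangle - indeterminacy f P2)"
  have I\<tau>: "I = \<tau> ` (triangle - indeterminacy f P2)"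
    unfolding I_def using restricts_to_\<tau> unfolding restricts_to_def by (intro image_cong) auto
  have \<tau>t: "\<tau> ` triangle = triangle" using bij_\<tau>(2) unfolding bij_betw_def by blast
  have It: "I \<subseteq> triangle" unfolding I\<tau> using \<tau>t by blast
  have tP: "triangle \<subseteq> P2" unfolding triangle_def P2_def by blast
  have "P2_closure I \<subseteq> triangle"
  proof -
    have "closed {v :: complex^3. v$1 * v$2 * v$3 = 0}"
      by (intro closed_Collect_eq continuous_on_mult continuous_on_component continuous_on_const continuous_on_id)
    moreover have "{v. v \<noteq> 0 \<and> pt v \<in> I} \<subseteq> {v. v$1 * v$2 * v$3 = 0}" using It pt_in_triangle by blast
    ultimately have cl: "closure {v. v \<noteq> 0 \<and> pt v \<in> I} \<subseteq> {v. v$1 * v$2 * v$3 = 0}" by (simp add: closure_minimal)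
    show ?thesis
    proof
      fix R assume "R \<in> P2_closure I"
      then obtain v where v: "R = pt v" "v \<in> closure {v. v \<noteq> 0 \<and> pt v \<in> I} - {0}" unfolding P2_closure_def by (rule imageE)
      hence "v \<noteq> 0" "v$1 * v$2 * v$3 = 0" using cl by auto
      thus "R \<in> triangle" unfolding v(1) using pt_in_triangle by blast
    qed
  qed
  moreover have "triangle \<subseteq> P2_closure I"
  proof
    fix R assume "R \<in> triangle"
    then obtain R' where R': "R' \<in> triangle" "R = \<tau> R'" using \<tau>t by blast
    show "R \<in> P2_closure I"
    proof (cases "R' \<in> indeterminacy f P2")
      case False
      hence "R \<in> I" unfolding I\<tau> using R' by blast
      thus ?thesis using P2_closure_subset It tP by blast
    next
      \<comment> \<open>f has no value at a base point; the image of this point under \<tau> is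
        obtained as a limit of values at neighbouring points of the line.\<close>
      case True
      then obtain j where j: "R' = edge_pt j (c j)" unfolding indeterminacy_f p_edge by blast
      have R: "R = edge_pt j (d j * c j)" unfolding R'(2) j by (rule \<tau>_edge) simp
      have ev: "\<forall>\<^sub>F s in at (d j * c j). evec j s \<in> closure {v. v \<noteq> 0 \<and> pt v \<in> I}"
      proof -
        have "\<forall>\<^sub>F s in at (d j * c j). s \<noteq> 0" "\<forall>\<^sub>F s in at (d j * c j). s \<noteq> d j * c j"
          using poly_eventually_nonzero[of "[:0, 1:]" "d j * c j"] poly_eventually_nonzero[of "[:- (d j * c j), 1:]" "d j * c j"] by simp_all
        thus ?thesis
        proof eventually_elim
          case (elim s)
          have s: "s / d j \<noteq> 0" "s / d j \<noteq> c j" using elim by (auto simp: field_simps)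
          have "edge_pt j (s / d j) \<notin> indeterminacy f P2" by (rule edge_regular(3)[OF s])
          hence "\<tau> (edge_pt j (s / d j)) \<in> I" unfolding I\<tau> using edge_pt_triangle by blast
          hence "pt (evec j s) \<in> I" unfolding \<tau>_edge[OF s(1)] unfolding edge_pt_evec by simp
          hence "evec j s \<in> {v. v \<noteq> 0 \<and> pt v \<in> I}" using evec_nonzero by simp
          thus ?case by (rule subsetD[OF closure_subset])
        qed
      qed
      have "((\<lambda>s. evec j s) \<longlongrightarrow> evec j (d j * c j)) (at (d j * c j))"
      proof (rule vec_tendstoI)
        show "((\<lambda>s. evec j s $ i) \<longlongrightarrow> evec j (d j * c j) $ i) (at (d j * c j))" for i
          using idx3(1)[of i j] by (elim disjE) simp_all
      qed
      hence "evec j (d j * c j) \<in> closure {v. v \<noteq> 0 \<and> pt v \<in> I}"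
        by (rule Lim_in_closed_set[OF closed_closure ev trivial_limit_at])
      thus ?thesis unfolding R P2_closure_def edge_pt_evec using evec_nonzero by blast
    qed
  qed
  moreover have "indeterminacy f P2 \<subseteq> triangle_reg" "indeterminacy (inv_into UNIV f) P2 \<subseteq> triangle_reg"
  proof -
    have e: "edge_pt j s \<in> triangle_reg" if "s \<noteq> 0" for j s unfolding triangle_reg_iff using that by blast
    show "indeterminacy f P2 \<subseteq> triangle_reg" unfolding indeterminacy_f using e by (auto simp: p_edge)
    show "indeterminacy (inv_into UNIV f) P2 \<subseteq> triangle_reg" unfolding indeterminacy_inv_f using e by (auto simp: q_edge)
  qed
  ultimately show ?thesis unfolding properly_fixes_triangle_def I_def by blast
qed

lemma reg_component_eq: "reg_component j = edge_pt j ` {s. s \<noteq> 0}"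
proof
  show "reg_component j \<subseteq> edge_pt j ` {s. s \<noteq> 0}"
  proof
    fix R assume "R \<in> reg_component j"
    then obtain v where v: "R \<in> triangle_reg" "R = pt v" "v \<noteq> 0" "v $ j = 0" unfolding reg_component_def by blast
    obtain i s where js: "s \<noteq> 0" "R = edge_pt i s" using v(1) unfolding triangle_reg_iff by blast
    obtain a where "evec i s = a *s v" using pt_eqD[of "evec i s" v] js(2) v(2,3) evec_nonzero unfolding edge_pt_evec by blast
    hence "i = j" using evec_eq_0_iff[OF js(1), of i j] v(4) by simp
    thus "R \<in> edge_pt j ` {s. s \<noteq> 0}" using js by blast
  qed
  show "edge_pt j ` {s. s \<noteq> 0} \<subseteq> reg_component j"
  proof
    fix R assume "R \<in> edge_pt j ` {s. s \<noteq> 0}"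
    then obtain s where s: "s \<noteq> 0" "R = edge_pt j s" by blast
    hence "R \<in> triangle_reg" unfolding triangle_reg_iff by blast
    moreover have "R = pt (evec j s)" "evec j s \<noteq> 0" "evec j s $ j = 0" using s(2) unfolding edge_pt_evec by simp_all
    ultimately show "R \<in> reg_component j" unfolding reg_component_def by blast
  qed
qed

lemma \<tau>_reg_component: "\<tau> ` reg_component j = reg_component j"
proof -
  have "\<tau> ` reg_component j = (\<lambda>s. edge_pt j (d j * s)) ` {s. s \<noteq> 0}"
    unfolding reg_component_eq image_image by (rule image_cong) (simp_all add: \<tau>_edge)
  also have "\<dots> = edge_pt j ` ((\<lambda>s. d j * s) ` {s. s \<noteq> 0})" by (simp add: image_image)
  also have "(\<lambda>s. d j * s) ` {s. s \<noteq> 0} = {s. s \<noteq> 0}"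
    by (auto simp: image_iff intro!: exI[of _ "_ / d j"])
  finally show ?thesis unfolding reg_component_eq .
qed

lemma push_divisor_\<tau>:
  assumes D: "{R. D R \<noteq> 0} \<subseteq> triangle_reg" and x: "x \<noteq> 0"
  shows "push_divisor \<tau> D (edge_pt j x) = D (edge_pt j (x / d j))"
proof -
  have iff: "\<tau> S = edge_pt j x \<longleftrightarrow> S = edge_pt j (x / d j)" if "S \<in> triangle_reg" for S
  proof -
    have "edge_pt j (x / d j) \<in> triangle_reg" unfolding triangle_reg_iff using x by (intro exI[of _ j] exI[of _ "x / d j"]) simp
    hence "\<tau> S = \<tau> (edge_pt j (x / d j)) \<longleftrightarrow> S = edge_pt j (x / d j)"
      using that bij_\<tau>(1) unfolding bij_betw_def by (auto dest: inj_onD)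
    moreover have "\<tau> (edge_pt j (x / d j)) = edge_pt j x" by (subst \<tau>_edge) (use x in simp_all)
    ultimately show ?thesis by simp
  qed
  have "{S. D S \<noteq> 0 \<and> \<tau> S = edge_pt j x} = (if D (edge_pt j (x / d j)) \<noteq> 0 then {edge_pt j (x / d j)} else {})"
    using iff D by auto
  thus ?thesis unfolding push_divisor_def by simp
qed

text \<open>On the \<open>j\<close>-th line, \<open>\<tau>(D) - D\<close> is the divisor of \<open>\<Prod>\<^sub>s ((t - d\<^sub>j s) / (t - s))\<^bsup>D(s)\<^esup>\<close>, with value \<open>1\<close> at
  \<open>\<infinity>\<close> and, as \<open>D\<close> has degree zero, also at \<open>0\<close>.\<close>

lemma multiplier_one: "has_multiplier \<tau> 1"
  unfolding has_multiplier_def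
proof (intro conjI ballI)
  fix D assume "D \<in> div0_triangle"
  hence D: "finite {R. D R \<noteq> 0}" "{R. D R \<noteq> 0} \<subseteq> triangle_reg"
    "\<And>j. (\<Sum>R | R \<in> reg_component j \<and> D R \<noteq> 0. D R) = 0" unfolding div0_triangle_def by auto
  define S where "S j = {s. s \<noteq> 0 \<and> D (edge_pt j s) \<noteq> 0}" for j
  define n where "n j s = D (edge_pt j s)" for j s
  have inj: "inj_on (edge_pt j) (S j)" for j unfolding inj_on_def S_def using edge_pt_eq_iff by auto
  have fin: "finite (S j)" for j
    by (rule inj_on_finite[OF inj _ D(1)]) (auto simp: S_def)
  have "edge_pt j ` S j = {R. R \<in> reg_component j \<and> D R \<noteq> 0}" for j unfolding reg_component_eq S_def by auto
  hence sum0: "(\<Sum>s\<in>S j. n j s) = 0" for j using D(3)[of j] sum.reindex[OF inj, of D j] unfolding n_def o_def by simp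
  \<comment> \<open>Zeros of negative multiplicity change sides, so that the numerator PP and the
    denominator QQ are polynomials.\<close>
  define PP where "PP j = (\<Prod>s\<in>S j. [:- (d j * s), 1:] ^ nat (n j s)) * (\<Prod>s\<in>S j. [:- s, 1:] ^ nat (- n j s))" for j
  define QQ where "QQ j = (\<Prod>s\<in>S j. [:- s, 1:] ^ nat (n j s)) * (\<Prod>s\<in>S j. [:- (d j * s), 1:] ^ nat (- n j s))" for j
  have val: "poly (\<Prod>s\<in>S j. [:- (d j * s), 1:] ^ k s) 0 = d j ^ (\<Sum>s\<in>S j. k s) * poly (\<Prod>s\<in>S j. [:- s, 1:] ^ k s) 0" for j k
    by (simp add: poly_prod power_sum prod.distrib[symmetric] power_mult_distrib[symmetric])
  have nzv: "poly (\<Prod>s\<in>S j. [:- s, 1:] ^ k s) 0 \<noteq> 0" for j k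
    using fin by (auto simp: poly_prod prod_zero_iff S_def)
  have "(\<Sum>s\<in>S j. int (nat (n j s))) - (\<Sum>s\<in>S j. int (nat (- n j s))) = 0" for j
  proof -
    have "int (nat a) - int (nat (- a)) = a" for a by (cases "a \<ge> 0") simp_all
    thus ?thesis unfolding sum_subtractf[symmetric] using sum0[of j] by simp
  qed
  \<comment> \<open>D has degree zero on the line. In the values at 0 the powers of
    \<open>d j\<close> in PP and QQ therefore agree.\<close>
  hence bal: "(\<Sum>s\<in>S j. nat (n j s)) = (\<Sum>s\<in>S j. nat (- n j s))" for j by (metis eq_iff_diff_eq_0 of_nat_eq_iff of_nat_sum)
  have v0: "poly (PP j) 0 = poly (QQ j) 0" "poly (QQ j) 0 \<noteq> 0" for j
    unfolding PP_def QQ_def poly_mult val using bal[of j] nzv by simp_all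
  have deg: "degree (\<Prod>s\<in>S j. [:- g s, 1:] ^ k s) = (\<Sum>s\<in>S j. k s)" for k j and g :: "complex \<Rightarrow> complex"
    by (subst degree_prod_sum_eq) (simp_all add: degree_power_eq)
  have nzp: "(\<Prod>s\<in>S j. [:- g s, 1:] ^ k s) \<noteq> 0" for k j and g :: "complex \<Rightarrow> complex" using fin by (simp add: prod_zero_iff)
  have lc: "lead_coeff (\<Prod>s\<in>S j. [:- g s, 1:] ^ k s) = 1" for k j and g :: "complex \<Rightarrow> complex"
    by (simp add: lead_coeff_prod lead_coeff_power)
  have degs: "degree (PP j) = degree (QQ j)" for j
    unfolding PP_def QQ_def using deg[where g = "\<lambda>s. s"] deg[where g = "\<lambda>s. d j * s"] nzp[where g = "\<lambda>s. s"] nzp[where g = "\<lambda>s. d j * s"]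
    by (simp add: degree_mult_eq)
  have lcs: "lead_coeff (PP j) = 1" "lead_coeff (QQ j) = 1" for j
    unfolding PP_def QQ_def lead_coeff_mult using lc[where g = "\<lambda>s. s"] lc[where g = "\<lambda>s. d j * s"] by simp_all
  have ord: "push_divisor \<tau> D (edge_pt j x) - 1 * D (edge_pt j x) = int (Polynomial.order x (PP j)) - int (Polynomial.order x (QQ j))" if x: "x \<noteq> 0" for j x
  proof -
    have o: "int (Polynomial.order x (\<Prod>s\<in>S j. [:- g s, 1:] ^ k s)) = (\<Sum>s\<in>S j. if g s = x then int (k s) else 0)" for k and g :: "complex \<Rightarrow> complex"
      unfolding order_prod_linear[OF fin] by (simp add: of_nat_sum if_distrib cong: if_cong)
    have "int (Polynomial.order x (PP j)) - int (Polynomial.order x (QQ j)) =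
       ((\<Sum>s\<in>S j. if d j * s = x then int (nat (n j s)) else 0) - (\<Sum>s\<in>S j. if d j * s = x then int (nat (- n j s)) else 0))
       - ((\<Sum>s\<in>S j. if s = x then int (nat (n j s)) else 0) - (\<Sum>s\<in>S j. if s = x then int (nat (- n j s)) else 0))"
      unfolding PP_def QQ_def using o[where g = "\<lambda>s. s"] o[where g = "\<lambda>s. d j * s"] nzp[where g = "\<lambda>s. s"] nzp[where g = "\<lambda>s. d j * s"]
      by (simp add: order_mult)
    also have "\<dots> = (\<Sum>s\<in>S j. if d j * s = x then n j s else 0) - (\<Sum>s\<in>S j. if s = x then n j s else 0)"
      unfolding sum_subtractf[symmetric] by (intro arg_cong2[of _ _ _ _ "(-)"] sum.cong) auto
    also have "(\<Sum>s\<in>S j. if s = x then n j s else 0) = n j x"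
      using fin x by (auto simp: sum.delta S_def n_def)
    also have "(\<Sum>s\<in>S j. if d j * s = x then n j s else 0) = (\<Sum>s\<in>S j. if s = x / d j then n j s else 0)"
      by (intro sum.cong) (auto simp: field_simps)
    also have "\<dots> = n j (x / d j)" using fin x by (auto simp: sum.delta S_def n_def)
    finally show ?thesis unfolding push_divisor_\<tau>[OF D(2) x] n_def by simp
  qed
  show "principal_triangle (\<lambda>R. push_divisor \<tau> D R - 1 * D R)"
    unfolding principal_triangle_def
    by (rule exI[of _ PP], rule exI[of _ QQ]) (use v0 degs lcs ord in simp)
qed simp

end

section \<open>Realization\<close>

lemma cis_eq_1_imp_int: "cis (2 * pi * x) = 1 \<Longrightarrow> x \<in> \<int>"
proof -
  assume "cis (2 * pi * x) = 1"
  hence "cos (2 * pi * x) = 1" by (metis cis.sel(1) one_complex.sel(1))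
  then obtain k :: int where "2 * pi * x = real_of_int k * 2 * pi" unfolding cos_one_2pi_int by blast
  hence "x = of_int k" by simp
  thus ?thesis by simp
qed

lemma not_int_between: "0 < x \<Longrightarrow> x < 1 \<Longrightarrow> (x :: real) \<notin> \<int>"
  by (auto elim!: Ints_cases)

text \<open>With \<open>\<theta> = 1 / (n\<^sub>1 (1 - 1/n\<^sub>1 - 1/n\<^sub>2 - 1/n\<^sub>3))\<close> the angles \<open>(1 + \<theta>)/n\<^sub>1\<close>, \<open>\<theta>/n\<^sub>2\<close>, \<open>\<theta>/n\<^sub>3\<close> add up to \<open>\<theta>\<close>.\<close>

lemma ex_rotations:
  fixes n :: "3 \<Rightarrow> nat"
  assumes n: "\<And>i. n i \<ge> 6"
  obtains \<delta> :: "3 \<Rightarrow> complex" and \<mu> where "\<And>j. \<delta> j \<noteq> 0" "\<mu> \<noteq> 1" "\<mu> \<noteq> 0" "\<delta> 1 * \<delta> 2 * \<delta> 3 = \<mu>" "\<And>j. \<delta> j ^ n j = \<mu>"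
    "\<And>j m. 1 \<le> m \<Longrightarrow> m \<le> n j \<Longrightarrow> \<delta> j ^ m \<noteq> 1"
proof -
  define s where "s = 1 / real (n 2) + 1 / real (n 3)"
  have inv: "0 < 1 / real (n i) \<and> 1 / real (n i) \<le> 1 / 6" for i using n[of i] by (auto simp: field_simps)
  have s: "0 < s" "s \<le> 1 / 3" unfolding s_def using inv[of 2] inv[of 3] by linarith+
  define N where "N = real (n 1)"
  have N: "N \<ge> 6" unfolding N_def using n[of 1] by simp
  have "N * (2 / 3) \<le> N * (1 - s)" using s N by (intro mult_left_mono) linarith+
  \<comment> \<open>The bound 6 enters through s at most 1/3 and N at least 6. They yield \<theta>
    at most 1/3, so that the angles of \<mu> and of the second and third rotations stay strictly
    between 0 and a full turn.\<close>
  hence den: "N * (1 - s) - 1 \<ge> 3" using N by linarith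
  define \<theta> where "\<theta> = 1 / (N * (1 - s) - 1)"
  have \<theta>: "0 < \<theta>" "\<theta> \<le> 1 / 3" "\<theta> * (N * (1 - s) - 1) = 1" unfolding \<theta>_def using den by (simp_all add: divide_le_eq)
  define \<phi> where "\<phi> j = (if j = 1 then (1 + \<theta>) / N else \<theta> / real (n j))" for j :: 3
  define \<delta> where "\<delta> j = cis (2 * pi * \<phi> j)" for j
  define \<mu> where "\<mu> = cis (2 * pi * \<theta>)"
  have pow: "\<delta> j ^ m = cis (2 * pi * (real m * \<phi> j))" for j m
    unfolding \<delta>_def Complex.DeMoivre by (simp add: mult_ac)
  show ?thesis
  proof (rule that[of \<delta> \<mu>])
    show "\<delta> j \<noteq> 0" for j unfolding \<delta>_def by simp
    show "\<mu> \<noteq> 0" unfolding \<mu>_def by simp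
    show "\<mu> \<noteq> 1" unfolding \<mu>_def using cis_eq_1_imp_int not_int_between[of \<theta>] \<theta> by auto
    have "\<phi> 1 + \<phi> 2 + \<phi> 3 = (1 + \<theta>) / N + \<theta> * s" unfolding \<phi>_def s_def by (simp add: distrib_left)
    also have "\<dots> = \<theta>"
    proof -
      have "1 + \<theta> = \<theta> * (1 - s) * N" using \<theta>(3) by (simp add: algebra_simps)
      hence "(1 + \<theta>) / N = \<theta> * (1 - s)" using N by simp
      thus ?thesis by (simp add: algebra_simps)
    qed
    finally show "\<delta> 1 * \<delta> 2 * \<delta> 3 = \<mu>" unfolding \<delta>_def \<mu>_def cis_mult by (simp flip: distrib_left)
    show "\<delta> j ^ n j = \<mu>" for j
    proof (cases "j = 1")
      case True
      have "real (n j) * \<phi> j = 1 + \<theta>" unfolding \<phi>_def N_def using True n[of 1] by simp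
      hence "\<delta> j ^ n j = cis (2 * pi + 2 * pi * \<theta>)" unfolding pow by (simp add: distrib_left)
      thus ?thesis unfolding \<mu>_def by (simp flip: cis_mult)
    next
      case False
      have "real (n j) * \<phi> j = \<theta>" unfolding \<phi>_def using False n[of j] by simp
      thus ?thesis unfolding pow \<mu>_def by simp
    qed
    fix j m assume m: "1 \<le> m" "m \<le> n j"
    have m': "1 \<le> real m" "real m \<le> real (n j)" using m by simp_all
    show "\<delta> j ^ m \<noteq> 1"
    proof
      assume "\<delta> j ^ m = 1"
      hence int: "real m * \<phi> j \<in> \<int>" unfolding pow by (rule cis_eq_1_imp_int)
      show False
      proof (cases "j = 1")
        case False
        have "real m * \<phi> j = \<theta> * (real m / real (n j))" unfolding \<phi>_def using False by simp
        moreover have r: "0 < real m / real (n j)" "real m / real (n j) \<le> 1" using m' by (simp_all add: divide_le_eq)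
        have "0 < \<theta> * (real m / real (n j))" by (rule mult_pos_pos[OF \<theta>(1) r(1)])
        moreover have "\<theta> * (real m / real (n j)) \<le> \<theta> * 1" by (rule mult_left_mono[OF r(2)]) (use \<theta>(1) in simp)
        ultimately show False using not_int_between[of "real m * \<phi> j"] int \<theta>(2) by simp
      next
        case True
        have mp: "real m * \<phi> j = (1 + \<theta>) * (real m / N)" unfolding \<phi>_def using True by simp
        have r: "0 < real m / N" "real m / N \<le> 1" using m' N unfolding N_def True by (simp_all add: divide_le_eq)
        have "0 < (1 + \<theta>) * (real m / N)" by (rule mult_pos_pos[OF _ r(1)]) (use \<theta>(1) in simp)
        moreover have "(1 + \<theta>) * (real m / N) \<le> (1 + \<theta>) * 1" by (rule mult_left_mono[OF r(2)]) (use \<theta>(1) in simp)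
        moreover obtain k :: int where k: "real m * \<phi> j = of_int k" using int by (rule Ints_cases)
        ultimately have "0 < real_of_int k" "real_of_int k < 2" using \<theta>(1,2) unfolding mp by argo+
        \<comment> \<open>The only integer in range. Eliminating \<theta> turns this case into (N -
          m)(1 - s) = 1. With s at most 1/3, the integer N - m lies between 1 and 3/2, so it is 1
          and s = 0, a contradiction.\<close>
        hence "k = 1" by linarith
        hence "(1 + \<theta>) * real m = N" using k N unfolding mp by (simp add: field_simps)
        hence km: "real m * \<theta> = N - real m" by (simp add: algebra_simps)
        have "real m * (\<theta> * (N * (1 - s) - 1)) = real m" unfolding \<theta>(3) by simp
        hence "(N - real m) * (N * (1 - s) - 1) = real m" unfolding mult.assoc[symmetric] km .
        hence "N * ((N - real m) * (1 - s)) = N * 1" by (simp add: algebra_simps)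
        hence 1: "(N - real m) * (1 - s) = 1" using N by simp
        have ge: "N - real m \<ge> 0" using m' unfolding N_def True by simp
        have "(N - real m) * (1 - s) \<le> (N - real m) * 1" using ge s by (intro mult_left_mono) simp_all
        hence "1 \<le> N - real m" unfolding 1 by simp
        moreover have "(N - real m) * (2 / 3) \<le> (N - real m) * (1 - s)" using ge s by (intro mult_left_mono) simp_all
        hence "N - real m \<le> 3 / 2" unfolding 1 by simp
        ultimately have "1 \<le> real_of_int (int (n 1) - int m)" "real_of_int (int (n 1) - int m) \<le> 3 / 2" unfolding N_def by simp_all
        hence "int (n 1) - int m = 1" by linarith
        hence "N - real m = 1" unfolding N_def by (metis of_int_1 of_int_diff of_int_of_nat_eq)
        thus False using 1 s by simp
      qed
    qed
  qed
qed

text \<open>Entries \<gamma> B_{j+1} and B_{j+2} in row j give d_j = - \<gamma> B_{j+1} / B_{j+2}.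
  The product of the three is - \<gamma>^3, so \<gamma> is a cube root of - \<mu>, and the values of
  B follow recursively. The determinant is (1 - \<mu>) B_1 B_2 B_3, which explains the condition
  \<mu> \<noteq> 1.\<close>

lemma ex_invariant_lines:
  fixes \<delta> :: "3 \<Rightarrow> complex"
  assumes \<delta>: "\<And>j. \<delta> j \<noteq> 0" and \<mu>: "\<mu> \<noteq> 1" "\<mu> \<noteq> 0" "\<delta> 1 * \<delta> 2 * \<delta> 3 = \<mu>"
  obtains b where "invariant_lines b" "\<And>j. triangle_map.d b j = \<delta> j"
proof -
  define \<gamma> where "\<gamma> = exp (Ln (- \<mu>) / 3)"
  have \<gamma>: "\<gamma> ^ 3 = - \<mu>" "\<gamma> \<noteq> 0"
    unfolding \<gamma>_def using \<mu>(2) by (simp_all flip: exp_of_nat_mult)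
  define B where "B k = (if k = 1 then \<gamma>\<^sup>2 / (\<delta> 1 * \<delta> 2) else if k = 2 then 1 else - \<gamma> / \<delta> 1)" for k :: 3
  have B: "B k \<noteq> 0" for k unfolding B_def using \<gamma> \<delta> by simp
  have rec: "B (j+2) * \<delta> j = - \<gamma> * B (j+1)" for j
  proof -
    have "\<gamma> * \<gamma>\<^sup>2 = - (\<delta> 1 * \<delta> 2 * \<delta> 3)" using \<gamma>(1) \<mu>(3) by (simp add: power3_eq_cube power2_eq_square mult.assoc)
    thus ?thesis using exhaust_3[of j] \<delta>
      by (elim disjE; simp only: idx_num; simp add: B_def field_simps power2_eq_square)
  qed
  define b where "b j k = (if k = j + 1 then \<gamma> * B k else B k)" for j k
  have b: "b j (j+1) = \<gamma> * B (j+1)" "b j (j+2) = B (j+2)" for j unfolding b_def using idx3(5)[of j] by simp_all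
  have "hollow_det b = (\<gamma> ^ 3 + 1) * (B 1 * B 2 * B 3)"
    unfolding hollow_det_def using b[of 1] b[of 2] b[of 3] unfolding idx_num by (simp add: power3_eq_cube algebra_simps)
  hence det: "hollow_det b \<noteq> 0" unfolding \<gamma>(1) using B \<mu>(1) by simp
  interpret triangle_map b id by unfold_locales (use det B \<gamma>(2) in \<open>simp_all add: b_def\<close>)
  have "d j = \<delta> j" for j unfolding d_def b
    by (subst nonzero_divide_eq_eq[OF B]) (use rec[of j] in \<open>simp add: mult.commute\<close>)
  thus ?thesis using that invariant_lines.intro[OF triangle_map_axioms] by blast
qed

context invariant_lines
begin

text \<open>The orbit of q i runs through the coordinates \<open>d i ^ m * e i\<close> of its line
  and, by \<open>d_return\<close>, is at \<open>c i\<close> after n i - 1 steps. As no intermediate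
  power of \<open>d i\<close> is 1, it neither meets p i earlier nor returns to q i. Only points of
  the i-th line are blown up, so the stages do not interfere with each other.\<close>

lemma realization_step_stage:
  assumes X: "surface X" "\<And>s. s \<noteq> 0 \<Longrightarrow> edge_pt i s \<in> X"
    and d: "d 1 * d 2 * d 3 = \<mu>" "d i ^ n i = \<mu>" "\<And>m. 1 \<le> m \<Longrightarrow> m \<le> n i \<Longrightarrow> d i ^ m \<noteq> 1" and n: "n i \<ge> 1"
  shows "\<exists>X'. realization_step f p q n id i X X' \<and> surface X' \<and> (\<forall>k s. k \<noteq> i \<longrightarrow> s \<noteq> 0 \<longrightarrow> edge_pt k s \<in> X \<longrightarrow> edge_pt k s \<in> X')"
proof -
  have e: "d i ^ n i * e i = d i * c i"
  proof -
    have "d i * (d (i+1) * d (i+2)) = \<mu>" using d(1) exhaust_3[of i] by (elim disjE; simp only: idx_num; simp add: mult_ac)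
    thus ?thesis using d_return[of i] unfolding d(2) by (metis mult.assoc)
  qed
  have ret: "d i ^ (n i - 1) * e i = c i"
  proof -
    have "d i * (d i ^ (n i - 1) * e i) = d i ^ n i * e i" using n by (cases "n i") simp_all
    thus ?thesis unfolding e using cde_nonzero(2)[of i] by simp
  qed
  have ne_c: "d i ^ m * e i \<noteq> c i" if m: "m < n i - 1" for m
  proof
    assume "d i ^ m * e i = c i"
    hence "d i ^ m * e i = d i ^ m * d i ^ (n i - 1 - m) * e i" using ret m by (simp flip: power_add)
    hence "d i ^ (n i - 1 - m) = 1" by simp
    moreover have "1 \<le> n i - 1 - m" "n i - 1 - m \<le> n i" using m by simp_all
    ultimately show False using d(3) by blast
  qed
  have ne_e: "d i ^ m * e i \<noteq> e i" if m: "0 < m" "m \<le> n i - 1" for m using d(3)[of m] that by simp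
  let ?o = "\<lambda>m. edge_pt i (d i ^ m * e i)"
  have step: "dominates (?o m) (f ` ?o (Suc m))" "map_pt f X (?o m) = ?o (Suc m)" if m: "m < n i - 1" for m
  proof -
    show dom: "dominates (?o m) (f ` ?o (Suc m))"
      using edge_regular(1)[OF _ ne_c[OF m]] by (simp add: mult.assoc)
    have "dominates (line_place i (d i ^ m * e i)) (?o m)" by (rule line_place_dominates)
    from map_pt_eqI(1)[OF birational_f X(1) centred_line X(2) this X(2) dom] show "map_pt f X (?o m) = ?o (Suc m)" by simp
  qed
  have orb: "(map_pt f X ^^ m) (q i) = ?o m" if "m \<le> n i - 1" for m
    using that
  proof (induction m)
    case 0
    have "q i = edge_pt i (e i)" using q_edge[of i] unfolding turn_id id_apply .
    thus ?case unfolding funpow_0 power_0 mult_1 .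
  next
    case (Suc m)
    hence m: "m < n i - 1" by simp
    have "(map_pt f X ^^ Suc m) (q i) = map_pt f X ((map_pt f X ^^ m) (q i))" by simp
    also have "\<dots> = map_pt f X (?o m)" by (rule arg_cong[OF Suc.IH[OF less_imp_le[OF m]]])
    also have "\<dots> = ?o (Suc m)" by (rule step(2)[OF m])
    finally show ?case .
  qed
  have oX: "?o m \<in> X" for m by (rule X(2)) simp
  have fwd: "?o m \<notin> indeterminacy f X" if "m < n i - 1" for m
    using step(1)[OF that] oX[of "Suc m"] unfolding indeterminacy_def by blast
  \<comment> \<open>The inverse of f is regular at these points because f is a local isomorphism at
    the preceding point of the orbit.\<close>
  have bwd: "?o m \<notin> indeterminacy (inv_into UNIV f) X" if m: "0 < m" "m \<le> n i - 1" for m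
  proof -
    obtain k where k: "m = Suc k" using m(1) by (cases m) auto
    have "f ` ?o m = ?o k"
      using edge_local_iso[of "d i ^ k * e i" i] ne_c[of k] ne_e[OF m] m(2) unfolding k by (simp add: mult.assoc)
    hence "inv_into UNIV f ` ?o k = ?o m" using f.image_inv(2) by metis
    hence "dominates (?o m) (inv_into UNIV f ` ?o k)" by (simp add: dominates_def)
    thus ?thesis using oX[of k] unfolding indeterminacy_def by blast
  qed
  define C where "C = (\<lambda>m. (map_pt f X ^^ m) (q i)) ` {..n i - 1}"
  have C: "C = ?o ` {..n i - 1}" unfolding C_def by (rule image_cong) (use orb in auto)
  have "realization_step f p q n id i X (blowup C X)"
    unfolding realization_step_def C_def[symmetric]
    using orb orb[of 0] orb[of "n i - 1"] ret oX[of 0] X(2)[of "c i"] fwd bwd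
    by (simp add: p_edge)
  moreover have "surface (blowup C X)" by (rule surface_blowup[OF X(1)]) (use C oX in auto)
  moreover have "edge_pt k s \<in> blowup C X" if "k \<noteq> i" "s \<noteq> 0" "edge_pt k s \<in> X" for k s
  proof -
    have "edge_pt k s \<noteq> ?o m" for m using edge_pt_eq_iff[OF that(2), of "d i ^ m * e i" k i] that(1) by simp
    thus ?thesis unfolding blowup_def C using that(3) by blast
  qed
  ultimately show ?thesis by blast
qed

lemma realizes_id:
  assumes d: "d 1 * d 2 * d 3 = \<mu>" "\<And>i. d i ^ n i = \<mu>" "\<And>i m. 1 \<le> m \<Longrightarrow> m \<le> n i \<Longrightarrow> d i ^ m \<noteq> 1" and n: "\<And>i. n i \<ge> 1"
  shows "realizes f n id"
proof -
  have st: "\<exists>X'. realization_step f p q n id i X X' \<and> surface X' \<and> (\<forall>k s. k \<noteq> i \<longrightarrow> s \<noteq> 0 \<longrightarrow> edge_pt k s \<in> X \<longrightarrow> edge_pt k s \<in> X')"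
    if X: "surface X" "\<And>s. s \<noteq> 0 \<Longrightarrow> edge_pt i s \<in> X" for i X
  proof (rule realization_step_stage[where n = n and \<mu> = \<mu>])
    show "edge_pt i s \<in> X" if "s \<noteq> 0" for s by (rule X(2)[OF that])
    show "d i ^ m \<noteq> 1" if "1 \<le> m" "m \<le> n i" for m by (rule d(3)[OF that])
  qed (rule X(1) d(1,2) n)+
  obtain X1 where X1: "realization_step f p q n id 1 P2 X1" "surface X1" "\<forall>k s. k \<noteq> 1 \<longrightarrow> s \<noteq> 0 \<longrightarrow> edge_pt k s \<in> P2 \<longrightarrow> edge_pt k s \<in> X1"
    using st[OF surface_P2 edge_pt_P2, of 1] by blast
  have e1: "edge_pt k s \<in> X1" if "k \<noteq> 1" "s \<noteq> 0" for k s using X1(3) edge_pt_P2 that by blast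
  obtain X2 where X2: "realization_step f p q n id 2 X1 X2" "surface X2" "\<forall>k s. k \<noteq> 2 \<longrightarrow> s \<noteq> 0 \<longrightarrow> edge_pt k s \<in> X1 \<longrightarrow> edge_pt k s \<in> X2"
    using st[OF X1(2), of 2] e1 by auto
  obtain X3 where X3: "realization_step f p q n id 3 X2 X3"
    using st[OF X2(2), of 3] e1 X2(3) by auto
  have "distinct [1, 2, 3 :: 3]" by simp
  thus ?thesis unfolding realizes_def using base_points_f X1(1) X2(1) X3 by blast
qed

end

section \<open>The two directions of the theorem\<close>

lemma realization_identity:
  fixes n :: "3 \<Rightarrow> nat" and \<sigma> :: "3 \<Rightarrow> 3"
  assumes n: "\<forall>i. n i \<ge> 1" and \<sigma>: "bij \<sigma>"
    and root: "\<exists>z :: complex. poly (map_poly complex_of_real (orbit_char_poly n \<sigma>)) z = 0 \<and> cmod z > 1"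
    and f: "quadratic_map f" "properly_fixes_triangle f" "realizes f n \<sigma>"
  shows "\<sigma> = id \<and> (\<exists>\<tau>. restricts_to f \<tau> \<and> (\<forall>j. \<tau> ` reg_component j = reg_component j) \<and> has_multiplier \<tau> 1)"
proof -
  obtain z :: complex where z: "poly (map_poly complex_of_real (orbit_char_poly n \<sigma>)) z = 0" "cmod z > 1" using root by blast
  obtain b \<kappa> where b: "triangle_map b \<kappa>" and fe: "f = quadratic.f (perm \<kappa> \<circ> hollow (flip b)) (hollow_inv b)"
    using properly_fixing_triangle_map[OF f(1,2)] by blast
  have id: "\<kappa> = id" "\<sigma> = id"
    using triangle_map.realizes_identity[OF b n \<sigma> z(2,1)] f(3) unfolding fe by blast+
  interpret invariant_lines b by (rule invariant_lines.intro) (use b id in simp)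
  show ?thesis unfolding fe id(1) using id(2) restricts_to_\<tau> \<tau>_reg_component multiplier_one by blast
qed

lemma realization_exists:
  fixes n :: "3 \<Rightarrow> nat"
  assumes n: "\<forall>i. n i \<ge> 6"
  shows "\<exists>f \<tau>. quadratic_map f \<and> properly_fixes_triangle f \<and> realizes f n id
     \<and> restricts_to f \<tau> \<and> (\<forall>j. \<tau> ` reg_component j = reg_component j) \<and> has_multiplier \<tau> 1"
proof -
  obtain \<delta> :: "3 \<Rightarrow> complex" and \<mu> where \<delta>: "\<And>j. \<delta> j \<noteq> 0" "\<mu> \<noteq> 1" "\<mu> \<noteq> 0" "\<delta> 1 * \<delta> 2 * \<delta> 3 = \<mu>" "\<And>j. \<delta> j ^ n j = \<mu>"
    "\<And>j m. 1 \<le> m \<Longrightarrow> m \<le> n j \<Longrightarrow> \<delta> j ^ m \<noteq> 1"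
    using ex_rotations[of n] n by blast
  obtain b where b: "invariant_lines b" "\<And>j. triangle_map.d b j = \<delta> j" using ex_invariant_lines[OF \<delta>(1-4)] by blast
  interpret invariant_lines b by (rule b)
  have "n i \<ge> 1" for i using n[rule_format, of i] by simp
  hence "realizes f n id" by (intro realizes_id[of \<mu>]) (use b(2) \<delta>(4-6) in auto)
  thus ?thesis using quadratic_map_f properly_fixes restricts_to_\<tau> \<tau>_reg_component multiplier_one by blast
qed

theorem theorem4:
  fixes n :: "3 \<Rightarrow> nat" and \<sigma> :: "3 \<Rightarrow> 3"
  assumes "\<forall>i. n i \<ge> 1" and "bij \<sigma>"
    and "\<exists>z :: complex. poly (map_poly complex_of_real (orbit_char_poly n \<sigma>)) z = 0 \<and> cmod z > 1"
  shows "(\<forall>f. quadratic_map f \<and> properly_fixes_triangle f \<and> realizes f n \<sigma> \<longrightarrow>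
            \<sigma> = id \<and>
            (\<exists>\<tau>. restricts_to f \<tau> \<and> (\<forall>j. \<tau> ` reg_component j = reg_component j)
                  \<and> has_multiplier \<tau> 1))
       \<and> (\<sigma> = id \<and> (\<forall>i. n i \<ge> 6) \<longrightarrow>
            (\<exists>f \<tau>. quadratic_map f \<and> properly_fixes_triangle f \<and> realizes f n \<sigma>
                  \<and> restricts_to f \<tau> \<and> (\<forall>j. \<tau> ` reg_component j = reg_component j)
                  \<and> has_multiplier \<tau> 1))"
proof (rule conjI; intro allI impI; elim conjE)
  show "\<sigma> = id \<and> (\<exists>\<tau>. restricts_to f \<tau> \<and> (\<forall>j. \<tau> ` reg_component j = reg_component j) \<and> has_multiplier \<tau> 1)"
    if "quadratic_map f" "properly_fixes_triangle f" "realizes f n \<sigma>" for f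
    by (rule realization_identity[OF assms that])
  show "\<exists>f \<tau>. quadratic_map f \<and> properly_fixes_triangle f \<and> realizes f n \<sigma>
      \<and> restricts_to f \<tau> \<and> (\<forall>j. \<tau> ` reg_component j = reg_component j) \<and> has_multiplier \<tau> 1"
    if "\<sigma> = id" "\<forall>i. n i \<ge> 6"
    unfolding that(1) by (rule realization_exists[OF that(2)])
qed

end
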